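(* In the setting described in the context, let $u\in H^1_0(\Omega)$ be the weak solution, i.e. $a(u,v)=(f,v)$ for all $v\in H^1_0(\Omega)$, let $u_h$ be the finite element approximation and $(\bm\sigma_h,\phi_h)$ the reconstructions defined in the context. Then $$|||u-u_h|||^2\le\sum_{K\in\mathcal{T}_h}\Big[w_K\|\varepsilon\nabla u_h+\varepsilon^{-1}\bm\sigma_h\|_K+\|\kappa(u_h-\phi_h)\|_K+\widetilde w_K\|f-\Pi_hf\|_K\Big]^2,$$ where $w_K:=\min\{1,C_*\sqrt{\varepsilon/(\kappa h_K)}\}$ and $\widetilde w_K:=\min\{h_K/(\pi\varepsilon),1/\kappa\}$ (with $1/\kappa=+\infty$ when $\kappa=0$).
   Context: Setting: $\Omega\subset\mathbb{R}^d$, $d\ge1$, polytopal domain with Lipschitz boundary; $\varepsilon>0$, $\kappa\ge0$, $f\in L^2(\Omega)$. $a(w,v):=\varepsilon^2(\nabla w,\nabla v)+\kappa^2(w,v)$ on $H^1_0(\Omega)$, energy norm $|||v|||:=a(v,v)^{1/2}$. $\mathcal{T}_h$ is a matching simplicial mesh, $h_K$ the diameter of $K$, $\vartheta_{\mathcal{T}}:=\max_K h_K/\rho_K$ ($\rho_K$ inradius-diameter). $p\ge1$; $\mathbb{P}_p(\mathcal{T}_h)$ discontinuous piecewise polynomials of degree $\le p$; $V_h:=\mathbb{P}_p(\mathcal{T}_h)\cap H^1_0(\Omega)$; $u_h\in V_h$ with $a(u_h,v_h)=(f,v_h)$ for all $v_h\in V_h$. $\Pi_h$ is the $L^2$-orthogonal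 projection onto $\mathbb{P}_p(\mathcal{T}_h)$. For each mesh vertex $\bm a$: $\psi_{\bm a}$ the hat function of $\bm a$, $\omega_{\bm a}$ the interior of its support with diameter $h_{\omega_{\bm a}}$, $\mathcal{T}_{\bm a}$ the elements of the patch; $\bm V_h^{\bm a}$ the set of $\bm v_h\in\bm H(\mathrm{div},\omega_{\bm a})$ piecewise in $\mathbb{P}_p(K;\mathbb{R}^d)+\mathbb{P}_p(K)\bm x$ on $\mathcal{T}_{\bm a}$ with $\bm v_h\cdot\bm n=0$ on $\partial\omega_{\bm a}$ if $\bm a\in\Omega$, resp. on $\partial\omega_{\bm a}\setminus\partial\Omega$ if $\bm a\in\partial\Omega$; $Q_h^{\bm a}:=\mathbb{P}_p(\mathcal{T}_{\bm a})$ if $\kappa>0$ or $\bm a\in\partial\Omega$, and the mean-zero subspace of it if $\kappa=0$ and $\bm a\in\Omega$. Constants: $C_{\mathrm{Tr}}:=\sqrt{\vartheta_{\mathcal{T}}(d+1)(2+d/\pi)}$, $C_{p+1,d,\partial K}:=\sqrt{(d+1)(p+2)(p+d+1)\vartheta_{\mathcal{T}}}$, $C_{p+1,d,K}:=\sqrt d\,\vartheta_{\mathcal{T}}\frac{\sqrt5}{4}(2\sqrt2)^d\sqrt{p(p+1)(p+2)(p+3)}$, $C_*:=\frac1{\sqrt2}\big(\frac1{\sqrt\pi}C_{p+1,d,K}+C_{\mathrm{Tr}}C_{p+1,d,\partial K}\big)$, $w_{\bm a}:=\min\{1,C_*\sqrt{\varepsilon/(\kappa h_{\omega_{\bm a}})}\}$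 (equal to $1$ if $\kappa=0$). $(\bm\sigma_h^{\bm a},\phi_h^{\bm a})$ is a minimizer over $(\bm v_h,q_h)\in\bm V_h^{\bm a}\times Q_h^{\bm a}$ with $\nabla\cdot\bm v_h+\kappa^2q_h=\Pi_h(f\psi_{\bm a})-\varepsilon^2\nabla u_h\cdot\nabla\psi_{\bm a}$ of $w_{\bm a}^2\|\varepsilon\psi_{\bm a}\nabla u_h+\varepsilon^{-1}\bm v_h\|_{\omega_{\bm a}}^2+\|\kappa[\Pi_h(\psi_{\bm a}u_h)-q_h]\|_{\omega_{\bm a}}^2$; then, with zero extensions, $\bm\sigma_h:=\sum_{\bm a}\bm\sigma_h^{\bm a}$, $\phi_h:=\sum_{\bm a}\phi_h^{\bm a}$. *)

theory Defs
  imports "HOL-Analysis.Analysis"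
begin

definition partial :: "'a::euclidean_space \<Rightarrow> ('a \<Rightarrow> real) \<Rightarrow> 'a \<Rightarrow> real" where
  "partial b f x = frechet_derivative f (at x) b"

definition iter_partial :: "'a::euclidean_space list \<Rightarrow> ('a \<Rightarrow> real) \<Rightarrow> 'a \<Rightarrow> real" where
  "iter_partial bs f = foldr partial bs f"

definition smooth_fun :: "('a::euclidean_space \<Rightarrow> real) \<Rightarrow> bool" where
  "smooth_fun f \<longleftrightarrow> (\<forall>bs. set bs \<subseteq> Basis \<longrightarrow> (\<forall>x. iter_partial bs f differentiable (at x)))"

definition grad :: "('a::euclidean_space \<Rightarrow> real) \<Rightarrow> 'a \<Rightarrow> 'a" where
  "grad f x = (\<Sum>b\<in>Basis. partial b f x *\<^sub>R b)"

definition tsupp :: "('a::euclidean_space \<Rightarrow> real) \<Rightarrow> 'a set" where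
  "tsupp f = closure {x. f x \<noteq> 0}"

definition test_fun :: "'a::euclidean_space set \<Rightarrow> ('a \<Rightarrow> real) \<Rightarrow> bool" where
  "test_fun S \<phi> \<longleftrightarrow> smooth_fun \<phi> \<and> compact (tsupp \<phi>) \<and> tsupp \<phi> \<subseteq> S"

definition L2 :: "'a::euclidean_space set \<Rightarrow> ('a \<Rightarrow> real) \<Rightarrow> bool" where
  "L2 S f \<longleftrightarrow> set_borel_measurable lebesgue S f \<and> set_integrable lebesgue S (\<lambda>x. (f x)\<^sup>2)"

definition L2v :: "'a::euclidean_space set \<Rightarrow> ('a \<Rightarrow> 'a) \<Rightarrow> bool" where
  "L2v S v \<longleftrightarrow> set_borel_measurable lebesgue S v \<and> set_integrable lebesgue S (\<lambda>x. (norm (v x))\<^sup>2)"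

definition L2norm :: "'a::euclidean_space set \<Rightarrow> ('a \<Rightarrow> real) \<Rightarrow> real" where
  "L2norm S f = sqrt (LINT x:S|lebesgue. (f x)\<^sup>2)"

definition L2normv :: "'a::euclidean_space set \<Rightarrow> ('a \<Rightarrow> 'a) \<Rightarrow> real" where
  "L2normv S v = sqrt (LINT x:S|lebesgue. (norm (v x))\<^sup>2)"

definition H1_grad :: "'a::euclidean_space set \<Rightarrow> ('a \<Rightarrow> real) \<Rightarrow> ('a \<Rightarrow> 'a) \<Rightarrow> bool" where
  "H1_grad S u G \<longleftrightarrow> L2 S u \<and> L2v S G \<and>
     (\<forall>\<phi>. test_fun S \<phi> \<longrightarrow>
        (LINT x:S|lebesgue. u x *\<^sub>R grad \<phi> x) = - (LINT x:S|lebesgue. \<phi> x *\<^sub>R G x))"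

definition H1 :: "'a::euclidean_space set \<Rightarrow> ('a \<Rightarrow> real) \<Rightarrow> bool" where
  "H1 S u \<longleftrightarrow> (\<exists>G. H1_grad S u G)"

text \<open>The weak gradient (determined almost everywhere).\<close>
definition wgrad :: "'a::euclidean_space set \<Rightarrow> ('a \<Rightarrow> real) \<Rightarrow> 'a \<Rightarrow> 'a" where
  "wgrad S u = (SOME G. H1_grad S u G)"

definition H10 :: "'a::euclidean_space set \<Rightarrow> ('a \<Rightarrow> real) \<Rightarrow> bool" where
  "H10 S u \<longleftrightarrow> H1 S u \<and>
     (\<exists>\<phi>s. (\<forall>n. test_fun S (\<phi>s n)) \<and>
        (\<lambda>n. L2norm S (\<lambda>x. \<phi>s n x - u x)) \<longlonglongrightarrow> 0 \<and>
        (\<lambda>n. L2normv S (\<lambda>x. grad (\<phi>s n) x - wgrad S u x)) \<longlonglongrightarrow> 0)"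

definition bil :: "real \<Rightarrow> real \<Rightarrow> 'a::euclidean_space set \<Rightarrow> ('a \<Rightarrow> real) \<Rightarrow> ('a \<Rightarrow> real) \<Rightarrow> real" where
  "bil eps kap \<Omega> w v =
     eps\<^sup>2 * (LINT x:\<Omega>|lebesgue. wgrad \<Omega> w x \<bullet> wgrad \<Omega> v x) + kap\<^sup>2 * (LINT x:\<Omega>|lebesgue. w x * v x)"

definition enorm :: "real \<Rightarrow> real \<Rightarrow> 'a::euclidean_space set \<Rightarrow> ('a \<Rightarrow> real) \<Rightarrow> real" where
  "enorm eps kap \<Omega> v = sqrt (bil eps kap \<Omega> v v)"

text \<open>v is in H(div, omega) with weak divergence D and zero normal trace on the
  boundary of omega away from the set G (G = {} : zero normal trace on all of the boundary).\<close>
definition hdiv_bc :: "'a::euclidean_space set \<Rightarrow> 'a set \<Rightarrow> ('a \<Rightarrow> 'a) \<Rightarrow> ('a \<Rightarrow> real) \<Rightarrow> bool" where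
  "hdiv_bc \<omega> G v D \<longleftrightarrow> L2v \<omega> v \<and> L2 \<omega> D \<and>
     (\<forall>\<phi>. smooth_fun \<phi> \<and> compact (tsupp \<phi>) \<and> tsupp \<phi> \<inter> G = {} \<longrightarrow>
        (LINT x:\<omega>|lebesgue. v x \<bullet> grad \<phi> x + D x * \<phi> x) = 0)"

definition lipschitz_domain :: "'a::euclidean_space set \<Rightarrow> bool" where
  "lipschitz_domain \<Omega> \<longleftrightarrow> open \<Omega> \<and> bounded \<Omega> \<and> \<Omega> \<noteq> {} \<and>
     (\<forall>x\<in>frontier \<Omega>. \<exists>r>0. \<exists>n L \<gamma>. norm n = 1 \<and>
        L-lipschitz_on {z. z \<bullet> n = 0} (\<gamma> :: 'a \<Rightarrow> real) \<and>
        \<Omega> \<inter> ball x r = {y \<in> ball x r. y \<bullet> n > \<gamma> (y - (y \<bullet> n) *\<^sub>R n)})"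

definition simplex_verts :: "'a::euclidean_space set \<Rightarrow> 'a set" where
  "simplex_verts K = {v. v extreme_point_of K}"

definition simplicial_mesh :: "'a::euclidean_space set \<Rightarrow> 'a set set \<Rightarrow> bool" where
  "simplicial_mesh \<Omega> T \<longleftrightarrow> finite T \<and> T \<noteq> {} \<and>
     (\<forall>K\<in>T. (int DIM('a)) simplex K) \<and>
     (\<forall>K\<in>T. \<forall>K'\<in>T. (K \<inter> K') face_of K \<and> (K \<inter> K') face_of K') \<and>
     \<Union>T = closure \<Omega>"

definition mesh_verts :: "'a::euclidean_space set set \<Rightarrow> 'a set" where
  "mesh_verts T = (\<Union>K\<in>T. simplex_verts K)"

definition rho :: "'a::euclidean_space set \<Rightarrow> real" where
  "rho K = Sup {2 * r | r c. ball c r \<subseteq> K}"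

definition shape_reg :: "'a::euclidean_space set set \<Rightarrow> real" where
  "shape_reg T = Max ((\<lambda>K. diameter K / rho K) ` T)"

definition poly_le :: "nat \<Rightarrow> ('a::euclidean_space \<Rightarrow> real) \<Rightarrow> bool" where
  "poly_le p q \<longleftrightarrow> (\<exists>A c. finite A \<and> (\<forall>\<alpha>\<in>A. (\<Sum>b\<in>Basis. \<alpha> b) \<le> p) \<and>
      (\<forall>x. q x = (\<Sum>\<alpha>\<in>A. c \<alpha> * (\<Prod>b\<in>Basis. (x \<bullet> b) ^ \<alpha> b))))"

text \<open>Discontinuous piecewise polynomials of degree at most p on the elements of T
  (values on element boundaries, a null set, are irrelevant).\<close>
definition pw_poly :: "nat \<Rightarrow> 'a::euclidean_space set set \<Rightarrow> ('a \<Rightarrow> real) \<Rightarrow> bool" where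
  "pw_poly p T v \<longleftrightarrow> (\<forall>K\<in>T. \<exists>q. poly_le p q \<and> (\<forall>x\<in>interior K. v x = q x))"

definition pw_RT :: "nat \<Rightarrow> 'a::euclidean_space set set \<Rightarrow> ('a \<Rightarrow> 'a) \<Rightarrow> bool" where
  "pw_RT p T v \<longleftrightarrow> (\<forall>K\<in>T. \<exists>Q r. (\<forall>b\<in>Basis. poly_le p (\<lambda>x. Q x \<bullet> b)) \<and> poly_le p r \<and>
      (\<forall>x\<in>interior K. v x = Q x + r x *\<^sub>R x))"

definition Pih :: "'a::euclidean_space set \<Rightarrow> 'a set set \<Rightarrow> nat \<Rightarrow> ('a \<Rightarrow> real) \<Rightarrow> 'a \<Rightarrow> real" where
  "Pih \<Omega> T p f = (SOME g. pw_poly p T g \<and> L2 \<Omega> g \<and>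
      (\<forall>q. pw_poly p T q \<longrightarrow> (LINT x:\<Omega>|lebesgue. (f x - g x) * q x) = 0))"

definition bary :: "'a::euclidean_space set \<Rightarrow> 'a \<Rightarrow> 'a \<Rightarrow> real" where
  "bary V a x = (THE \<mu>. (\<forall>v. v \<notin> V \<longrightarrow> \<mu> v = 0) \<and> (\<Sum>v\<in>V. \<mu> v) = 1 \<and>
                        (\<Sum>v\<in>V. \<mu> v *\<^sub>R v) = x) a"

definition hat :: "'a::euclidean_space set set \<Rightarrow> 'a \<Rightarrow> 'a \<Rightarrow> real" where
  "hat T a x = (if \<exists>K\<in>T. x \<in> K \<and> a \<in> simplex_verts K
                then bary (simplex_verts (SOME K. K \<in> T \<and> x \<in> K \<and> a \<in> simplex_verts K)) a x
                else 0)"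

definition patch_elems :: "'a::euclidean_space set set \<Rightarrow> 'a \<Rightarrow> 'a set set" where
  "patch_elems T a = {K \<in> T. a \<in> simplex_verts K}"

definition patch :: "'a::euclidean_space set set \<Rightarrow> 'a \<Rightarrow> 'a set" where
  "patch T a = interior (\<Union>(patch_elems T a))"

definition C_Tr :: "real \<Rightarrow> real \<Rightarrow> real" where
  "C_Tr d th = sqrt (th * (d + 1) * (2 + d / pi))"

definition C_bdry :: "real \<Rightarrow> real \<Rightarrow> real \<Rightarrow> real" where
  "C_bdry p d th = sqrt ((d + 1) * (p + 2) * (p + d + 1) * th)"

definition C_elem :: "real \<Rightarrow> real \<Rightarrow> real \<Rightarrow> real" where
  "C_elem p d th = sqrt d * th * (sqrt 5 / 4) * (2 * sqrt 2) powr d * sqrt (p * (p + 1) * (p + 2) * (p + 3))"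

definition C_star :: "real \<Rightarrow> real \<Rightarrow> real \<Rightarrow> real" where
  "C_star p d th = (1 / sqrt 2) * ((1 / sqrt pi) * C_elem p d th + C_Tr d th * C_bdry p d th)"

definition wfac :: "real \<Rightarrow> real \<Rightarrow> real \<Rightarrow> real \<Rightarrow> real" where
  "wfac C eps kap h = (if kap = 0 then 1 else min 1 (C * sqrt (eps / (kap * h))))"

text \<open>tilde w = min{h/(pi eps), 1/kappa}, with 1/kappa = +infinity if kappa = 0.\<close>
definition wtil :: "real \<Rightarrow> real \<Rightarrow> real \<Rightarrow> real" where
  "wtil eps kap h = (if kap = 0 then h / (pi * eps) else min (h / (pi * eps)) (1 / kap))"

definition patch_rhs where
  "patch_rhs eps \<Omega> T p f uh a x =
     Pih \<Omega> T p (\<lambda>y. f y * hat T a y) x - eps\<^sup>2 * (wgrad \<Omega> uh x \<bullet> wgrad \<Omega> (hat T a) x)"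

definition patch_adm where
  "patch_adm eps kap \<Omega> T p f uh a v q \<longleftrightarrow>
     pw_RT p (patch_elems T a) v \<and>
     pw_poly p (patch_elems T a) q \<and>
     (kap = 0 \<and> a \<in> \<Omega> \<longrightarrow> (LINT x:patch T a|lebesgue. q x) = 0) \<and>
     (\<exists>D. hdiv_bc (patch T a) (if a \<in> \<Omega> then {} else frontier \<Omega> \<inter> frontier (patch T a)) v D \<and>
          (AE x in lebesgue. x \<in> patch T a \<longrightarrow> D x + kap\<^sup>2 * q x = patch_rhs eps \<Omega> T p f uh a x))"

definition patch_fun where
  "patch_fun eps kap \<Omega> T p uh a v q =
     (wfac (C_star (real p) (real DIM('a)) (shape_reg T)) eps kap (diameter (patch T a)))\<^sup>2 *
       (L2normv (patch T a) (\<lambda>x. (eps * hat T a x) *\<^sub>R wgrad \<Omega> uh x + (1 / eps) *\<^sub>R v x))\<^sup>2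
     + (L2norm (patch T a) (\<lambda>x. kap * (Pih \<Omega> T p (\<lambda>y. hat T a y * uh y) x - q x)))\<^sup>2"
  for T :: "'a::euclidean_space set set"

end

theory Submission
  imports Defs
begin

text \<open>
  Let \<open>v\<close> be a test function and \<open>e = u - uh\<close>. Equilibration turns the error equation \<open>a(e,v)\<close> into three
  elementwise terms, and \<open>v\<close> may tend to \<open>e\<close> because test functions are dense in \<open>H10\<close>. Two of the terms need work.

  The oscillation \<open>f - Pih f\<close> is orthogonal to affine functions since \<open>p \<ge> 1\<close>. On a simplex with barycentric
  coordinates \<open>lam\<close>, the Dirichlet form with density \<open>\<Sum>a<b. lam a * lam b * (\<partial>(a - b) v)\<^sup>2\<close> is generated by an operator
  which preserves polynomial degree and multiplies the part of degree \<open>m\<close> by \<open>- m (m + d)\<close>. Its spectral gap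
  beyond affine functions is \<open>2 (d + 2)\<close>, and its density is at most \<open>h\<^sup>2/4\<close> times the squared gradient, so the Poincare
  constant modulo affine functions is at most \<open>h / sqrt (8 (d + 2)) \<le> h / pi\<close>.

  For the flux term, a vector \<open>y - z\<close> with \<open>y, z \<in> K\<close> is the difference of \<open>x - z\<close> and \<open>x - y\<close>, so a directional
  derivative is a combination of radial derivatives centred at the vertices. In polar coordinates these reduce to
  one-dimensional integrals with weight \<open>s ^ (d - 1)\<close> of a polynomial against a derivative; integrating by parts
  and using sharp endpoint and Markov bounds gives, for a polynomial field \<open>g\<close>, a bound of \<open>(g, grad v)\<close> by
  \<open>sqrt 2 * C_star * h powr (-1/2)\<close> times the norm of \<open>g\<close> and the geometric mean of the norms of \<open>v\<close> and \<open>grad v\<close>.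
\<close>

section \<open>Polynomials on the unit interval with weight a power of the variable\<close>

text \<open>The patch fluxes are tested by \<open>hdiv_bc\<close> against smooth functions only, and
  \<open>wgrad\<close> is a choice determined up to null sets. Hence the residual identity is
  derived for test functions, the element estimates are proved for C1 functions, which can be
  restricted to rays and chords, and the limit is taken only in one final scalar inequality. The
  weight \<open>wfac\<close> calls for a flux estimate by the geometric mean of the norms of
  \<open>v\<close> and its gradient. Instead of a three-factor Hoelder inequality over all rays, the
  one-dimensional estimate is stated with free Young parameters, integrated as an inequality between
  quadratic expressions, and optimised afterwards on the element. The factor 191/100 of the ray
  estimate is small enough that, after two radial bounds per direction, the factor
  \<open>sqrt d\<close> for the components and the ratio of diameter to \<open>rho\<close>, the
  product stays below \<open>sqrt 2 * C_star\<close>. The factor \<open>sqrt 2\<close> is then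
  absorbed by \<open>sqrt 2 * sqrt (a * b) \<le> sqrt (a\<^sup>2 + b\<^sup>2)\<close>, which
  produces the energy norm.\<close>

lemma projection_exists:
  fixes \<beta> :: "('x \<Rightarrow> real) \<Rightarrow> ('x \<Rightarrow> real) \<Rightarrow> real" and b :: "'i \<Rightarrow> 'x \<Rightarrow> real"
  assumes S: "\<And>f g c. f \<in> S \<Longrightarrow> g \<in> S \<Longrightarrow> (\<lambda>x. f x + c * g x) \<in> S"
    and lin: "\<And>f g h c. f \<in> S \<Longrightarrow> g \<in> S \<Longrightarrow> h \<in> S \<Longrightarrow> \<beta> (\<lambda>x. f x + c * g x) h = \<beta> f h + c * \<beta> g h"
    and sym: "\<And>f g. f \<in> S \<Longrightarrow> g \<in> S \<Longrightarrow> \<beta> f g = \<beta> g f"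
    and psd: "\<And>f. f \<in> S \<Longrightarrow> 0 \<le> \<beta> f f"
    and fin: "finite I" and b: "\<And>i. i \<in> I \<Longrightarrow> b i \<in> S" and f: "f \<in> S"
  shows "\<exists>c. (\<lambda>x. f x - (\<Sum>i\<in>I. c i * b i x)) \<in> S \<and>
             (\<forall>i\<in>I. \<beta> (\<lambda>x. f x - (\<Sum>i\<in>I. c i * b i x)) (b i) = 0)"
  using fin b f
proof (induction I arbitrary: f rule: finite_induct)
  case empty
  then show ?case by simp
next
  case (insert j I)
  obtain c where c: "(\<lambda>x. f x - (\<Sum>i\<in>I. c i * b i x)) \<in> S"
    "\<And>i. i \<in> I \<Longrightarrow> \<beta> (\<lambda>x. f x - (\<Sum>i\<in>I. c i * b i x)) (b i) = 0"
    using insert.IH[OF insert.prems(1) insert.prems(2)] by auto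
  have bj: "b j \<in> S" using insert.prems by auto
  obtain c' where c': "(\<lambda>x. b j x - (\<Sum>i\<in>I. c' i * b i x)) \<in> S"
    "\<And>i. i \<in> I \<Longrightarrow> \<beta> (\<lambda>x. b j x - (\<Sum>i\<in>I. c' i * b i x)) (b i) = 0"
    using insert.IH[OF insert.prems(1) bj] by auto
  have orth_sum: "(\<lambda>x. g x + (\<Sum>i\<in>J. a i * b i x)) \<in> S \<and> \<beta> (\<lambda>x. g x + (\<Sum>i\<in>J. a i * b i x)) h = \<beta> g h"
    if "J \<subseteq> I" "g \<in> S" "h \<in> S" "\<And>i. i \<in> I \<Longrightarrow> \<beta> h (b i) = 0" for J g h a
  proof -
    have "finite J" using that insert.hyps finite_subset by blast
    then show ?thesis using that(1)
    proof (induction J rule: finite_induct)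
      case empty
      then show ?case using that by simp
    next
      case (insert k J)
      have k: "b k \<in> S" "k \<in> I" using insert.prems \<open>\<And>i. i \<in> insert j I \<Longrightarrow> b i \<in> S\<close> by auto
      have eq: "(\<lambda>x. g x + (\<Sum>i\<in>insert k J. a i * b i x)) = (\<lambda>x. (g x + (\<Sum>i\<in>J. a i * b i x)) + a k * b k x)"
        using insert.hyps by (simp add: algebra_simps fun_eq_iff)
      have "\<beta> (b k) h = 0" using sym[OF k(1) that(3)] that(4)[OF k(2)] by simp
      then show ?case unfolding eq using insert S lin k that(3) by simp
    qed
  qed
  define r where "r = (\<lambda>x. f x - (\<Sum>i\<in>I. c i * b i x))"
  define r0 where "r0 = (\<lambda>x. b j x - (\<Sum>i\<in>I. c' i * b i x))"
  define t where "t = (if \<beta> r0 r0 = 0 then 0 else \<beta> r r0 / \<beta> r0 r0)"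
  have rS: "r \<in> S" and r0S: "r0 \<in> S" using c c' by (auto simp: r_def r0_def)
  \<comment> \<open>The form is only semidefinite and the \<open>b i\<close> may be dependent, so
    \<open>r0\<close> can have norm 0. Such a direction is orthogonal to \<open>r\<close>: otherwise
    \<open>s\<close> is chosen to make the form at \<open>r + s * r0\<close> equal to -1.\<close>
  have zero: "\<beta> r r0 = 0" if "\<beta> r0 r0 = 0"
  proof (rule ccontr)
    assume nz: "\<beta> r r0 \<noteq> 0"
    define s where "s = - (\<beta> r r + 1) / (2 * \<beta> r r0)"
    have "(\<lambda>x. r x + s * r0 x) \<in> S" using S rS r0S by blast
    then have "0 \<le> \<beta> (\<lambda>x. r x + s * r0 x) (\<lambda>x. r x + s * r0 x)" by (rule psd)
    also have "\<dots> = \<beta> r (\<lambda>x. r x + s * r0 x) + s * \<beta> r0 (\<lambda>x. r x + s * r0 x)"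
      using lin rS r0S S by blast
    also have "\<dots> = \<beta> r r + 2 * s * \<beta> r r0"
      using lin[OF rS r0S rS] lin[OF rS r0S r0S] that sym[OF rS r0S]
        sym[OF rS \<open>(\<lambda>x. r x + s * r0 x) \<in> S\<close>] sym[OF r0S \<open>(\<lambda>x. r x + s * r0 x) \<in> S\<close>]
      by simp
    also have "\<dots> = -1" using nz by (simp add: s_def field_simps)
    finally show False by simp
  qed
  define w where "w = (\<lambda>x. r x + (-t) * r0 x)"
  have wS: "w \<in> S" unfolding w_def using S rS r0S by blast
  have w_r0: "\<beta> w r0 = 0" unfolding w_def lin[OF rS r0S r0S] using zero by (simp add: t_def)
  have w_b: "\<beta> w (b i) = 0" if "i \<in> I" for i
  proof -
    have "b i \<in> S" using that insert.prems(1) by auto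
    then show ?thesis unfolding w_def lin[OF rS r0S \<open>b i \<in> S\<close>] using that c(2) c'(2)
      by (simp add: r_def r0_def)
  qed
  have bj_eq: "b j = (\<lambda>x. r0 x + (\<Sum>i\<in>I. c' i * b i x))" by (simp add: r0_def)
  have w_bj: "\<beta> w (b j) = 0"
    using orth_sum[OF subset_refl r0S wS w_b, of c'] sym[OF wS bj] sym[OF wS r0S] w_r0
    unfolding bj_eq[symmetric] by simp
  define C where "C = (\<lambda>i. if i = j then t else c i - t * c' i)"
  have "w = (\<lambda>x. f x - (\<Sum>i\<in>insert j I. C i * b i x))"
  proof
    fix x
    have "(\<Sum>i\<in>I. C i * b i x) = (\<Sum>i\<in>I. (c i - t * c' i) * b i x)"
      using insert.hyps by (intro sum.cong) (auto simp: C_def)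
    also have "\<dots> = (\<Sum>i\<in>I. c i * b i x) - t * (\<Sum>i\<in>I. c' i * b i x)"
      by (simp add: algebra_simps sum_subtractf sum_distrib_left)
    finally show "w x = f x - (\<Sum>i\<in>insert j I. C i * b i x)"
      using insert.hyps by (simp add: w_def r_def r0_def C_def algebra_simps)
  qed
  then show ?case using wS w_b w_bj by (intro exI[of _ C]) auto
qed

section \<open>The radial inner product on the unit interval\<close>

definition wip :: "nat \<Rightarrow> (real \<Rightarrow> real) \<Rightarrow> (real \<Rightarrow> real) \<Rightarrow> real" where
  "wip d f g = integral {0..1} (\<lambda>s. f s * g s * s ^ (d - 1))"

lemma wip_integrable:
  assumes "continuous_on {0..1} f" "continuous_on {0..1} g"
  shows "(\<lambda>s. f s * g s * s ^ (d - 1)) integrable_on {0..1::real}"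
  by (intro integrable_continuous_interval continuous_intros assms)

lemma wip_sym: "wip d f g = wip d g f"
  by (simp add: wip_def mult.commute)

lemma wip_lin:
  assumes "continuous_on {0..1} f" "continuous_on {0..1} g" "continuous_on {0..1} h"
  shows "wip d (\<lambda>s. f s + c * g s) h = wip d f h + c * wip d g h"
proof -
  have "wip d (\<lambda>s. f s + c * g s) h =
      integral {0..1} (\<lambda>s. f s * h s * s ^ (d - 1) + c * (g s * h s * s ^ (d - 1)))"
    unfolding wip_def by (rule integral_cong) (simp add: algebra_simps)
  also have "\<dots> = wip d f h + c * wip d g h"
    unfolding wip_def
    by (subst integral_add, (intro integrable_continuous_interval continuous_intros assms)+, simp)
  finally show ?thesis .
qed

lemma wip_lin_right:
  assumes "continuous_on {0..1} f" "continuous_on {0..1} g" "continuous_on {0..1} h"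
  shows "wip d h (\<lambda>s. f s + c * g s) = wip d h f + c * wip d h g"
  using wip_lin[OF assms] by (simp add: wip_sym)

lemma wip_nonneg: "continuous_on {0..1} f \<Longrightarrow> 0 \<le> wip d f f"
  unfolding wip_def by (intro integral_nonneg wip_integrable) auto

lemma quadratic_nonneg_discriminant:
  fixes a b c :: real
  assumes "\<And>t. 0 \<le> a + 2 * t * b + t\<^sup>2 * c" "0 \<le> a" "0 \<le> c"
  shows "b\<^sup>2 \<le> a * c"
proof (cases "c = 0")
  case True
  have "b = 0"
  proof (rule ccontr)
    assume "b \<noteq> 0"
    then show False using assms(1)[of "- (a + 1) / (2 * b)"] True by (simp add: field_simps)
  qed
  then show ?thesis using True by simp
next
  case False
  then have "c > 0" using assms by simp
  then show ?thesis using assms(1)[of "- b / c"] by (simp add: field_simps power2_eq_square)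
qed

lemma wip_Cauchy_Schwarz:
  assumes f: "continuous_on {0..1} f" and g: "continuous_on {0..1} g"
  shows "(wip d f g)\<^sup>2 \<le> wip d f f * wip d g g"
proof (rule quadratic_nonneg_discriminant)
  fix t
  have c: "continuous_on {0..1} (\<lambda>s. f s + t * g s)" by (intro continuous_intros f g)
  have "0 \<le> wip d (\<lambda>s. f s + t * g s) (\<lambda>s. f s + t * g s)" by (rule wip_nonneg[OF c])
  also have "\<dots> = wip d f f + 2 * t * wip d f g + t\<^sup>2 * wip d g g"
    by (simp add: wip_lin[OF f g c] wip_lin_right[OF f g f] wip_lin_right[OF f g g] wip_sym[of d g f]
        algebra_simps power2_eq_square)
  finally show "0 \<le> wip d f f + 2 * t * wip d f g + t\<^sup>2 * wip d g g" .
qed (auto intro: wip_nonneg f g)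

text \<open>The operator \<open>E f = s f' + (d/2) f\<close> is antisymmetric up to the boundary value at 1.\<close>
lemma wip_by_parts:
  assumes d: "d \<ge> 1"
    and f: "\<And>s. s \<in> {0..1} \<Longrightarrow> (f has_real_derivative f' s) (at s within {0..1})" "continuous_on {0..1} f'"
    and g: "\<And>s. s \<in> {0..1} \<Longrightarrow> (g has_real_derivative g' s) (at s within {0..1})" "continuous_on {0..1} g'"
  shows "wip d (\<lambda>s. s * f' s) g + wip d f (\<lambda>s. s * g' s) + real d * wip d f g = f 1 * g 1"
proof -
  have cf: "continuous_on {0..1} f" and cg: "continuous_on {0..1} g"
    using f(1) g(1) by (meson DERIV_continuous continuous_on_eq_continuous_within)+
  have dd: "s ^ d = s * s ^ (d - 1)" for s :: real using d by (cases d) auto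
  have "((\<lambda>s. s ^ d * f s * g s) has_vector_derivative
      ((s * f' s) * g s * s ^ (d - 1) + f s * (s * g' s) * s ^ (d - 1) + real d * (f s * g s * s ^ (d - 1))))
      (at s within {0..1})" if "s \<in> {0..1}" for s
    unfolding has_real_derivative_iff_has_vector_derivative[symmetric]
    by (rule derivative_eq_intros f(1) g(1) that refl | simp add: dd algebra_simps)+
  then have "((\<lambda>s. (s * f' s) * g s * s ^ (d - 1) + f s * (s * g' s) * s ^ (d - 1) + real d * (f s * g s * s ^ (d - 1)))
      has_integral (1 ^ d * f 1 * g 1 - 0 ^ d * f 0 * g 0)) {0..1}"
    by (intro fundamental_theorem_of_calculus) auto
  then have "integral {0..1} (\<lambda>s. (s * f' s) * g s * s ^ (d - 1) + f s * (s * g' s) * s ^ (d - 1)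
      + real d * (f s * g s * s ^ (d - 1))) = f 1 * g 1"
    using d by (simp add: integral_unique)
  moreover have "integral {0..1} (\<lambda>s. (s * f' s) * g s * s ^ (d - 1) + f s * (s * g' s) * s ^ (d - 1)
      + real d * (f s * g s * s ^ (d - 1))) =
      wip d (\<lambda>s. s * f' s) g + wip d f (\<lambda>s. s * g' s) + real d * wip d f g"
    unfolding wip_def
    by (subst integral_add, (intro integrable_continuous_interval continuous_intros cf cg f(2) g(2))+,
        subst integral_add, (intro integrable_continuous_interval continuous_intros cf cg f(2) g(2))+, simp)
  ultimately show ?thesis by simp
qed

text \<open>Up to scaling these are Jacobi polynomials transplanted to \<open>[0,1]\<close>. Only
  the orthogonality and the leading coefficient enter below.\<close>

definition monic_orth :: "nat \<Rightarrow> nat \<Rightarrow> real poly \<Rightarrow> bool" where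
  "monic_orth d N P \<longleftrightarrow> degree P \<le> N \<and> coeff P N = 1 \<and> (\<forall>Q. degree Q < N \<longrightarrow> wip d (poly P) (poly Q) = 0)"

lemma wip_poly_sum_right:
  assumes "finite I" "continuous_on {0..1} h"
  shows "wip d h (\<lambda>s. \<Sum>i\<in>I. c i * s ^ k i) = (\<Sum>i\<in>I. c i * wip d h (\<lambda>s. s ^ k i))"
  using assms(1)
proof (induction I rule: finite_induct)
  case empty
  then show ?case by (simp add: wip_def)
next
  case (insert i I)
  have "(\<lambda>s. \<Sum>i\<in>insert i I. c i * s ^ k i) = (\<lambda>s. (\<Sum>i\<in>I. c i * s ^ k i) + c i * s ^ k i)"
    using insert by (simp add: add.commute)
  then show ?case using insert
    by (simp only: wip_lin_right[OF continuous_on_sum[OF continuous_on_mult_left[OF continuous_on_power[OF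
        continuous_on_id]]]
          continuous_on_power[OF continuous_on_id] assms(2)]) simp
qed

lemma monic_orth_exists: "\<exists>P. monic_orth d N P"
proof -
  let ?S = "{f. continuous_on {0..1::real} f}"
  have "\<exists>c. (\<lambda>x. x ^ N - (\<Sum>i<N. c i * x ^ i)) \<in> ?S \<and>
      (\<forall>i\<in>{..<N}. wip d (\<lambda>x. x ^ N - (\<Sum>i<N. c i * x ^ i)) (\<lambda>s. s ^ i) = 0)"
    by (rule projection_exists[where S = ?S and \<beta> = "wip d" and b = "\<lambda>i s. s ^ i"])
      (auto intro!: continuous_intros wip_lin wip_nonneg wip_sym)
  then obtain c where c: "\<And>i. i < N \<Longrightarrow> wip d (\<lambda>x. x ^ N - (\<Sum>i<N. c i * x ^ i)) (\<lambda>s. s ^ i) = 0"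
    by auto
  define P where "P = monom 1 N - (\<Sum>i<N. monom (c i) i)"
  have P: "poly P = (\<lambda>x. x ^ N - (\<Sum>i<N. c i * x ^ i))"
    by (simp add: P_def poly_sum poly_monom fun_eq_iff)
  have "degree P \<le> N" unfolding P_def
    by (intro degree_diff_le degree_sum_le degree_monom_le order_trans[OF degree_monom_le]) auto
  moreover have "coeff P N = 1" by (simp add: P_def coeff_sum)
  moreover have "wip d (poly P) (poly Q) = 0" if "degree Q < N" for Q
  proof -
    have "poly Q = (\<lambda>s. \<Sum>i\<le>degree Q. coeff Q i * s ^ i)" by (simp add: poly_altdef fun_eq_iff)
    then have "wip d (poly P) (poly Q) = (\<Sum>i\<le>degree Q. coeff Q i * wip d (poly P) (\<lambda>s. s ^ i))"
      by (simp add: wip_poly_sum_right continuous_intros)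
    also have "\<dots> = 0" using c that by (intro sum.neutral) (auto simp: P)
    finally show ?thesis .
  qed
  ultimately show ?thesis unfolding monic_orth_def by blast
qed

text \<open>The monomial of degree \<open>n\<close> is multiplied by \<open>n + d / 2\<close>, so
  degrees never grow. The shift \<open>d / 2\<close> takes half of the term produced by
  differentiating the weight and leaves only a boundary value as symmetric part.\<close>

definition Eop :: "nat \<Rightarrow> real poly \<Rightarrow> real poly" where
  "Eop d Q = pCons 0 (pderiv Q) + smult (real d / 2) Q"

lemma poly_Eop: "poly (Eop d Q) s = s * poly (pderiv Q) s + (real d / 2) * poly Q s"
  by (simp add: Eop_def)

lemma coeff_Eop: "coeff (Eop d Q) n = (real n + real d / 2) * coeff Q n"
  by (cases n) (auto simp: Eop_def coeff_pCons coeff_pderiv algebra_simps)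

lemma degree_Eop: "degree Q \<le> N \<Longrightarrow> degree (Eop d Q) \<le> N"
  by (intro degree_le) (auto simp: coeff_Eop coeff_eq_0)

abbreviation pip :: "nat \<Rightarrow> real poly \<Rightarrow> real poly \<Rightarrow> real" where
  "pip d P Q \<equiv> wip d (poly P) (poly Q)"

lemma cont_poly: "continuous_on A (poly (P :: real poly))"
  by (intro continuous_intros)

lemma pip_lin: "pip d (P + smult c Q) R = pip d P R + c * pip d Q R"
  using wip_lin[OF cont_poly cont_poly cont_poly, of d P c Q R] by (simp add: poly_add[abs_def] poly_smult[abs_def])

lemma pip_lin_right: "pip d R (P + smult c Q) = pip d R P + c * pip d R Q"
  using pip_lin[of d P c Q R] by (simp add: wip_sym)

lemma Eop_by_parts:
  assumes "d \<ge> 1"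
  shows "pip d (Eop d P) Q + pip d P (Eop d Q) = poly P 1 * poly Q 1"
proof -
  have "wip d (\<lambda>s. s * poly (pderiv P) s) (poly Q) + wip d (poly P) (\<lambda>s. s * poly (pderiv Q) s)
      + real d * wip d (poly P) (poly Q) = poly P 1 * poly Q 1"
    by (rule wip_by_parts[OF assms]) (auto intro!: cont_poly poly_DERIV DERIV_subset[OF poly_DERIV])
  moreover have "pip d (Eop d P) Q = wip d (\<lambda>s. s * poly (pderiv P) s) (poly Q) + (real d / 2) * pip d P Q" for P Q
    using wip_lin[of "\<lambda>s. s * poly (pderiv P) s" "poly P" "poly Q" d "real d / 2"]
    by (simp add: poly_Eop[abs_def] cont_poly continuous_intros)
  ultimately show ?thesis by (simp add: wip_sym[of d "poly P"])
qed

lemma Cauchy_Schwarz_two: "(a * x + b * y)\<^sup>2 \<le> (a\<^sup>2 + b\<^sup>2) * (x\<^sup>2 + y\<^sup>2)" for a b x y :: real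
  using zero_le_power2[of "a * y - b * x"] by (simp add: power2_eq_square algebra_simps)

lemma le_of_power2_le_mult: "(a::real)\<^sup>2 \<le> b * a \<Longrightarrow> 0 \<le> a \<Longrightarrow> 0 \<le> b \<Longrightarrow> a \<le> b"
  by (cases "a = 0") (auto simp: power2_eq_square)

text \<open>
  Decompose along the orthogonal polynomials: the value at 1 and the matrix of \<open>E\<close> are known
  exactly, because \<open>E\<close> is upper triangular while its symmetric part has rank one.\<close>
lemma poly_endpoint_and_Markov:
  assumes d: "d \<ge> 1" and "degree Q \<le> N"
  shows "(poly Q 1)\<^sup>2 \<le> real ((N + 1) * (N + d)) * pip d Q Q \<and>
    pip d (Eop d Q) (Eop d Q) \<le> (real ((N + 1) * (N + d)))\<^sup>2 / 2 * pip d Q Q"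
  using assms(2)
proof (induction N arbitrary: Q)
  case 0
  then obtain c where Q: "Q = [:c:]" by (auto elim: degree_eq_zeroE)
  have "Eop d Q = [:real d / 2 * c:]" by (simp add: Q Eop_def)
  moreover have "wip d (\<lambda>s. a) (\<lambda>s. a) = a\<^sup>2 / real d" for a
  proof -
    have "((\<lambda>s. a * a * s ^ (d - 1)) has_integral (a * a * (1 ^ d / real d) - a * a * (0 ^ d / real d))) {0..1::real}"
    proof (intro fundamental_theorem_of_calculus)
      fix s :: real assume "s \<in> {0..1}"
      show "((\<lambda>s. a * a * (s ^ d / real d)) has_vector_derivative a * a * s ^ (d - 1)) (at s within {0..1})"
        unfolding has_real_derivative_iff_has_vector_derivative[symmetric]
        using d by (auto intro!: derivative_eq_intros)
    qed auto
    then have "((\<lambda>s. a * a * s ^ (d - 1)) has_integral (a * a * (1 / real d))) {0..1::real}"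
      using d by (simp add: zero_power)
    then show ?thesis unfolding wip_def power2_eq_square by (simp only: integral_unique) simp
  qed
  moreover have "poly [:x:] = (\<lambda>s. x)" for x :: real by (simp add: fun_eq_iff)
  moreover have "0 \<le> c * (c * real d)" by (simp add: mult.assoc[symmetric])
  ultimately show ?case using d by (simp add: Q) (simp add: field_simps power2_eq_square)
next
  case (Suc N)
  define M where "M = real ((N + 1) * (N + d))"
  \<comment> \<open>\<open>k\<close> is twice the eigenvalue of \<open>E\<close> in degree
    \<open>Suc N\<close> and at the same time the increment of the constant
    \<open>(N + 1) * (N + d)\<close>. This coincidence closes the induction.\<close>
  define k where "k = 2 * real (Suc N) + real d"
  have kM: "real ((Suc N + 1) * (Suc N + d)) = M + k"
    by (simp add: M_def k_def algebra_simps)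
  have M0: "M \<ge> 0" and k0: "k \<ge> 0" by (simp_all add: M_def k_def)
  obtain P where P: "degree P \<le> Suc N" "coeff P (Suc N) = 1" "\<And>Q. degree Q \<le> N \<Longrightarrow> pip d P Q = 0"
    using monic_orth_exists[of d "Suc N"] by (auto simp: monic_orth_def less_Suc_eq_le)
  define nP where "nP = pip d P P"
  have nP0: "nP \<ge> 0" unfolding nP_def by (rule wip_nonneg[OF cont_poly])
  define r where "r = Eop d P + smult (- (k / 2)) P"
  have r_deg: "degree r \<le> N"
  proof (rule degree_le, intro allI impI)
    fix i assume "i > N"
    show "coeff r i = 0"
    proof (cases "i = Suc N")
      case True
      then show ?thesis by (simp add: r_def coeff_Eop P(2) k_def)
    next
      case False
      then show ?thesis using \<open>i > N\<close> P(1) by (simp add: r_def coeff_Eop coeff_eq_0)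
    qed
  qed
  have EP: "Eop d P = r + smult (k / 2) P" by (simp add: r_def)
  have rP: "pip d P r = 0" "pip d r P = 0" using P(3)[OF r_deg] by (auto simp: wip_sym)
  \<comment> \<open>Put both arguments of the integration by parts equal to \<open>P\<close>: the
    part \<open>r\<close> of \<open>E P\<close> has lower degree and is orthogonal to
    \<open>P\<close>, so only twice \<open>k / 2 * nP\<close> is left.\<close>
  have P1: "(poly P 1)\<^sup>2 = k * nP"
    using Eop_by_parts[OF d, of P P] unfolding EP pip_lin pip_lin_right rP nP_def[symmetric]
    by (simp add: power2_eq_square)
  \<comment> \<open>In the pairing of \<open>E P\<close> with \<open>r\<close> the term
    \<open>E r\<close> drops out, being of degree at most \<open>N\<close>. So \<open>r\<close> acts
    as \<open>poly P 1\<close> times the evaluation at 1 on lower degrees, and its size is governed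
    by the endpoint bound of the induction hypothesis.\<close>
  have rr: "pip d r r \<le> (poly P 1)\<^sup>2 * M"
  proof (rule le_of_power2_le_mult)
    have "pip d (Eop d P) r = poly P 1 * poly r 1"
      using Eop_by_parts[OF d, of P r] P(3)[OF degree_Eop[OF r_deg]] by simp
    then have "pip d r r = poly P 1 * poly r 1"
      unfolding EP pip_lin rP by simp
    then have "(pip d r r)\<^sup>2 = (poly P 1)\<^sup>2 * (poly r 1)\<^sup>2" by (simp add: power_mult_distrib)
    also have "\<dots> \<le> (poly P 1)\<^sup>2 * (M * pip d r r)"
      using Suc.IH[OF r_deg] by (intro mult_left_mono) (auto simp: M_def)
    finally show "(pip d r r)\<^sup>2 \<le> (poly P 1)\<^sup>2 * M * pip d r r" by (simp add: mult.assoc)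
  qed (use M0 in \<open>auto intro!: wip_nonneg cont_poly\<close>)
  define \<alpha> where "\<alpha> = coeff Q (Suc N)"
  define Q0 where "Q0 = Q + smult (- \<alpha>) P"
  have Q0_deg: "degree Q0 \<le> N"
  proof (rule degree_le, intro allI impI)
    fix i assume "i > N"
    show "coeff Q0 i = 0"
    proof (cases "i = Suc N")
      case True
      then show ?thesis by (simp add: Q0_def \<alpha>_def P(2))
    next
      case False
      then show ?thesis using \<open>i > N\<close> P(1) Suc.prems by (simp add: Q0_def coeff_eq_0)
    qed
  qed
  have Q: "Q = Q0 + smult \<alpha> P" by (simp add: Q0_def)
  define n0 where "n0 = pip d Q0 Q0"
  have n00: "n0 \<ge> 0" unfolding n0_def by (rule wip_nonneg[OF cont_poly])
  have orth: "pip d P R = 0" "pip d R P = 0" if "degree R \<le> N" for R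
    using P(3)[OF that] by (auto simp: wip_sym)
  have nQ: "pip d Q Q = n0 + \<alpha>\<^sup>2 * nP"
    unfolding Q pip_lin pip_lin_right by (simp add: orth[OF Q0_deg] n0_def nP_def power2_eq_square)
  have IH1: "(poly Q0 1)\<^sup>2 \<le> M * n0" and IH2: "pip d (Eop d Q0) (Eop d Q0) \<le> M\<^sup>2 / 2 * n0"
    using Suc.IH[OF Q0_deg] by (auto simp: M_def n0_def)
  have "(poly Q 1)\<^sup>2 \<le> (M + k) * (n0 + \<alpha>\<^sup>2 * nP)"
  proof -
    have "\<bar>poly Q 1\<bar> \<le> \<bar>poly Q0 1\<bar> + \<bar>\<alpha>\<bar> * \<bar>poly P 1\<bar>"
      unfolding Q by (simp add: abs_mult[symmetric])
    also have "\<dots> \<le> sqrt M * sqrt n0 + sqrt k * (\<bar>\<alpha>\<bar> * sqrt nP)"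
    proof -
      have "\<bar>poly Q0 1\<bar> \<le> sqrt M * sqrt n0"
        using real_sqrt_le_mono[OF IH1] by (simp add: real_sqrt_mult)
      moreover have "\<bar>poly P 1\<bar> = sqrt k * sqrt nP"
        using arg_cong[OF P1, of sqrt] by (simp add: real_sqrt_mult)
      ultimately show ?thesis by (simp add: algebra_simps)
    qed
    finally have "(poly Q 1)\<^sup>2 \<le> (sqrt M * sqrt n0 + sqrt k * (\<bar>\<alpha>\<bar> * sqrt nP))\<^sup>2"
      by (metis abs_ge_zero power2_abs power_mono)
    also have "\<dots> \<le> (M + k) * (n0 + \<alpha>\<^sup>2 * nP)"
      using Cauchy_Schwarz_two[of "sqrt M" "sqrt n0" "sqrt k" "\<bar>\<alpha>\<bar> * sqrt nP"] M0 k0 n00 nP0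
      by (simp add: power_mult_distrib)
    finally show ?thesis .
  qed
  moreover have "pip d (Eop d Q) (Eop d Q) \<le> (M + k)\<^sup>2 / 2 * (n0 + \<alpha>\<^sup>2 * nP)"
  proof -
    \<comment> \<open>\<open>T\<close> is the part of \<open>E Q\<close> of degree at most
      \<open>N\<close>; the remainder is a multiple of \<open>P\<close>, hence orthogonal to
      it.\<close>
    define T where "T = Eop d Q0 + smult \<alpha> r"
    have T_deg: "degree T \<le> N"
      unfolding T_def using degree_Eop[OF Q0_deg] r_deg by (intro degree_add_le) (auto intro: order_trans[OF
          degree_smult_le])
    have EQ: "Eop d Q = T + smult (\<alpha> * k / 2) P"
      by (rule poly_eqI) (simp add: coeff_Eop T_def r_def Q algebra_simps)
    have 1: "pip d (Eop d Q) (Eop d Q) = pip d T T + (\<alpha> * k / 2)\<^sup>2 * nP"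
      unfolding EQ pip_lin pip_lin_right by (simp add: orth[OF T_deg] nP_def power2_eq_square)
    define e where "e = pip d (Eop d Q0) (Eop d Q0)"
    define \<rho> where "\<rho> = pip d r r"
    have e0: "e \<ge> 0" and \<rho>0: "\<rho> \<ge> 0" unfolding e_def \<rho>_def by (auto intro!: wip_nonneg cont_poly)
    have "(pip d (Eop d Q0) r)\<^sup>2 \<le> e * \<rho>"
      unfolding e_def \<rho>_def by (rule wip_Cauchy_Schwarz) (auto intro: cont_poly)
    then have cs: "\<bar>pip d (Eop d Q0) r\<bar> \<le> sqrt e * sqrt \<rho>"
      using real_sqrt_le_mono by (fastforce simp: real_sqrt_mult)
    have "pip d T T = e + 2 * \<alpha> * pip d (Eop d Q0) r + \<alpha>\<^sup>2 * \<rho>"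
      unfolding T_def pip_lin pip_lin_right e_def \<rho>_def
      by (simp add: wip_sym[of d "poly r" "poly (Eop d Q0)"] algebra_simps power2_eq_square)
    also have "\<dots> \<le> e + 2 * \<bar>\<alpha>\<bar> * (sqrt e * sqrt \<rho>) + \<alpha>\<^sup>2 * \<rho>"
    proof -
      have "\<alpha> * pip d (Eop d Q0) r \<le> \<bar>\<alpha>\<bar> * \<bar>pip d (Eop d Q0) r\<bar>" by (metis abs_ge_self abs_mult)
      also have "\<dots> \<le> \<bar>\<alpha>\<bar> * (sqrt e * sqrt \<rho>)" using cs by (intro mult_left_mono) auto
      finally show ?thesis by simp
    qed
    also have "\<dots> = (sqrt e + \<bar>\<alpha>\<bar> * sqrt \<rho>)\<^sup>2"
      using e0 \<rho>0 by (simp add: power2_sum power_mult_distrib)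
    also have "\<dots> \<le> (M / sqrt 2 * sqrt n0 + sqrt (k * M) * (\<bar>\<alpha>\<bar> * sqrt nP))\<^sup>2"
    proof (intro power_mono add_mono)
      have "sqrt e \<le> sqrt (M\<^sup>2 / 2 * n0)" using IH2 by (simp add: e_def)
      also have "\<dots> = M / sqrt 2 * sqrt n0" using M0 by (simp add: real_sqrt_mult real_sqrt_divide)
      finally show "sqrt e \<le> M / sqrt 2 * sqrt n0" .
      have "sqrt \<rho> \<le> sqrt (k * nP * M)" using rr by (simp add: \<rho>_def P1)
      also have "\<dots> = sqrt (k * M) * sqrt nP" by (simp add: real_sqrt_mult algebra_simps)
      finally show "\<bar>\<alpha>\<bar> * sqrt \<rho> \<le> sqrt (k * M) * (\<bar>\<alpha>\<bar> * sqrt nP)"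
        by (metis abs_ge_zero mult.left_commute mult_left_mono)
    qed (use e0 \<rho>0 in auto)
    also have "\<dots> \<le> (M\<^sup>2 / 2 + k * M) * (n0 + \<alpha>\<^sup>2 * nP)"
      using Cauchy_Schwarz_two[of "M / sqrt 2" "sqrt n0" "sqrt (k * M)" "\<bar>\<alpha>\<bar> * sqrt nP"] M0 k0 n00 nP0
      by (simp add: power_mult_distrib power_divide)
    finally have "pip d T T \<le> (M\<^sup>2 / 2 + k * M) * (n0 + \<alpha>\<^sup>2 * nP)" .
    \<comment> \<open>The constant that occurs is \<open>k\<^sup>2 / 4\<close>; relaxed to
      \<open>k\<^sup>2 / 2\<close> it completes the square
      \<open>(M + k)\<^sup>2 / 2\<close>.\<close>
    moreover have "(\<alpha> * k / 2)\<^sup>2 * nP \<le> k\<^sup>2 / 2 * (n0 + \<alpha>\<^sup>2 * nP)"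
    proof -
      have "(\<alpha> * k / 2)\<^sup>2 * nP = k\<^sup>2 / 4 * (\<alpha>\<^sup>2 * nP)" by (simp add: power2_eq_square)
      also have "\<dots> \<le> k\<^sup>2 / 2 * (n0 + \<alpha>\<^sup>2 * nP)" using n00 nP0 by (intro mult_mono) auto
      finally show ?thesis .
    qed
    moreover have "(M + k)\<^sup>2 / 2 = M\<^sup>2 / 2 + k * M + k\<^sup>2 / 2"
      by (simp add: power2_eq_square field_simps)
    ultimately show ?thesis unfolding 1 by (simp add: distrib_right)
  qed
  ultimately show ?case unfolding nQ kM by blast
qed

text \<open>If \<open>s * v' s\<close> is small compared with \<open>v\<close>, Cauchy-Schwarz is
  enough. Otherwise integration by parts moves the derivative to \<open>Q\<close>, where the
  endpoint and Markov bounds apply. The number \<open>c = 191/100\<close> satisfies \<open>sqrt (2 +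
  1 / (3 * c\<^sup>2)) + (1 / sqrt 2 + 1 / 6) / c \<le> c\<close>. The right-hand side is quadratic
  in each function so that it can be integrated over all rays.\<close>

lemma ray_inequality:
  assumes d: "d \<ge> 1" and N: "N \<ge> 2" and Q: "degree Q \<le> N"
    and v: "\<And>s. s \<in> {0..1} \<Longrightarrow> (v has_real_derivative v' s) (at s within {0..1})" "continuous_on {0..1} v'"
    and pos: "\<kappa> > 0" "\<mu> > 0"
  shows "\<bar>wip d (poly Q) (\<lambda>s. s * v' s)\<bar> \<le> 191/100 * sqrt (real ((N + 1) * (N + d))) *
    (\<kappa> / 2 * wip d (poly Q) (poly Q) +
     1 / (4 * \<kappa>) * (\<mu> * wip d v v + wip d (\<lambda>s. s * v' s) (\<lambda>s. s * v' s) / \<mu>))"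
proof -
  define M where "M = real ((N + 1) * (N + d))"
  define C where "C = 191/100 * sqrt M"
  have cv: "continuous_on {0..1} v" using v(1) by (meson DERIV_continuous continuous_on_eq_continuous_within)
  have csv: "continuous_on {0..1} (\<lambda>s. s * v' s)" by (intro continuous_intros v(2))
  note cQ = cont_poly[of "{0..1}" Q]
  define X where "X = wip d (poly Q) (\<lambda>s. s * v' s)"
  define n where "n = sqrt (wip d (poly Q) (poly Q))"
  define a where "a = sqrt (wip d v v)"
  define b where "b = sqrt (wip d (\<lambda>s. s * v' s) (\<lambda>s. s * v' s))"
  have n2: "wip d (poly Q) (poly Q) = n\<^sup>2" and a2: "wip d v v = a\<^sup>2"
    and b2: "wip d (\<lambda>s. s * v' s) (\<lambda>s. s * v' s) = b\<^sup>2"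
    by (simp_all add: n_def a_def b_def wip_nonneg cQ cv csv)
  have nn: "n \<ge> 0" "a \<ge> 0" "b \<ge> 0" by (simp_all add: n_def a_def b_def wip_nonneg cQ cv csv)
  have cs: "\<bar>wip d f g\<bar> \<le> sqrt (wip d f f) * sqrt (wip d g g)"
    if "continuous_on {0..1} f" "continuous_on {0..1} g" for f g
    using real_sqrt_le_mono[OF wip_Cauchy_Schwarz[OF that, of d]] by (simp add: real_sqrt_mult)
  \<comment> \<open>Degree bound at least 2 enters here: it lets \<open>M\<close> absorb the
    dimension coming from the weight.\<close>
  have M3: "3 * real d \<le> M" and M0: "M > 0"
  proof -
    have "real (3 * d) \<le> real ((N + 1) * (N + d))"
      unfolding of_nat_le_iff using N by (intro mult_mono) auto
    then show "3 * real d \<le> M" by (simp add: M_def)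
    then show "M > 0" using d by simp
  qed
  have C0: "C > 0" using M0 by (simp add: C_def)
  have C2: "C\<^sup>2 = 36481/10000 * M" using M0 by (simp add: C_def power_mult_distrib power2_eq_square)
  have "\<bar>X\<bar> \<le> C * (n * sqrt (a * b))"
  proof (cases "b \<le> C\<^sup>2 * a")
    case True
    have "b = sqrt (b * b)" using nn by simp
    also have "\<dots> \<le> sqrt (C\<^sup>2 * a * b)" using True nn by (intro real_sqrt_le_mono mult_right_mono)
    also have "\<dots> = C * sqrt (a * b)" using C0 by (simp add: real_sqrt_mult)
    finally have "n * b \<le> n * (C * sqrt (a * b))" using nn by (intro mult_left_mono)
    then show ?thesis using cs[OF cQ csv] by (simp add: X_def n_def[symmetric] b_def[symmetric] mult.left_commute)
  next
    case False
    define y where "y = sqrt (a * b)"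
    have y0: "y \<ge> 0" using nn by (simp add: y_def)
    have y2: "y\<^sup>2 = a * b" using nn by (simp add: y_def)
    have ay: "C\<^sup>2 * a\<^sup>2 \<le> y\<^sup>2" using False nn mult_right_mono[of "C\<^sup>2 * a" b a]
      unfolding y2 by (simp add: power2_eq_square mult.commute mult.left_commute)
    have ay': "C * a \<le> y"
      by (rule power2_le_imp_le) (use ay y0 in \<open>auto simp: power_mult_distrib\<close>)
    have parts: "wip d (\<lambda>s. s * poly (pderiv Q) s) v + wip d (poly Q) (\<lambda>s. s * v' s) + real d * wip d (poly Q) v
        = poly Q 1 * v 1"
      by (rule wip_by_parts[OF d]) (auto intro!: cont_poly DERIV_subset[OF poly_DERIV] v)
    have EQ: "wip d (poly (Eop d Q)) v = wip d (\<lambda>s. s * poly (pderiv Q) s) v + (real d / 2) * wip d (poly Q) v"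
      using wip_lin[of "\<lambda>s. s * poly (pderiv Q) s" "poly Q" v d "real d / 2"] cv
      by (simp add: poly_Eop[abs_def] cont_poly continuous_intros)
    have X: "X = poly Q 1 * v 1 - wip d (poly (Eop d Q)) v - (real d / 2) * wip d (poly Q) v"
      using parts EQ by (simp add: X_def)
    note PM = poly_endpoint_and_Markov[OF d Q, folded M_def]
    have "\<bar>poly Q 1\<bar> \<le> sqrt M * n"
      using real_sqrt_le_mono[OF conjunct1[OF PM]] by (simp add: real_sqrt_mult n_def)
    \<comment> \<open>The square of the endpoint value is \<open>2 * wip d v (s v')\<close> plus
      \<open>d\<close> times the squared norm of \<open>v\<close>. In this regime the second term is
      at most \<open>y\<^sup>2 / (3 * c\<^sup>2)\<close> with \<open>c = 191/100\<close>, and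
      14462/10000 bounds \<open>sqrt (2 + 1 / (3 * c\<^sup>2))\<close>.\<close>
    moreover have "\<bar>v 1\<bar> \<le> 14462/10000 * y"
    proof (rule power2_le_imp_le)
      have "wip d (\<lambda>s. s * v' s) v + wip d v (\<lambda>s. s * v' s) + real d * wip d v v = v 1 * v 1"
        by (rule wip_by_parts[OF d]) (auto intro!: v)
      then have "(v 1)\<^sup>2 = 2 * wip d v (\<lambda>s. s * v' s) + real d * a\<^sup>2"
        by (simp add: power2_eq_square[of "v 1"] wip_sym[of d "\<lambda>s. s * v' s" v] a2)
      also have "\<dots> \<le> 2 * y\<^sup>2 + real d * a\<^sup>2"
        using cs[OF cv csv] by (simp add: y2 a_def b_def)
      also have "\<dots> \<le> 2 * y\<^sup>2 + M / 3 * a\<^sup>2" using M3 by (intro add_left_mono mult_right_mono) auto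
      also have "\<dots> \<le> (14462/10000 * y)\<^sup>2"
        proof -
        have "(14462/10000 * y)\<^sup>2 = 209149444/100000000 * y\<^sup>2" by (simp add: power2_eq_square)
        moreover have "36481/10000 * (M * a\<^sup>2) \<le> y\<^sup>2" using ay by (simp add: C2)
        ultimately show ?thesis using zero_le_power2[of y] by linarith
      qed
      finally show "\<bar>v 1\<bar>\<^sup>2 \<le> (14462/10000 * y)\<^sup>2" by simp
    qed (use y0 in auto)
    ultimately have 1: "\<bar>poly Q 1 * v 1\<bar> \<le> sqrt M * n * (14462/10000 * y)"
      unfolding abs_mult by (intro mult_mono) (use nn M0 in auto)
    \<comment> \<open>The decimal is a rational upper bound for \<open>1 / sqrt 2\<close>.\<close>
    have E: "sqrt (wip d (poly (Eop d Q)) (poly (Eop d Q))) \<le> 70712/100000 * M * n"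
    proof -
      have "sqrt (wip d (poly (Eop d Q)) (poly (Eop d Q))) \<le> sqrt (M\<^sup>2 / 2 * n\<^sup>2)"
        using PM by (intro real_sqrt_le_mono) (simp add: n2)
      also have "\<dots> = sqrt (1/2) * M * n" using M0 nn by (simp add: real_sqrt_mult real_sqrt_divide)
      also have "\<dots> \<le> 70712/100000 * M * n"
        using M0 nn by (intro mult_right_mono real_le_lsqrt real_sqrt_le_iff[THEN iffD2])
          (auto intro!: real_le_lsqrt simp: power2_eq_square)
      finally show ?thesis .
    qed
    have 2: "\<bar>wip d (poly (Eop d Q)) v\<bar> \<le> 70712/100000 * M * n * a"
      using cs[OF cont_poly cv] E nn by (smt (verit) a_def mult_right_mono)
    have 3: "\<bar>(real d / 2) * wip d (poly Q) v\<bar> \<le> M / 6 * (n * a)"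
      unfolding abs_mult using cs[OF cQ cv] M3 nn
      by (intro mult_mono) (auto simp: n_def a_def)
    have Ma: "M * a \<le> 100/191 * sqrt M * y"
    proof -
      have "191/100 * (M * a) = sqrt M * (C * a)" using M0 by (simp add: C_def)
      also have "\<dots> \<le> sqrt M * y" using ay' M0 by (intro mult_left_mono) auto
      finally show ?thesis by simp
    qed
    have "\<bar>X\<bar> \<le> sqrt M * n * (14462/10000 * y) + 70712/100000 * M * n * a + M / 6 * (n * a)"
      using 1 2 3 unfolding X by linarith
    also have "\<dots> = n * (14462/10000 * (sqrt M * y) + (70712/100000 + 1/6) * (M * a))"
      by (simp add: algebra_simps)
    also have "\<dots> \<le> n * (14462/10000 * (sqrt M * y) + (70712/100000 + 1/6) * (100/191 * sqrt M * y))"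
      using Ma nn by (intro mult_left_mono add_left_mono) auto
    also have "\<dots> \<le> n * (191/100 * (sqrt M * y))"
      using nn y0 M0 by (intro mult_left_mono) auto
    finally show ?thesis by (simp add: C_def y_def algebra_simps)
  qed
  also have "\<dots> \<le> C * (\<kappa> / 2 * n\<^sup>2 + 1 / (4 * \<kappa>) * (\<mu> * a\<^sup>2 + b\<^sup>2 / \<mu>))"
  proof (intro mult_left_mono)
    have ab: "2 * (a * b) \<le> \<mu> * a\<^sup>2 + b\<^sup>2 / \<mu>"
      using zero_le_power2[of "\<mu> * a - b"] pos by (simp add: field_simps power2_eq_square)
    have "n * sqrt (a * b) \<le> \<kappa> / 2 * n\<^sup>2 + (sqrt (a * b))\<^sup>2 / (2 * \<kappa>)"
      using zero_le_power2[of "\<kappa> * n - sqrt (a * b)"] pos(1) by (simp add: field_simps power2_eq_square)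
    also have "(sqrt (a * b))\<^sup>2 / (2 * \<kappa>) \<le> 1 / (4 * \<kappa>) * (\<mu> * a\<^sup>2 + b\<^sup>2 / \<mu>)"
      using ab pos(1) nn by (simp add: field_simps)
    finally show "n * sqrt (a * b) \<le> \<kappa> / 2 * n\<^sup>2 + 1 / (4 * \<kappa>) * (\<mu> * a\<^sup>2 + b\<^sup>2 / \<mu>)" by simp
  qed (use C0 in auto)
  finally show ?thesis by (simp add: X_def C_def M_def n2 a2 b2)
qed

section \<open>Barycentric coordinates and polar integration on a simplex\<close>

text \<open>The vertices, not their hull, are the parameter. The coordinates \<open>bary V\<close>
  are then affine functions on the whole space, negative somewhere off the simplex, and can be
  differentiated and compared across its boundary.\<close>

locale full_simplex =
  fixes V :: "'a::euclidean_space set"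
  assumes indep: "\<not> affine_dependent V" and card_V: "card V = DIM('a) + 1"
begin

definition K :: "'a set" where "K = convex hull V"

abbreviation lam :: "'a \<Rightarrow> 'a \<Rightarrow> real" where "lam \<equiv> bary V"

lemma fin: "finite V"
  using card_V card.infinite by fastforce

lemma affine_hull_V: "affine hull V = UNIV"
proof -
  have "aff_dim V = DIM('a)"
    using aff_dim_affine_independent[OF indep] card_V by simp
  then show ?thesis by (simp add: aff_dim_eq_full)
qed

lemma bary_coords_unique:
  fixes \<mu> \<nu> :: "'a \<Rightarrow> real"
  assumes "(\<Sum>v\<in>V. \<mu> v) = 1" "(\<Sum>v\<in>V. \<mu> v *\<^sub>R v) = x" "(\<Sum>v\<in>V. \<nu> v) = 1" "(\<Sum>v\<in>V. \<nu> v *\<^sub>R v) = x" "v \<in> V"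
  shows "\<mu> v = \<nu> v"
proof (rule ccontr)
  assume "\<mu> v \<noteq> \<nu> v"
  then have "\<exists>S u. finite S \<and> S \<subseteq> V \<and> (\<Sum>v\<in>S. u v) = 0 \<and> (\<exists>v\<in>S. u v \<noteq> 0) \<and> (\<Sum>v\<in>S. u v *\<^sub>R v) = 0"
    using assms fin
    by (intro exI[of _ V] exI[of _ "\<lambda>v. \<mu> v - \<nu> v"]) (auto simp: sum_subtractf scaleR_diff_left)
  then show False using indep affine_dependent_explicit by blast
qed

lemma lam_props:
  "(\<forall>v. v \<notin> V \<longrightarrow> lam v x = 0) \<and> (\<Sum>v\<in>V. lam v x) = 1 \<and> (\<Sum>v\<in>V. lam v x *\<^sub>R v) = x"
proof -
  have "x \<in> affine hull V" by (simp add: affine_hull_V)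
  then obtain u where u: "sum u V = 1" "(\<Sum>v\<in>V. u v *\<^sub>R v) = x"
    using affine_hull_finite[OF fin] by auto
  let ?P = "\<lambda>\<mu>. (\<forall>v. v \<notin> V \<longrightarrow> \<mu> v = 0) \<and> (\<Sum>v\<in>V. \<mu> v) = 1 \<and> (\<Sum>v\<in>V. \<mu> v *\<^sub>R v) = x"
  have "?P (\<lambda>v. if v \<in> V then u v else 0)" using u by (auto cong: sum.cong)
  then have ex: "\<exists>\<mu>. ?P \<mu>" by (rule exI[where x = "\<lambda>v. if v \<in> V then u v else 0"])
  have uniq: "\<mu> = \<nu>" if "?P \<mu>" "?P \<nu>" for \<mu> \<nu>
  proof
    fix v show "\<mu> v = \<nu> v"
      using bary_coords_unique[of \<mu> x \<nu> v] that by (cases "v \<in> V") auto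
  qed
  have "\<exists>!\<mu>. ?P \<mu>" by (rule ex_ex1I[OF ex uniq])
  then have "?P (THE \<mu>. ?P \<mu>)" by (rule theI')
  then show ?thesis by (simp add: bary_def)
qed

lemma lam_outside: "v \<notin> V \<Longrightarrow> lam v x = 0" using lam_props by blast
lemma lam_sum: "(\<Sum>v\<in>V. lam v x) = 1" using lam_props by blast
lemma lam_repr: "(\<Sum>v\<in>V. lam v x *\<^sub>R v) = x" using lam_props by blast

lemma lam_eqI:
  assumes "(\<Sum>v\<in>V. \<mu> v) = 1" "(\<Sum>v\<in>V. \<mu> v *\<^sub>R v) = x" "v \<in> V"
  shows "lam v x = \<mu> v"
  using bary_coords_unique[OF lam_sum lam_repr assms(1,2,3)] .

lemma lam_affine: "lam v (x + t *\<^sub>R (y - z)) = lam v x + t * (lam v y - lam v z)"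
proof (cases "v \<in> V")
  case True
  show ?thesis
  proof (rule lam_eqI[OF _ _ True])
    show "(\<Sum>v\<in>V. lam v x + t * (lam v y - lam v z)) = 1"
      by (simp add: sum.distrib sum_distrib_left[symmetric] sum_subtractf lam_sum)
    have "(\<Sum>v\<in>V. (lam v x + t * (lam v y - lam v z)) *\<^sub>R v) =
        (\<Sum>v\<in>V. lam v x *\<^sub>R v) + t *\<^sub>R ((\<Sum>v\<in>V. lam v y *\<^sub>R v) - (\<Sum>v\<in>V. lam v z *\<^sub>R v))"
      by (simp add: scaleR_add_left scaleR_diff_left sum.distrib sum_subtractf scaleR_sum_right
          scaleR_diff_right algebra_simps)
    then show "(\<Sum>v\<in>V. (lam v x + t * (lam v y - lam v z)) *\<^sub>R v) = x + t *\<^sub>R (y - z)"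
      by (simp add: lam_repr)
  qed
qed (simp add: lam_outside)

lemma lam_vertex: "a \<in> V \<Longrightarrow> v \<in> V \<Longrightarrow> lam v a = (if v = a then 1 else 0)"
  using fin by (intro lam_eqI) (auto simp: if_distrib[of "\<lambda>c. c *\<^sub>R _"] cong: if_cong)

text \<open>The constant gradient of the affine function \<open>lam v\<close>.\<close>

definition dlam :: "'a \<Rightarrow> 'a" where "dlam v = (\<Sum>b\<in>Basis. (lam v b - lam v 0) *\<^sub>R b)"

lemma lam_inner: "lam v x = lam v 0 + x \<bullet> dlam v"
proof -
  define f where "f = (\<lambda>x. lam v x - lam v 0)"
  have "linear f"
  proof (rule linearI)
    fix x y c
    show "f (x + y) = f x + f y" using lam_affine[of v x 1 y 0] by (simp add: f_def)
    show "f (c *\<^sub>R x) = c *\<^sub>R f x" using lam_affine[of v 0 c x 0] by (simp add: f_def)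
  qed
  then have "f x = (\<Sum>b\<in>Basis. (x \<bullet> b) * f b)"
    by (subst euclidean_representation[of x, symmetric], subst linear_sum) (auto simp: linear_cmul)
  then have "f x = x \<bullet> dlam v"
    by (simp add: f_def dlam_def inner_sum_right mult.commute)
  then show ?thesis by (simp add: f_def)
qed

lemma lam_diff: "lam v x - lam v y = (x - y) \<bullet> dlam v"
  using lam_inner[of v x] lam_inner[of v y] by (simp add: inner_diff_left)

lemma continuous_lam [continuous_intros]: "continuous_on S (lam v)"
proof -
  have eq: "lam v = (\<lambda>x. lam v 0 + x \<bullet> dlam v)" by (rule ext) (rule lam_inner)
  show ?thesis by (subst eq) (intro continuous_intros)
qed

lemma lam_measurable [measurable]: "lam v \<in> borel_measurable borel"
  using continuous_lam borel_measurable_continuous_onI by blast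

lemma K_iff: "x \<in> K \<longleftrightarrow> (\<forall>v\<in>V. lam v x \<ge> 0)"
proof
  assume "x \<in> K"
  then obtain u where "\<forall>v\<in>V. 0 \<le> u v" "sum u V = 1" "(\<Sum>v\<in>V. u v *\<^sub>R v) = x"
    unfolding K_def convex_hull_finite[OF fin] by auto
  then show "\<forall>v\<in>V. lam v x \<ge> 0" using lam_eqI by metis
next
  assume "\<forall>v\<in>V. lam v x \<ge> 0"
  then show "x \<in> K" unfolding K_def convex_hull_finite[OF fin]
    by (intro CollectI exI[of _ "\<lambda>v. lam v x"]) (auto simp: lam_sum lam_repr)
qed

lemma K_compact: "compact K" unfolding K_def using fin by (simp add: finite_imp_compact_convex_hull)
lemma K_closed: "closed K" using K_compact compact_imp_closed by blast
lemma K_convex: "convex K" unfolding K_def by simp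
lemma V_subset_K: "V \<subseteq> K" unfolding K_def by (rule hull_subset)

lemma K_borel [measurable]: "K \<in> sets borel" using K_closed by (rule borel_closed)

lemma lam_le_1: "x \<in> K \<Longrightarrow> lam v x \<le> 1"
proof (cases "v \<in> V")
  case True
  assume x: "x \<in> K"
  have "lam v x \<le> (\<Sum>v\<in>V. lam v x)" using x K_iff True fin by (intro member_le_sum) auto
  then show ?thesis by (simp add: lam_sum)
qed (simp add: lam_outside)

lemma lam_nonneg: "x \<in> K \<Longrightarrow> 0 \<le> lam v x"
  using K_iff lam_outside by (cases "v \<in> V") auto

lemma lam_eq_1: assumes "x \<in> K" "a \<in> V" "lam a x = 1" shows "x = a"
proof -
  have "(\<Sum>v\<in>V - {a}. lam v x) = 0"
    using lam_sum[of x] assms fin by (simp add: sum_diff1)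
  then have "\<forall>v\<in>V - {a}. lam v x = 0"
    using assms K_iff fin by (subst (asm) sum_nonneg_eq_0_iff) auto
  then have "(\<Sum>v\<in>V. lam v x *\<^sub>R v) = (\<Sum>v\<in>V. if v = a then a else 0)"
    using assms by (intro sum.cong) auto
  then show ?thesis using assms(2) fin by (simp add: lam_repr)
qed

text \<open>The dilation about \<open>a\<close> divides \<open>1 - lam a\<close> and every other
  coordinate by \<sigma>. The cone at \<open>a\<close> is therefore preserved and only the cut-off
  moves; this is the change of domain in the polar formula.\<close>

lemma cone_K_iff:
  assumes a: "a \<in> V" and \<sigma>: "\<sigma> > 0"
  shows "a + (1 / \<sigma>) *\<^sub>R (z - a) \<in> K \<and> 1 - lam a z \<le> 1 \<longleftrightarrow> z \<in> K \<and> 1 - lam a z \<le> \<sigma>"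
proof -
  have 1: "lam v (a + (1 / \<sigma>) *\<^sub>R (z - a)) = lam v z / \<sigma>" if "v \<in> V" "v \<noteq> a" for v
    using lam_affine[of v a "1/\<sigma>" z a] lam_vertex[OF a that(1)] that by simp
  have 2: "lam a (a + (1 / \<sigma>) *\<^sub>R (z - a)) = 1 - (1 - lam a z) / \<sigma>"
    using lam_affine[of a a "1/\<sigma>" z a] lam_vertex[OF a a] by (simp add: field_simps diff_divide_distrib)
  define y where "y = a + (1 / \<sigma>) *\<^sub>R (z - a)"
  have "y \<in> K \<longleftrightarrow> (\<forall>v\<in>V. v \<noteq> a \<longrightarrow> lam v z \<ge> 0) \<and> 1 - lam a z \<le> \<sigma>"
  proof -
    have "y \<in> K \<longleftrightarrow> (\<forall>v\<in>V. v \<noteq> a \<longrightarrow> lam v y \<ge> 0) \<and> lam a y \<ge> 0"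
      unfolding K_iff using a by auto
    then show ?thesis using 1 2 \<sigma> by (simp add: y_def[symmetric] zero_le_divide_iff divide_le_eq)
  qed
  moreover have "z \<in> K \<longleftrightarrow> (\<forall>v\<in>V. v \<noteq> a \<longrightarrow> lam v z \<ge> 0) \<and> 0 \<le> lam a z"
    unfolding K_iff using a by auto
  ultimately show ?thesis unfolding y_def by auto
qed

lemma nn_integral_dilate:
  fixes h :: "'a \<Rightarrow> ennreal"
  assumes [measurable]: "h \<in> borel_measurable borel" and "\<sigma> > 0"
  shows "(\<integral>\<^sup>+x. h x \<partial>lborel) = ennreal (1 / \<sigma> ^ DIM('a)) * (\<integral>\<^sup>+z. h (a + (1 / \<sigma>) *\<^sub>R (z - a)) \<partial>lborel)"
proof -
  have eq: "a + (1 / \<sigma>) *\<^sub>R (z - a) = (a - (1 / \<sigma>) *\<^sub>R a) + (1 / \<sigma>) *\<^sub>R z" for z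
    by (simp add: algebra_simps)
  show ?thesis unfolding eq
    using assms(2)
    by (subst lborel_affine[of "1/\<sigma>" "a - (1 / \<sigma>) *\<^sub>R a"])
      (auto simp: nn_integral_density nn_integral_distr nn_integral_cmult power_one_over ennreal_power)
qed

lemma nn_integral_inverse_power:
  assumes "\<gamma> > 0" "d \<ge> 1"
  shows "(\<integral>\<^sup>+\<sigma>. ennreal (1 / \<sigma> ^ (d + 1)) * indicator {\<gamma>..} \<sigma> \<partial>lborel) = ennreal (1 / (real d * \<gamma> ^ d))"
proof -
  have "(\<integral>\<^sup>+\<sigma>. ennreal (1 / \<sigma> ^ (d + 1)) * indicator {\<gamma>..} \<sigma> \<partial>lborel) = ennreal (0 - (- (1 / (real d * \<gamma> ^ d))))"
  proof (rule nn_integral_FTC_atLeast)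
    fix x assume "\<gamma> \<le> x"
    then have x: "x > 0" using assms by simp
    have "x ^ d = x * x ^ (d - 1)" using assms by (cases d) auto
    then show "((\<lambda>x. - (1 / (real d * x ^ d))) has_real_derivative 1 / x ^ (d + 1)) (at x)"
      using x assms by (auto intro!: derivative_eq_intros simp: field_simps power2_eq_square)
    show "0 \<le> 1 / x ^ (d + 1)" using x by simp
  next
    have "((\<lambda>x::real. - (1 / (real d * x ^ d))) \<longlongrightarrow> - (1 / real d * 0)) at_top"
    proof -
      have "((\<lambda>x::real. inverse (x ^ d)) \<longlongrightarrow> 0) at_top"
        using assms by (intro tendsto_inverse_0_at_top filterlim_pow_at_top filterlim_ident) auto
      then have "((\<lambda>x::real. - (1 / real d * inverse (x ^ d))) \<longlongrightarrow> - (1 / real d * 0)) at_top"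
        by (intro tendsto_intros)
      then show ?thesis by (simp add: field_simps inverse_eq_divide)
    qed
    then show "((\<lambda>x::real. - (1 / (real d * x ^ d))) \<longlongrightarrow> 0) at_top" by simp
  qed (use assms in simp_all)
  then show ?thesis by simp
qed

text \<open>Polar coordinates centred at a vertex \<open>a\<close>; the gauge of \<open>K\<close> is the affine function \<open>1 - lam a\<close>.\<close>
lemma polar_nn_integral:
  fixes F :: "'a \<Rightarrow> ennreal"
  assumes a: "a \<in> V" and [measurable]: "F \<in> borel_measurable borel"
  defines "d \<equiv> DIM('a)"
  shows "(\<integral>\<^sup>+x. F x * indicator K x \<partial>lborel) = ennreal (real d) *
    (\<integral>\<^sup>+x. (\<integral>\<^sup>+s. F (a + (s / (1 - lam a x)) *\<^sub>R (x - a)) * ennreal (s ^ (d - 1)) * indicator {0..1} s \<partial>lborel)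
       * indicator K x \<partial>lborel)"
proof -
  have d: "d \<ge> 1" by (simp add: d_def Suc_leI)
  define g where "g = (\<lambda>x. 1 - lam a x)"
  have [measurable]: "g \<in> borel_measurable borel" unfolding g_def by measurable
  have g0: "g x \<ge> 0" if "x \<in> K" for x using lam_le_1[OF that] by (simp add: g_def)
  have ae: "AE x in lborel. x \<noteq> a" by (rule AE_lborel_singleton)
  have gpos: "g x > 0" if "x \<in> K" "x \<noteq> a" for x
    using g0[OF that(1)] lam_eq_1[OF that(1) a] that(2) by (auto simp: g_def less_le)
  \<comment> \<open>The substitution \<open>s = g x * \<sigma>\<close> frees the argument of
    \<open>F\<close> from the factor \<open>1 / g x\<close> at the price of the weight
    \<open>g x ^ d\<close>. Averaging over \<open>x\<close> in \<open>K\<close> takes the place of a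
    surface integral over the facet opposite to \<open>a\<close>.\<close>
  define H where "H = (\<lambda>x \<sigma>. F (a + \<sigma> *\<^sub>R (x - a)) * ennreal (\<sigma> ^ (d - 1) * g x ^ d) *
     indicator {0..1} (g x * \<sigma>) * indicator {0<..} \<sigma> * indicator K x)"
  have [measurable]: "(\<lambda>(x, \<sigma>). H x \<sigma>) \<in> borel_measurable (borel \<Otimes>\<^sub>M borel)"
    unfolding H_def by measurable
  have S1: "(\<integral>\<^sup>+s. F (a + (s / g x) *\<^sub>R (x - a)) * ennreal (s ^ (d - 1)) * indicator {0..1} s \<partial>lborel) * indicator K x
     = (\<integral>\<^sup>+\<sigma>. H x \<sigma> \<partial>lborel)" if x: "x \<noteq> a" for x
  proof (cases "x \<in> K")
    case True
    note gp = gpos[OF True x]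
    have "(\<integral>\<^sup>+s. F (a + (s / g x) *\<^sub>R (x - a)) * ennreal (s ^ (d - 1)) * indicator {0..1} s \<partial>lborel)
      = ennreal \<bar>g x\<bar> * (\<integral>\<^sup>+\<sigma>. F (a + ((0 + g x * \<sigma>) / g x) *\<^sub>R (x - a)) * ennreal ((0 + g x * \<sigma>) ^ (d - 1)) *
          indicator {0..1} (0 + g x * \<sigma>) \<partial>lborel)"
      using gp by (subst nn_integral_real_affine[where c = "g x" and t = 0]) auto
    also have "\<dots> = (\<integral>\<^sup>+\<sigma>. ennreal \<bar>g x\<bar> * (F (a + ((0 + g x * \<sigma>) / g x) *\<^sub>R (x - a)) * ennreal ((0 + g x * \<sigma>) ^ (d -
        1)) * indicator {0..1} (0 + g x * \<sigma>)) \<partial>lborel)"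
      by (subst nn_integral_cmult) auto
    also have "\<dots> = (\<integral>\<^sup>+\<sigma>. H x \<sigma> \<partial>lborel)"
    proof (rule nn_integral_cong_AE)
      have *: "ennreal \<bar>g x\<bar> * (F (a + ((0 + g x * \<sigma>) / g x) *\<^sub>R (x - a)) * ennreal ((0 + g x * \<sigma>) ^ (d - 1)) *
          indicator {0..1} (0 + g x * \<sigma>)) = H x \<sigma>"
        if "\<sigma> \<noteq> 0" for \<sigma>
      proof (cases "g x * \<sigma> \<in> {0..1}")
        case c: True
        then have \<sigma>: "\<sigma> > 0" using gp that by (auto simp: zero_le_mult_iff)
        have "ennreal (g x) * ennreal ((g x * \<sigma>) ^ (d - 1)) = ennreal (g x * (g x * \<sigma>) ^ (d - 1))"
          using gp \<sigma> by (simp add: ennreal_mult')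
        also have "g x * (g x * \<sigma>) ^ (d - 1) = \<sigma> ^ (d - 1) * g x ^ d"
          using d by (cases d) (auto simp: power_mult_distrib)
        finally have "ennreal (g x) * ennreal ((g x * \<sigma>) ^ (d - 1)) = ennreal (\<sigma> ^ (d - 1) * g x ^ d)" .
        then show ?thesis using c \<sigma> True gp
          by (simp add: H_def) (metis mult.left_commute)
      next
        case False
        then show ?thesis by (simp add: H_def)
      qed
      show "AE \<sigma> in lborel. ennreal \<bar>g x\<bar> * (F (a + ((0 + g x * \<sigma>) / g x) *\<^sub>R (x - a)) * ennreal ((0 + g x * \<sigma>) ^ (d -
          1)) * indicator {0..1} (0 + g x * \<sigma>)) = H x \<sigma>"
        using AE_lborel_singleton[of "0::real"] by (rule eventually_mono) (use * in blast)
    qed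
    finally show ?thesis using True by simp
  qed (simp add: H_def)
  \<comment> \<open>For fixed \<sigma>, \<open>z = a + \<sigma> *\<^sub>R (x - a)\<close> becomes
    the variable. Jacobian and weights combine to \<open>g z ^ d / \<sigma> ^ (d + 1)\<close>, and
    the cut-off of the segment becomes \<open>g z \<le> \<sigma>\<close>.\<close>
  have S3: "(\<integral>\<^sup>+x. H x \<sigma> \<partial>lborel) = (\<integral>\<^sup>+z. F z * ennreal (g z ^ d) * (ennreal (1 / \<sigma> ^ (d + 1)) * indicator {g z..} \<sigma>)
      * indicator K z \<partial>lborel)"
    if "\<sigma> > 0" for \<sigma>
  proof -
    have "(\<integral>\<^sup>+x. H x \<sigma> \<partial>lborel) = ennreal (1 / \<sigma> ^ d) * (\<integral>\<^sup>+z. H (a + (1 / \<sigma>) *\<^sub>R (z - a)) \<sigma> \<partial>lborel)"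
      unfolding d_def by (rule nn_integral_dilate[OF _ that]) (simp add: H_def)
    also have "\<dots> = (\<integral>\<^sup>+z. ennreal (1 / \<sigma> ^ d) * H (a + (1 / \<sigma>) *\<^sub>R (z - a)) \<sigma> \<partial>lborel)"
      by (subst nn_integral_cmult) (simp_all add: H_def)
    also have "\<dots> = (\<integral>\<^sup>+z. F z * ennreal (g z ^ d) * (ennreal (1 / \<sigma> ^ (d + 1)) * indicator {g z..} \<sigma>) * indicator K z
        \<partial>lborel)"
    proof (rule nn_integral_cong)
      fix z
      have gz: "g (a + (1 / \<sigma>) *\<^sub>R (z - a)) = g z / \<sigma>"
        using lam_affine[of a a "1/\<sigma>" z a] lam_vertex[OF a a] by (simp add: g_def field_simps diff_divide_distrib)
      have zz: "a + \<sigma> *\<^sub>R (a + (1 / \<sigma>) *\<^sub>R (z - a) - a) = z" using that by simp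
      show "ennreal (1 / \<sigma> ^ d) * H (a + (1 / \<sigma>) *\<^sub>R (z - a)) \<sigma> =
         F z * ennreal (g z ^ d) * (ennreal (1 / \<sigma> ^ (d + 1)) * indicator {g z..} \<sigma>) * indicator K z"
      proof (cases "z \<in> K \<and> g z \<le> \<sigma>")
        case True
        then have c: "a + (1 / \<sigma>) *\<^sub>R (z - a) \<in> K" "g z \<le> 1"
          using cone_K_iff[OF a that, of z] by (auto simp: g_def)
        have "ennreal (1 / \<sigma> ^ d) * ennreal (\<sigma> ^ (d - 1) * (g z / \<sigma>) ^ d) = ennreal (g z ^ d) * ennreal (1 / \<sigma> ^ (d +
            1))"
        proof -
          have "1 / \<sigma> ^ d * (\<sigma> ^ (d - 1) * (g z / \<sigma>) ^ d) = g z ^ d * (1 / \<sigma> ^ (d + 1))"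
            using that d by (cases d) (auto simp: field_simps power_divide)
          then show ?thesis using that g0[of z] True by (simp add: ennreal_mult'[symmetric] ennreal_mult''[symmetric])
        qed
        then show ?thesis using True c that g0[of z] unfolding H_def gz zz
          by (simp add: mult_ac)
      next
        case False
        then have "\<not> (a + (1 / \<sigma>) *\<^sub>R (z - a) \<in> K \<and> g z \<le> 1)"
          using cone_K_iff[OF a that, of z] by (auto simp: g_def)
        then show ?thesis using False that unfolding H_def gz zz by (auto simp: indicator_def)
      qed
    qed
    finally show ?thesis .
  qed
  have "(\<integral>\<^sup>+x. (\<integral>\<^sup>+s. F (a + (s / g x) *\<^sub>R (x - a)) * ennreal (s ^ (d - 1)) * indicator {0..1} s \<partial>lborel) * indicator K
      x \<partial>lborel)
     = (\<integral>\<^sup>+x. (\<integral>\<^sup>+\<sigma>. H x \<sigma> \<partial>lborel) \<partial>lborel)"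
    by (rule nn_integral_cong_AE) (use ae S1 in \<open>auto elim!: eventually_mono\<close>)
  also have "\<dots> = (\<integral>\<^sup>+\<sigma>. (\<integral>\<^sup>+x. H x \<sigma> \<partial>lborel) \<partial>lborel)"
    by (rule lborel_pair.Fubini') simp
  also have "\<dots> = (\<integral>\<^sup>+\<sigma>. (\<integral>\<^sup>+z. F z * ennreal (g z ^ d) * (ennreal (1 / \<sigma> ^ (d + 1)) * indicator {g z..} \<sigma> * indicator
      {0<..} \<sigma>) * indicator K z \<partial>lborel) \<partial>lborel)"
  proof (rule nn_integral_cong)
    fix \<sigma> :: real
    show "(\<integral>\<^sup>+x. H x \<sigma> \<partial>lborel) = (\<integral>\<^sup>+z. F z * ennreal (g z ^ d) * (ennreal (1 / \<sigma> ^ (d + 1)) * indicator {g z..} \<sigma> *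
        indicator {0<..} \<sigma>) * indicator K z \<partial>lborel)"
      by (cases "\<sigma> > 0") (simp_all add: S3, simp add: H_def)
  qed
  also have "\<dots> = (\<integral>\<^sup>+z. (\<integral>\<^sup>+\<sigma>. F z * ennreal (g z ^ d) * (ennreal (1 / \<sigma> ^ (d + 1)) * indicator {g z..} \<sigma> * indicator
      {0<..} \<sigma>) * indicator K z \<partial>lborel) \<partial>lborel)"
  proof (rule lborel_pair.Fubini')
    have [measurable]: "Measurable.pred (borel \<Otimes>\<^sub>M borel) (\<lambda>(z::'a, \<sigma>::real). \<sigma> \<in> {g z..})" 
      unfolding atLeast_iff by measurable
    show "(\<lambda>(z, \<sigma>). F z * ennreal (g z ^ d) * (ennreal (1 / \<sigma> ^ (d + 1)) * indicator {g z..} \<sigma> * indicator {0<..} \<sigma>) *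
        indicator K z) \<in> borel_measurable (lborel \<Otimes>\<^sub>M lborel)"
      by measurable
  qed
  \<comment> \<open>The inner integral over \<sigma> is now a pure tail integral, equal to
    \<open>1 / (d * g z ^ d)\<close>; it cancels the weight \<open>g z ^ d\<close>.\<close>
  also have "\<dots> = (\<integral>\<^sup>+z. ennreal (1 / real d) * (F z * indicator K z) \<partial>lborel)"
  proof (rule nn_integral_cong_AE)
    have "(\<integral>\<^sup>+\<sigma>. F z * ennreal (g z ^ d) * (ennreal (1 / \<sigma> ^ (d + 1)) * indicator {g z..} \<sigma> * indicator {0<..} \<sigma>) *
        indicator K z \<partial>lborel)
      = ennreal (1 / real d) * (F z * indicator K z)" if "z \<noteq> a" for z
    proof (cases "z \<in> K")
      case True
      note gp = gpos[OF True that]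
      have "(\<integral>\<^sup>+\<sigma>. F z * ennreal (g z ^ d) * (ennreal (1 / \<sigma> ^ (d + 1)) * indicator {g z..} \<sigma> * indicator {0<..} \<sigma>) *
          indicator K z \<partial>lborel)
        = (\<integral>\<^sup>+\<sigma>. F z * ennreal (g z ^ d) * (ennreal (1 / \<sigma> ^ (d + 1)) * indicator {g z..} \<sigma>) \<partial>lborel)"
        using True gp by (intro nn_integral_cong) (auto simp: indicator_def)
      also have "\<dots> = F z * ennreal (g z ^ d) * ennreal (1 / (real d * g z ^ d))"
        using nn_integral_inverse_power[OF gp d] by (subst nn_integral_cmult) auto
      also have "\<dots> = F z * (ennreal (g z ^ d) * ennreal (1 / (real d * g z ^ d)))" by (simp add: mult.assoc)
      also have "ennreal (g z ^ d) * ennreal (1 / (real d * g z ^ d)) = ennreal (1 / real d)"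
        using gp d by (subst ennreal_mult'[symmetric]) (auto simp: field_simps)
      finally show ?thesis using True by (simp add: mult.commute)
    qed simp
    then show "AE z in lborel. (\<integral>\<^sup>+\<sigma>. F z * ennreal (g z ^ d) * (ennreal (1 / \<sigma> ^ (d + 1)) * indicator {g z..} \<sigma> *
        indicator {0<..} \<sigma>) * indicator K z \<partial>lborel)
      = ennreal (1 / real d) * (F z * indicator K z)"
      using ae by (auto elim!: eventually_mono)
  qed
  also have "\<dots> = ennreal (1 / real d) * (\<integral>\<^sup>+z. F z * indicator K z \<partial>lborel)"
    by (rule nn_integral_cmult) simp
  finally have "ennreal (real d) * (\<integral>\<^sup>+x. (\<integral>\<^sup>+s. F (a + (s / g x) *\<^sub>R (x - a)) * ennreal (s ^ (d - 1)) * indicator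
      {0..1} s \<partial>lborel) * indicator K x \<partial>lborel)
    = ennreal (real d) * (ennreal (1 / real d) * (\<integral>\<^sup>+z. F z * indicator K z \<partial>lborel))" by simp
  also have "\<dots> = (ennreal (real d) * ennreal (1 / real d)) * (\<integral>\<^sup>+z. F z * indicator K z \<partial>lborel)"
    by (simp add: mult.assoc)
  also have "ennreal (real d) * ennreal (1 / real d) = 1"
    using d by (subst ennreal_mult'[symmetric]) auto
  finally show ?thesis by (simp add: g_def)
qed

end

section \<open>Polynomials in several variables, filtered by degree\<close>

text \<open>The index is a strict degree bound: \<open>pol n\<close> consists of the polynomials of
  degree less than \<open>n\<close>, and \<open>pol 0\<close> of the zero function. Derivatives then
  lower the index without an exception for constants, and degree at most \<open>p\<close> reads
  \<open>pol (Suc p)\<close>.\<close>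

inductive pol :: "nat \<Rightarrow> ('a::euclidean_space \<Rightarrow> real) \<Rightarrow> bool" where
  pol_zero: "pol n (\<lambda>x. 0)"
| pol_const: "pol (Suc n) (\<lambda>x. c)"
| pol_add: "pol n f \<Longrightarrow> pol n g \<Longrightarrow> pol n (\<lambda>x. f x + g x)"
| pol_mult_inner: "pol n f \<Longrightarrow> pol (Suc n) (\<lambda>x. (x \<bullet> c) * f x)"

lemma pol_cong: "pol n f \<Longrightarrow> (\<And>x. f x = g x) \<Longrightarrow> pol n g"
  by (metis ext)

lemma pol_0D: "pol n f \<Longrightarrow> n = 0 \<Longrightarrow> f x = 0"
  by (induction rule: pol.induct) auto

lemma pol_mono: "pol n f \<Longrightarrow> n \<le> m \<Longrightarrow> pol m f"
proof (induction arbitrary: m rule: pol.induct)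
  case (pol_const n c)
  then show ?case by (cases m) (auto intro: pol.intros)
next
  case (pol_mult_inner n f c)
  then show ?case by (cases m) (auto intro: pol.intros)
qed (auto intro: pol.intros)

lemma pol_scale: "pol n f \<Longrightarrow> pol n (\<lambda>x. c * f x)"
proof (induction rule: pol.induct)
  case (pol_zero n)
  then show ?case by (simp add: pol.pol_zero)
next
  case (pol_const n c')
  then show ?case by (rule pol.pol_const)
next
  case (pol_add n f g)
  show ?case by (rule pol_cong[OF pol.pol_add[OF pol_add.IH]]) (simp add: algebra_simps)
next
  case (pol_mult_inner n f v)
  show ?case by (rule pol_cong[OF pol.pol_mult_inner[OF pol_mult_inner.IH, of v]]) simp
qed

lemma pol_diff: "pol n f \<Longrightarrow> pol n g \<Longrightarrow> pol n (\<lambda>x. f x - g x)"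
  using pol_add[OF _ pol_scale[of n g "-1"], of f] by simp

lemma pol_sum: "(\<And>i. i \<in> I \<Longrightarrow> pol n (f i)) \<Longrightarrow> pol n (\<lambda>x. \<Sum>i\<in>I. f i x)"
  by (induction I rule: infinite_finite_induct) (auto intro: pol.intros)

lemma pol_mult_affine: "pol n f \<Longrightarrow> pol (Suc n) (\<lambda>x. (\<alpha> + x \<bullet> c) * f x)"
  by (rule pol_cong[OF pol_add[OF pol_mult_inner[of n f c] pol_mono[OF pol_scale[of n f \<alpha>]]]])
    (auto simp: algebra_simps)

lemma pol_affine: "pol (Suc (Suc n)) (\<lambda>x. \<alpha> + x \<bullet> c)"
  using pol_mult_affine[OF pol_const[of n 1], of \<alpha> c] by simp

lemma pol_continuous: "pol n f \<Longrightarrow> continuous_on S f"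
  by (induction rule: pol.induct) (auto intro!: continuous_intros)

lemma pol_ray: "pol n f \<Longrightarrow> \<exists>Q :: real poly. (\<forall>s. f (a + s *\<^sub>R w) = poly Q s) \<and> (Q = 0 \<or> degree Q < n)"
proof (induction rule: pol.induct)
  case (pol_zero n)
  then show ?case by (intro exI[of _ 0]) auto
next
  case (pol_const n c)
  then show ?case by (intro exI[of _ "[:c:]"]) auto
next
  case (pol_add n f g)
  then obtain P Q where PQ: "\<forall>s. f (a + s *\<^sub>R w) = poly P s" "P = 0 \<or> degree P < n"
    "\<forall>s. g (a + s *\<^sub>R w) = poly Q s" "Q = 0 \<or> degree Q < n" by auto
  then have "P + Q = 0 \<or> degree (P + Q) < n" by (auto intro: degree_add_less)
  then show ?case using PQ by (intro exI[of _ "P + Q"]) auto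
next
  case (pol_mult_inner n f c)
  then obtain P where P: "\<forall>s. f (a + s *\<^sub>R w) = poly P s" "P = 0 \<or> degree P < n" by auto
  have "degree ([:a \<bullet> c, w \<bullet> c:] * P) < Suc n" if "P \<noteq> 0"
    using degree_mult_le[of "[:a \<bullet> c, w \<bullet> c:]" P] P(2) that by (auto split: if_splits)
  then have "[:a \<bullet> c, w \<bullet> c:] * P = 0 \<or> degree ([:a \<bullet> c, w \<bullet> c:] * P) < Suc n" by (cases "P = 0") (simp, blast)
  moreover have "((a + s *\<^sub>R w) \<bullet> c) * f (a + s *\<^sub>R w) = poly ([:a \<bullet> c, w \<bullet> c:] * P) s" for s
    using P(1) by (simp add: inner_add_left algebra_simps)
  ultimately show ?case by blast
qed

text \<open>The last two clauses are Euler's identities modulo lower degree: on the part of top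
  degree \<open>n - 1\<close>, the first and second radial derivatives act as multiplication by
  \<open>n - 1\<close> and by \<open>(n - 1) * (n - 2)\<close>. They supply the eigenvalues of the
  operator on the simplex. \<open>H x e\<close> is the second derivative along \<open>e\<close>; the
  map \<open>k x e\<close> is kept in order to expand it bilinearly.\<close>

lemma pol_derivatives:
  "pol n q \<Longrightarrow> \<exists>g H k. (\<forall>x. (q has_derivative (\<lambda>h. h \<bullet> g x)) (at x)) \<and>
     (\<forall>x e. ((\<lambda>y. e \<bullet> g y) has_derivative k x e) (at x) \<and> k x e e = H x e) \<and>
     (\<forall>e. pol (n - 1) (\<lambda>x. e \<bullet> g x)) \<and> (\<forall>e. pol (n - 2) (\<lambda>x. H x e)) \<and>
     pol (n - 1) (\<lambda>x. x \<bullet> g x - (real n - 1) * q x) \<and>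
     pol (n - 1) (\<lambda>x. H x x - (real n - 1) * (real n - 2) * q x)"
proof (induction rule: pol.induct)
  case (pol_zero n)
  show ?case
    by (rule exI[of _ "\<lambda>x. 0"], rule exI[of _ "\<lambda>x e. 0"], rule exI[of _ "\<lambda>x e h. 0"])
      (auto intro!: pol.intros)
next
  case (pol_const n c)
  have "pol (Suc n - 1) (\<lambda>x. x \<bullet> 0 - (real (Suc n) - 1) * c)"
    by (cases n) (auto intro: pol.intros)
  moreover have "pol (Suc n - 1) (\<lambda>x. 0 - (real (Suc n) - 1) * (real (Suc n) - 2) * c)"
    by (cases n) (auto intro: pol.intros)
  ultimately show ?case
    by (intro exI[of _ "\<lambda>x. 0"] exI[of _ "\<lambda>x e. 0"] exI[of _ "\<lambda>x e h. 0"])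
      (auto intro!: pol.intros)
next
  case (pol_add n q1 q2)
  obtain g1 H1 k1 where 1: "\<forall>x. (q1 has_derivative (\<lambda>h. h \<bullet> g1 x)) (at x)"
     "\<forall>x e. ((\<lambda>y. e \<bullet> g1 y) has_derivative k1 x e) (at x) \<and> k1 x e e = H1 x e"
     "\<forall>e. pol (n - 1) (\<lambda>x. e \<bullet> g1 x)" "\<forall>e. pol (n - 2) (\<lambda>x. H1 x e)"
     "pol (n - 1) (\<lambda>x. x \<bullet> g1 x - (real n - 1) * q1 x)"
     "pol (n - 1) (\<lambda>x. H1 x x - (real n - 1) * (real n - 2) * q1 x)" using pol_add.IH(1) by blast
  obtain g2 H2 k2 where 2: "\<forall>x. (q2 has_derivative (\<lambda>h. h \<bullet> g2 x)) (at x)"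
     "\<forall>x e. ((\<lambda>y. e \<bullet> g2 y) has_derivative k2 x e) (at x) \<and> k2 x e e = H2 x e"
     "\<forall>e. pol (n - 1) (\<lambda>x. e \<bullet> g2 x)" "\<forall>e. pol (n - 2) (\<lambda>x. H2 x e)"
     "pol (n - 1) (\<lambda>x. x \<bullet> g2 x - (real n - 1) * q2 x)"
     "pol (n - 1) (\<lambda>x. H2 x x - (real n - 1) * (real n - 2) * q2 x)" using pol_add.IH(2) by blast
  show ?case
  proof (rule exI[of _ "\<lambda>x. g1 x + g2 x"], rule exI[of _ "\<lambda>x e. H1 x e + H2 x e"],
      rule exI[of _ "\<lambda>x e h. k1 x e h + k2 x e h"], intro conjI allI)
    fix x e
    show "((\<lambda>x. q1 x + q2 x) has_derivative (\<lambda>h. h \<bullet> (g1 x + g2 x))) (at x)"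
      using has_derivative_add[OF 1(1)[rule_format] 2(1)[rule_format], of x] by (simp add: inner_add_right)
    show "((\<lambda>y. e \<bullet> (g1 y + g2 y)) has_derivative (\<lambda>h. k1 x e h + k2 x e h)) (at x)"
      using has_derivative_add[of "\<lambda>y. e \<bullet> g1 y" "k1 x e" "at x" "\<lambda>y. e \<bullet> g2 y" "k2 x e"] 1(2) 2(2)
      by (simp add: inner_add_right)
    show "k1 x e e + k2 x e e = H1 x e + H2 x e" using 1(2) 2(2) by simp
    show "pol (n - 1) (\<lambda>x. e \<bullet> (g1 x + g2 x))" using 1(3) 2(3) by (simp add: inner_add_right pol.pol_add)
    show "pol (n - 2) (\<lambda>x. H1 x e + H2 x e)" using 1(4) 2(4) by (simp add: pol.pol_add)
    show "pol (n - 1) (\<lambda>x. x \<bullet> (g1 x + g2 x) - (real n - 1) * (q1 x + q2 x))"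
      by (rule pol_cong[OF pol.pol_add[OF 1(5) 2(5)]]) (simp add: algebra_simps)
    show "pol (n - 1) (\<lambda>x. H1 x x + H2 x x - (real n - 1) * (real n - 2) * (q1 x + q2 x))"
      by (rule pol_cong[OF pol.pol_add[OF 1(6) 2(6)]]) (simp add: algebra_simps)
  qed
next
  case (pol_mult_inner n f c)
  show ?case
  proof (cases "n = 0")
    case True
    then have "f = (\<lambda>x. 0)" using pol_0D[OF pol_mult_inner.hyps] by auto
    then show ?thesis
      by (intro exI[of _ "\<lambda>x. 0"] exI[of _ "\<lambda>x e. 0"] exI[of _ "\<lambda>x e h. 0"]) (auto intro!: pol.intros)
  next
    case False
    obtain g H k where 1: "\<And>x. (f has_derivative (\<lambda>h. h \<bullet> g x)) (at x)"
     "\<And>x e. ((\<lambda>y. e \<bullet> g y) has_derivative k x e) (at x)" "\<And>x e. k x e e = H x e"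
     "\<And>e. pol (n - 1) (\<lambda>x. e \<bullet> g x)" "\<And>e. pol (n - 2) (\<lambda>x. H x e)"
     "pol (n - 1) (\<lambda>x. x \<bullet> g x - (real n - 1) * f x)"
     "pol (n - 1) (\<lambda>x. H x x - (real n - 1) * (real n - 2) * f x)" using pol_mult_inner.IH by blast
    have Suc: "Suc (n - 1) = n" "Suc n - 1 = n" "Suc n - 2 = n - 1" using False by auto
    show ?thesis
    proof (rule exI[of _ "\<lambda>x. f x *\<^sub>R c + (x \<bullet> c) *\<^sub>R g x"],
        rule exI[of _ "\<lambda>x e. 2 * (e \<bullet> c) * (e \<bullet> g x) + (x \<bullet> c) * H x e"],
        rule exI[of _ "\<lambda>x e h. (h \<bullet> g x) * (e \<bullet> c) + ((h \<bullet> c) * (e \<bullet> g x) + (x \<bullet> c) * k x e h)"], intro conjI allI)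
      fix x e
      show "((\<lambda>x. x \<bullet> c * f x) has_derivative (\<lambda>h. h \<bullet> (f x *\<^sub>R c + (x \<bullet> c) *\<^sub>R g x))) (at x)"
        by (rule derivative_eq_intros 1(1) refl | simp add: algebra_simps fun_eq_iff)+
      have "((\<lambda>y. f y * (e \<bullet> c) + (y \<bullet> c) * (e \<bullet> g y)) has_derivative
          (\<lambda>h. (h \<bullet> g x) * (e \<bullet> c) + ((h \<bullet> c) * (e \<bullet> g x) + (x \<bullet> c) * k x e h))) (at x)"
        by (rule derivative_eq_intros 1(1) 1(2) refl | simp add: algebra_simps fun_eq_iff)+
      then show "((\<lambda>y. e \<bullet> (f y *\<^sub>R c + (y \<bullet> c) *\<^sub>R g y)) has_derivative
          (\<lambda>h. (h \<bullet> g x) * (e \<bullet> c) + ((h \<bullet> c) * (e \<bullet> g x) + (x \<bullet> c) * k x e h))) (at x)"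
        by (simp add: inner_add_right)
      show "(e \<bullet> g x) * (e \<bullet> c) + ((e \<bullet> c) * (e \<bullet> g x) + (x \<bullet> c) * k x e e) =
          2 * (e \<bullet> c) * (e \<bullet> g x) + (x \<bullet> c) * H x e" by (simp add: 1(3))
      have A: "pol n (\<lambda>x. (e \<bullet> c) * f x)" using pol_mult_inner.hyps pol_scale by blast
      have B: "pol n (\<lambda>x. (x \<bullet> c) * (e \<bullet> g x))" using pol.pol_mult_inner[OF 1(4)] Suc(1) by simp
      show "pol (Suc n - 1) (\<lambda>x. e \<bullet> (f x *\<^sub>R c + (x \<bullet> c) *\<^sub>R g x))"
        unfolding Suc by (rule pol_cong[OF pol.pol_add[OF A B]]) (simp add: inner_add_right)
      have "pol (n - 1) (\<lambda>x. (x \<bullet> c) * H x e)"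
      proof (cases "n = 1")
        case True
        then have "(\<lambda>x. (x \<bullet> c) * H x e) = (\<lambda>x. 0)" using pol_0D[OF 1(5)] by auto
        then show ?thesis by (simp add: pol.pol_zero)
      next
        case F: False
        then have "Suc (n - 2) = n - 1" using False by simp
        then show ?thesis using pol.pol_mult_inner[OF 1(5), of c e] by simp
      qed
      then show "pol (Suc n - 2) (\<lambda>x. 2 * (e \<bullet> c) * (e \<bullet> g x) + (x \<bullet> c) * H x e)"
        unfolding Suc by (intro pol.pol_add pol_scale 1(4))
      \<comment> \<open>Under multiplication by \<open>x \<bullet> c\<close> the product rule raises
        the radial eigenvalue by exactly one, so the new Euler remainder is the old one times
        \<open>x \<bullet> c\<close>. For the second derivative it is twice this remainder plus
        \<open>D\<close>.\<close>
      have C: "pol n (\<lambda>x. (x \<bullet> c) * (x \<bullet> g x - (real n - 1) * f x))"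
        using pol.pol_mult_inner[OF 1(6)] Suc(1) by simp
      show "pol (Suc n - 1) (\<lambda>x. x \<bullet> (f x *\<^sub>R c + (x \<bullet> c) *\<^sub>R g x) - (real (Suc n) - 1) * (x \<bullet> c * f x))"
        unfolding Suc by (rule pol_cong[OF C]) (simp add: inner_add_right algebra_simps)
      have D: "pol n (\<lambda>x. (x \<bullet> c) * (H x x - (real n - 1) * (real n - 2) * f x))"
        using pol.pol_mult_inner[OF 1(7)] Suc(1) by simp
      show "pol (Suc n - 1) (\<lambda>x. 2 * (x \<bullet> c) * (x \<bullet> g x) + (x \<bullet> c) * H x x
          - (real (Suc n) - 1) * (real (Suc n) - 2) * (x \<bullet> c * f x))"
        unfolding Suc by (rule pol_cong[OF pol.pol_add[OF pol_scale[OF C, of 2] D]]) (simp add: algebra_simps)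
    qed
  qed
qed

definition monomial :: "'a::euclidean_space list \<Rightarrow> 'a \<Rightarrow> real" where
  "monomial cs x = prod_list (map (\<lambda>c. x \<bullet> c) cs)"

text \<open>Lists in place of exponent maps: a monomial occurs once for each order of its factors.
  The repetition is harmless, as the lists serve only as a finite spanning family.\<close>

definition mono_index :: "nat \<Rightarrow> 'a::euclidean_space list set" where
  "mono_index n = {cs. set cs \<subseteq> Basis \<and> length cs < n}"

lemma finite_mono_index: "finite (mono_index n)"
proof -
  have "mono_index n \<subseteq> {cs. set cs \<subseteq> Basis \<and> length cs \<le> n}" by (auto simp: mono_index_def)
  then show ?thesis using finite_lists_length_le[OF finite_Basis] finite_subset by blast
qed

lemma pol_monomial: "length cs < n \<Longrightarrow> pol n (monomial cs)"
proof (induction cs arbitrary: n)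
  case Nil
  then obtain m where "n = Suc m" by (cases n) auto
  then show ?case by (simp add: monomial_def[abs_def] pol_const)
next
  case (Cons c cs)
  obtain m where "n = Suc m" using Cons.prems by (cases n) auto
  then show ?case using Cons pol_mult_inner[of m "monomial cs" c] by (simp add: monomial_def[abs_def])
qed

lemma pol_span: "pol n f \<Longrightarrow> \<exists>c. \<forall>x. f x = (\<Sum>cs\<in>mono_index n. c cs * monomial cs x)"
proof (induction rule: pol.induct)
  case (pol_zero n)
  then show ?case by (intro exI[of _ "\<lambda>_. 0"]) simp
next
  case (pol_const n c)
  have "(\<Sum>cs\<in>(mono_index (Suc n) :: 'a list set). (if cs = [] then c else 0) * monomial cs x) = c" for x :: 'a
  proof -
    have "(\<Sum>cs\<in>(mono_index (Suc n) :: 'a list set). (if cs = [] then c else 0) * monomial cs x) =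
        (\<Sum>cs\<in>(mono_index (Suc n) :: 'a list set). if cs = [] then c else 0)"
      by (intro sum.cong) (auto simp: monomial_def)
    also have "\<dots> = c"
    proof -
      have "[] \<in> (mono_index (Suc n) :: 'a list set)" by (simp add: mono_index_def)
      then show ?thesis using finite_mono_index[of "Suc n", where 'a='a] by simp
    qed
    finally show ?thesis .
  qed
  then show ?case by metis
next
  case (pol_add n f g)
  then obtain c1 c2 where "\<forall>x. f x = (\<Sum>cs\<in>mono_index n. c1 cs * monomial cs x)"
    "\<forall>x. g x = (\<Sum>cs\<in>mono_index n. c2 cs * monomial cs x)" by blast
  then show ?case
    by (intro exI[of _ "\<lambda>cs. c1 cs + c2 cs"]) (simp add: sum.distrib algebra_simps)
next
  case (pol_mult_inner n f v)
  then obtain c where c: "\<forall>x. f x = (\<Sum>cs\<in>mono_index n. c cs * monomial cs x)" by blast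
  let ?J = "(\<lambda>(b, cs). b # cs) ` (Basis \<times> mono_index n) :: 'a list set"
  have J: "?J \<subseteq> mono_index (Suc n)" by (auto simp: mono_index_def)
  have inj: "inj_on (\<lambda>(b, cs). b # cs) (Basis \<times> mono_index n)" by (auto simp: inj_on_def)
  let ?c = "\<lambda>cs. if cs \<in> ?J then (v \<bullet> hd cs) * c (tl cs) else 0"
  have "(x \<bullet> v) * f x = (\<Sum>cs\<in>mono_index (Suc n). ?c cs * monomial cs x)" for x
  proof -
    have "(\<Sum>cs\<in>mono_index (Suc n). ?c cs * monomial cs x) = (\<Sum>cs\<in>?J. (v \<bullet> hd cs) * c (tl cs) * monomial cs x)"
      using J by (intro sum.mono_neutral_cong_right finite_mono_index) auto
    also have "\<dots> = (\<Sum>(b, cs)\<in>Basis \<times> mono_index n. (v \<bullet> b) * c cs * ((x \<bullet> b) * monomial cs x))"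
      by (subst sum.reindex[OF inj]) (auto intro!: sum.cong simp: monomial_def)
    also have "\<dots> = (\<Sum>b\<in>Basis. \<Sum>cs\<in>mono_index n. (v \<bullet> b) * c cs * ((x \<bullet> b) * monomial cs x))"
      by (simp add: sum.cartesian_product)
    also have "\<dots> = (\<Sum>b\<in>Basis. (x \<bullet> b) * (v \<bullet> b)) * (\<Sum>cs\<in>mono_index n. c cs * monomial cs x)"
      by (simp add: sum_product algebra_simps)
    also have "\<dots> = (x \<bullet> v) * f x" using c by (simp add: euclidean_inner[of x v])
    finally show ?thesis by simp
  qed
  then show ?case by (intro exI[of _ ?c]) simp
qed

lemma poly_le_imp_pol:
  assumes "poly_le p q" shows "pol (Suc p) q"
proof -
  obtain A c where Ac: "finite A" "\<And>\<alpha>. \<alpha> \<in> A \<Longrightarrow> (\<Sum>b\<in>Basis. \<alpha> b) \<le> p"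
    "\<And>x. q x = (\<Sum>\<alpha>\<in>A. c \<alpha> * (\<Prod>b\<in>Basis. (x \<bullet> b) ^ \<alpha> b))"
    using assms unfolding poly_le_def by blast
  have pw: "pol (n + k) (\<lambda>x. (x \<bullet> b) ^ k * f x)" if "pol n f" for n k b and f :: "'a \<Rightarrow> real"
  proof (induction k)
    case (Suc k)
    show ?case using pol_mult_inner[OF Suc, of b] by (simp add: mult.assoc)
  qed (use that in simp)
  have pr: "pol (Suc (\<Sum>b\<in>B. \<alpha> b)) (\<lambda>x. \<Prod>b\<in>B. (x \<bullet> b) ^ \<alpha> b)" if "finite B" for B and \<alpha> :: "'a \<Rightarrow> nat"
    using that
  proof (induction B rule: finite_induct)
    case empty
    then show ?case by (simp add: pol_const)
  next
    case (insert b B)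
    then show ?case using pw[OF insert.IH, where k="\<alpha> b" and b=b] by (simp add: add.commute)
  qed
  have "pol (Suc p) (\<lambda>x. \<Sum>\<alpha>\<in>A. c \<alpha> * (\<Prod>b\<in>Basis. (x \<bullet> b) ^ \<alpha> b))"
    by (intro pol_sum pol_scale pol_mono[OF pr]) (use Ac in auto)
  then show ?thesis using Ac(3) by (simp add: pol_cong)
qed

lemma poly_le_mono: "cs \<in> mono_index (Suc p) \<Longrightarrow> \<exists>\<alpha>. (\<Sum>b\<in>Basis. \<alpha> b) \<le> p \<and> (\<forall>x. monomial cs x = (\<Prod>b\<in>Basis. (x \<bullet> b) ^ \<alpha>
    b))"
proof -
  assume cs: "cs \<in> mono_index (Suc p)"
  have *: "set cs \<subseteq> Basis \<Longrightarrow> (\<Sum>b\<in>Basis. count_list cs b) = length cs \<and>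
     (\<forall>x. monomial cs x = (\<Prod>b\<in>Basis. (x \<bullet> b) ^ count_list cs b))"
  proof (induction cs)
    case (Cons c cs)
    have "(\<Sum>b\<in>Basis. count_list (c # cs) b) = (\<Sum>b\<in>Basis. count_list cs b + (if b = c then 1 else 0))"
      by (intro sum.cong) auto
    also have "\<dots> = length (c # cs)" using Cons by (simp add: sum.distrib)
    finally have 1: "(\<Sum>b\<in>Basis. count_list (c # cs) b) = length (c # cs)" .
    have "monomial (c # cs) x = (\<Prod>b\<in>Basis. (x \<bullet> b) ^ count_list (c # cs) b)" for x
    proof -
      have "(\<Prod>b\<in>Basis. (x \<bullet> b) ^ count_list (c # cs) b) =
          (\<Prod>b\<in>Basis. (x \<bullet> b) ^ count_list cs b * (if b = c then x \<bullet> c else 1))"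
        by (intro prod.cong) auto
      also have "\<dots> = (\<Prod>b\<in>Basis. (x \<bullet> b) ^ count_list cs b) * (x \<bullet> c)"
        using Cons.prems by (simp add: prod.distrib prod.delta)
      also have "\<dots> = monomial (c # cs) x" using Cons by (simp add: monomial_def mult.commute)
      finally show ?thesis by simp
    qed
    then show ?case using 1 by blast
  qed (simp add: monomial_def)
  then show ?thesis using cs by (intro exI[of _ "count_list cs"]) (auto simp: mono_index_def)
qed

lemma poly_le_add: assumes "poly_le p f" "poly_le p g" shows "poly_le p (\<lambda>x. f x + g x)"
proof -
  obtain A c where 1: "finite A" "\<forall>\<alpha>\<in>A. (\<Sum>b\<in>Basis. \<alpha> b) \<le> p"
    "\<forall>x. f x = (\<Sum>\<alpha>\<in>A. c \<alpha> * (\<Prod>b\<in>Basis. (x \<bullet> b) ^ \<alpha> b))" using assms(1) unfolding poly_le_def by blast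
  obtain A' c' where 2: "finite A'" "\<forall>\<alpha>\<in>A'. (\<Sum>b\<in>Basis. \<alpha> b) \<le> p"
    "\<forall>x. g x = (\<Sum>\<alpha>\<in>A'. c' \<alpha> * (\<Prod>b\<in>Basis. (x \<bullet> b) ^ \<alpha> b))" using assms(2) unfolding poly_le_def by blast
  let ?d = "\<lambda>\<alpha>. (if \<alpha> \<in> A then c \<alpha> else 0) + (if \<alpha> \<in> A' then c' \<alpha> else 0)"
  have "f x + g x = (\<Sum>\<alpha>\<in>A \<union> A'. ?d \<alpha> * (\<Prod>b\<in>Basis. (x \<bullet> b) ^ \<alpha> b))" for x
  proof -
    have "(\<Sum>\<alpha>\<in>A \<union> A'. (if \<alpha> \<in> A then c \<alpha> else 0) * (\<Prod>b\<in>Basis. (x \<bullet> b) ^ \<alpha> b)) = f x"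
      unfolding 1(3)[rule_format] using 1 2 by (intro sum.mono_neutral_cong_right) auto
    moreover have "(\<Sum>\<alpha>\<in>A \<union> A'. (if \<alpha> \<in> A' then c' \<alpha> else 0) * (\<Prod>b\<in>Basis. (x \<bullet> b) ^ \<alpha> b)) = g x"
      unfolding 2(3)[rule_format] using 1 2 by (intro sum.mono_neutral_cong_right) auto
    ultimately show ?thesis by (simp add: distrib_right sum.distrib)
  qed
  then show ?thesis unfolding poly_le_def using 1 2
    by (intro exI[of _ "A \<union> A'"] exI[of _ ?d]) auto
qed

lemma poly_le_iff_pol: "poly_le p q \<longleftrightarrow> pol (Suc p) q"
proof
  assume "pol (Suc p) q"
  then obtain c where c: "\<forall>x. q x = (\<Sum>cs\<in>mono_index (Suc p). c cs * monomial cs x)" using pol_span by blast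
  have m: "poly_le p (\<lambda>x. c cs * monomial cs x)" if cs: "cs \<in> mono_index (Suc p)" for cs
  proof -
    obtain \<alpha> where "(\<Sum>b\<in>Basis. \<alpha> b) \<le> p" "\<forall>x. monomial cs x = (\<Prod>b\<in>Basis. (x \<bullet> b) ^ \<alpha> b)"
      using poly_le_mono[OF cs] by blast
    then show ?thesis unfolding poly_le_def
      by (intro exI[of _ "{\<alpha>}"] exI[of _ "\<lambda>_. c cs"]) simp
  qed
  have "poly_le p (\<lambda>x. \<Sum>cs\<in>I. c cs * monomial cs x)" if "finite I" "I \<subseteq> mono_index (Suc p)" for I
    using that
  proof (induction I rule: finite_induct)
    case empty
    then show ?case unfolding poly_le_def by (intro exI[of _ "{}"]) simp
  next
    case (insert cs I)
    then show ?case using poly_le_add[OF m[of cs], of "\<lambda>x. \<Sum>cs\<in>I. c cs * monomial cs x"] by simp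
  qed
  moreover have "q = (\<lambda>x. \<Sum>cs\<in>mono_index (Suc p). c cs * monomial cs x)" using c by auto
  ultimately show "poly_le p q" using finite_mono_index[of "Suc p", where 'a='a] by simp
qed (rule poly_le_imp_pol)

section \<open>Square integrable functions\<close>

text \<open>One predicate for scalar and vector fields over any measure; on
  \<open>lebesgue_on S\<close> it agrees with \<open>L2 S\<close> and \<open>L2v S\<close> for
  measurable \<open>S\<close>.\<close>

definition sqi :: "'a measure \<Rightarrow> ('a \<Rightarrow> 'b::euclidean_space) \<Rightarrow> bool" where
  "sqi M f \<longleftrightarrow> f \<in> borel_measurable M \<and> integrable M (\<lambda>x. (norm (f x))\<^sup>2)"

lemma sqi_scale: "sqi M f \<Longrightarrow> sqi M (\<lambda>x. c *\<^sub>R f x)"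
  by (auto simp: sqi_def power_mult_distrib)

lemma sqi_add:
  assumes "sqi M f" "sqi M g" shows "sqi M (\<lambda>x. f x + g x)"
proof -
  have [measurable]: "f \<in> borel_measurable M" "g \<in> borel_measurable M" using assms by (auto simp: sqi_def)
  have "integrable M (\<lambda>x. 2 * (norm (f x))\<^sup>2 + 2 * (norm (g x))\<^sup>2)" using assms by (auto simp: sqi_def)
  then have "integrable M (\<lambda>x. (norm (f x + g x))\<^sup>2)"
  proof (rule Bochner_Integration.integrable_bound)
    have "(norm (f x + g x))\<^sup>2 \<le> 2 * (norm (f x))\<^sup>2 + 2 * (norm (g x))\<^sup>2" for x
    proof -
      have "(norm (f x + g x))\<^sup>2 \<le> (norm (f x) + norm (g x))\<^sup>2"
        by (intro power_mono norm_triangle_ineq) auto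
      also have "\<dots> \<le> 2 * (norm (f x))\<^sup>2 + 2 * (norm (g x))\<^sup>2"
        using zero_le_power2[of "norm (f x) - norm (g x)"] by (simp add: power2_eq_square algebra_simps)
      finally show ?thesis .
    qed
    then show "AE x in M. norm ((norm (f x + g x))\<^sup>2) \<le> norm (2 * (norm (f x))\<^sup>2 + 2 * (norm (g x))\<^sup>2)"
      by (auto intro!: AE_I2)
  qed simp
  then show ?thesis by (simp add: sqi_def)
qed

lemma sqi_diff: "sqi M f \<Longrightarrow> sqi M g \<Longrightarrow> sqi M (\<lambda>x. f x - g x)"
  using sqi_add[OF _ sqi_scale[of M g "-1"], of f] by simp

lemma sqi_sum: "(\<And>i. i \<in> I \<Longrightarrow> sqi M (f i)) \<Longrightarrow> sqi M (\<lambda>x. \<Sum>i\<in>I. f i x)"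
proof (induction I rule: infinite_finite_induct)
  case (insert i I)
  then show ?case using sqi_add[of M "f i" "\<lambda>x. \<Sum>i\<in>I. f i x"] by auto
qed (auto simp: sqi_def)

lemma sqi_inner_integrable:
  assumes "sqi M f" "sqi M g" shows "integrable M (\<lambda>x. f x \<bullet> g x)"
proof -
  have [measurable]: "f \<in> borel_measurable M" "g \<in> borel_measurable M" using assms by (auto simp: sqi_def)
  have "integrable M (\<lambda>x. (norm (f x))\<^sup>2 + (norm (g x))\<^sup>2)" using assms by (auto simp: sqi_def)
  then show ?thesis
  proof (rule Bochner_Integration.integrable_bound)
    have "\<bar>f x \<bullet> g x\<bar> \<le> (norm (f x))\<^sup>2 + (norm (g x))\<^sup>2" for x
    proof -
      have "\<bar>f x \<bullet> g x\<bar> \<le> norm (f x) * norm (g x)" by (rule Cauchy_Schwarz_ineq2)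
      also have "\<dots> \<le> (norm (f x))\<^sup>2 + (norm (g x))\<^sup>2"
        using sum_squares_bound[of "norm (f x)" "norm (g x)"]
          mult_nonneg_nonneg[OF norm_ge_zero[of "f x"] norm_ge_zero[of "g x"]] by linarith
      finally show ?thesis .
    qed
    then show "AE x in M. norm (f x \<bullet> g x) \<le> norm ((norm (f x))\<^sup>2 + (norm (g x))\<^sup>2)"
      by (auto intro!: AE_I2)
  qed simp
qed

lemma sqi_mult_integrable:
  fixes f g :: "'a \<Rightarrow> real"
  shows "sqi M f \<Longrightarrow> sqi M g \<Longrightarrow> integrable M (\<lambda>x. f x * g x)"
  using sqi_inner_integrable[of M f g] by simp

lemma sqi_Cauchy_Schwarz:
  assumes "sqi M f" "sqi M g"
  shows "\<bar>\<integral>x. f x \<bullet> g x \<partial>M\<bar> \<le> sqrt (\<integral>x. (norm (f x))\<^sup>2 \<partial>M) * sqrt (\<integral>x. (norm (g x))\<^sup>2 \<partial>M)"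
proof -
  have i: "integrable M (\<lambda>x. f x \<bullet> g x)" "integrable M (\<lambda>x. (norm (f x))\<^sup>2)" "integrable M (\<lambda>x. (norm (g x))\<^sup>2)"
    using assms sqi_inner_integrable by (auto simp: sqi_def)
  have "(\<integral>x. f x \<bullet> g x \<partial>M)\<^sup>2 \<le> (\<integral>x. (norm (f x))\<^sup>2 \<partial>M) * (\<integral>x. (norm (g x))\<^sup>2 \<partial>M)"
  proof (rule quadratic_nonneg_discriminant)
    fix t
    have "0 \<le> (\<integral>x. (norm (f x + t *\<^sub>R g x))\<^sup>2 \<partial>M)" by simp
    also have "\<dots> = (\<integral>x. (norm (f x))\<^sup>2 + 2 * t * (f x \<bullet> g x) + t\<^sup>2 * (norm (g x))\<^sup>2 \<partial>M)"
      by (intro Bochner_Integration.integral_cong refl)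
        (unfold power2_norm_eq_inner, simp add: inner_add_left inner_add_right inner_commute power2_eq_square
            algebra_simps)
    also have "\<dots> = (\<integral>x. (norm (f x))\<^sup>2 \<partial>M) + 2 * t * (\<integral>x. f x \<bullet> g x \<partial>M) + t\<^sup>2 * (\<integral>x. (norm (g x))\<^sup>2 \<partial>M)"
      using i by simp
    finally show "0 \<le> (\<integral>x. (norm (f x))\<^sup>2 \<partial>M) + 2 * t * (\<integral>x. f x \<bullet> g x \<partial>M) + t\<^sup>2 * (\<integral>x. (norm (g x))\<^sup>2 \<partial>M)" .
  qed auto
  then show ?thesis using real_sqrt_le_mono by (fastforce simp: real_sqrt_mult)
qed

lemma sqi_Cauchy_Schwarz_real:
  fixes f g :: "'a \<Rightarrow> real"
  assumes "sqi M f" "sqi M g"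
  shows "\<bar>\<integral>x. f x * g x \<partial>M\<bar> \<le> sqrt (\<integral>x. (f x)\<^sup>2 \<partial>M) * sqrt (\<integral>x. (g x)\<^sup>2 \<partial>M)"
  using sqi_Cauchy_Schwarz[OF assms] by simp

section \<open>From set integrals to the restricted measure \<open>lebesgue_on\<close>\<close>

lemma compact_imp_lebesgue: "compact (S::'a::euclidean_space set) \<Longrightarrow> S \<in> sets lebesgue"
  by (simp add: compact_imp_closed)

lemma integrable_lebesgue_on_compact:
  fixes f :: "'a::euclidean_space \<Rightarrow> 'b::euclidean_space"
  assumes "compact K" "continuous_on K f"
  shows "integrable (lebesgue_on K) f"
proof -
  have "integrable lborel (\<lambda>x. indicator K x *\<^sub>R f x)" by (rule borel_integrable_compact[OF assms])
  then have "integrable lebesgue (\<lambda>x. indicator K x *\<^sub>R f x)"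
    by (subst integrable_completion) auto
  then show ?thesis using assms by (subst integrable_restrict_space) (auto simp: compact_imp_lebesgue)
qed

lemma sqi_compact:
  fixes f :: "'a::euclidean_space \<Rightarrow> 'b::euclidean_space"
  assumes "compact K" "continuous_on K f"
  shows "sqi (lebesgue_on K) f"
  unfolding sqi_def using integrable_lebesgue_on_compact[OF assms]
  by (auto intro!: integrable_lebesgue_on_compact assms continuous_intros)

lemma set_integral_lebesgue_on:
  fixes f :: "'a::euclidean_space \<Rightarrow> 'b::{banach, second_countable_topology}"
  assumes "S \<in> sets lebesgue"
  shows "(LINT x:S|lebesgue. f x) = (\<integral>x. f x \<partial>lebesgue_on S)"
  using assms by (simp add: set_lebesgue_integral_def integral_restrict_space)

lemma set_integrable_lebesgue_on:
  fixes f :: "'a::euclidean_space \<Rightarrow> 'b::{banach, second_countable_topology}"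
  assumes "S \<in> sets lebesgue"
  shows "set_integrable lebesgue S f \<longleftrightarrow> integrable (lebesgue_on S) f"
  using assms by (simp add: set_integrable_def integrable_restrict_space)

lemma L2_iff_sqi: assumes "S \<in> sets lebesgue" shows "L2 S f \<longleftrightarrow> sqi (lebesgue_on S) f"
  using assms
  by (simp add: L2_def sqi_def set_integrable_lebesgue_on set_borel_measurable_def borel_measurable_restrict_space_iff)

lemma L2v_iff_sqi: assumes "S \<in> sets lebesgue" shows "L2v S f \<longleftrightarrow> sqi (lebesgue_on S) f"
  using assms
  by (simp add: L2v_def sqi_def set_integrable_lebesgue_on set_borel_measurable_def borel_measurable_restrict_space_iff)

lemma L2norm_lebesgue_on: assumes "S \<in> sets lebesgue" shows "L2norm S f = sqrt (\<integral>x. (f x)\<^sup>2 \<partial>lebesgue_on S)"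
  using assms by (simp add: L2norm_def set_integral_lebesgue_on)

lemma L2normv_lebesgue_on: assumes "S \<in> sets lebesgue" shows "L2normv S f = sqrt (\<integral>x. (norm (f x))\<^sup>2 \<partial>lebesgue_on S)"
  using assms by (simp add: L2normv_def set_integral_lebesgue_on)

section \<open>Radial derivatives and fluxes on a simplex\<close>

text \<open>The best parameters are \<open>\<kappa> = y / n\<close> and \<open>\<mu> = b / a\<close>
  with \<open>y = sqrt (a * b)\<close>. They make no sense if a norm vanishes, so all three norms
  are first increased by \<delta>, which then tends to 0.\<close>

lemma young_optimal:
  fixes X C n a b :: real
  assumes X: "\<And>\<kappa> \<mu>. \<kappa> > 0 \<Longrightarrow> \<mu> > 0 \<Longrightarrow> X \<le> C * (\<kappa> / 2 * n\<^sup>2 + 1 / (4 * \<kappa>) * (\<mu> * a\<^sup>2 + b\<^sup>2 / \<mu>))"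
    and nn: "n \<ge> 0" "a \<ge> 0" "b \<ge> 0" "C \<ge> 0"
  shows "X \<le> C * (n * sqrt (a * b))"
proof -
  have le: "X \<le> C * ((n + \<delta>) * sqrt ((a + \<delta>) * (b + \<delta>)))" if "\<delta> > 0" for \<delta>
  proof -
    define n' where "n' = n + \<delta>"
    define a' where "a' = a + \<delta>"
    define b' where "b' = b + \<delta>"
    have p: "n' > 0" "a' > 0" "b' > 0" using nn that by (auto simp: n'_def a'_def b'_def)
    define y where "y = sqrt (a' * b')"
    have y: "y > 0" "y\<^sup>2 = a' * b'" using p by (auto simp: y_def)
    have "X \<le> C * ((y / n') / 2 * n\<^sup>2 + 1 / (4 * (y / n')) * ((b' / a') * a\<^sup>2 + b\<^sup>2 / (b' / a')))"
      using p y by (intro X) auto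
    also have "\<dots> \<le> C * ((y / n') / 2 * n'\<^sup>2 + 1 / (4 * (y / n')) * ((b' / a') * a'\<^sup>2 + b'\<^sup>2 / (b' / a')))"
      using p y nn that
      by (intro mult_left_mono add_mono divide_right_mono power_mono) (auto simp: n'_def a'_def b'_def)
    also have "(y / n') / 2 * n'\<^sup>2 = y * n' / 2" using p by (simp add: power2_eq_square)
    also have "(b' / a') * a'\<^sup>2 + b'\<^sup>2 / (b' / a') = 2 * y\<^sup>2"
      using p y by (simp add: power2_eq_square)
    also have "1 / (4 * (y / n')) * (2 * y\<^sup>2) = y * n' / 2" using y(1) p by (simp add: power2_eq_square field_simps)
    finally show ?thesis by (simp add: y_def n'_def a'_def b'_def mult.commute)
  qed
  have "((\<lambda>\<delta>. C * ((n + \<delta>) * sqrt ((a + \<delta>) * (b + \<delta>)))) \<longlongrightarrow> C * ((n + 0) * sqrt ((a + 0) * (b + 0)))) (at_right 0)"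
    by (intro tendsto_intros)
  moreover have "\<forall>\<^sub>F \<delta> in at_right 0. X \<le> C * ((n + \<delta>) * sqrt ((a + \<delta>) * (b + \<delta>)))"
    using le by (auto simp: eventually_at_right_field intro: exI[of _ 1])
  ultimately have "X \<le> C * ((n + 0) * sqrt ((a + 0) * (b + 0)))"
    by (intro tendsto_lowerbound) auto
  then show ?thesis by simp
qed

context full_simplex
begin

lemma ray_in_K:
  assumes "a \<in> V" "x \<in> K" "x \<noteq> a" "s \<in> {0..1}"
  shows "a + (s / (1 - lam a x)) *\<^sub>R (x - a) \<in> K"
proof -
  have g: "1 - lam a x > 0" using lam_le_1[OF assms(2)] lam_eq_1[OF assms(2,1)] assms(3) by (auto simp: less_le)
  have 1: "lam v (a + (s / (1 - lam a x)) *\<^sub>R (x - a)) = lam v a + s / (1 - lam a x) * (lam v x - lam v a)" for v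
    using lam_affine[of v a "s / (1 - lam a x)" x a] by simp
  show ?thesis unfolding K_iff
  proof
    fix v assume v: "v \<in> V"
    show "0 \<le> lam v (a + (s / (1 - lam a x)) *\<^sub>R (x - a))"
    proof (cases "v = a")
      case True
      have "s / (1 - lam a x) * (lam a x - 1) = - s" using g by (simp add: field_simps)
      then show ?thesis using 1[of a] lam_vertex[OF assms(1) assms(1)] assms(4) True by simp
    next
      case False
      then show ?thesis using 1[of v] lam_vertex[OF assms(1) v] lam_nonneg[OF assms(2)] g assms(4) by simp
    qed
  qed
qed

text \<open>By the polar formula the integral over \<open>K\<close> is an average of ray integrals.
  That formula is stated for nonnegative integrands, so \<Phi> is lifted by a constant
  \<open>c\<close>, whose contribution is the same on every ray and is subtracted at the
  end.\<close>

lemma radial_integral_nonneg: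
  fixes \<Phi> :: "'a \<Rightarrow> real"
  assumes a: "a \<in> V" and \<Phi>: "continuous_on UNIV \<Phi>"
    and ray: "\<And>w. 0 \<le> integral {0..1} (\<lambda>s. \<Phi> (a + s *\<^sub>R w) * s ^ (DIM('a) - 1))"
  shows "0 \<le> (\<integral>x. \<Phi> x \<partial>lebesgue_on K)"
proof -
  have [measurable]: "\<Phi> \<in> borel_measurable borel" using \<Phi> by (simp add: borel_measurable_continuous_onI)
  have "bounded (\<Phi> ` K)" using K_compact \<Phi> by (meson compact_continuous_image compact_imp_bounded continuous_on_subset
      subset_UNIV)
  then obtain c0 where c0: "\<And>x. x \<in> K \<Longrightarrow> \<bar>\<Phi> x\<bar> \<le> c0" by (auto simp: bounded_iff)
  define c where "c = \<bar>c0\<bar>"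
  have c: "\<Phi> x + c \<ge> 0" if "x \<in> K" for x using c0[OF that] by (auto simp: c_def)
  have c_nn: "c \<ge> 0" by (simp add: c_def)
  have dpos: "DIM('a) > 0" by simp
  have inner: "ennreal (c / real DIM('a)) \<le> (\<integral>\<^sup>+s. ennreal (\<Phi> (a + (s / (1 - lam a x)) *\<^sub>R (x - a)) + c) * ennreal (s ^
      (DIM('a) - 1)) * indicator {0..1} s \<partial>lborel)"
    if x: "x \<in> K" "x \<noteq> a" for x
  proof -
    \<comment> \<open>\<open>a + w\<close> is the point where the ray from \<open>a\<close> through
      \<open>x\<close> meets the opposite facet: there \<open>lam a\<close> is 0.\<close>
    define w where "w = (1 / (1 - lam a x)) *\<^sub>R (x - a)"
    have w: "a + (s / (1 - lam a x)) *\<^sub>R (x - a) = a + s *\<^sub>R w" for s by (simp add: w_def)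
    have cont: "continuous_on {0..1} (\<lambda>s. \<Phi> (a + s *\<^sub>R w))"
      by (intro continuous_on_compose2[OF \<Phi>] continuous_intros) auto
    have i1: "(\<lambda>s. \<Phi> (a + s *\<^sub>R w) * s ^ (DIM('a) - 1)) integrable_on {0..1}"
      by (intro integrable_continuous_interval continuous_intros cont)
    have i2: "((\<lambda>s::real. c * s ^ (DIM('a) - 1)) has_integral (c * (1 ^ DIM('a) / real DIM('a)) - c * (0 ^ DIM('a) /
        real DIM('a)))) {0..1}"
    proof (intro fundamental_theorem_of_calculus)
      fix s :: real assume "s \<in> {0..1}"
      show "((\<lambda>s. c * (s ^ DIM('a) / real DIM('a))) has_vector_derivative c * s ^ (DIM('a) - 1)) (at s within {0..1})"
        unfolding has_real_derivative_iff_has_vector_derivative[symmetric]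
        using dpos by (auto intro!: derivative_eq_intros)
    qed auto
    then have i2: "((\<lambda>s::real. c * s ^ (DIM('a) - 1)) has_integral (c / real DIM('a))) {0..1}" by (simp add: zero_power)
    have hi: "((\<lambda>s. (\<Phi> (a + s *\<^sub>R w) + c) * s ^ (DIM('a) - 1)) has_integral
        (integral {0..1} (\<lambda>s. \<Phi> (a + s *\<^sub>R w) * s ^ (DIM('a) - 1)) + c / real DIM('a))) {0..1}"
      using has_integral_add[OF integrable_integral[OF i1] i2] by (simp add: algebra_simps)
    have "(\<integral>\<^sup>+s. ennreal (\<Phi> (a + s *\<^sub>R w) + c) * ennreal (s ^ (DIM('a) - 1)) * indicator {0..1} s \<partial>lborel)
        = (\<integral>\<^sup>+s. ennreal ((\<Phi> (a + s *\<^sub>R w) + c) * s ^ (DIM('a) - 1)) * indicator {0..1} s \<partial>lborel)"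
      using c ray_in_K[OF a x] by (intro nn_integral_cong) (auto simp: w indicator_def ennreal_mult)
    also have "\<dots> = ennreal (integral {0..1} (\<lambda>s. \<Phi> (a + s *\<^sub>R w) * s ^ (DIM('a) - 1)) + c / real DIM('a))"
      using c ray_in_K[OF a x] by (intro nn_integral_has_integral_lebesgue'[OF _ hi]) (auto simp: w)
    also have "\<dots> \<ge> ennreal (c / real DIM('a))" using ray[of w] by (intro ennreal_leI) auto
    finally show ?thesis unfolding w .
  qed
  have fin_K: "emeasure lborel K < \<infinity>" using K_compact by (rule emeasure_compact_finite)
  have ic: "integrable lborel (\<lambda>x. indicator K x *\<^sub>R (\<Phi> x + c))"
    by (intro borel_integrable_compact K_compact continuous_intros continuous_on_subset[OF \<Phi>]) auto
  have "ennreal (c * measure lborel K) = ennreal (real DIM('a)) * (ennreal (c / real DIM('a)) * emeasure lborel K)"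
  proof -
    have "ennreal (real DIM('a)) * (ennreal (c / real DIM('a)) * emeasure lborel K)
        = (ennreal (real DIM('a)) * ennreal (c / real DIM('a))) * ennreal (measure lborel K)"
      using fin_K by (simp add: emeasure_eq_ennreal_measure mult.assoc)
    also have "ennreal (real DIM('a)) * ennreal (c / real DIM('a)) = ennreal c"
      using c_nn dpos by (simp add: ennreal_mult[symmetric])
    finally show ?thesis using c_nn by (simp add: ennreal_mult)
  qed
  also have "ennreal (c / real DIM('a)) * emeasure lborel K = (\<integral>\<^sup>+x. ennreal (c / real DIM('a)) * indicator K x
      \<partial>lborel)"
    by (simp add: nn_integral_cmult_indicator)
  also have "ennreal (real DIM('a)) * \<dots> \<le> ennreal (real DIM('a)) * (\<integral>\<^sup>+x. (\<integral>\<^sup>+s. ennreal (\<Phi> (a + (s / (1 - lam a x))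
      *\<^sub>R (x - a)) + c) * ennreal (s ^ (DIM('a) - 1)) * indicator {0..1} s \<partial>lborel) * indicator K x \<partial>lborel)"
  proof (intro mult_left_mono nn_integral_mono_AE)
    show "AE x in lborel. ennreal (c / real DIM('a)) * indicator K x \<le>
       (\<integral>\<^sup>+s. ennreal (\<Phi> (a + (s / (1 - lam a x)) *\<^sub>R (x - a)) + c) * ennreal (s ^ (DIM('a) - 1)) * indicator {0..1} s
           \<partial>lborel) * indicator K x"
      using AE_lborel_singleton[of a] by (rule eventually_mono) (use inner in \<open>auto simp: indicator_def\<close>)
  qed simp
  also have "\<dots> = (\<integral>\<^sup>+x. ennreal (\<Phi> x + c) * indicator K x \<partial>lborel)"
    by (rule polar_nn_integral[OF a, symmetric]) simp
  also have "\<dots> = (\<integral>\<^sup>+x. ennreal (indicator K x *\<^sub>R (\<Phi> x + c)) \<partial>lborel)"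
    by (intro nn_integral_cong) (auto simp: indicator_def)
  also have "\<dots> = ennreal (\<integral>x. indicator K x *\<^sub>R (\<Phi> x + c) \<partial>lborel)"
    using c by (intro nn_integral_eq_integral[OF ic]) (auto simp: indicator_def)
  finally have "c * measure lborel K \<le> (\<integral>x. indicator K x *\<^sub>R (\<Phi> x + c) \<partial>lborel)"
    using c by (subst (asm) ennreal_le_iff) (auto intro!: integral_nonneg_AE simp: indicator_def)
  also have "\<dots> = (\<integral>x. indicator K x *\<^sub>R (\<Phi> x + c) \<partial>lebesgue)"
    by (rule integral_completion[symmetric]) simp
  also have "\<dots> = (\<integral>x. \<Phi> x + c \<partial>lebesgue_on K)"
    by (subst integral_restrict_space) auto
  also have "\<dots> = (\<integral>x. \<Phi> x \<partial>lebesgue_on K) + (\<integral>x. c \<partial>lebesgue_on K)"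
    by (rule Bochner_Integration.integral_add)
      (auto intro!: integrable_lebesgue_on_compact K_compact continuous_on_subset[OF \<Phi>] continuous_intros)
  also have "(\<integral>x. c \<partial>lebesgue_on K) = c * measure lborel K"
    by (simp add: measure_restrict_space)
  finally show ?thesis by simp
qed

definition radial_const :: "nat \<Rightarrow> real" where
  "radial_const N = 191/100 * sqrt (real ((N + 1) * (N + DIM('a))))"

lemma radial_const_nonneg: "radial_const N \<ge> 0" by (simp add: radial_const_def)

text \<open>On a ray from \<open>a\<close>, \<open>(x - a) \<bullet> gv x\<close> turns into
  \<open>s * v' s\<close> and \<open>q\<close> into a polynomial of degree at most \<open>N\<close>.
  The ray inequality thus says that the difference \<Phi> of the two quadratic sides has nonnegative
  ray integrals, for all Young parameters.\<close>

lemma radial_bound: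
  assumes a: "a \<in> V" and N: "N \<ge> 2" and q: "pol (Suc N) q"
    and v: "\<And>x. (v has_derivative (\<lambda>h. h \<bullet> gv x)) (at x)" and gv: "continuous_on UNIV gv"
  shows "\<bar>\<integral>x. q x * ((x - a) \<bullet> gv x) \<partial>lebesgue_on K\<bar> \<le> radial_const N *
    (sqrt (\<integral>x. (q x)\<^sup>2 \<partial>lebesgue_on K) *
     sqrt (sqrt (\<integral>x. (v x)\<^sup>2 \<partial>lebesgue_on K) * sqrt (\<integral>x. ((x - a) \<bullet> gv x)\<^sup>2 \<partial>lebesgue_on K)))"
proof -
  let ?C = "radial_const N"
  have cv: "continuous_on UNIV v" using v by (meson continuous_on_eq_continuous_within has_derivative_continuous
      has_derivative_at_withinI)
  have cK: "integrable (lebesgue_on K) F" if "continuous_on UNIV F" for F :: "'a \<Rightarrow> real"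
    by (intro integrable_lebesgue_on_compact K_compact continuous_on_subset[OF that]) auto
  have main: "(\<integral>x. q x * ((x - a) \<bullet> gv x) \<partial>lebesgue_on K) \<le> ?C * (\<kappa> / 2 * (\<integral>x. (q x)\<^sup>2 \<partial>lebesgue_on K) +
      1 / (4 * \<kappa>) * (\<mu> * (\<integral>x. (v x)\<^sup>2 \<partial>lebesgue_on K) + (\<integral>x. ((x - a) \<bullet> gv x)\<^sup>2 \<partial>lebesgue_on K) / \<mu>))"
    if pos: "\<kappa> > 0" "\<mu> > 0" and q: "pol (Suc N) q" for \<kappa> \<mu> q
  proof -
    have cq: "continuous_on UNIV q" using q by (rule pol_continuous)
    define \<Phi> where "\<Phi> = (\<lambda>x. ?C * (\<kappa> / 2 * (q x)\<^sup>2 + 1 / (4 * \<kappa>) * (\<mu> * (v x)\<^sup>2 + ((x - a) \<bullet> gv x)\<^sup>2 / \<mu>)) - q x * ((x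
        - a) \<bullet> gv x))"
    have "0 \<le> (\<integral>x. \<Phi> x \<partial>lebesgue_on K)"
    proof (rule radial_integral_nonneg[OF a])
      show "continuous_on UNIV \<Phi>" unfolding \<Phi>_def divide_inverse by (intro continuous_intros cq cv gv)
      fix w
      obtain Q where Q: "\<And>s. q (a + s *\<^sub>R w) = poly Q s" "Q = 0 \<or> degree Q < Suc N"
        using pol_ray[OF q, of a w] by blast
      have degQ: "degree Q \<le> N" using Q(2) by auto
      define vs where "vs = (\<lambda>s. v (a + s *\<^sub>R w))"
      define vs' where "vs' = (\<lambda>s. w \<bullet> gv (a + s *\<^sub>R w))"
      have der: "(vs has_real_derivative vs' s) (at s within {0..1})" for s
      proof -
        have "((\<lambda>s. a + s *\<^sub>R w) has_derivative (\<lambda>t. t *\<^sub>R w)) (at s within {0..1})"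
          by (auto intro!: derivative_eq_intros)
        from has_derivative_compose[OF this v]
        have "(vs has_derivative (\<lambda>t. (t *\<^sub>R w) \<bullet> gv (a + s *\<^sub>R w))) (at s within {0..1})"
          by (simp add: vs_def)
        moreover have "(\<lambda>t. (t *\<^sub>R w) \<bullet> gv (a + s *\<^sub>R w)) = (*) (vs' s)"
          by (rule ext) (simp add: vs'_def)
        ultimately show ?thesis by (simp add: has_field_derivative_def)
      qed
      have cvs': "continuous_on {0..1} vs'" unfolding vs'_def
        by (intro continuous_intros continuous_on_compose2[OF gv]) auto
      have cvs: "continuous_on {0..1} vs" unfolding vs_def
        by (intro continuous_intros continuous_on_compose2[OF cv]) auto
      have Dv: "(a + s *\<^sub>R w - a) \<bullet> gv (a + s *\<^sub>R w) = s * vs' s" for s by (simp add: vs'_def)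
      note ray = ray_inequality[OF _ N degQ der cvs' pos, of "DIM('a)"]
      have hi: "((\<lambda>s. f s * g s * s ^ (DIM('a) - 1)) has_integral wip DIM('a) f g) {0..1}"
        if "continuous_on {0..1} f" "continuous_on {0..1} g" for f g
        unfolding wip_def using wip_integrable[OF that] by (rule integrable_integral)
      let ?s = "\<lambda>s. s * vs' s"
      have cs: "continuous_on {0..1} ?s" by (intro continuous_intros cvs')
      have "((\<lambda>s. ?C * (\<kappa> / 2 * (poly Q s * poly Q s * s ^ (DIM('a) - 1)) + 1 / (4 * \<kappa>) * (\<mu> * (vs s * vs s * s ^
          (DIM('a) - 1)) +
             (1 / \<mu>) * (?s s * ?s s * s ^ (DIM('a) - 1)))) - poly Q s * ?s s * s ^ (DIM('a) - 1)) has_integral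
          (?C * (\<kappa> / 2 * wip DIM('a) (poly Q) (poly Q) + 1 / (4 * \<kappa>) * (\<mu> * wip DIM('a) vs vs + (1 / \<mu>) * wip DIM('a)
              ?s ?s)) - wip DIM('a) (poly Q) ?s)) {0..1}"
        by (intro has_integral_diff has_integral_mult_right has_integral_add hi cont_poly cvs cs)
      moreover have "(\<lambda>s. \<Phi> (a + s *\<^sub>R w) * s ^ (DIM('a) - 1)) =
          (\<lambda>s. ?C * (\<kappa> / 2 * (poly Q s * poly Q s * s ^ (DIM('a) - 1)) + 1 / (4 * \<kappa>) * (\<mu> * (vs s * vs s * s ^ (DIM('a)
              - 1)) +
             (1 / \<mu>) * (?s s * ?s s * s ^ (DIM('a) - 1)))) - poly Q s * ?s s * s ^ (DIM('a) - 1))"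
      proof
        fix s
        show "\<Phi> (a + s *\<^sub>R w) * s ^ (DIM('a) - 1) = ?C * (\<kappa> / 2 * (poly Q s * poly Q s * s ^ (DIM('a) - 1)) + 1 / (4 *
            \<kappa>) * (\<mu> * (vs s * vs s * s ^ (DIM('a) - 1)) +
             (1 / \<mu>) * (?s s * ?s s * s ^ (DIM('a) - 1)))) - poly Q s * ?s s * s ^ (DIM('a) - 1)"
          unfolding \<Phi>_def Q(1) Dv vs_def power2_eq_square divide_inverse by algebra
      qed
      ultimately have "integral {0..1} (\<lambda>s. \<Phi> (a + s *\<^sub>R w) * s ^ (DIM('a) - 1)) =
         ?C * (\<kappa> / 2 * wip DIM('a) (poly Q) (poly Q) + 1 / (4 * \<kappa>) * (\<mu> * wip DIM('a) vs vs + (1 / \<mu>) * wip DIM('a) ?s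
             ?s)) - wip DIM('a) (poly Q) ?s"
        by (simp only: integral_unique)
      then show "0 \<le> integral {0..1} (\<lambda>s. \<Phi> (a + s *\<^sub>R w) * s ^ (DIM('a) - 1))"
        using ray by (simp add: radial_const_def Suc_leI)
    qed
    also have "(\<integral>x. \<Phi> x \<partial>lebesgue_on K) = ?C * (\<kappa> / 2 * (\<integral>x. (q x)\<^sup>2 \<partial>lebesgue_on K) +
      1 / (4 * \<kappa>) * (\<mu> * (\<integral>x. (v x)\<^sup>2 \<partial>lebesgue_on K) + (\<integral>x. ((x - a) \<bullet> gv x)\<^sup>2 \<partial>lebesgue_on K) / \<mu>)) - (\<integral>x. q x * ((x
          - a) \<bullet> gv x) \<partial>lebesgue_on K)"
    proof -
      have "integrable (lebesgue_on K) (\<lambda>x. (q x)\<^sup>2)" "integrable (lebesgue_on K) (\<lambda>x. (v x)\<^sup>2)"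
        "integrable (lebesgue_on K) (\<lambda>x. ((x - a) \<bullet> gv x)\<^sup>2)" "integrable (lebesgue_on K) (\<lambda>x. q x * ((x - a) \<bullet> gv x))"
        by (intro cK continuous_intros cq cv gv)+
      then show ?thesis unfolding \<Phi>_def by simp
    qed
    finally show ?thesis by simp
  qed
  have nn: "(\<integral>x. (F x)\<^sup>2 \<partial>lebesgue_on K) \<ge> 0" for F :: "'a \<Rightarrow> real" by simp
  have "(\<integral>x. q x * ((x - a) \<bullet> gv x) \<partial>lebesgue_on K) \<le> ?C *
    (sqrt (\<integral>x. (q x)\<^sup>2 \<partial>lebesgue_on K) *
     sqrt (sqrt (\<integral>x. (v x)\<^sup>2 \<partial>lebesgue_on K) * sqrt (\<integral>x. ((x - a) \<bullet> gv x)\<^sup>2 \<partial>lebesgue_on K)))"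
    by (rule young_optimal) (use main[OF _ _ q] nn radial_const_nonneg in auto)
  moreover have "- (\<integral>x. q x * ((x - a) \<bullet> gv x) \<partial>lebesgue_on K) \<le> ?C *
    (sqrt (\<integral>x. (q x)\<^sup>2 \<partial>lebesgue_on K) *
     sqrt (sqrt (\<integral>x. (v x)\<^sup>2 \<partial>lebesgue_on K) * sqrt (\<integral>x. ((x - a) \<bullet> gv x)\<^sup>2 \<partial>lebesgue_on K)))"
  proof (rule young_optimal)
    fix \<kappa> \<mu> :: real assume "\<kappa> > 0" "\<mu> > 0"
    from main[OF this pol_scale[OF q, of "-1"]]
    show "- (\<integral>x. q x * ((x - a) \<bullet> gv x) \<partial>lebesgue_on K) \<le> ?C * (\<kappa> / 2 * (sqrt (\<integral>x. (q x)\<^sup>2 \<partial>lebesgue_on K))\<^sup>2 +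
      1 / (4 * \<kappa>) * (\<mu> * (sqrt (\<integral>x. (v x)\<^sup>2 \<partial>lebesgue_on K))\<^sup>2 + (sqrt (\<integral>x. ((x - a) \<bullet> gv x)\<^sup>2 \<partial>lebesgue_on K))\<^sup>2 / \<mu>))"
      by simp
  qed (use radial_const_nonneg in auto)
  ultimately show ?thesis by (simp add: abs_le_iff)
qed

lemma diameter_bound: "x \<in> K \<Longrightarrow> y \<in> K \<Longrightarrow> norm (x - y) \<le> diameter K"
  using diameter_bounded_bound[OF compact_imp_bounded[OF K_compact]] by (simp add: dist_norm)

text \<open>Antipodal points of an inscribed ball realise every direction \<open>e\<close> with the
  same length \<open>2 * r\<close>; the factor 2 pays for the two radial bounds. A centre
  \<open>y\<close> in \<open>K\<close> inherits the bound of the vertices because the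
  \<open>lam a y\<close> are convex weights.\<close>

lemma directional_bound:
  assumes N: "N \<ge> 2" and q: "pol (Suc N) q"
    and v: "\<And>x. (v has_derivative (\<lambda>h. h \<bullet> gv x)) (at x)" and gv: "continuous_on UNIV gv"
    and r: "ball c r \<subseteq> K" "r > 0" and e: "norm e = 1"
  shows "r * \<bar>\<integral>x. q x * (e \<bullet> gv x) \<partial>lebesgue_on K\<bar> \<le> radial_const N *
    (sqrt (\<integral>x. (q x)\<^sup>2 \<partial>lebesgue_on K) *
     sqrt (sqrt (\<integral>x. (v x)\<^sup>2 \<partial>lebesgue_on K) * (diameter K * sqrt (\<integral>x. (norm (gv x))\<^sup>2 \<partial>lebesgue_on K))))"
    (is "_ \<le> ?R")
proof -
  let ?I = "\<lambda>F. (\<integral>x. F x \<partial>lebesgue_on K)"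
  have cK: "integrable (lebesgue_on K) F" if "continuous_on UNIV F" for F :: "'a \<Rightarrow> real"
    by (intro integrable_lebesgue_on_compact K_compact continuous_on_subset[OF that]) auto
  have cq: "continuous_on UNIV q" using q by (rule pol_continuous)
  have h0: "diameter K \<ge> 0" using diameter_ge_0[OF compact_imp_bounded[OF K_compact]] .
  have vert: "\<bar>\<integral>x. q x * ((x - a) \<bullet> gv x) \<partial>lebesgue_on K\<bar> \<le> ?R" if "a \<in> V" for a
  proof -
    have "(\<integral>x. ((x - a) \<bullet> gv x)\<^sup>2 \<partial>lebesgue_on K) \<le> (\<integral>x. (diameter K)\<^sup>2 * (norm (gv x))\<^sup>2 \<partial>lebesgue_on K)"
    proof (rule integral_mono)
      fix x assume "x \<in> space (lebesgue_on K)"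
      then have x: "x \<in> K" by simp
      have "\<bar>(x - a) \<bullet> gv x\<bar> \<le> norm (x - a) * norm (gv x)" by (rule Cauchy_Schwarz_ineq2)
      also have "\<dots> \<le> diameter K * norm (gv x)"
        using diameter_bound[OF x] V_subset_K that by (intro mult_right_mono) auto
      finally have "\<bar>(x - a) \<bullet> gv x\<bar>\<^sup>2 \<le> (diameter K * norm (gv x))\<^sup>2" by (intro power_mono) auto
      then show "((x - a) \<bullet> gv x)\<^sup>2 \<le> (diameter K)\<^sup>2 * (norm (gv x))\<^sup>2" by (simp add: power_mult_distrib)
    qed (intro cK continuous_intros gv)+
    then have "sqrt (\<integral>x. ((x - a) \<bullet> gv x)\<^sup>2 \<partial>lebesgue_on K) \<le> diameter K * sqrt (\<integral>x. (norm (gv x))\<^sup>2 \<partial>lebesgue_on K)"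
      using h0 real_sqrt_le_mono by (fastforce simp: real_sqrt_mult)
    then have "radial_const N * (sqrt (\<integral>x. (q x)\<^sup>2 \<partial>lebesgue_on K) *
     sqrt (sqrt (\<integral>x. (v x)\<^sup>2 \<partial>lebesgue_on K) * sqrt (\<integral>x. ((x - a) \<bullet> gv x)\<^sup>2 \<partial>lebesgue_on K))) \<le> ?R"
      using radial_const_nonneg by (intro mult_left_mono real_sqrt_le_mono) auto
    then show ?thesis using radial_bound[OF that N q v gv] by linarith
  qed
  have pt: "\<bar>\<integral>x. q x * ((x - y) \<bullet> gv x) \<partial>lebesgue_on K\<bar> \<le> ?R" if "y \<in> K" for y
  proof -
    have "(\<integral>x. q x * ((x - y) \<bullet> gv x) \<partial>lebesgue_on K) = (\<integral>x. (\<Sum>a\<in>V. lam a y * (q x * ((x - a) \<bullet> gv x))) \<partial>lebesgue_on K)"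
    proof (rule Bochner_Integration.integral_cong[OF refl])
      fix x
      have "x - y = (\<Sum>a\<in>V. lam a y *\<^sub>R (x - a))"
        by (simp add: scaleR_diff_right sum_subtractf scaleR_sum_left[symmetric] lam_sum lam_repr)
      then have "(x - y) \<bullet> gv x = (\<Sum>a\<in>V. lam a y * ((x - a) \<bullet> gv x))" by (simp add: inner_sum_left)
      then show "q x * ((x - y) \<bullet> gv x) = (\<Sum>a\<in>V. lam a y * (q x * ((x - a) \<bullet> gv x)))"
        by (simp only: sum_distrib_left mult.left_commute[of "q x"])
    qed
    also have "\<dots> = (\<Sum>a\<in>V. lam a y * (\<integral>x. q x * ((x - a) \<bullet> gv x) \<partial>lebesgue_on K))"
      by (subst Bochner_Integration.integral_sum) (auto intro!: cK continuous_intros cq gv)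
    also have "\<bar>\<dots>\<bar> \<le> (\<Sum>a\<in>V. \<bar>lam a y * (\<integral>x. q x * ((x - a) \<bullet> gv x) \<partial>lebesgue_on K)\<bar>)" by (rule sum_abs)
    also have "\<dots> \<le> (\<Sum>a\<in>V. lam a y * ?R)"
      using vert lam_nonneg[OF that] by (intro sum_mono) (simp add: abs_mult mult_left_mono)
    also have "\<dots> = ?R" by (simp add: sum_distrib_right[symmetric] lam_sum)
    finally show ?thesis .
  qed
  have cb: "cball c r \<subseteq> K" using r K_closed closure_minimal[of "ball c r" K] by (simp add: closure_ball)
  have y: "c + r *\<^sub>R e \<in> K" "c - r *\<^sub>R e \<in> K" using cb r(2) e by (auto simp: dist_norm subset_eq)
  have "2 * r * (\<integral>x. q x * (e \<bullet> gv x) \<partial>lebesgue_on K) =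
      (\<integral>x. q x * ((x - (c - r *\<^sub>R e)) \<bullet> gv x) - q x * ((x - (c + r *\<^sub>R e)) \<bullet> gv x) \<partial>lebesgue_on K)"
    unfolding Bochner_Integration.integral_mult_right_zero[symmetric]
    by (rule Bochner_Integration.integral_cong[OF refl]) (simp add: inner_add_left inner_diff_left algebra_simps)
  also have "\<dots> = (\<integral>x. q x * ((x - (c - r *\<^sub>R e)) \<bullet> gv x) \<partial>lebesgue_on K) - (\<integral>x. q x * ((x - (c + r *\<^sub>R e)) \<bullet> gv x)
      \<partial>lebesgue_on K)"
    by (rule Bochner_Integration.integral_diff) (intro cK continuous_intros cq gv)+
  also have "\<bar>\<dots>\<bar> \<le> ?R + ?R" using pt[OF y(1)] pt[OF y(2)] by linarith
  finally show ?thesis using r(2) by (simp add: abs_mult)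
qed

text \<open>Summing over coordinates costs \<open>sqrt d\<close> by Cauchy-Schwarz. To pass from
  single inscribed balls to the supremum \<open>rho K\<close>, the estimate is divided by
  \<open>X\<close>, which makes the right-hand side an upper bound for all \<open>2 * r\<close>;
  hence the separate case \<open>X = 0\<close>.\<close>

lemma flux_bound:
  assumes N: "N \<ge> 2" and g: "\<And>b. b \<in> Basis \<Longrightarrow> pol (Suc N) (\<lambda>x. g x \<bullet> b)"
    and v: "\<And>x. (v has_derivative (\<lambda>h. h \<bullet> gv x)) (at x)" and gv: "continuous_on UNIV gv"
  shows "rho K * \<bar>\<integral>x. g x \<bullet> gv x \<partial>lebesgue_on K\<bar> \<le> 2 * sqrt (real DIM('a)) * radial_const N *
    (sqrt (\<integral>x. (norm (g x))\<^sup>2 \<partial>lebesgue_on K) *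
     sqrt (sqrt (\<integral>x. (v x)\<^sup>2 \<partial>lebesgue_on K) * (diameter K * sqrt (\<integral>x. (norm (gv x))\<^sup>2 \<partial>lebesgue_on K))))"
    (is "_ \<le> 2 * sqrt (real DIM('a)) * radial_const N * (?G * ?Y)")
proof -
  have cK: "integrable (lebesgue_on K) F" if "continuous_on UNIV F" for F :: "'a \<Rightarrow> real"
    by (intro integrable_lebesgue_on_compact K_compact continuous_on_subset[OF that]) auto
  have cg: "continuous_on UNIV (\<lambda>x. g x \<bullet> b)" if "b \<in> Basis" for b using g[OF that] by (rule pol_continuous)
  define X where "X = \<bar>\<integral>x. g x \<bullet> gv x \<partial>lebesgue_on K\<bar>"
  define n where "n = (\<lambda>b. sqrt (\<integral>x. (g x \<bullet> b)\<^sup>2 \<partial>lebesgue_on K))"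
  have h0: "diameter K \<ge> 0" using diameter_ge_0[OF compact_imp_bounded[OF K_compact]] .
  have Y0: "?Y \<ge> 0" using h0 by simp
  have sum_n: "(\<Sum>b\<in>Basis. n b) \<le> sqrt (real DIM('a)) * ?G"
  proof -
    have "(\<Sum>b\<in>Basis. n b * 1)\<^sup>2 \<le> (\<Sum>b\<in>Basis. (n b)\<^sup>2) * (\<Sum>b\<in>(Basis::'a set). 1\<^sup>2)"
      by (rule Cauchy_Schwarz_ineq_sum)
    also have "(\<Sum>b\<in>Basis. (n b)\<^sup>2) = (\<Sum>b\<in>Basis. (\<integral>x. (g x \<bullet> b)\<^sup>2 \<partial>lebesgue_on K))" by (simp add: n_def)
    also have "\<dots> = (\<integral>x. (\<Sum>b\<in>Basis. (g x \<bullet> b)\<^sup>2) \<partial>lebesgue_on K)"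
      by (subst Bochner_Integration.integral_sum) (auto intro!: cK continuous_intros cg)
    also have "\<dots> = (\<integral>x. (norm (g x))\<^sup>2 \<partial>lebesgue_on K)"
    proof (intro Bochner_Integration.integral_cong refl)
      fix x
      have "(norm (g x))\<^sup>2 = g x \<bullet> g x" by (rule power2_norm_eq_inner)
      also have "\<dots> = (\<Sum>b\<in>Basis. (g x \<bullet> b) * (g x \<bullet> b))" by (rule euclidean_inner)
      finally show "(\<Sum>b\<in>Basis. (g x \<bullet> b)\<^sup>2) = (norm (g x))\<^sup>2" by (simp add: power2_eq_square)
    qed
    finally have "(\<Sum>b\<in>Basis. n b)\<^sup>2 \<le> real DIM('a) * (\<integral>x. (norm (g x))\<^sup>2 \<partial>lebesgue_on K)" by (simp add: mult.commute)
    then have "sqrt ((\<Sum>b\<in>Basis. n b)\<^sup>2) \<le> sqrt (real DIM('a) * (\<integral>x. (norm (g x))\<^sup>2 \<partial>lebesgue_on K))"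
      by (rule real_sqrt_le_mono)
    then show ?thesis by (simp add: real_sqrt_mult)
  qed
  have key: "r * X \<le> sqrt (real DIM('a)) * radial_const N * (?G * ?Y)" if r: "ball c r \<subseteq> K" "r > 0" for c r
  proof -
    have "(\<integral>x. g x \<bullet> gv x \<partial>lebesgue_on K) = (\<integral>x. (\<Sum>b\<in>Basis. (g x \<bullet> b) * (b \<bullet> gv x)) \<partial>lebesgue_on K)"
      by (intro Bochner_Integration.integral_cong refl) (simp add: euclidean_inner[of "g _" "gv _"] inner_commute)
    also have "\<dots> = (\<Sum>b\<in>Basis. (\<integral>x. (g x \<bullet> b) * (b \<bullet> gv x) \<partial>lebesgue_on K))"
      by (rule Bochner_Integration.integral_sum) (auto intro!: cK continuous_intros cg gv)
    finally have "r * X \<le> r * (\<Sum>b\<in>Basis. \<bar>\<integral>x. (g x \<bullet> b) * (b \<bullet> gv x) \<partial>lebesgue_on K\<bar>)"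
      unfolding X_def using r(2) by (intro mult_left_mono) auto
    also have "\<dots> = (\<Sum>b\<in>Basis. r * \<bar>\<integral>x. (g x \<bullet> b) * (b \<bullet> gv x) \<partial>lebesgue_on K\<bar>)" by (rule sum_distrib_left)
    also have "\<dots> \<le> (\<Sum>b\<in>Basis. radial_const N * (n b * ?Y))"
      unfolding n_def by (intro sum_mono directional_bound[OF N g v gv r]) auto
    also have "\<dots> = radial_const N * ((\<Sum>b\<in>Basis. n b) * ?Y)" by (simp add: sum_distrib_left sum_distrib_right)
    also have "\<dots> \<le> radial_const N * ((sqrt (real DIM('a)) * ?G) * ?Y)"
      using sum_n Y0 radial_const_nonneg by (intro mult_left_mono mult_right_mono)
    finally show ?thesis by (simp add: algebra_simps)
  qed
  let ?B = "2 * sqrt (real DIM('a)) * radial_const N * (?G * ?Y)"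
  have B0: "?B \<ge> 0" using Y0 radial_const_nonneg by simp
  show ?thesis
  proof (cases "X = 0")
    case True
    then show ?thesis using B0 by (simp add: X_def)
  next
    case False
    then have X: "X > 0" by (simp add: X_def)
    have "rho K \<le> ?B / X" unfolding rho_def
    proof (rule cSup_least)
      \<comment> \<open>Radii that are not positive give empty balls and belong to the set, so it is
        never empty.\<close>
      have "2 * 0 \<in> {2 * r |r c. ball c r \<subseteq> K}" by (intro CollectI exI[of _ 0]) auto
      then show "{2 * r |r c. ball c r \<subseteq> K} \<noteq> {}" by blast
      fix y assume "y \<in> {2 * r |r c. ball c r \<subseteq> K}"
      then obtain r c where rc: "y = 2 * r" "ball c r \<subseteq> K" by blast
      show "y \<le> ?B / X"
      proof (cases "r > 0")
        case True
        then show ?thesis using key[OF rc(2) True] X rc(1) by (simp add: pos_le_divide_eq)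
      next
        case False
        then have "y \<le> 0" using rc by simp
        also have "0 \<le> ?B / X" using B0 X by simp
        finally show ?thesis .
      qed
    qed
    then show ?thesis using X by (simp add: pos_le_divide_eq X_def)
  qed
qed

lemma interior_K_nonempty: "interior K \<noteq> {}"
  using indep card_V unfolding K_def by (simp add: interior_convex_hull_eq_empty)

lemma rho_pos: "rho K > 0"
proof -
  obtain c where "c \<in> interior K" using interior_K_nonempty by blast
  then obtain r where r: "r > 0" "ball c r \<subseteq> K" by (auto simp: mem_interior)
  have "2 * r \<le> rho K" unfolding rho_def
  proof (rule cSup_upper)
    show "bdd_above {2 * r |r c. ball c r \<subseteq> K}"
    proof (rule bdd_aboveI)
      fix y assume "y \<in> {2 * r |r c. ball c r \<subseteq> K}"
      then obtain r c where rc: "y = 2 * r" "ball c r \<subseteq> K" by blast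
      show "y \<le> max 0 (diameter K)"
      proof (cases "r > 0")
        case True
        have "diameter (ball c r) \<le> diameter K"
          using rc(2) compact_imp_bounded[OF K_compact] by (rule diameter_subset)
        then show ?thesis using True rc(1) by (simp add: diameter_ball)
      qed (use rc in auto)
    qed
  qed (use r in blast)
  then show ?thesis using r by simp
qed

end

section \<open>A Poincare inequality modulo affine functions\<close>

text \<open>Translation invariance of Lebesgue measure, differentiated in the direction \<open>e\<close>.\<close>
lemma integral_directional_derivative_eq_0:
  fixes G g :: "'a::euclidean_space \<Rightarrow> real"
  assumes [measurable]: "G \<in> borel_measurable borel" "g \<in> borel_measurable borel"
    and int: "integrable lborel G" and t0: "t0 > 0"
    and lip: "\<And>x t. 0 < t \<Longrightarrow> t \<le> t0 \<Longrightarrow> \<bar>G (x + t *\<^sub>R e) - G x\<bar> \<le> C * t"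
    and supp: "\<And>x. G x \<noteq> 0 \<Longrightarrow> norm x \<le> R"
    and lim: "AE x in lborel. ((\<lambda>t. (G (x + t *\<^sub>R e) - G x) / t) \<longlongrightarrow> g x) (at_right 0)"
  shows "integrable lborel g" "(\<integral>x. g x \<partial>lborel) = 0"
proof -
  define t where "t = (\<lambda>n. t0 / real (Suc n))"
  have t: "t n > 0" "t n \<le> t0" for n using t0 by (auto simp: t_def field_simps)
  have nz: "t n \<noteq> 0" for n using t(1)[of n] by simp
  have "t \<longlonglongrightarrow> 0"
    unfolding t_def using tendsto_mult_right_zero[OF LIMSEQ_inverse_real_of_nat, of t0] by (simp add: divide_inverse)
  then have t_lim: "filterlim t (at_right 0) sequentially"
    using t(1) nz by (auto simp: filterlim_at intro!: always_eventually)
  have shift: "integrable lborel (\<lambda>x. G (x + t n *\<^sub>R e))" "(\<integral>x. G (x + t n *\<^sub>R e) \<partial>lborel) = (\<integral>x. G x \<partial>lborel)" for n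
  proof -
    have "integrable (distr lborel borel ((+) (t n *\<^sub>R e))) G" by (simp add: lborel_distr_plus int)
    then have "integrable lborel (\<lambda>x. G (t n *\<^sub>R e + x))" by (subst (asm) integrable_distr_eq) auto
    then show "integrable lborel (\<lambda>x. G (x + t n *\<^sub>R e))" by (simp add: add.commute)
    have "(\<integral>x. G x \<partial>lborel) = (\<integral>x. G x \<partial>distr lborel borel ((+) (t n *\<^sub>R e)))" by (simp add: lborel_distr_plus)
    also have "\<dots> = (\<integral>x. G (t n *\<^sub>R e + x) \<partial>lborel)" by (subst integral_distr) auto
    finally show "(\<integral>x. G (x + t n *\<^sub>R e) \<partial>lborel) = (\<integral>x. G x \<partial>lborel)" by (simp add: add.commute)
  qed
  define D where "D = (\<lambda>n x. (G (x + t n *\<^sub>R e) - G x) / t n)"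
  have D0: "(\<integral>x. D n x \<partial>lborel) = 0" for n unfolding D_def using shift[of n] int by simp
  \<comment> \<open>The difference quotients vanish outside this ball and are bounded by
    \<open>C\<close> inside, so a multiple of its indicator dominates all of them.\<close>
  define B where "B = cball (0::'a) (R + t0 * norm e)"
  have C0: "C \<ge> 0"
  proof -
    have "0 \<le> \<bar>G (0 + t 0 *\<^sub>R e) - G 0\<bar>" by simp
    also have "\<dots> \<le> C * t 0" using t lip by blast
    finally show ?thesis using t[of 0] by (simp add: zero_le_mult_iff)
  qed
  have bound: "norm (D n x) \<le> indicator B x * C" for n x
  proof (cases "x \<in> B")
    case True
    have "\<bar>G (x + t n *\<^sub>R e) - G x\<bar> \<le> C * t n" using t lip by blast
    then show ?thesis using True t[of n] by (simp add: D_def divide_le_eq)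
  next
    case False
    then have nx: "norm x > R + t0 * norm e" by (simp add: B_def)
    have "norm x \<le> norm (x + t n *\<^sub>R e) + norm (t n *\<^sub>R e)" by (metis add_diff_cancel_right' norm_triangle_ineq4)
    moreover have "norm (t n *\<^sub>R e) \<le> t0 * norm e" using t[of n] by (simp add: mult_right_mono)
    ultimately have "norm (x + t n *\<^sub>R e) > R" using nx by linarith
    moreover have "norm x > R" using nx t0 by (smt (verit) mult_nonneg_nonneg norm_ge_zero)
    ultimately have "G (x + t n *\<^sub>R e) = 0" "G x = 0" using supp by (meson not_le)+
    then show ?thesis using False by (simp add: D_def)
  qed
  have [measurable]: "D n \<in> borel_measurable borel" for n unfolding D_def by measurable
  have w: "integrable lborel (\<lambda>x. indicator B x * C)"
  proof -
    have "integrable lborel (indicator B :: 'a \<Rightarrow> real)"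
      unfolding B_def using emeasure_bounded_finite[OF bounded_cball[of "0::'a" "R + t0 * norm e"]]
      by (intro integrable_real_indicator) auto
    then show ?thesis by simp
  qed
  have ae: "AE x in lborel. (\<lambda>n. D n x) \<longlonglongrightarrow> g x"
    using lim
  proof (rule eventually_mono)
    fix x assume "((\<lambda>t. (G (x + t *\<^sub>R e) - G x) / t) \<longlongrightarrow> g x) (at_right 0)"
    from filterlim_compose[OF this t_lim] show "(\<lambda>n. D n x) \<longlonglongrightarrow> g x" by (simp add: D_def)
  qed
  have conv: "integrable lborel g \<and> (\<lambda>n. \<integral>x. D n x \<partial>lborel) \<longlonglongrightarrow> (\<integral>x. g x \<partial>lborel)"
    using integrable_dominated_convergence[where f=g and s=D and w="\<lambda>x. indicator B x * C" and M=lborel]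
      integral_dominated_convergence[where f=g and s=D and w="\<lambda>x. indicator B x * C" and M=lborel] w ae bound
    by auto
  then show "integrable lborel g" by blast
  show "(\<integral>x. g x \<partial>lborel) = 0" using conv D0 by (simp add: LIMSEQ_const_iff)
qed

definition C1_grad :: "('a::euclidean_space \<Rightarrow> real) \<Rightarrow> ('a \<Rightarrow> 'a) \<Rightarrow> bool" where
  "C1_grad v gv \<longleftrightarrow> (\<forall>x. (v has_derivative (\<lambda>h. h \<bullet> gv x)) (at x)) \<and> continuous_on UNIV gv"

lemma C1_gradD: "C1_grad v gv \<Longrightarrow> (v has_derivative (\<lambda>h. h \<bullet> gv x)) (at x)"
  "C1_grad v gv \<Longrightarrow> continuous_on UNIV gv" by (auto simp: C1_grad_def)

lemma C1_grad_continuous: "C1_grad v gv \<Longrightarrow> continuous_on UNIV v"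
  by (meson C1_gradD(1) continuous_on_eq_continuous_within has_derivative_continuous has_derivative_at_withinI)

lemma C1_grad_unique: assumes "C1_grad v g" "C1_grad v g'" shows "g = g'"
proof
  fix x
  have "(\<lambda>h. h \<bullet> g x) = (\<lambda>h. h \<bullet> g' x)"
    using has_derivative_unique C1_gradD(1)[OF assms(1)] C1_gradD(1)[OF assms(2)] by blast
  then show "g x = g' x" by (metis inner_commute vector_eq_ldot)
qed

lemma C1_grad_add_scaled: assumes "C1_grad v gv" "C1_grad w gw" shows "C1_grad (\<lambda>x. v x + c * w x) (\<lambda>x. gv x + c *\<^sub>R gw
    x)"
proof -
  have "((\<lambda>x. v x + c * w x) has_derivative (\<lambda>h. h \<bullet> gv x + c * (h \<bullet> gw x))) (at x)" for x
    by (intro has_derivative_add has_derivative_mult_right C1_gradD(1) assms)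
  then show ?thesis using assms unfolding C1_grad_def
    by (auto simp: inner_add_right intro!: continuous_intros)
qed

lemma pol_mult: "pol n f \<Longrightarrow> pol m g \<Longrightarrow> pol (n + m) (\<lambda>x. f x * g x)"
proof (induction rule: pol.induct)
  case (pol_zero n)
  then show ?case by (simp add: pol.pol_zero)
next
  case (pol_const n c)
  then show ?case by (intro pol_mono[OF pol_scale]) auto
next
  case (pol_add n f g')
  then show ?case using pol.pol_add[OF pol_add.IH(1) pol_add.IH(2)] by (simp add: distrib_right)
next
  case (pol_mult_inner n f c)
  then show ?case using pol.pol_mult_inner[of "n + m" "\<lambda>x. f x * g x" c] by (simp add: mult.assoc)
qed

text \<open>Brings the approximants of the Stone-Weierstrass theorem into the filtered
  class.\<close>

lemma real_polynomial_function_imp_pol: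
  fixes f :: "'a::euclidean_space \<Rightarrow> real"
  shows "real_polynomial_function f \<Longrightarrow> \<exists>n. pol n f"
proof (induction rule: real_polynomial_function.induct)
  case (linear f)
  interpret bounded_linear f by fact
  have "f x = 0 + x \<bullet> (\<Sum>b\<in>Basis. f b *\<^sub>R b)" for x
    by (subst euclidean_representation[of x, symmetric], subst sum)
      (auto simp: scaleR inner_sum_right inner_commute mult.commute)
  then have "f = (\<lambda>x. 0 + x \<bullet> (\<Sum>b\<in>Basis. f b *\<^sub>R b))" by blast
  then show ?case using pol_affine by metis
next
  case (const c)
  then show ?case using pol_const by blast
next
  case (add f g)
  then obtain n m where "pol n f" "pol m g" by blast
  then have "pol (max n m) f" "pol (max n m) g" by (auto intro: pol_mono)
  then show ?case using pol_add by blast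
next
  case (mult f g)
  then show ?case using pol_mult by blast
qed

context full_simplex
begin

section \<open>Integration along chords parallel to an edge\<close>

lemma frontier_K_null: "AE x in lborel. x \<notin> frontier K"
proof -
  have "negligible (frontier K)" using K_convex by (rule negligible_convex_frontier)
  then have "frontier K \<in> null_sets lebesgue" by (simp add: negligible_iff_null_sets)
  then have "AE x in lebesgue. x \<notin> frontier K" by (rule AE_not_in)
  then show ?thesis by (simp add: AE_completion_iff)
qed

lemma integral_K_lborel:
  fixes f :: "'a \<Rightarrow> real"
  assumes [measurable]: "f \<in> borel_measurable borel"
  shows "(\<integral>x. f x \<partial>lebesgue_on K) = (\<integral>x. indicator K x *\<^sub>R f x \<partial>lborel)"
  by (subst integral_restrict_space) (auto intro!: integral_completion)

text \<open>On chords parallel to the edge \<open>a - b\<close> only \<open>lam a\<close> and \<open>lam b\<close> vary, so \<open>lam a * lam b * \<psi>\<close>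
  vanishes at the end points of each chord.\<close>
lemma chord_integral_eq_0:
  assumes ab: "a \<in> V" "b \<in> V" "a \<noteq> b"
    and \<psi>: "\<And>x. (\<psi> has_derivative \<psi>' x) (at x)" and c: "continuous_on UNIV (\<lambda>x. \<psi>' x (a - b))"
  shows "(\<integral>x. (lam b x - lam a x) * \<psi> x + lam a x * lam b x * \<psi>' x (a - b) \<partial>lebesgue_on K) = 0"
proof -
  define e where "e = a - b"
  define F where "F = (\<lambda>x. lam a x * lam b x * \<psi> x)"
  define F' where "F' = (\<lambda>x. (lam b x - lam a x) * \<psi> x + lam a x * lam b x * \<psi>' x e)"
  have c\<psi>: "continuous_on UNIV \<psi>"
    using \<psi> by (meson continuous_on_eq_continuous_within has_derivative_continuous has_derivative_at_withinI)
  have cF: "continuous_on UNIV F" unfolding F_def by (intro continuous_intros c\<psi>)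
  have cF': "continuous_on UNIV F'" unfolding F'_def e_def by (intro continuous_intros c\<psi> c)
  have [measurable]: "F \<in> borel_measurable borel" "F' \<in> borel_measurable borel"
    using cF cF' by (auto intro: borel_measurable_continuous_onI)
  have lam_e: "lam v (x + t *\<^sub>R e) = lam v x + t * (lam v a - lam v b)" for v x t
    unfolding e_def by (rule lam_affine)
  have la: "lam a (x + t *\<^sub>R e) = lam a x + t" "lam b (x + t *\<^sub>R e) = lam b x - t" for x t
    using lam_e[of a x t] lam_e[of b x t] ab by (simp_all add: lam_vertex)
  have lo: "lam v (x + t *\<^sub>R e) = lam v x" if "v \<in> V" "v \<noteq> a" "v \<noteq> b" for v x t
    using lam_e[of v x t] ab that by (simp add: lam_vertex)
  have line: "((\<lambda>s. F (x + s *\<^sub>R e)) has_real_derivative F' (x + s *\<^sub>R e)) (at s)" for x s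
  proof -
    have "((\<lambda>s. x + s *\<^sub>R e) has_derivative (\<lambda>t. t *\<^sub>R e)) (at s)" by (auto intro!: derivative_eq_intros)
    from has_derivative_compose[OF this \<psi>]
    have "((\<lambda>s. \<psi> (x + s *\<^sub>R e)) has_derivative (\<lambda>t. \<psi>' (x + s *\<^sub>R e) (t *\<^sub>R e))) (at s)" .
    moreover have "(\<lambda>t. \<psi>' (x + s *\<^sub>R e) (t *\<^sub>R e)) = (*) (\<psi>' (x + s *\<^sub>R e) e)"
      using linear_cmul[OF has_derivative_linear[OF \<psi>]] by (auto simp: mult.commute)
    ultimately have d: "((\<lambda>s. \<psi> (x + s *\<^sub>R e)) has_real_derivative \<psi>' (x + s *\<^sub>R e) e) (at s)"
      by (simp add: has_field_derivative_def)
    have "((\<lambda>s. (lam a x + s) * (lam b x - s) * \<psi> (x + s *\<^sub>R e)) has_real_derivative F' (x + s *\<^sub>R e)) (at s)"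
      unfolding F'_def la by (rule derivative_eq_intros d refl | simp add: algebra_simps)+
    then show ?thesis by (simp add: F_def la)
  qed
  obtain C0 where C0: "\<And>x. x \<in> K \<Longrightarrow> \<bar>\<psi> x\<bar> \<le> C0"
    using compact_imp_bounded[OF compact_continuous_image[OF continuous_on_subset[OF c\<psi>] K_compact]]
    by (auto simp: bounded_iff)
  obtain C1 where C1: "\<And>x. x \<in> K \<Longrightarrow> \<bar>F' x\<bar> \<le> C1"
    using compact_imp_bounded[OF compact_continuous_image[OF continuous_on_subset[OF cF'] K_compact]]
    by (auto simp: bounded_iff)
  obtain R where R: "\<And>x. x \<in> K \<Longrightarrow> norm x \<le> R" using compact_imp_bounded[OF K_compact] by (auto simp: bounded_iff)
  define C where "C = max \<bar>C0\<bar> \<bar>C1\<bar>"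
  define G where "G = (\<lambda>x. indicator K x * F x)"
  define g where "g = (\<lambda>x. indicator (interior K) x * F' x)"
  have [measurable]: "G \<in> borel_measurable borel" "g \<in> borel_measurable borel"
    unfolding G_def g_def by (auto simp: borel_open)
  \<comment> \<open>A segment of parameter length \<open>t\<close> can enter or leave
    \<open>K\<close> only where \<open>lam a\<close> or \<open>lam b\<close> is at most
    \<open>t\<close>. The weight \<open>lam a * lam b\<close> then makes the jump of
    \<open>G\<close> of order \<open>t\<close>, so the cut-off function stays Lipschitz along
    \<open>e\<close>.\<close>
  have Fb: "\<bar>F x\<bar> \<le> C * t" if "x \<in> K" "lam a x \<le> t \<or> lam b x \<le> t" for x t
  proof -
    have "lam a x * lam b x \<le> t"
    proof -
      have "lam a x * lam b x \<le> lam a x * 1" "lam a x * lam b x \<le> 1 * lam b x"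
        using lam_nonneg[OF that(1)] lam_le_1[OF that(1)] by (intro mult_mono; simp)+
      then show ?thesis using that(2) by linarith
    qed
    then have "(lam a x * lam b x) * \<bar>\<psi> x\<bar> \<le> t * C"
      using C0[OF that(1)] lam_nonneg[OF that(1)] by (intro mult_mono') (auto simp: C_def)
    then show ?thesis using lam_nonneg[OF that(1)] by (simp add: F_def abs_mult mult.commute)
  qed
  have lip: "\<bar>G (x + t *\<^sub>R e) - G x\<bar> \<le> C * t" if t: "0 < t" "t \<le> 1" for x t
  proof -
    consider "x \<in> K" "x + t *\<^sub>R e \<in> K" | "x \<in> K" "x + t *\<^sub>R e \<notin> K" | "x \<notin> K" "x + t *\<^sub>R e \<in> K" | "x \<notin> K" "x + t *\<^sub>R e \<notin>
        K"
      by blast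
    then show ?thesis
    proof cases
      case 1
      obtain s where s: "0 < s" "s < t" "F (x + t *\<^sub>R e) - F (x + 0 *\<^sub>R e) = (t - 0) * F' (x + s *\<^sub>R e)"
        using MVT2[OF t(1) line, of x] by blast
      have "x + s *\<^sub>R e = (1 - s / t) *\<^sub>R x + (s / t) *\<^sub>R (x + t *\<^sub>R e)" using t by (simp add: algebra_simps)
      also have "\<dots> \<in> K" using K_convex 1 s t by (intro convexD) auto
      finally have "\<bar>F' (x + s *\<^sub>R e)\<bar> \<le> C" using C1 by (fastforce simp: C_def)
      then show ?thesis using s(3) 1 t by (simp add: G_def abs_mult mult.commute mult_left_mono)
    next
      case 2
      then obtain v where v: "v \<in> V" "lam v (x + t *\<^sub>R e) < 0" using K_iff by (meson not_le)
      \<comment> \<open>Along \<open>e\<close> the coordinate \<open>lam a\<close> grows,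
        \<open>lam b\<close> decreases and all others are constant: the simplex can only be left
        through the facet \<open>lam b = 0\<close>.\<close>
      have "v = b"
      proof (rule ccontr)
        assume "v \<noteq> b"
        then show False using v la(1)[of x t] lo[OF v(1)] lam_nonneg[OF 2(1), of v] t by (cases "v = a") auto
      qed
      then have "lam b x \<le> t" using v la(2)[of x t] by simp
      then show ?thesis using Fb[OF 2(1)] 2 by (simp add: G_def)
    next
      case 3
      then obtain v where v: "v \<in> V" "lam v x < 0" using K_iff by (meson not_le)
      have "v = a"
      proof (rule ccontr)
        assume "v \<noteq> a"
        then show False using v la(2)[of x t] lo[OF v(1), of x t] lam_nonneg[OF 3(2), of v] t by (cases "v = b") auto
      qed
      then have "lam a (x + t *\<^sub>R e) \<le> t" using v la(1)[of x t] by simp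
      then show ?thesis using Fb[OF 3(2)] 3 by (simp add: G_def)
    qed (use t in \<open>simp add: G_def C_def\<close>)
  qed
  have lim: "AE x in lborel. ((\<lambda>t. (G (x + t *\<^sub>R e) - G x) / t) \<longlongrightarrow> g x) (at_right 0)"
    using frontier_K_null
  proof (rule eventually_mono)
    fix x assume "x \<notin> frontier K"
    have line0: "((\<lambda>t. x + t *\<^sub>R e) \<longlongrightarrow> x) (at_right 0)"
      by (rule tendsto_eq_intros refl | simp)+
    show "((\<lambda>t. (G (x + t *\<^sub>R e) - G x) / t) \<longlongrightarrow> g x) (at_right 0)"
    proof (cases "x \<in> K")
      case True
      then have xi: "x \<in> interior K" using \<open>x \<notin> frontier K\<close> K_closed by (simp add: frontier_def closure_closed)
      have "((\<lambda>s. F (x + s *\<^sub>R e)) has_real_derivative F' (x + 0 *\<^sub>R e)) (at 0)" by (rule line)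
      then have "((\<lambda>s. (F (x + s *\<^sub>R e) - F x) / s) \<longlongrightarrow> F' x) (at 0)"
        by (simp add: has_field_derivative_iff)
      then have "((\<lambda>s. (F (x + s *\<^sub>R e) - F x) / s) \<longlongrightarrow> F' x) (at_right 0)"
        by (rule tendsto_mono[rotated]) (simp add: at_le)
      moreover have "\<forall>\<^sub>F s in at_right 0. x + s *\<^sub>R e \<in> interior K"
        using topological_tendstoD[OF line0 open_interior xi] .
      then have "\<forall>\<^sub>F s in at_right 0. (F (x + s *\<^sub>R e) - F x) / s = (G (x + s *\<^sub>R e) - G x) / s"
        by (rule eventually_mono) (use True interior_subset[of K] in \<open>auto simp: G_def indicator_def\<close>)
      ultimately have "((\<lambda>s. (G (x + s *\<^sub>R e) - G x) / s) \<longlongrightarrow> F' x) (at_right 0)"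
        by (rule Lim_transform_eventually)
      then show ?thesis using xi by (simp add: g_def)
    next
      case False
      then have "x \<in> - K" "open (- K)" using K_closed by auto
      then have "\<forall>\<^sub>F s in at_right 0. x + s *\<^sub>R e \<in> - K" using topological_tendstoD[OF line0] by blast
      then have "\<forall>\<^sub>F s in at_right 0. 0 = (G (x + s *\<^sub>R e) - G x) / s"
        by (rule eventually_mono) (use False in \<open>auto simp: G_def\<close>)
      then have "((\<lambda>s. (G (x + s *\<^sub>R e) - G x) / s) \<longlongrightarrow> 0) (at_right 0)"
        using Lim_transform_eventually[OF tendsto_const] by fast
      then show ?thesis using False interior_subset[of K] by (auto simp: g_def indicator_def)
    qed
  qed
  have intG: "integrable lborel G"
    unfolding G_def using borel_integrable_compact[OF K_compact continuous_on_subset[OF cF]] by simp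
  have "(\<integral>x. g x \<partial>lborel) = 0"
    by (rule integral_directional_derivative_eq_0(2)[where G = G and e = e and C = C and R = R and ?t0.0 = 1])
      (use lip lim intG R in \<open>auto simp: G_def indicator_def split: if_splits\<close>)
  moreover have "(\<integral>x. F' x \<partial>lebesgue_on K) = (\<integral>x. g x \<partial>lborel)"
    unfolding integral_K_lborel[OF \<open>F' \<in> borel_measurable borel\<close>]
  proof (rule integral_cong_AE)
    show "AE x in lborel. indicator K x *\<^sub>R F' x = g x"
      using frontier_K_null
      by (rule eventually_mono) (use K_closed interior_subset in \<open>auto simp: g_def indicator_def frontier_def
          closure_closed\<close>)
  qed auto
  ultimately show ?thesis unfolding F'_def e_def by simp
qed

section \<open>The weighted Dirichlet form and its generator\<close>

abbreviation IK :: "('a \<Rightarrow> real) \<Rightarrow> real" where "IK F \<equiv> (\<integral>x. F x \<partial>lebesgue_on K)"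

lemma integrable_K: "continuous_on UNIV F \<Longrightarrow> integrable (lebesgue_on K) F" for F :: "'a \<Rightarrow> real"
  by (intro integrable_lebesgue_on_compact K_compact) (auto intro: continuous_on_subset)

lemma sqi_K: "continuous_on UNIV F \<Longrightarrow> sqi (lebesgue_on K) F" for F :: "'a \<Rightarrow> real"
  by (intro sqi_compact K_compact) (auto intro: continuous_on_subset)

text \<open>The Dirichlet form of a Wright-Fisher diffusion whose invariant measure is the uniform
  one. Ordered pairs are summed, hence the factor 1/2. The arguments are vector fields, to be read
  as gradients, so that the form expands without any differentiation.\<close>

definition Bform :: "('a \<Rightarrow> 'a) \<Rightarrow> ('a \<Rightarrow> 'a) \<Rightarrow> real" where
  "Bform g h = (\<Sum>a\<in>V. \<Sum>b\<in>V. IK (\<lambda>x. lam a x * lam b x * ((a - b) \<bullet> g x) * ((a - b) \<bullet> h x))) / 2"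

lemma Bform_sym: "Bform g h = Bform h g"
  by (simp add: Bform_def mult.assoc mult.commute[of "_ \<bullet> g _"])

lemma Bform_add:
  assumes "continuous_on UNIV g" "continuous_on UNIV g'" "continuous_on UNIV h"
  shows "Bform (\<lambda>x. g x + c *\<^sub>R g' x) h = Bform g h + c * Bform g' h"
proof -
  have "IK (\<lambda>x. lam a x * lam b x * ((a - b) \<bullet> (g x + c *\<^sub>R g' x)) * ((a - b) \<bullet> h x)) =
      IK (\<lambda>x. lam a x * lam b x * ((a - b) \<bullet> g x) * ((a - b) \<bullet> h x)) + c * IK (\<lambda>x. lam a x * lam b x * ((a - b) \<bullet> g' x)
          * ((a - b) \<bullet> h x))" for a b
  proof -
    have "IK (\<lambda>x. lam a x * lam b x * ((a - b) \<bullet> (g x + c *\<^sub>R g' x)) * ((a - b) \<bullet> h x)) =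
       IK (\<lambda>x. lam a x * lam b x * ((a - b) \<bullet> g x) * ((a - b) \<bullet> h x) + c * (lam a x * lam b x * ((a - b) \<bullet> g' x) * ((a
           - b) \<bullet> h x)))"
      by (intro Bochner_Integration.integral_cong refl) (simp add: inner_add_right distrib_left distrib_right)
    also have "\<dots> = IK (\<lambda>x. lam a x * lam b x * ((a - b) \<bullet> g x) * ((a - b) \<bullet> h x)) + IK (\<lambda>x. c * (lam a x * lam b x *
        ((a - b) \<bullet> g' x) * ((a - b) \<bullet> h x)))"
      by (intro Bochner_Integration.integral_add integrable_K continuous_intros assms)
    finally show ?thesis by simp
  qed
  then show ?thesis by (simp add: Bform_def sum.distrib sum_distrib_left add_divide_distrib)
qed

lemma Bform_nonneg: "Bform g g \<ge> 0"
proof -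
  have "0 \<le> IK (\<lambda>x. lam a x * lam b x * ((a - b) \<bullet> g x) * ((a - b) \<bullet> g x))" for a b
    by (rule integral_nonneg_AE) (auto intro!: AE_I2 simp: lam_nonneg mult.assoc)
  then show ?thesis by (simp add: Bform_def sum_nonneg)
qed

lemma Bform_add_square:
  assumes "continuous_on UNIV g" "continuous_on UNIV h"
  shows "Bform (\<lambda>x. g x + c *\<^sub>R h x) (\<lambda>x. g x + c *\<^sub>R h x) = Bform g g + 2 * c * Bform g h + c\<^sup>2 * Bform h h"
proof -
  have s: "continuous_on UNIV (\<lambda>x. g x + c *\<^sub>R h x)" by (intro continuous_intros assms)
  have "Bform (\<lambda>x. g x + c *\<^sub>R h x) (\<lambda>x. g x + c *\<^sub>R h x) = Bform g (\<lambda>x. g x + c *\<^sub>R h x) + c * Bform h (\<lambda>x. g x + c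
      *\<^sub>R h x)"
    by (rule Bform_add[OF assms s])
  also have "Bform g (\<lambda>x. g x + c *\<^sub>R h x) = Bform g g + c * Bform h g"
    by (subst Bform_sym) (rule Bform_add[OF assms assms(1)])
  also have "Bform h (\<lambda>x. g x + c *\<^sub>R h x) = Bform g h + c * Bform h h"
    by (subst Bform_sym) (rule Bform_add[OF assms assms(2)])
  finally show ?thesis by (simp add: Bform_sym[of h g] power2_eq_square algebra_simps)
qed

text \<open>The pointwise density of \<open>Bform\<close> is the variance of \<open>a \<bullet> \<xi>\<close> when the vertex \<open>a\<close> is drawn
  with probability \<open>lam a x\<close>; a variable with range of length \<open>h\<close> has variance at most \<open>h\<^sup>2/4\<close>.\<close>
lemma variance_bound:
  assumes "x \<in> K"
  shows "(\<Sum>a\<in>V. \<Sum>b\<in>V. lam a x * lam b x * ((a - b) \<bullet> \<xi>)\<^sup>2) / 2 \<le> (diameter K)\<^sup>2 / 4 * (norm \<xi>)\<^sup>2"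
proof -
  define A where "A = (\<lambda>a. a \<bullet> \<xi>)"
  define hi where "hi = Max (A ` V)"
  define lo where "lo = Min (A ` V)"
  \<comment> \<open>The variance is at most the second moment about any point; the midpoint of the
    range gives a quarter of the squared length.\<close>
  define m where "m = (hi + lo) / 2"
  have ne: "V \<noteq> {}" using card_V by auto
  have bnd: "lo \<le> A a" "A a \<le> hi" if "a \<in> V" for a using that fin by (auto simp: hi_def lo_def)
  have nn: "lam a x \<ge> 0" for a using lam_nonneg[OF assms] .
  have "hi \<in> A ` V" "lo \<in> A ` V" using ne fin by (auto simp: hi_def lo_def)
  then obtain a b where ab: "a \<in> V" "b \<in> V" "hi = A a" "lo = A b" by blast
  have "hi - lo = (a - b) \<bullet> \<xi>" by (simp add: ab A_def inner_diff_left)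
  also have "\<dots> \<le> norm (a - b) * norm \<xi>" by (rule norm_cauchy_schwarz)
  also have "\<dots> \<le> diameter K * norm \<xi>" using diameter_bound ab V_subset_K by (intro mult_right_mono) auto
  finally have hl: "hi - lo \<le> diameter K * norm \<xi>" .
  have hl0: "hi - lo \<ge> 0" using bnd[OF ab(1)] by simp
  have "(\<Sum>a\<in>V. \<Sum>b\<in>V. lam a x * lam b x * ((a - b) \<bullet> \<xi>)\<^sup>2) / 2 \<le> (\<Sum>a\<in>V. lam a x * (A a - m)\<^sup>2)"
  proof -
    define p where "p = (\<lambda>a. A a - m)"
    have "(\<Sum>a\<in>V. \<Sum>b\<in>V. lam a x * lam b x * ((a - b) \<bullet> \<xi>)\<^sup>2) =
        (\<Sum>a\<in>V. \<Sum>b\<in>V. lam b x * (lam a x * (p a)\<^sup>2) + lam a x * (lam b x * (p b)\<^sup>2) - 2 * ((lam a x * p a) * (lam b x *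
            p b)))"
      by (intro sum.cong refl) (simp add: p_def A_def inner_diff_left power2_eq_square algebra_simps)
    also have "\<dots> = 2 * (\<Sum>a\<in>V. lam a x * (p a)\<^sup>2) - 2 * (\<Sum>a\<in>V. lam a x * p a)\<^sup>2"
      by (simp add: sum.distrib sum_subtractf sum_distrib_left[symmetric] sum_distrib_right[symmetric] lam_sum
          power2_eq_square)
    finally show ?thesis by (simp add: p_def)
  qed
  also have "\<dots> \<le> (\<Sum>a\<in>V. lam a x * ((hi - lo) / 2)\<^sup>2)"
  proof (intro sum_mono mult_left_mono nn)
    fix a assume "a \<in> V"
    then have "\<bar>A a - m\<bar> \<le> (hi - lo) / 2" using bnd[of a] by (auto simp: m_def abs_le_iff field_simps)
    then have "\<bar>A a - m\<bar>\<^sup>2 \<le> ((hi - lo) / 2)\<^sup>2" by (intro power_mono) auto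
    then show "(A a - m)\<^sup>2 \<le> ((hi - lo) / 2)\<^sup>2" by simp
  qed
  also have "\<dots> = (hi - lo)\<^sup>2 / 4" unfolding sum_distrib_right[symmetric] lam_sum by (simp add: power_divide)
  also have "\<dots> \<le> (diameter K * norm \<xi>)\<^sup>2 / 4" using hl hl0 by (intro divide_right_mono power_mono) auto
  finally show ?thesis by (simp add: power_mult_distrib)
qed

lemma Bform_le:
  assumes g: "continuous_on UNIV g"
  shows "Bform g g \<le> (diameter K)\<^sup>2 / 4 * IK (\<lambda>x. (norm (g x))\<^sup>2)"
proof -
  have "Bform g g = IK (\<lambda>x. (\<Sum>a\<in>V. \<Sum>b\<in>V. lam a x * lam b x * ((a - b) \<bullet> g x) * ((a - b) \<bullet> g x)) / 2)"
    unfolding Bform_def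
    by (simp, subst Bochner_Integration.integral_sum,
        (auto intro!: integrable_K continuous_intros g Bochner_Integration.integrable_sum
            Bochner_Integration.integral_sum[symmetric] sum.cong)[2])
  also have "\<dots> \<le> IK (\<lambda>x. (diameter K)\<^sup>2 / 4 * (norm (g x))\<^sup>2)"
  proof (rule integral_mono)
    fix x assume "x \<in> space (lebesgue_on K)"
    then show "(\<Sum>a\<in>V. \<Sum>b\<in>V. lam a x * lam b x * ((a - b) \<bullet> g x) * ((a - b) \<bullet> g x)) / 2 \<le> (diameter K)\<^sup>2 / 4 * (norm (g
        x))\<^sup>2"
      using variance_bound[of x "g x"] by (simp add: power2_eq_square mult.assoc)
  qed (intro integrable_K continuous_intros g; simp)+
  finally show ?thesis by simp
qed

lemma pol_lam_mult: "pol n f \<Longrightarrow> pol (Suc n) (\<lambda>x. lam a x * f x)"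
proof -
  assume "pol n f"
  then have "pol (Suc n) (\<lambda>x. (lam a 0 + x \<bullet> dlam a) * f x)" by (rule pol_mult_affine)
  then show ?thesis by (rule pol_cong) (simp only: lam_inner[symmetric])
qed

text \<open>The operator \<open>L\<close> generated by \<open>Bform\<close>: it preserves the degree and acts on the top degree part of
  a polynomial of degree \<open>m\<close> as \<open>-m(m+d)\<close>.\<close>
lemma Bform_operator:
  assumes q: "pol (Suc m) q"
  shows "\<exists>gq Lq. C1_grad q gq \<and> pol (Suc m) Lq \<and>
    pol m (\<lambda>x. Lq x + real m * (real m + real DIM('a)) * q x) \<and>
    (\<forall>v gv. C1_grad v gv \<longrightarrow> Bform gv gq = - IK (\<lambda>x. v x * Lq x))"
proof -
  obtain g H k where D: "\<forall>x. (q has_derivative (\<lambda>h. h \<bullet> g x)) (at x)"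
     "\<forall>x e. ((\<lambda>y. e \<bullet> g y) has_derivative k x e) (at x) \<and> k x e e = H x e"
     "\<forall>e. pol (Suc m - 1) (\<lambda>x. e \<bullet> g x)" "\<forall>e. pol (Suc m - 2) (\<lambda>x. H x e)"
     "pol (Suc m - 1) (\<lambda>x. x \<bullet> g x - (real (Suc m) - 1) * q x)"
     "pol (Suc m - 1) (\<lambda>x. H x x - (real (Suc m) - 1) * (real (Suc m) - 2) * q x)"
    using pol_derivatives[OF q] by blast
  have idx: "Suc m - 1 = m" "Suc m - 2 = m - 1" "real (Suc m) - 1 = real m" "real (Suc m) - 2 = real m - 1" by auto
  note D = D[unfolded idx]
  have der: "(q has_derivative (\<lambda>h. h \<bullet> g x)) (at x)"
    and k: "((\<lambda>y. e \<bullet> g y) has_derivative k x e) (at x)" "k x e e = H x e"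
    and pg: "pol m (\<lambda>x. e \<bullet> g x)" and pH: "pol (m - 1) (\<lambda>x. H x e)" for x e
    using D(1-4) by auto
  note eu1 = D(5) and eu2 = D(6)
  have cg: "continuous_on UNIV (\<lambda>x. e \<bullet> g x)" for e using pg pol_continuous by blast
  have cgv: "continuous_on UNIV g"
    by (subst continuous_on_componentwise) (use cg in \<open>simp add: inner_commute\<close>)
  have cH: "continuous_on UNIV (\<lambda>x. H x e)" for e using pH pol_continuous by blast
  have C1q: "C1_grad q g" using der cgv by (simp add: C1_grad_def)
  have klin: "linear (k x e)" for x e using has_derivative_linear[OF k(1)] .
  \<comment> \<open>Linearity in \<open>e\<close> follows from uniqueness of derivatives. With the
    linearity of each derivative it makes \<open>k x\<close> bilinear, so it can be expanded over
    the vertices.\<close>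
  have kadd: "k x (c *\<^sub>R e + c' *\<^sub>R e') h = c * k x e h + c' * k x e' h" for x c c' e e' h
  proof -
    have "((\<lambda>y. c * (e \<bullet> g y) + c' * (e' \<bullet> g y)) has_derivative (\<lambda>h. c * k x e h + c' * k x e' h)) (at x)"
      by (intro has_derivative_add has_derivative_mult_right k)
    then have "((\<lambda>y. (c *\<^sub>R e + c' *\<^sub>R e') \<bullet> g y) has_derivative (\<lambda>h. c * k x e h + c' * k x e' h)) (at x)"
      by (simp add: inner_add_left)
    from has_derivative_unique[OF k(1) this] show ?thesis by (rule fun_cong)
  qed
  have ksum: "k x (\<Sum>a\<in>V. c a *\<^sub>R a) h = (\<Sum>a\<in>V. c a * k x a h)" for x c h
  proof -
    have "k x (\<Sum>a\<in>I. c a *\<^sub>R a) h = (\<Sum>a\<in>I. c a * k x a h)" if "finite I" for I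
      using that
    proof (induction I rule: finite_induct)
      case empty
      have "k x (0 *\<^sub>R 0 + 0 *\<^sub>R 0) h = 0 * k x 0 h + 0 * k x 0 h" by (rule kadd)
      then show ?case by simp
    next
      case (insert a I)
      then show ?case using kadd[of x "c a" a 1 "\<Sum>a\<in>I. c a *\<^sub>R a" h] by simp
    qed
    then show ?thesis using fin by blast
  qed
  have ksum2: "k x h (\<Sum>a\<in>V. c a *\<^sub>R a) = (\<Sum>a\<in>V. c a * k x h a)" for x c h
    using linear_sum[OF klin, of x h "\<lambda>a. c a *\<^sub>R a" V] linear_cmul[OF klin] by simp
  have kdiff: "k x (a - b) (a - b) = k x a a + k x b b - k x a b - k x b a" for x a b
  proof -
    have "k x (a - b) h = k x a h - k x b h" for h using kadd[of x 1 a "-1" b h] by simp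
    then show ?thesis using linear_diff[OF klin] by simp
  qed
  define s where "s = (\<Sum>a\<in>V. a)"
  \<comment> \<open>Collapsed form of the sum over pairs in \<open>Lq_eq\<close>: the
    \<open>lam a x\<close> are weights with sum 1 and barycentre \<open>x\<close>. In top degree
    \<open>m\<close>, the term \<open>- H x x\<close> contributes \<open>- m * (m - 1)\<close> and
    the last term \<open>- (d + 1) * m\<close>, together \<open>- m * (m + d)\<close>; the other two
    terms have lower degree.\<close>
  define Lq where "Lq = (\<lambda>x. (\<Sum>a\<in>V. lam a x * H x a) - H x x + s \<bullet> g x - (real DIM('a) + 1) * (x \<bullet> g x))"
  have Lq_eq: "(\<Sum>a\<in>V. \<Sum>b\<in>V. (lam b x - lam a x) * ((a - b) \<bullet> g x) + lam a x * lam b x * H x (a - b)) / 2 = Lq x" for x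
  proof -
    define G where "G = (\<lambda>a. a \<bullet> g x)"
    have sx: "(\<Sum>a\<in>V. lam a x * G a) = x \<bullet> g x"
    proof -
      have "x \<bullet> g x = (\<Sum>a\<in>V. lam a x *\<^sub>R a) \<bullet> g x" by (simp add: lam_repr)
      then show ?thesis by (simp add: inner_sum_left G_def)
    qed
    have sG: "(\<Sum>a\<in>V. G a) = s \<bullet> g x" by (simp add: G_def s_def inner_sum_left)
    have cardV: "real (card V) = real DIM('a) + 1" by (simp add: card_V)
    have 1: "(\<Sum>a\<in>V. \<Sum>b\<in>V. (lam b x - lam a x) * ((a - b) \<bullet> g x)) = 2 * (s \<bullet> g x - (real DIM('a) + 1) * (x \<bullet> g x))"
    proof -
      have "(\<Sum>a\<in>V. \<Sum>b\<in>V. (lam b x - lam a x) * ((a - b) \<bullet> g x)) =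
          (\<Sum>a\<in>V. \<Sum>b\<in>V. lam b x * G a - lam b x * G b - lam a x * G a + lam a x * G b)"
        by (intro sum.cong refl) (simp add: G_def inner_diff_left algebra_simps)
      also have "\<dots> = (\<Sum>a\<in>V. (\<Sum>b\<in>V. lam b x) * G a - (\<Sum>b\<in>V. lam b x * G b) - real (card V) * (lam a x * G a) + lam a x *
          (\<Sum>b\<in>V. G b))"
        by (simp add: sum.distrib sum_subtractf sum_distrib_left sum_distrib_right)
      also have "\<dots> = (\<Sum>a\<in>V. G a) - real (card V) * (\<Sum>b\<in>V. lam b x * G b) - real (card V) * (\<Sum>a\<in>V. lam a x * G a) +
          (\<Sum>a\<in>V. lam a x) * (\<Sum>b\<in>V. G b)"
        by (simp add: sum.distrib sum_subtractf sum_distrib_left[symmetric] sum_distrib_right[symmetric] lam_sum)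
      also have "\<dots> = 2 * (s \<bullet> g x - (real DIM('a) + 1) * (x \<bullet> g x))" unfolding lam_sum sx sG cardV by (simp add:
          algebra_simps)
      finally show ?thesis .
    qed
    have kx: "k x x x = (\<Sum>a\<in>V. \<Sum>b\<in>V. lam a x * lam b x * k x a b)"
    proof -
      have "k x x x = k x (\<Sum>a\<in>V. lam a x *\<^sub>R a) (\<Sum>a\<in>V. lam a x *\<^sub>R a)" by (simp add: lam_repr)
      also have "\<dots> = (\<Sum>a\<in>V. lam a x * (\<Sum>b\<in>V. lam b x * k x a b))" by (subst ksum) (simp only: ksum2)
      finally show ?thesis by (simp add: sum_distrib_left mult.assoc)
    qed
    have 2: "(\<Sum>a\<in>V. \<Sum>b\<in>V. lam a x * lam b x * H x (a - b)) = 2 * ((\<Sum>a\<in>V. lam a x * H x a) - H x x)"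
    proof -
      have "(\<Sum>a\<in>V. \<Sum>b\<in>V. lam a x * lam b x * H x (a - b)) = (\<Sum>a\<in>V. \<Sum>b\<in>V. lam b x * (lam a x * H x a) + lam a x * (lam b
          x * H x b)
           - lam a x * lam b x * k x a b - lam b x * lam a x * k x b a)"
        by (intro sum.cong refl) (simp add: k(2)[symmetric] kdiff algebra_simps)
      also have "\<dots> = (\<Sum>b\<in>V. lam b x) * (\<Sum>a\<in>V. lam a x * H x a) + (\<Sum>a\<in>V. lam a x) * (\<Sum>b\<in>V. lam b x * H x b)
          - (\<Sum>a\<in>V. \<Sum>b\<in>V. lam a x * lam b x * k x a b) - (\<Sum>a\<in>V. \<Sum>b\<in>V. lam b x * lam a x * k x b a)"
        by (simp add: sum.distrib sum_subtractf sum_distrib_left[symmetric] sum_distrib_right[symmetric] lam_sum)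
      also have "(\<Sum>a\<in>V. \<Sum>b\<in>V. lam b x * lam a x * k x b a) = (\<Sum>a\<in>V. \<Sum>b\<in>V. lam a x * lam b x * k x a b)" by (rule
          sum.swap)
      finally show ?thesis by (simp add: lam_sum kx[symmetric] k(2))
    qed
    show ?thesis unfolding Lq_def sum.distrib 1 2 by simp
  qed
  have top: "pol m (\<lambda>x. Lq x + real m * (real m + real DIM('a)) * q x)"
  proof -
    have lamH: "pol m (\<lambda>x. lam a x * H x a)" for a
    proof (cases m)
      case 0
      have "H x a = 0" for x using pol_0D[OF pH] 0 by simp
      then show ?thesis by (simp add: pol_zero)
    next
      case (Suc j)
      then show ?thesis using pol_lam_mult[OF pH] by simp
    qed
    have "pol m (\<lambda>x. (\<Sum>a\<in>V. lam a x * H x a) - (H x x - real m * (real m - 1) * q x) + s \<bullet> g x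
        - (real DIM('a) + 1) * (x \<bullet> g x - real m * q x))"
      by (intro pol_diff pol_add pol_sum pol_scale lamH eu1 eu2 pg)
    then show ?thesis by (rule pol_cong) (simp add: Lq_def algebra_simps)
  qed
  have pL: "pol (Suc m) Lq"
    using pol_diff[OF pol_mono[OF top] pol_scale[OF q, of "real m * (real m + real DIM('a))"]] by simp
  have parts: "Bform gv g = - IK (\<lambda>x. v x * Lq x)" if v: "C1_grad v gv" for v gv
  proof -
    note cv = C1_grad_continuous[OF v] and cgv' = C1_gradD(2)[OF v]
    \<comment> \<open>The chord identity for the product of \<open>v\<close> and the derivative of
      \<open>q\<close> along \<open>a - b\<close>.\<close>
    have one: "IK (\<lambda>x. lam a x * lam b x * ((a - b) \<bullet> gv x) * ((a - b) \<bullet> g x)) =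
       - IK (\<lambda>x. v x * ((lam b x - lam a x) * ((a - b) \<bullet> g x) + lam a x * lam b x * H x (a - b)))"
      if ab: "a \<in> V" "b \<in> V" for a b
    proof (cases "a = b")
      case True
      have "H x 0 = 0" for x using linear_0[OF klin] k(2)[of x 0] by simp
      then show ?thesis using True by simp
    next
      case False
      define e where "e = a - b"
      have d: "((\<lambda>x. v x * (e \<bullet> g x)) has_derivative (\<lambda>h. v x * k x e h + (h \<bullet> gv x) * (e \<bullet> g x))) (at x)" for x
        by (intro has_derivative_mult C1_gradD(1)[OF v] k)
      have "0 = IK (\<lambda>x. (lam b x - lam a x) * (v x * (e \<bullet> g x)) + lam a x * lam b x * (v x * k x e (a - b) + ((a - b) \<bullet>
          gv x) * (e \<bullet> g x)))"
        by (rule chord_integral_eq_0[OF ab False d, symmetric])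
          (unfold e_def[symmetric] k(2), intro continuous_intros cv cg cH cgv')
      also have "\<dots> = IK (\<lambda>x. v x * ((lam b x - lam a x) * (e \<bullet> g x) + lam a x * lam b x * H x e) + lam a x * lam b x *
          (e \<bullet> gv x) * (e \<bullet> g x))"
        by (intro Bochner_Integration.integral_cong refl) (simp add: e_def[symmetric] k(2) algebra_simps)
      also have "\<dots> = IK (\<lambda>x. v x * ((lam b x - lam a x) * (e \<bullet> g x) + lam a x * lam b x * H x e)) + IK (\<lambda>x. lam a x *
          lam b x * (e \<bullet> gv x) * (e \<bullet> g x))"
        by (intro Bochner_Integration.integral_add integrable_K continuous_intros cv cg cH cgv')
      finally show ?thesis by (simp add: e_def)
    qed
    have "Bform gv g = (\<Sum>a\<in>V. \<Sum>b\<in>V. - IK (\<lambda>x. v x * ((lam b x - lam a x) * ((a - b) \<bullet> g x) + lam a x * lam b x * H x (a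
        - b)))) / 2"
      unfolding Bform_def using one by simp
    also have "\<dots> = - ((\<Sum>a\<in>V. \<Sum>b\<in>V. IK (\<lambda>x. v x * ((lam b x - lam a x) * ((a - b) \<bullet> g x) + lam a x * lam b x * H x (a -
        b)))) / 2)"
      by (simp add: sum_negf)
    also have "(\<Sum>a\<in>V. \<Sum>b\<in>V. IK (\<lambda>x. v x * ((lam b x - lam a x) * ((a - b) \<bullet> g x) + lam a x * lam b x * H x (a - b)))) =
       (\<Sum>a\<in>V. IK (\<lambda>x. \<Sum>b\<in>V. v x * ((lam b x - lam a x) * ((a - b) \<bullet> g x) + lam a x * lam b x * H x (a - b))))"
      by (intro sum.cong refl Bochner_Integration.integral_sum[symmetric] integrable_K continuous_intros cv cg cH)
    also have "\<dots> = IK (\<lambda>x. \<Sum>a\<in>V. \<Sum>b\<in>V. v x * ((lam b x - lam a x) * ((a - b) \<bullet> g x) + lam a x * lam b x * H x (a - b)))"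
      by (intro Bochner_Integration.integral_sum[symmetric] integrable_K continuous_intros cv cg cH)
    also have "\<dots> / 2 = IK (\<lambda>x. (\<Sum>a\<in>V. \<Sum>b\<in>V. v x * ((lam b x - lam a x) * ((a - b) \<bullet> g x) + lam a x * lam b x * H x (a -
        b))) / 2)"
      by simp
    also have "\<dots> = IK (\<lambda>x. v x * Lq x)"
      by (intro Bochner_Integration.integral_cong refl) (simp add: Lq_eq[symmetric] sum_distrib_left)
    finally show ?thesis .
  qed
  show ?thesis using C1q pL top parts by blast
qed

lemma K_projection:
  assumes f: "sqi (lebesgue_on K) f"
  shows "\<exists>r. pol n r \<and> (\<forall>s. pol n s \<longrightarrow> IK (\<lambda>x. (f x - r x) * s x) = 0)"
proof -
  let ?S = "{f :: 'a \<Rightarrow> real. sqi (lebesgue_on K) f}"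
  have m: "sqi (lebesgue_on K) (monomial cs)" if "cs \<in> mono_index n" for cs
    using that pol_monomial[of cs n] by (intro sqi_K pol_continuous) (auto simp: mono_index_def)
  have "\<exists>c. (\<lambda>x. f x - (\<Sum>cs\<in>mono_index n. c cs * monomial cs x)) \<in> ?S \<and>
      (\<forall>cs\<in>mono_index n. IK (\<lambda>x. (f x - (\<Sum>cs\<in>mono_index n. c cs * monomial cs x)) * monomial cs x) = 0)"
  proof (rule projection_exists[where S = ?S and \<beta> = "\<lambda>f g. IK (\<lambda>x. f x * g x)"])
    fix f g h :: "'a \<Rightarrow> real" and c assume *: "f \<in> ?S" "g \<in> ?S"
    show "(\<lambda>x. f x + c * g x) \<in> ?S" using sqi_add[of "lebesgue_on K" f] sqi_scale[of "lebesgue_on K" g c] * by simp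
    assume "h \<in> ?S"
    then have "integrable (lebesgue_on K) (\<lambda>x. f x * h x)" "integrable (lebesgue_on K) (\<lambda>x. g x * h x)"
      using * sqi_mult_integrable by auto
    then have "IK (\<lambda>x. f x * h x + c * (g x * h x)) = IK (\<lambda>x. f x * h x) + c * IK (\<lambda>x. g x * h x)" by simp
    moreover have "IK (\<lambda>x. (f x + c * g x) * h x) = IK (\<lambda>x. f x * h x + c * (g x * h x))"
      by (intro Bochner_Integration.integral_cong refl) (simp add: algebra_simps)
    ultimately show "IK (\<lambda>x. (f x + c * g x) * h x) = IK (\<lambda>x. f x * h x) + c * IK (\<lambda>x. g x * h x)" by simp
  qed (use f m finite_mono_index in \<open>auto simp: mult.commute\<close>)
  then obtain c where c: "sqi (lebesgue_on K) (\<lambda>x. f x - (\<Sum>cs\<in>mono_index n. c cs * monomial cs x))"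
    "\<And>cs. cs \<in> mono_index n \<Longrightarrow> IK (\<lambda>x. (f x - (\<Sum>cs\<in>mono_index n. c cs * monomial cs x)) * monomial cs x) = 0" by auto
  define r where "r = (\<lambda>x. \<Sum>cs\<in>mono_index n. c cs * monomial cs x)"
  have "pol n r" unfolding r_def by (intro pol_sum pol_scale pol_monomial) (auto simp: mono_index_def)
  moreover have "IK (\<lambda>x. (f x - r x) * s x) = 0" if ps: "pol n s" for s
  proof -
    obtain c' where s: "\<And>x. s x = (\<Sum>cs\<in>mono_index n. c' cs * monomial cs x)" using pol_span[OF ps] by blast
    have "IK (\<lambda>x. (f x - r x) * s x) = IK (\<lambda>x. \<Sum>cs\<in>mono_index n. c' cs * ((f x - r x) * monomial cs x))"
      unfolding s by (intro Bochner_Integration.integral_cong refl) (simp add: sum_distrib_left mult.left_commute)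
    also have "\<dots> = (\<Sum>cs\<in>mono_index n. IK (\<lambda>x. c' cs * ((f x - r x) * monomial cs x)))"
      using c(1) m sqi_mult_integrable unfolding r_def
      by (intro Bochner_Integration.integral_sum) auto
    also have "\<dots> = 0" using c(2) by (intro sum.neutral) (simp add: r_def)
    finally show ?thesis .
  qed
  ultimately show ?thesis by blast
qed

lemma IK_add_scaled:
  assumes "sqi (lebesgue_on K) f" "sqi (lebesgue_on K) g" "sqi (lebesgue_on K) h"
  shows "IK (\<lambda>x. (f x + c * g x) * h x) = IK (\<lambda>x. f x * h x) + c * IK (\<lambda>x. g x * h x)"
proof -
  have "IK (\<lambda>x. (f x + c * g x) * h x) = IK (\<lambda>x. f x * h x + c * (g x * h x))"
    by (intro Bochner_Integration.integral_cong refl) (simp add: algebra_simps)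
  then show ?thesis using sqi_mult_integrable[OF assms(1,3)] sqi_mult_integrable[OF assms(2,3)] by simp
qed

lemma IK_square_add:
  assumes "sqi (lebesgue_on K) f" "sqi (lebesgue_on K) g" "IK (\<lambda>x. f x * g x) = 0"
  shows "IK (\<lambda>x. (f x + g x)\<^sup>2) = IK (\<lambda>x. (f x)\<^sup>2) + IK (\<lambda>x. (g x)\<^sup>2)"
proof -
  have "IK (\<lambda>x. (f x + g x)\<^sup>2) = IK (\<lambda>x. (f x * f x + 2 * (f x * g x)) + g x * g x)"
    by (intro Bochner_Integration.integral_cong refl) (simp add: power2_eq_square algebra_simps)
  also have "\<dots> = IK (\<lambda>x. f x * f x) + 2 * IK (\<lambda>x. f x * g x) + IK (\<lambda>x. g x * g x)"
    using sqi_mult_integrable[OF assms(1,1)] sqi_mult_integrable[OF assms(1,2)] sqi_mult_integrable[OF assms(2,2)] by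
        simp
  finally show ?thesis using assms(3) by (simp add: power2_eq_square)
qed

text \<open>The component \<open>w\<close> of degree at most \<open>n\<close> that is orthogonal to
  \<open>pol n\<close> is also \<open>Bform\<close>-orthogonal to the rest, since the operator maps
  \<open>pol n\<close> into itself. On \<open>w\<close> it acts as \<open>- n * (n + d)\<close> up
  to an element of \<open>pol n\<close>, which \<open>w\<close> does not see, and
  \<open>n \<ge> 2\<close> makes this at least the gap. At index 2 the orthogonality forces the norm
  of \<open>q\<close> to vanish.\<close>

lemma spectral_gap_pol:
  assumes "n \<ge> 2" "pol n q" "C1_grad q gq" "\<And>r. pol 2 r \<Longrightarrow> IK (\<lambda>x. q x * r x) = 0"
  shows "2 * (2 + real DIM('a)) * IK (\<lambda>x. (q x)\<^sup>2) \<le> Bform gq gq"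
  using assms
proof (induction n arbitrary: q gq rule: nat_induct_at_least)
  case base
  have "IK (\<lambda>x. (q x)\<^sup>2) = 0" using base(3)[OF base(1)] by (simp add: power2_eq_square)
  then show ?case using Bform_nonneg[of gq] by simp
next
  case (Suc n)
  obtain m where m: "n = Suc m" using Suc.hyps by (cases n) auto
  have sq: "sqi (lebesgue_on K) f" if "pol j f" for j f using sqi_K[OF pol_continuous[OF that]] .
  obtain q0 where q0: "pol n q0" "\<And>s. pol n s \<Longrightarrow> IK (\<lambda>x. (q x - q0 x) * s x) = 0"
    using K_projection[OF sq[OF Suc.prems(1)], of n] by blast
  define w where "w = (\<lambda>x. q x - q0 x)"
  have w: "pol (Suc n) w" unfolding w_def using Suc.prems(1) pol_mono[OF q0(1)] by (intro pol_diff) auto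
  have worth: "IK (\<lambda>x. w x * s x) = 0" if "pol n s" for s using q0(2)[OF that] by (simp add: w_def)
  obtain g0 L0 where g0: "C1_grad q0 g0" "pol (Suc m) L0" "\<And>v gv. C1_grad v gv \<Longrightarrow> Bform gv g0 = - IK (\<lambda>x. v x * L0 x)"
    using Bform_operator[of m q0] q0(1) m by blast
  obtain gw Lw where gw: "C1_grad w gw" "pol n (\<lambda>x. Lw x + real n * (real n + real DIM('a)) * w x)"
     "pol (Suc n) Lw" "\<And>v gv. C1_grad v gv \<Longrightarrow> Bform gv gw = - IK (\<lambda>x. v x * Lw x)"
    using Bform_operator[OF w] by blast
  have "C1_grad (\<lambda>x. q0 x + 1 * w x) (\<lambda>x. g0 x + 1 *\<^sub>R gw x)" by (rule C1_grad_add_scaled[OF g0(1) gw(1)])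
  moreover have "(\<lambda>x. q0 x + 1 * w x) = q" by (auto simp: w_def)
  ultimately have gq: "gq = (\<lambda>x. g0 x + 1 *\<^sub>R gw x)" using C1_grad_unique[OF Suc.prems(2)] by simp
  have "IK (\<lambda>x. q0 x * r x) = 0" if "pol 2 r" for r
  proof -
    have "pol n r" using pol_mono[OF that Suc.hyps] .
    have "IK (\<lambda>x. (q x + (-1) * w x) * r x) = IK (\<lambda>x. q x * r x) + (-1) * IK (\<lambda>x. w x * r x)"
      by (rule IK_add_scaled) (use sq Suc.prems(1) w that in blast)+
    then show ?thesis using Suc.prems(3)[OF that] worth[OF \<open>pol n r\<close>] by (simp add: w_def)
  qed
  then have IH: "2 * (2 + real DIM('a)) * IK (\<lambda>x. (q0 x)\<^sup>2) \<le> Bform g0 g0"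
    using Suc.IH[OF q0(1) g0(1)] by blast
  have B0w: "Bform g0 gw = 0" using g0(3)[OF gw(1)] worth g0(2) m by (simp add: Bform_sym[of g0])
  have Bww: "Bform gw gw = real n * (real n + real DIM('a)) * IK (\<lambda>x. (w x)\<^sup>2)"
  proof -
    define c where "c = real n * (real n + real DIM('a))"
    have "IK (\<lambda>x. (Lw x + c * w x) * w x) = IK (\<lambda>x. Lw x * w x) + c * IK (\<lambda>x. w x * w x)"
      by (rule IK_add_scaled) (use sq gw(3) w in blast)+
    moreover have "IK (\<lambda>x. (Lw x + c * w x) * w x) = 0" using worth[OF gw(2)] by (simp add: c_def mult.commute)
    ultimately show ?thesis using gw(4)[OF gw(1)] by (simp add: c_def power2_eq_square mult.commute)
  qed
  have "2 * (2 + real DIM('a)) \<le> real n * (real n + real DIM('a))"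
    using Suc.hyps by (intro mult_mono) auto
  then have "2 * (2 + real DIM('a)) * IK (\<lambda>x. (w x)\<^sup>2) \<le> Bform gw gw"
    unfolding Bww by (intro mult_right_mono) auto
  moreover have "Bform gq gq = Bform g0 g0 + Bform gw gw"
    unfolding gq Bform_add_square[OF C1_gradD(2)[OF g0(1)] C1_gradD(2)[OF gw(1)]] B0w by simp
  moreover have "IK (\<lambda>x. (q x)\<^sup>2) = IK (\<lambda>x. (q0 x)\<^sup>2) + IK (\<lambda>x. (w x)\<^sup>2)"
    using IK_square_add[OF sq[OF q0(1)] sq[OF w]] worth[OF q0(1)] by (simp add: w_def mult.commute)
  ultimately show ?case using IH by (simp add: distrib_left)
qed

text \<open>Only \<open>v\<close> is approximated, never its gradient. For the projection
  \<open>w\<close> of \<open>v\<close> on \<open>pol n\<close> the polynomial \<open>Lw\<close> is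
  again in \<open>pol n\<close>, so \<open>Bform gv gw = Bform gw gw\<close>; nonnegativity of the
  form then gives \<open>Bform gw gw \<le> Bform gv gv\<close>. Stone-Weierstrass is used for the L2
  distance alone.\<close>

lemma weighted_poincare:
  assumes v: "C1_grad v gv" and orth: "\<And>r. pol 2 r \<Longrightarrow> IK (\<lambda>x. v x * r x) = 0"
  shows "2 * (2 + real DIM('a)) * IK (\<lambda>x. (v x)\<^sup>2) \<le> Bform gv gv"
proof -
  define c where "c = 2 * (2 + real DIM('a))"
  define A where "A = measure (lebesgue_on K) K"
  note cv = C1_grad_continuous[OF v]
  have le: "c * IK (\<lambda>x. (v x)\<^sup>2) \<le> Bform gv gv + c * (\<delta> * A)" if \<delta>: "\<delta> > 0" for \<delta>
  proof -
    obtain P where P: "real_polynomial_function P" "\<And>x. x \<in> K \<Longrightarrow> \<bar>v x - P x\<bar> < sqrt \<delta>"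
      using Stone_Weierstrass_real_polynomial_function[OF K_compact continuous_on_subset[OF cv subset_UNIV], of "sqrt
          \<delta>"] \<delta>
      by (metis real_sqrt_gt_zero)
    obtain n0 where "pol n0 P" using real_polynomial_function_imp_pol[OF P(1)] by blast
    define n where "n = max 2 n0"
    have Pn: "pol n P" using pol_mono[OF \<open>pol n0 P\<close>] by (simp add: n_def)
    have n2: "n \<ge> 2" by (simp add: n_def)
    obtain m where m: "n = Suc m" using n2 by (cases n) auto
    have sq: "sqi (lebesgue_on K) f" if "pol j f" for j f using sqi_K[OF pol_continuous[OF that]] .
    obtain w where w: "pol n w" "\<And>s. pol n s \<Longrightarrow> IK (\<lambda>x. (v x - w x) * s x) = 0"
      using K_projection[OF sqi_K[OF cv], of n] by blast
    define z where "z = (\<lambda>x. v x - w x)"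
    have zorth: "IK (\<lambda>x. z x * s x) = 0" if "pol n s" for s using w(2)[OF that] by (simp add: z_def)
    have sz: "sqi (lebesgue_on K) z" unfolding z_def by (intro sqi_diff sqi_K cv sq[OF w(1)])
    obtain gw Lw where gw: "C1_grad w gw" "pol n Lw" "\<And>v gv. C1_grad v gv \<Longrightarrow> Bform gv gw = - IK (\<lambda>x. v x * Lw x)"
      using Bform_operator[of m w] w(1) m by blast
    have "IK (\<lambda>x. w x * r x) = 0" if "pol 2 r" for r
    proof -
      have "pol n r" using pol_mono[OF that n2] .
      have "IK (\<lambda>x. (v x + (-1) * z x) * r x) = IK (\<lambda>x. v x * r x) + (-1) * IK (\<lambda>x. z x * r x)"
        by (rule IK_add_scaled) (use sqi_K[OF cv] sz sq[OF that] in auto)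
      then show ?thesis using orth[OF that] zorth[OF \<open>pol n r\<close>] by (simp add: z_def)
    qed
    then have gap: "c * IK (\<lambda>x. (w x)\<^sup>2) \<le> Bform gw gw"
      unfolding c_def by (rule spectral_gap_pol[OF n2 w(1) gw(1)])
    have "Bform gv gw = Bform gw gw"
    proof -
      have "IK (\<lambda>x. (w x + 1 * z x) * Lw x) = IK (\<lambda>x. w x * Lw x) + 1 * IK (\<lambda>x. z x * Lw x)"
        by (rule IK_add_scaled) (use sz sq w(1) gw(2) in blast)+
      then have "IK (\<lambda>x. v x * Lw x) = IK (\<lambda>x. w x * Lw x)" using zorth[OF gw(2)] by (simp add: z_def)
      then show ?thesis using gw(3)[OF v] gw(3)[OF gw(1)] by simp
    qed
    moreover have "0 \<le> Bform gv gv + 2 * (-1) * Bform gv gw + (-1)\<^sup>2 * Bform gw gw"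
      unfolding Bform_add_square[OF C1_gradD(2)[OF v] C1_gradD(2)[OF gw(1)], symmetric] by (rule Bform_nonneg)
    ultimately have Bw: "Bform gw gw \<le> Bform gv gv" by simp
    have "IK (\<lambda>x. (z x)\<^sup>2) \<le> \<delta> * A"
    proof -
      have sP: "sqi (lebesgue_on K) (\<lambda>x. w x - P x)" using sqi_diff sq w(1) Pn by blast
      have "IK (\<lambda>x. z x * (w x - P x)) = 0" using zorth[OF pol_diff[OF w(1) Pn]] .
      from IK_square_add[OF sz sP this]
      have "IK (\<lambda>x. (z x)\<^sup>2) \<le> IK (\<lambda>x. (z x + (w x - P x))\<^sup>2)" by simp
      also have "\<dots> = IK (\<lambda>x. (v x - P x)\<^sup>2)" by (simp add: z_def)
      also have "\<dots> \<le> IK (\<lambda>x. \<delta>)"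
      proof (rule integral_mono)
        show "integrable (lebesgue_on K) (\<lambda>x. (v x - P x)\<^sup>2)"
          by (intro integrable_K continuous_intros cv pol_continuous[OF Pn])
        show "integrable (lebesgue_on K) (\<lambda>x. \<delta>)" by (intro integrable_K continuous_intros)
        fix x assume "x \<in> space (lebesgue_on K)"
        then have "\<bar>v x - P x\<bar> < sqrt \<delta>" using P(2) by simp
        then have "\<bar>v x - P x\<bar>\<^sup>2 \<le> (sqrt \<delta>)\<^sup>2" by (intro power_mono) auto
        then show "(v x - P x)\<^sup>2 \<le> \<delta>" using \<delta> by simp
      qed
      finally show ?thesis by (simp add: A_def mult.commute)
    qed
    then have "c * IK (\<lambda>x. (z x)\<^sup>2) \<le> c * (\<delta> * A)" by (intro mult_left_mono) (auto simp: c_def)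
    moreover have "IK (\<lambda>x. (v x)\<^sup>2) = IK (\<lambda>x. (w x)\<^sup>2) + IK (\<lambda>x. (z x)\<^sup>2)"
      using IK_square_add[OF sq[OF w(1)] sz] zorth[OF w(1)] by (simp add: z_def mult.commute)
    ultimately show ?thesis using gap Bw by (simp add: distrib_left)
  qed
  have "((\<lambda>\<delta>. Bform gv gv + c * (\<delta> * A)) \<longlongrightarrow> Bform gv gv + c * (0 * A)) (at_right 0)"
    by (intro tendsto_intros)
  moreover have "\<forall>\<^sub>F \<delta> in at_right 0. c * IK (\<lambda>x. (v x)\<^sup>2) \<le> Bform gv gv + c * (\<delta> * A)"
    using le by (auto simp: eventually_at_right_field intro: exI[of _ 1])
  ultimately have "c * IK (\<lambda>x. (v x)\<^sup>2) \<le> Bform gv gv + c * (0 * A)" by (intro tendsto_lowerbound) auto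
  then show ?thesis by (simp add: c_def)
qed

text \<open>The operator preserves affine functions, so the affine projection \<open>r\<close> of
  \<open>v\<close> is \<open>Bform\<close>-orthogonal to \<open>v - r\<close>. Removing it can only
  lower the form, which allows the gradient of \<open>v\<close> itself on the right-hand
  side.\<close>

lemma poincare_P1:
  assumes v: "C1_grad v gv" and F: "sqi (lebesgue_on K) F" and orth: "\<And>r. pol 2 r \<Longrightarrow> IK (\<lambda>x. F x * r x) = 0"
  shows "\<bar>IK (\<lambda>x. F x * v x)\<bar> \<le> diameter K / pi * sqrt (IK (\<lambda>x. (F x)\<^sup>2)) * sqrt (IK (\<lambda>x. (norm (gv x))\<^sup>2))"
proof -
  note cv = C1_grad_continuous[OF v]
  have h0: "diameter K \<ge> 0" using diameter_ge_0[OF compact_imp_bounded[OF K_compact]] .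
  obtain r where r: "pol 2 r" "\<And>s. pol 2 s \<Longrightarrow> IK (\<lambda>x. (v x - r x) * s x) = 0"
    using K_projection[OF sqi_K[OF cv], of 2] by blast
  obtain gr Lr where gr: "C1_grad r gr" "pol 2 Lr" "\<And>v gv. C1_grad v gv \<Longrightarrow> Bform gv gr = - IK (\<lambda>x. v x * Lr x)"
    using Bform_operator[of 1 r] r(1) by (auto simp: numeral_2_eq_2)
  define z where "z = (\<lambda>x. v x + (-1) * r x)"
  define gz where "gz = (\<lambda>x. gv x + (-1) *\<^sub>R gr x)"
  have z: "C1_grad z gz" unfolding z_def gz_def by (rule C1_grad_add_scaled[OF v gr(1)])
  have zorth: "IK (\<lambda>x. z x * s x) = 0" if "pol 2 s" for s using r(2)[OF that] by (simp add: z_def)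
  have P: "2 * (2 + real DIM('a)) * IK (\<lambda>x. (z x)\<^sup>2) \<le> Bform gz gz" by (rule weighted_poincare[OF z zorth])
  have "Bform gz gr = 0" using gr(3)[OF z] zorth[OF gr(2)] by simp
  moreover have "gv = (\<lambda>x. gz x + 1 *\<^sub>R gr x)" by (simp add: gz_def)
  ultimately have "Bform gv gv = Bform gz gz + Bform gr gr"
    using Bform_add_square[OF C1_gradD(2)[OF z] C1_gradD(2)[OF gr(1)], of 1] by simp
  then have Bz: "Bform gz gz \<le> (diameter K)\<^sup>2 / 4 * IK (\<lambda>x. (norm (gv x))\<^sup>2)"
    using Bform_nonneg[of gr] Bform_le[OF C1_gradD(2)[OF v]] by linarith
  have "pi\<^sup>2 \<le> 4 * 4" unfolding power2_eq_square using pi_less_4 pi_gt_zero by (intro mult_mono) auto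
  then have "pi\<^sup>2 \<le> 8 * (2 + real DIM('a))" by (simp add: Suc_leI)
  then have "pi\<^sup>2 * IK (\<lambda>x. (z x)\<^sup>2) \<le> 8 * (2 + real DIM('a)) * IK (\<lambda>x. (z x)\<^sup>2)"
    by (intro mult_right_mono) auto
  also have "\<dots> \<le> (diameter K)\<^sup>2 * IK (\<lambda>x. (norm (gv x))\<^sup>2)" proof -
    have "8 * (2 + real DIM('a)) * IK (\<lambda>x. (z x)\<^sup>2) = 4 * (2 * (2 + real DIM('a)) * IK (\<lambda>x. (z x)\<^sup>2))" by simp
    then show ?thesis using P Bz by linarith
  qed
  finally have "sqrt (pi\<^sup>2 * IK (\<lambda>x. (z x)\<^sup>2)) \<le> sqrt ((diameter K)\<^sup>2 * IK (\<lambda>x. (norm (gv x))\<^sup>2))"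
    by (rule real_sqrt_le_mono)
  then have nz: "sqrt (IK (\<lambda>x. (z x)\<^sup>2)) \<le> diameter K / pi * sqrt (IK (\<lambda>x. (norm (gv x))\<^sup>2))"
    using h0 by (simp add: real_sqrt_mult field_simps)
  have sz: "sqi (lebesgue_on K) z" by (rule sqi_K[OF C1_grad_continuous[OF z]])
  have "IK (\<lambda>x. (z x + 1 * r x) * F x) = IK (\<lambda>x. z x * F x) + 1 * IK (\<lambda>x. r x * F x)"
    by (rule IK_add_scaled) (use sz F sqi_K[OF pol_continuous[OF r(1)]] in auto)
  then have "IK (\<lambda>x. F x * v x) = IK (\<lambda>x. F x * z x)" using orth[OF r(1)] by (simp add: z_def mult.commute)
  also have "\<bar>\<dots>\<bar> \<le> sqrt (IK (\<lambda>x. (F x)\<^sup>2)) * sqrt (IK (\<lambda>x. (z x)\<^sup>2))" by (rule sqi_Cauchy_Schwarz_real[OF F sz])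
  also have "\<dots> \<le> sqrt (IK (\<lambda>x. (F x)\<^sup>2)) * (diameter K / pi * sqrt (IK (\<lambda>x. (norm (gv x))\<^sup>2)))"
    using nz by (intro mult_left_mono) auto
  finally show ?thesis by (simp add: mult.assoc mult.left_commute)
qed

end

section \<open>Test functions and weak gradients\<close>

lemma smooth_fun_differentiable: "smooth_fun f \<Longrightarrow> f differentiable (at x)"
  unfolding smooth_fun_def by (drule spec[of _ "[]"]) (simp add: iter_partial_def)

lemma smooth_fun_partial:
  fixes f :: "'a::euclidean_space \<Rightarrow> real"
  assumes f: "smooth_fun f" and b: "b \<in> Basis" shows "smooth_fun (partial b f)"
  unfolding smooth_fun_def
proof (intro allI impI)
  fix bs :: "'a list" and x assume bs: "set bs \<subseteq> Basis"
  have "iter_partial bs (partial b f) = iter_partial (bs @ [b]) f" by (simp add: iter_partial_def)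
  then show "iter_partial bs (partial b f) differentiable at x" using f b bs unfolding smooth_fun_def by simp
qed

lemma grad_inner: assumes "f differentiable (at x)" shows "(f has_derivative (\<lambda>h. h \<bullet> grad f x)) (at x)"
proof -
  have d: "(f has_derivative frechet_derivative f (at x)) (at x)" using assms frechet_derivative_works by blast
  have "frechet_derivative f (at x) h = h \<bullet> grad f x" for h
  proof -
    have "frechet_derivative f (at x) h = frechet_derivative f (at x) (\<Sum>b\<in>Basis. (h \<bullet> b) *\<^sub>R b)"
      by (simp add: euclidean_representation)
    also have "\<dots> = (\<Sum>b\<in>Basis. (h \<bullet> b) * frechet_derivative f (at x) b)"
      using has_derivative_linear[OF d] by (simp add: linear_sum linear_cmul)
    finally show ?thesis by (simp add: grad_def partial_def inner_sum_right mult.commute)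
  qed
  then have "frechet_derivative f (at x) = (\<lambda>h. h \<bullet> grad f x)" by blast
  then show ?thesis using d by simp
qed

lemma smooth_fun_C1: assumes "smooth_fun f" shows "C1_grad f (grad f)"
proof -
  have "continuous_on UNIV (partial b f)" if "b \<in> Basis" for b
    using smooth_fun_differentiable[OF smooth_fun_partial[OF assms that]]
    by (meson continuous_at_imp_continuous_on differentiable_imp_continuous_within)
  then have "continuous_on UNIV (grad f)" unfolding grad_def by (intro continuous_intros)
  then show ?thesis using grad_inner[OF smooth_fun_differentiable[OF assms]] by (simp add: C1_grad_def)
qed

lemma smooth_fun_add_scaled:
  assumes f: "smooth_fun f" and g: "smooth_fun g" shows "smooth_fun (\<lambda>x. f x + c * g x)"
proof -
  have "iter_partial bs (\<lambda>x. f x + c * g x) = (\<lambda>x. iter_partial bs f x + c * iter_partial bs g x) "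
    if "set bs \<subseteq> Basis" for bs
    using that
  proof (induction bs)
    case Nil
    then show ?case by (simp add: iter_partial_def)
  next
    case (Cons b bs)
    have eq: "iter_partial (b # bs) h = partial b (iter_partial bs h)" for h by (simp add: iter_partial_def)
    have d: "iter_partial bs f differentiable at x" "iter_partial bs g differentiable at x" for x
      using f g Cons.prems by (auto simp: smooth_fun_def)
    show ?case unfolding eq
    proof
      fix x
      have "((\<lambda>x. iter_partial bs f x + c * iter_partial bs g x) has_derivative
         (\<lambda>h. frechet_derivative (iter_partial bs f) (at x) h + c * frechet_derivative (iter_partial bs g) (at x) h))
             (at x)"
        by (intro has_derivative_add has_derivative_mult_right) (use d frechet_derivative_works in blast)+
      from frechet_derivative_at[OF this, symmetric]
      show "partial b (iter_partial bs (\<lambda>x. f x + c * g x)) x = partial b (iter_partial bs f) x + c * partial b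
          (iter_partial bs g) x"
        using Cons by (simp add: partial_def)
    qed
  qed
  then show ?thesis using f g unfolding smooth_fun_def by (auto intro!: derivative_intros)
qed

text \<open>The polynomial factor is carried along because the family is then closed under
  differentiation, also at 0.\<close>

definition flat_exp :: "real poly \<Rightarrow> real \<Rightarrow> real" where
  "flat_exp P t = (if t > 0 then poly P (1 / t) * exp (- (1 / t)) else 0)"

lemma poly_div_exp_tendsto_0: "((\<lambda>x. poly P x / exp x) \<longlongrightarrow> 0) at_top" for P :: "real poly"
proof -
  have "((\<lambda>x. \<Sum>i\<le>degree P. coeff P i * (x ^ i / exp x)) \<longlongrightarrow> (\<Sum>i\<le>degree P. coeff P i * 0)) at_top"
    by (intro tendsto_intros tendsto_power_div_exp_0)
  then show ?thesis by (simp add: poly_altdef sum_divide_distrib)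
qed

lemma flat_exp_DERIV:
  "(flat_exp P has_real_derivative flat_exp ([:0, 0, 1:] * (P - pderiv P)) t) (at t)"
proof -
  consider "t > 0" | "t < 0" | "t = 0" by linarith
  then show ?thesis
  proof cases
    case 1
    have d: "((\<lambda>t. poly P (1 / t)) has_real_derivative poly (pderiv P) (1 / t) * (- (1 / t\<^sup>2))) (at t)"
      using 1 by (intro DERIV_chain2[of "poly P"] poly_DERIV) (auto intro!: derivative_eq_intros simp: power2_eq_square)
    have "((\<lambda>t. poly P (1 / t) * exp (- (1 / t))) has_real_derivative flat_exp ([:0, 0, 1:] * (P - pderiv P)) t) (at t)"
      using 1 by (auto intro!: derivative_eq_intros d simp: flat_exp_def power2_eq_square field_simps)
    then show ?thesis
    proof (rule has_field_derivative_transform_within_open[where S = "{0<..}"])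
      show "poly P (1 / x) * exp (- (1 / x)) = flat_exp P x" if "x \<in> {0<..}" for x using that by (simp add:
          flat_exp_def)
    qed (use 1 in auto)
  next
    case 2
    have "((\<lambda>t. 0) has_real_derivative flat_exp ([:0, 0, 1:] * (P - pderiv P)) t) (at t)"
      using 2 by (simp add: flat_exp_def)
    then show ?thesis
    proof (rule has_field_derivative_transform_within_open[where S = "{..<0}"])
      show "0 = flat_exp P x" if "x \<in> {..<0}" for x using that by (simp add: flat_exp_def)
    qed (use 2 in auto)
  next
    case 3
    have "((\<lambda>h. flat_exp P h / h) \<longlongrightarrow> 0) (at_right 0)"
    proof -
      \<comment> \<open>With \<open>x = 1 / h\<close> the difference quotient at 0 is
        \<open>x * poly P x / exp x\<close>; \<open>pCons 0 P\<close> is the polynomial in the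
        numerator.\<close>
      have "((\<lambda>h. poly (pCons 0 P) (inverse h) / exp (inverse h)) \<longlongrightarrow> 0) (at_right (0::real))"
        by (rule filterlim_compose[OF poly_div_exp_tendsto_0 filterlim_inverse_at_top_right])
      moreover have "\<forall>\<^sub>F h in at_right 0. poly (pCons 0 P) (inverse h) / exp (inverse h) = flat_exp P h / h"
        by (auto simp: eventually_at_right_field flat_exp_def exp_minus field_simps intro!: exI[of _ 1])
      ultimately show ?thesis by (rule Lim_transform_eventually)
    qed
    moreover have "((\<lambda>h. flat_exp P h / h) \<longlongrightarrow> 0) (at_left 0)"
    proof (rule Lim_transform_eventually[OF tendsto_const])
      show "\<forall>\<^sub>F h in at_left 0. 0 = flat_exp P h / h"
        by (auto simp: eventually_at_left_field flat_exp_def intro!: exI[of _ "-1"])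
    qed
    ultimately have "((\<lambda>h. flat_exp P h / h) \<longlongrightarrow> 0) (at 0)" by (simp add: filterlim_at_split)
    then show ?thesis using 3 by (simp add: has_field_derivative_iff flat_exp_def)
  qed
qed

text \<open>\<open>smooth_fun\<close> asks for all iterated partial derivatives. Within a class that
  contains the derivatives of its members it suffices to differentiate once.\<close>

inductive smooth_class :: "('a::euclidean_space \<Rightarrow> real) \<Rightarrow> bool" where
  smooth_class_const: "smooth_class (\<lambda>x. c)"
| smooth_class_base: "smooth_class (\<lambda>x. flat_exp P (x \<bullet> w + m))"
| smooth_class_add: "smooth_class f \<Longrightarrow> smooth_class g \<Longrightarrow> smooth_class (\<lambda>x. f x + g x)"
| smooth_class_mult: "smooth_class f \<Longrightarrow> smooth_class g \<Longrightarrow> smooth_class (\<lambda>x. f x * g x)"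

lemma smooth_class_derivative:
  "smooth_class f \<Longrightarrow> \<exists>f'. (\<forall>x. (f has_derivative f' x) (at x)) \<and> (\<forall>b. smooth_class (\<lambda>x. f' x b))"
proof (induction rule: smooth_class.induct)
  case (smooth_class_const c)
  show ?case by (rule exI[of _ "\<lambda>x h. 0"]) (auto intro: smooth_class.intros)
next
  case (smooth_class_base P w m)
  define P' where "P' = [:0, 0, 1:] * (P - pderiv P)"
  have "((\<lambda>x. flat_exp P (x \<bullet> w + m)) has_derivative (\<lambda>h. (h \<bullet> w) * flat_exp P' (x \<bullet> w + m))) (at x)" for x
    unfolding P'_def
    by (rule DERIV_compose_FDERIV[OF flat_exp_DERIV]) (auto intro!: derivative_eq_intros)
  moreover have "smooth_class (\<lambda>x. (b \<bullet> w) * flat_exp P' (x \<bullet> w + m))" for b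
    by (intro smooth_class.intros)
  ultimately show ?case by (intro exI[of _ "\<lambda>x h. (h \<bullet> w) * flat_exp P' (x \<bullet> w + m)"]) auto
next
  case (smooth_class_add f g)
  then obtain f' g' where "\<forall>x. (f has_derivative f' x) (at x)" "\<forall>b. smooth_class (\<lambda>x. f' x b)"
    "\<forall>x. (g has_derivative g' x) (at x)" "\<forall>b. smooth_class (\<lambda>x. g' x b)" by blast
  then show ?case
    by (intro exI[of _ "\<lambda>x h. f' x h + g' x h"]) (auto intro!: smooth_class.intros has_derivative_add)
next
  case (smooth_class_mult f g)
  then obtain f' g' where *: "\<forall>x. (f has_derivative f' x) (at x)" "\<forall>b. smooth_class (\<lambda>x. f' x b)"
    "\<forall>x. (g has_derivative g' x) (at x)" "\<forall>b. smooth_class (\<lambda>x. g' x b)" by blast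
  then show ?case using smooth_class_mult.hyps
    by (intro exI[of _ "\<lambda>x h. f x * g' x h + f' x h * g x"]) (auto intro!: smooth_class.intros has_derivative_mult)
qed

lemma smooth_class_smooth: assumes "smooth_class f" shows "smooth_fun f"
proof -
  have "smooth_class (iter_partial bs f)" for bs
  proof (induction bs)
    case Nil
    then show ?case using assms by (simp add: iter_partial_def)
  next
    case (Cons b bs)
    obtain f' where f': "\<forall>x. (iter_partial bs f has_derivative f' x) (at x)" "\<forall>b. smooth_class (\<lambda>x. f' x b)"
      using smooth_class_derivative[OF Cons] by blast
    have "iter_partial (b # bs) f = (\<lambda>x. f' x b)"
    proof
      fix x
      have "frechet_derivative (iter_partial bs f) (at x) = f' x"
        using frechet_derivative_at f'(1) by metis
      then show "iter_partial (b # bs) f x = f' x b" by (simp add: iter_partial_def partial_def)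
    qed
    then show ?case using f'(2) by simp
  qed
  then show ?thesis unfolding smooth_fun_def using smooth_class_derivative
    by (meson differentiable_def)
qed

lemma smooth_class_prod: "finite I \<Longrightarrow> (\<And>i. i \<in> I \<Longrightarrow> smooth_class (f i)) \<Longrightarrow> smooth_class (\<lambda>x. \<Prod>i\<in>I. f i x)"
  by (induction I rule: finite_induct) (auto intro: smooth_class.intros)

text \<open>As \<open>n\<close> grows, \<open>flat_exp 1 (real n * t)\<close> tends to 1 for
  \<open>t > 0\<close> and stays 0 otherwise. This gives bounded smooth approximations of the
  indicator of \<open>box l u\<close> with support in a fixed closed box, in place of
  mollification.\<close>

definition bump :: "nat \<Rightarrow> 'a::euclidean_space \<Rightarrow> 'a \<Rightarrow> 'a \<Rightarrow> real" where
  "bump n l u x = (\<Prod>b\<in>Basis. flat_exp 1 (real n * (x \<bullet> b - l \<bullet> b)) * flat_exp 1 (real n * (u \<bullet> b - x \<bullet> b)))"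

lemma flat_exp_1_bounds: "0 \<le> flat_exp 1 t" "flat_exp 1 t \<le> 1" by (auto simp: flat_exp_def)

lemma bump_test_fun:
  assumes "cbox l u \<subseteq> S" shows "test_fun S (bump n l u)"
proof -
  have base: "smooth_class (\<lambda>x. flat_exp 1 (real n * (x \<bullet> b - l \<bullet> b)) * flat_exp 1 (real n * (u \<bullet> b - x \<bullet> b)))" for b
  proof -
    have 1: "real n * (x \<bullet> b - l \<bullet> b) = x \<bullet> (real n *\<^sub>R b) + (- real n * (l \<bullet> b))" for x by (simp add: algebra_simps)
    have 2: "real n * (u \<bullet> b - x \<bullet> b) = x \<bullet> (- real n *\<^sub>R b) + real n * (u \<bullet> b)" for x by (simp add: algebra_simps)
    show ?thesis unfolding 1 2 by (intro smooth_class.intros)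
  qed
  have "smooth_fun (bump n l u)" unfolding bump_def[abs_def]
    by (intro smooth_class_smooth smooth_class_prod base) auto
  moreover have "tsupp (bump n l u) \<subseteq> cbox l u"
    unfolding tsupp_def
  proof (rule closure_minimal)
    show "{x. bump n l u x \<noteq> 0} \<subseteq> cbox l u"
    proof
      fix x assume "x \<in> {x. bump n l u x \<noteq> 0}"
      then have *: "flat_exp 1 (real n * (x \<bullet> b - l \<bullet> b)) \<noteq> 0" "flat_exp 1 (real n * (u \<bullet> b - x \<bullet> b)) \<noteq> 0" if "b \<in>
          Basis" for b
        using that by (auto simp: bump_def prod_zero_iff)
      show "x \<in> cbox l u" unfolding mem_box
      proof
        fix b :: 'a assume "b \<in> Basis"
        from *[OF this] show "l \<bullet> b \<le> x \<bullet> b \<and> x \<bullet> b \<le> u \<bullet> b"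
          by (auto simp: flat_exp_def zero_less_mult_iff split: if_splits)
      qed
    qed
  qed auto
  moreover from this have "compact (tsupp (bump n l u))"
    using bounded_subset[OF bounded_cbox] closed_closure unfolding compact_eq_bounded_closed tsupp_def by blast
  ultimately show ?thesis using assms unfolding test_fun_def by blast
qed

lemma bump_bounds: "0 \<le> bump n l u x" "bump n l u x \<le> 1"
proof -
  show "0 \<le> bump n l u x" unfolding bump_def by (intro prod_nonneg mult_nonneg_nonneg ballI flat_exp_1_bounds)
  show "bump n l u x \<le> 1" unfolding bump_def
    by (intro prod_le_1) (auto intro!: mult_le_one flat_exp_1_bounds mult_nonneg_nonneg)
qed

lemma bump_limit: "(\<lambda>n. bump n l u x) \<longlonglongrightarrow> indicator (box l u) x"
proof -
  have fe: "(\<lambda>n. flat_exp 1 (real n * t)) \<longlonglongrightarrow> (if t > 0 then 1 else 0)" for t :: real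
  proof (cases "t > 0")
    case True
    have "(\<lambda>n. exp (- (inverse (real n) * (1 / t)))) \<longlonglongrightarrow> exp (- (0 * (1 / t)))"
      by (intro tendsto_intros lim_inverse_n)
    moreover have "\<forall>\<^sub>F n in sequentially. exp (- (inverse (real n) * (1 / t))) = flat_exp 1 (real n * t)"
      using eventually_gt_at_top[of 0] by eventually_elim (use True in \<open>auto simp: flat_exp_def field_simps\<close>)
    ultimately have "(\<lambda>n. flat_exp 1 (real n * t)) \<longlonglongrightarrow> exp (- (0 * (1 / t)))" by (rule Lim_transform_eventually)
    then show ?thesis using True by simp
  next
    case False
    then have "flat_exp 1 (real n * t) = 0" for n by (auto simp: flat_exp_def zero_less_mult_iff)
    then show ?thesis using False by simp
  qed
  have "(\<lambda>n. bump n l u x) \<longlonglongrightarrow> (\<Prod>b\<in>Basis. (if x \<bullet> b - l \<bullet> b > 0 then 1 else 0) * (if u \<bullet> b - x \<bullet> b > 0 then 1 else 0))"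
    unfolding bump_def by (intro tendsto_intros fe)
  also have "(\<Prod>b\<in>Basis. (if x \<bullet> b - l \<bullet> b > 0 then 1 else 0) * (if u \<bullet> b - x \<bullet> b > 0 then 1 else 0)) = (indicator (box
      l u) x :: real)"
  proof (cases "x \<in> box l u")
    case True
    then show ?thesis by (auto simp: mem_box intro!: prod.neutral)
  next
    case False
    then obtain b where "b \<in> Basis" "\<not> (l \<bullet> b < x \<bullet> b \<and> x \<bullet> b < u \<bullet> b)" by (auto simp: mem_box)
    then have "(\<Prod>b\<in>Basis. (if x \<bullet> b - l \<bullet> b > 0 then 1 else 0) * (if u \<bullet> b - x \<bullet> b > 0 then 1 else 0)) = (0::real)"
      by (intro prod_zero) (auto intro!: bexI[of _ b])
    then show ?thesis using False by simp
  qed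
  finally show ?thesis .
qed

text \<open>Boxes form an intersection-stable generator of the Borel sets, so the integral of
  \<open>g\<close> vanishes over every Borel set, in particular where \<open>g\<close> is positive
  and where it is negative. The total integral, needed for complements, is the limit over growing
  boxes.\<close>

lemma box_integrals_zero_imp_AE_zero:
  fixes g :: "'a::euclidean_space \<Rightarrow> real"
  assumes int: "integrable lborel g" and box: "\<And>a b. (\<integral>x. indicator (box a b) x * g x \<partial>lborel) = 0"
  shows "AE x in lborel. g x = 0"
proof -
  have [measurable]: "g \<in> borel_measurable borel" using int by auto
  have intA: "integrable lborel (\<lambda>x. indicator A x * g x)" if "A \<in> sets borel" for A
    using integrable_mult_indicator[OF _ int, of A] that by simp
  have total: "(\<integral>x. g x \<partial>lborel) = 0"
  proof -
    have "(\<lambda>n. \<integral>x. indicator (box (- real n *\<^sub>R One) (real n *\<^sub>R One)) x * g x \<partial>lborel) \<longlonglongrightarrow> (\<integral>x. g x \<partial>lborel)"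
    proof (rule integral_dominated_convergence[where w = "\<lambda>x. \<bar>g x\<bar>"])
      show "AE x in lborel. (\<lambda>n. indicator (box (- real n *\<^sub>R One) (real n *\<^sub>R One)) x * g x) \<longlonglongrightarrow> g x"
      proof (rule AE_I2)
        fix x :: 'a
        obtain N :: nat where N: "norm x < real N" using reals_Archimedean2 by blast
        have "\<forall>\<^sub>F n in sequentially. g x = indicator (box (- real n *\<^sub>R One) (real n *\<^sub>R One)) x * g x"
        proof (rule eventually_sequentiallyI[of N])
          fix n assume "N \<le> n"
          have "- real n < x \<bullet> b \<and> x \<bullet> b < real n" if "b \<in> Basis" for b
            using Basis_le_norm[OF that, of x] N \<open>N \<le> n\<close> by (auto simp: abs_le_iff)
          then have "x \<in> box (- real n *\<^sub>R One) (real n *\<^sub>R One)" by (simp add: mem_box)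
          then show "g x = indicator (box (- real n *\<^sub>R One) (real n *\<^sub>R One)) x * g x" by simp
        qed
        then show "(\<lambda>n. indicator (box (- real n *\<^sub>R One) (real n *\<^sub>R One)) x * g x) \<longlonglongrightarrow> g x"
          by (rule Lim_transform_eventually[OF tendsto_const])
      qed
    qed (use int in \<open>auto simp: indicator_def\<close>)
    then show ?thesis using box by (simp add: LIMSEQ_const_iff)
  qed
  have A0: "(\<integral>x. indicator A x * g x \<partial>lborel) = 0" if "A \<in> sets borel" for A
  proof -
    let ?E = "range (\<lambda>(a, b). box a b :: 'a set)"
    have st: "Int_stable ?E"
    proof (rule Int_stableI)
      fix A B :: "'a set" assume "A \<in> ?E" "B \<in> ?E"
      then obtain a b c d where "A = box a b" "B = box c d" by auto
      then show "A \<inter> B \<in> ?E" by (auto simp: box_Int_box)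
    qed
    have "?E \<subseteq> Pow UNIV" "A \<in> sigma_sets UNIV ?E" using that by (simp_all add: borel_eq_box)
    with st show ?thesis
    proof (induction rule: sigma_sets_induct_disjoint)
      case (compl A)
      then have "A \<in> sets borel" by (simp add: borel_eq_box)
      have "(\<integral>x. indicator (UNIV - A) x * g x \<partial>lborel) = (\<integral>x. g x - indicator A x * g x \<partial>lborel)"
        by (intro Bochner_Integration.integral_cong refl) (auto simp: indicator_def)
      also have "\<dots> = 0" using compl total int intA[OF \<open>A \<in> sets borel\<close>] by simp
      finally show ?case .
    next
      case (union A)
      then have m: "\<And>i. A i \<in> sets borel" by (simp add: borel_eq_box subset_eq image_subset_iff)
      have U: "(\<Union>i. A i) \<in> sets borel" using m by auto
      have "(\<integral>x. indicator (\<Union>i. A i) x *\<^sub>R g x \<partial>lborel) = (\<Sum>i. \<integral>x. indicator (A i) x *\<^sub>R g x \<partial>lborel)"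
        using lebesgue_integral_countable_add[of A lborel g] m union(1) int intA[OF U]
        unfolding set_lebesgue_integral_def set_integrable_def
        by (auto simp: disjoint_family_on_def integrable_mult_indicator)
      then show ?case using union by simp
    qed (use box in auto)
  qed
  have pos: "AE x in lborel. \<not> g x > 0"
  proof -
    define A where "A = {x. g x > 0}"
    have Ab: "A \<in> sets borel" unfolding A_def by measurable
    have "AE x in lborel. indicator A x * g x = 0"
      using integral_nonneg_eq_0_iff_AE[OF intA[OF Ab]] A0[OF Ab] by (auto simp: A_def indicator_def)
    then show ?thesis by (rule eventually_mono) (auto simp: A_def indicator_def)
  qed
  have neg: "AE x in lborel. \<not> g x < 0"
  proof -
    define A where "A = {x. g x < 0}"
    have Ab: "A \<in> sets borel" unfolding A_def by measurable
    have i: "integrable lborel (\<lambda>x. - (indicator A x * g x))" using intA[OF Ab] by simp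
    have "AE x in lborel. - (indicator A x * g x) = 0"
      using integral_nonneg_eq_0_iff_AE[OF i] A0[OF Ab] by (auto simp: A_def indicator_def)
    then show ?thesis by (rule eventually_mono) (auto simp: A_def indicator_def)
  qed
  show ?thesis using pos neg by eventually_elim auto
qed

lemma AE_lebesgue_on_iff:
  assumes "S \<in> sets lebesgue"
  shows "(AE x in lebesgue_on S. P x) \<longleftrightarrow> (AE x in lebesgue. x \<in> S \<longrightarrow> P x)"
  using assms by (subst AE_restrict_space_iff) auto

lemma integrable_lebesgue_on_subset:
  fixes f :: "'a::euclidean_space \<Rightarrow> real"
  assumes "integrable lebesgue f" "S \<in> sets lebesgue" shows "integrable (lebesgue_on S) f"
  using assms by (subst integrable_restrict_space) (auto simp del: real_scaleR_def intro!: integrable_mult_indicator)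

lemma sqi_bounded_support:
  fixes \<phi> :: "'a::euclidean_space \<Rightarrow> real"
  assumes "continuous_on UNIV \<phi>" "compact C" "\<And>x. x \<notin> C \<Longrightarrow> \<phi> x = 0" "S \<in> sets lebesgue"
  shows "sqi (lebesgue_on S) \<phi>"
proof -
  have [measurable]: "\<phi> \<in> borel_measurable borel" using assms(1) by (simp add: borel_measurable_continuous_onI)
  have "integrable lborel (\<lambda>x. indicator C x *\<^sub>R (\<phi> x)\<^sup>2)"
    by (intro borel_integrable_compact assms continuous_intros continuous_on_subset[OF assms(1)]) auto
  moreover have "(\<lambda>x. indicator C x *\<^sub>R (\<phi> x)\<^sup>2) = (\<lambda>x. (\<phi> x)\<^sup>2)" using assms(3) by (auto simp: indicator_def
      fun_eq_iff)
  ultimately have "integrable lebesgue (\<lambda>x. (\<phi> x)\<^sup>2)" by (simp add: integrable_completion)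
  then have "integrable (lebesgue_on S) (\<lambda>x. (\<phi> x)\<^sup>2)"
    using assms(4) by (rule integrable_lebesgue_on_subset)
  moreover have "\<phi> \<in> borel_measurable (lebesgue_on S)"
    by (intro measurable_restrict_space1 measurable_completion) simp
  ultimately show ?thesis by (simp add: sqi_def)
qed

lemma test_funD:
  assumes "test_fun S \<phi>"
  shows "C1_grad \<phi> (grad \<phi>)" "compact (tsupp \<phi>)" "\<And>x. x \<notin> tsupp \<phi> \<Longrightarrow> \<phi> x = 0" "\<And>x. x \<notin> tsupp \<phi> \<Longrightarrow> grad \<phi> x = 0" "tsupp \<phi>
      \<subseteq> S"
proof -
  show "C1_grad \<phi> (grad \<phi>)" "compact (tsupp \<phi>)" "tsupp \<phi> \<subseteq> S" using assms smooth_fun_C1 by (auto simp: test_fun_def)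
  have z: "\<phi> x = 0" if "x \<notin> tsupp \<phi>" for x using that closure_subset[of "{x. \<phi> x \<noteq> 0}"] by (auto simp: tsupp_def)
  then show "\<phi> x = 0" if "x \<notin> tsupp \<phi>" for x using that .
  show "grad \<phi> x = 0" if "x \<notin> tsupp \<phi>" for x
  proof -
    have "open (- tsupp \<phi>)" unfolding tsupp_def by (intro open_Compl closed_closure)
    then have "(\<phi> has_derivative (\<lambda>h. 0)) (at x)"
      using z that has_derivative_transform_within_open[OF has_derivative_const[of 0 "at x"], of "- tsupp \<phi>" \<phi>] by auto
    then have "frechet_derivative \<phi> (at x) = (\<lambda>h. 0)" using frechet_derivative_at by metis
    then show ?thesis by (simp add: grad_def partial_def)
  qed
qed

lemma test_fun_sqi:
  assumes "test_fun S' \<phi>" "S \<in> sets lebesgue"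
  shows "sqi (lebesgue_on S) \<phi>" "sqi (lebesgue_on S) (grad \<phi>)"
proof -
  note D = test_funD[OF assms(1)]
  show "sqi (lebesgue_on S) \<phi>"
    using sqi_bounded_support[OF C1_grad_continuous[OF D(1)] D(2) D(3) assms(2)] .
  have "sqi (lebesgue_on S) (\<lambda>x. grad \<phi> x \<bullet> b)" for b
    by (rule sqi_bounded_support[OF _ D(2) _ assms(2)]) (auto intro!: continuous_intros C1_gradD(2)[OF D(1)] simp: D(4))
  then have "sqi (lebesgue_on S) (\<lambda>x. \<Sum>b\<in>Basis. (grad \<phi> x \<bullet> b) *\<^sub>R b)"
  proof (intro sqi_sum)
    fix b :: 'a assume "b \<in> Basis"
    assume *: "\<And>b. sqi (lebesgue_on S) (\<lambda>x. grad \<phi> x \<bullet> b)"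
    then show "sqi (lebesgue_on S) (\<lambda>x. (grad \<phi> x \<bullet> b) *\<^sub>R b)"
      using \<open>b \<in> Basis\<close> *[of b] by (auto simp: sqi_def intro!: borel_measurable_scaleR)
  qed
  then show "sqi (lebesgue_on S) (grad \<phi>)" by (simp add: euclidean_representation)
qed

text \<open>The limit of bump functions annihilates the integral over every box whose closed version
  lies in \<open>S\<close>, and \<open>S\<close> is a countable union of closed boxes. In between,
  the localised function is replaced by a Borel representative, because boxes generate the Borel
  sets only.\<close>

lemma fundamental_lemma:
  fixes f :: "'a::euclidean_space \<Rightarrow> real"
  assumes S: "open S" and f: "sqi (lebesgue_on S) f"
    and test: "\<And>\<phi>. test_fun S \<phi> \<Longrightarrow> (\<integral>x. \<phi> x * f x \<partial>lebesgue_on S) = 0"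
  shows "AE x in lebesgue. x \<in> S \<longrightarrow> f x = 0"
proof -
  have Sm: "S \<in> sets lebesgue" using S by auto
  have fm: "f \<in> borel_measurable (lebesgue_on S)" using f by (simp add: sqi_def)
  have boxint: "integrable (lebesgue_on S) (\<lambda>x. indicator (cbox l u) x * f x)" for l u
  proof -
    have "sqi (lebesgue_on S) (indicator (cbox l u) :: 'a \<Rightarrow> real)"
    proof -
      have "integrable lebesgue (indicator (cbox l u) :: 'a \<Rightarrow> real)"
        by (intro integrable_real_indicator) (auto simp: emeasure_lborel_cbox_eq)
      then have "integrable (lebesgue_on S) (indicator (cbox l u) :: 'a \<Rightarrow> real)"
        using Sm by (rule integrable_lebesgue_on_subset)
      moreover have "(\<lambda>x. (norm (indicator (cbox l u) x :: real))\<^sup>2) = (indicator (cbox l u) :: 'a \<Rightarrow> real)"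
        by (auto simp: indicator_def)
      ultimately show ?thesis by (simp add: sqi_def)
    qed
    then show ?thesis using f by (rule sqi_mult_integrable)
  qed
  have box0: "(\<integral>x. indicator (box l u) x * f x \<partial>lebesgue_on S) = 0" if sub: "cbox l u \<subseteq> S" for l u
  proof -
    have "(\<lambda>n. \<integral>x. bump n l u x * f x \<partial>lebesgue_on S) \<longlonglongrightarrow> (\<integral>x. indicator (box l u) x * f x \<partial>lebesgue_on S)"
    proof (rule integral_dominated_convergence[where w = "\<lambda>x. \<bar>indicator (cbox l u) x * f x\<bar>"])
      show "integrable (lebesgue_on S) (\<lambda>x. \<bar>indicator (cbox l u) x * f x\<bar>)" using boxint by simp
      show "AE x in lebesgue_on S. (\<lambda>n. bump n l u x * f x) \<longlonglongrightarrow> indicator (box l u) x * f x"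
        by (intro AE_I2 tendsto_intros bump_limit)
      have "sqi (lebesgue_on S) (bump n l u)" for n by (rule test_fun_sqi(1)[OF bump_test_fun[OF sub] Sm])
      then have bm: "bump n l u \<in> borel_measurable (lebesgue_on S)" for n by (simp add: sqi_def)
      show "(\<lambda>x. bump n l u x * f x) \<in> borel_measurable (lebesgue_on S)" for n using bm fm by simp
      have "box l u \<in> sets lebesgue" by simp
      then have "(indicator (box l u) :: 'a \<Rightarrow> real) \<in> borel_measurable (lebesgue_on S)"
        by (intro measurable_restrict_space1 borel_measurable_indicator)
      then show "(\<lambda>x. indicator (box l u) x * f x) \<in> borel_measurable (lebesgue_on S)" using fm by simp
      show "AE x in lebesgue_on S. norm (bump n l u x * f x) \<le> \<bar>indicator (cbox l u) x * f x\<bar>" for n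
      proof (rule AE_I2)
        fix x
        have "bump n l u x = 0" if "x \<notin> cbox l u"
          using test_funD(3,5)[OF bump_test_fun[of l u "cbox l u" n]] that by auto
        then show "norm (bump n l u x * f x) \<le> \<bar>indicator (cbox l u) x * f x\<bar>"
          using bump_bounds[of n l u x] by (auto simp: indicator_def abs_mult mult_left_le_one_le)
      qed
    qed
    moreover have "(\<integral>x. bump n l u x * f x \<partial>lebesgue_on S) = 0" for n by (rule test[OF bump_test_fun[OF sub]])
    ultimately show ?thesis by (simp add: LIMSEQ_const_iff)
  qed
  have loc: "AE x in lebesgue. x \<in> cbox l u \<longrightarrow> f x = 0" if sub: "cbox l u \<subseteq> S" for l u
  proof -
    define g where "g = (\<lambda>x. indicator (box l u) x * f x)"
    have bS: "box l u \<subseteq> S" using sub box_subset_cbox by blast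
    have gS: "(\<lambda>x. indicator S x *\<^sub>R (indicator (cbox l u) x * f x)) = (\<lambda>x. indicator (cbox l u) x * f x)"
      using sub by (auto simp: indicator_def fun_eq_iff)
    have "integrable lebesgue (\<lambda>x. indicator (cbox l u) x * f x)"
      using boxint[of l u] Sm gS by (simp add: integrable_restrict_space)
    then have "integrable lebesgue (\<lambda>x. indicator (box l u) x *\<^sub>R (indicator (cbox l u) x * f x))"
      by (intro integrable_mult_indicator) auto
    moreover have "(\<lambda>x. indicator (box l u) x *\<^sub>R (indicator (cbox l u) x * f x)) = g"
      using box_subset_cbox[of l u] by (auto simp: g_def indicator_def fun_eq_iff)
    ultimately have gint: "integrable lebesgue g" by simp
    then have "g \<in> borel_measurable lebesgue" by auto
    then obtain g' where g': "g' \<in> borel_measurable lborel" "AE x in lborel. g x = g' x"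
      using completion_ex_borel_measurable_real by blast
    have ae: "AE x in lebesgue. g x = g' x" using g'(2) by (rule AE_completion)
    have [measurable]: "g' \<in> borel_measurable borel" using g'(1) by simp
    have "integrable lebesgue g'"
      using gint ae by (subst integrable_cong_AE[of _ _ g]) (auto intro: measurable_completion elim: eventually_mono)
    then have int': "integrable lborel g'" by (simp add: integrable_completion)
    have "AE x in lborel. g' x = 0"
    proof (rule box_integrals_zero_imp_AE_zero[OF int'])
      fix a b :: 'a
      have "(\<integral>x. indicator (box a b) x * g' x \<partial>lborel) = (\<integral>x. indicator (box a b) x * g' x \<partial>lebesgue)"
        by (rule integral_completion[symmetric]) simp
      also have "\<dots> = (\<integral>x. indicator (box a b) x * g x \<partial>lebesgue)"
      proof (rule integral_cong_AE)
        show "(\<lambda>x. indicator (box a b) x * g' x) \<in> borel_measurable lebesgue" by (rule measurable_completion) simp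
        show "(\<lambda>x. indicator (box a b) x * g x) \<in> borel_measurable lebesgue"
          using gint by (intro borel_measurable_times borel_measurable_indicator) auto
      qed (use ae in \<open>auto elim: eventually_mono\<close>)
      also have "\<dots> = (\<integral>x. indicator S x *\<^sub>R (indicator (box a b \<inter> box l u) x * f x) \<partial>lebesgue)"
        using bS by (intro Bochner_Integration.integral_cong refl) (auto simp: g_def indicator_def)
      also have "\<dots> = (\<integral>x. indicator (box a b \<inter> box l u) x * f x \<partial>lebesgue_on S)"
        using Sm by (simp add: integral_restrict_space)
      also have "\<dots> = 0"
      proof -
        define p where "p = (\<Sum>i\<in>Basis. max (a \<bullet> i) (l \<bullet> i) *\<^sub>R i)"
        define q where "q = (\<Sum>i\<in>Basis. min (b \<bullet> i) (u \<bullet> i) *\<^sub>R i)"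
        have "box a b \<inter> box l u = box p q" by (simp add: box_Int_box p_def q_def)
        moreover have "cbox p q \<subseteq> cbox l u" by (auto simp: mem_box p_def q_def)
        ultimately show ?thesis using box0 sub by auto
      qed
      finally show "(\<integral>x. indicator (box a b) x * g' x \<partial>lborel) = 0" .
    qed
    then have "AE x in lebesgue. g' x = 0" by (rule AE_completion)
    moreover have "AE x in lebesgue. x \<notin> cbox l u - box l u"
      by (intro AE_not_in) (metis negligible_frontier_interval negligible_iff_null_sets)
    ultimately show ?thesis using ae by eventually_elim (auto simp: g_def)
  qed
  obtain D where D: "countable D" "D \<subseteq> Pow S" "\<And>X. X \<in> D \<Longrightarrow> \<exists>a b. X = cbox a b" "\<Union>D = S"
    using open_countable_Union_open_cbox[OF S] by metis
  have "AE x in lebesgue. \<forall>X\<in>D. x \<in> X \<longrightarrow> f x = 0"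
  proof (rule AE_ball_countable[OF D(1), THEN iffD2], rule ballI)
    fix X assume X: "X \<in> D"
    obtain a b where "X = cbox a b" using D(3)[OF X] by blast
    then show "AE x in lebesgue. x \<in> X \<longrightarrow> f x = 0" using loc D(2) X by blast
  qed
  then show ?thesis by (rule eventually_mono) (use D(4) in blast)
qed

lemma sqi_scaleR_integrable:
  fixes f :: "'a \<Rightarrow> real" and g :: "'a \<Rightarrow> 'b::euclidean_space"
  assumes "sqi M f" "sqi M g" shows "integrable M (\<lambda>x. f x *\<^sub>R g x)"
proof -
  have [measurable]: "f \<in> borel_measurable M" "g \<in> borel_measurable M" using assms by (auto simp: sqi_def)
  have "sqi M (\<lambda>x. norm (g x))" using assms(2) by (auto simp: sqi_def)
  then have "integrable M (\<lambda>x. f x * norm (g x))" by (rule sqi_mult_integrable[OF assms(1)])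
  then show ?thesis by (rule Bochner_Integration.integrable_bound) (auto simp: abs_mult)
qed

lemma integral_lebesgue_on_cong_support:
  fixes f :: "'a::euclidean_space \<Rightarrow> 'b::euclidean_space"
  assumes "S \<in> sets lebesgue" "S' \<in> sets lebesgue" "S' \<subseteq> S" "\<And>x. x \<notin> S' \<Longrightarrow> f x = 0"
  shows "(\<integral>x. f x \<partial>lebesgue_on S) = (\<integral>x. f x \<partial>lebesgue_on S')"
proof -
  have "(\<lambda>x. indicator S x *\<^sub>R f x) = (\<lambda>x. indicator S' x *\<^sub>R f x)"
    using assms(3,4) by (auto simp: indicator_def fun_eq_iff)
  then show ?thesis using assms(1,2) by (simp add: integral_restrict_space)
qed

lemma sqi_subset:
  fixes f :: "'a::euclidean_space \<Rightarrow> 'b::euclidean_space"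
  assumes "sqi (lebesgue_on S) f" "S \<in> sets lebesgue" "S' \<in> sets lebesgue" "S' \<subseteq> S"
  shows "sqi (lebesgue_on S') f"
proof -
  have e: "lebesgue_on S' = restrict_space (lebesgue_on S) S'"
    using assms(2-4) by (simp add: restrict_restrict_space Int_absorb1)
  have "S' \<inter> space (lebesgue_on S) \<in> sets (lebesgue_on S)" "S' \<in> sets (lebesgue_on S)"
    using assms(2-4) by (auto simp: sets_restrict_space_iff Int_absorb2)
  note m = this
  have 1: "f \<in> borel_measurable (restrict_space (lebesgue_on S) S')"
    by (rule measurable_restrict_space1) (use assms(1) in \<open>simp add: sqi_def\<close>)
  have 2: "integrable (lebesgue_on S) (\<lambda>x. (norm (f x))\<^sup>2)" using assms(1) by (simp add: sqi_def)
  have "integrable (restrict_space (lebesgue_on S) S') (\<lambda>x. (norm (f x))\<^sup>2)"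
    unfolding integrable_restrict_space[OF m(1)] by (rule integrable_mult_indicator[OF m(2) 2])
  with 1 show ?thesis unfolding sqi_def e by blast
qed

section \<open>Weak gradients: restriction, linearity, uniqueness\<close>

lemma H1_grad_iff:
  assumes "open S"
  shows "H1_grad S u G \<longleftrightarrow> sqi (lebesgue_on S) u \<and> sqi (lebesgue_on S) G \<and>
    (\<forall>\<phi>. test_fun S \<phi> \<longrightarrow> (\<integral>x. u x *\<^sub>R grad \<phi> x \<partial>lebesgue_on S) = - (\<integral>x. \<phi> x *\<^sub>R G x \<partial>lebesgue_on S))"
proof -
  have "S \<in> sets lebesgue" using assms by auto
  then show ?thesis by (simp add: H1_grad_def L2_iff_sqi L2v_iff_sqi set_integral_lebesgue_on)
qed

lemma H1_grad_subset:
  assumes S: "open S" "open S'" "S' \<subseteq> S" and H: "H1_grad S u G"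
  shows "H1_grad S' u G"
proof -
  have m: "S \<in> sets lebesgue" "S' \<in> sets lebesgue" using S by auto
  note H = H[unfolded H1_grad_iff[OF S(1)]]
  show ?thesis unfolding H1_grad_iff[OF S(2)]
  proof (intro conjI allI impI)
    show "sqi (lebesgue_on S') u" "sqi (lebesgue_on S') G" using H sqi_subset[OF _ m S(3)] by auto
    fix \<phi> assume t: "test_fun S' \<phi>"
    then have t': "test_fun S \<phi>" using S(3) by (auto simp: test_fun_def)
    note D = test_funD[OF t]
    have z: "\<phi> x = 0" "grad \<phi> x = 0" if "x \<notin> S'" for x using D that by auto
    have "(\<integral>x. u x *\<^sub>R grad \<phi> x \<partial>lebesgue_on S') = (\<integral>x. u x *\<^sub>R grad \<phi> x \<partial>lebesgue_on S)"
      by (rule integral_lebesgue_on_cong_support[OF m S(3), symmetric]) (simp add: z)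
    also have "\<dots> = - (\<integral>x. \<phi> x *\<^sub>R G x \<partial>lebesgue_on S)" using H t' by blast
    also have "(\<integral>x. \<phi> x *\<^sub>R G x \<partial>lebesgue_on S) = (\<integral>x. \<phi> x *\<^sub>R G x \<partial>lebesgue_on S')"
      by (rule integral_lebesgue_on_cong_support[OF m S(3)]) (simp add: z)
    finally show "(\<integral>x. u x *\<^sub>R grad \<phi> x \<partial>lebesgue_on S') = - (\<integral>x. \<phi> x *\<^sub>R G x \<partial>lebesgue_on S')" .
  qed
qed

lemma H1_grad_add_scaled:
  assumes S: "open S" and u: "H1_grad S u G" and v: "H1_grad S v H"
  shows "H1_grad S (\<lambda>x. u x + c * v x) (\<lambda>x. G x + c *\<^sub>R H x)"
proof -
  have m: "S \<in> sets lebesgue" using S by auto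
  note u = u[unfolded H1_grad_iff[OF S]] and v = v[unfolded H1_grad_iff[OF S]]
  show ?thesis unfolding H1_grad_iff[OF S]
  proof (intro conjI allI impI)
    show "sqi (lebesgue_on S) (\<lambda>x. u x + c * v x)" using u v sqi_add sqi_scale[of _ v c] by fastforce
    show "sqi (lebesgue_on S) (\<lambda>x. G x + c *\<^sub>R H x)" using u v sqi_add sqi_scale by blast
    fix \<phi> assume t: "test_fun S \<phi>"
    note s = test_fun_sqi[OF t m]
    have i: "integrable (lebesgue_on S) (\<lambda>x. u x *\<^sub>R grad \<phi> x)" "integrable (lebesgue_on S) (\<lambda>x. v x *\<^sub>R grad \<phi> x)"
      "integrable (lebesgue_on S) (\<lambda>x. \<phi> x *\<^sub>R G x)" "integrable (lebesgue_on S) (\<lambda>x. \<phi> x *\<^sub>R H x)"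
      using u v s sqi_scaleR_integrable by blast+
    have "(\<integral>x. (u x + c * v x) *\<^sub>R grad \<phi> x \<partial>lebesgue_on S) = (\<integral>x. u x *\<^sub>R grad \<phi> x + c *\<^sub>R (v x *\<^sub>R grad \<phi> x)
        \<partial>lebesgue_on S)"
      by (simp add: scaleR_add_left)
    also have "\<dots> = (\<integral>x. u x *\<^sub>R grad \<phi> x \<partial>lebesgue_on S) + c *\<^sub>R (\<integral>x. v x *\<^sub>R grad \<phi> x \<partial>lebesgue_on S)"
      using i by (simp del: scaleR_scaleR)
    also have "\<dots> = - ((\<integral>x. \<phi> x *\<^sub>R G x \<partial>lebesgue_on S) + c *\<^sub>R (\<integral>x. \<phi> x *\<^sub>R H x \<partial>lebesgue_on S))"
      using u v t by simp
    also have "(\<integral>x. \<phi> x *\<^sub>R G x \<partial>lebesgue_on S) + c *\<^sub>R (\<integral>x. \<phi> x *\<^sub>R H x \<partial>lebesgue_on S) = (\<integral>x. \<phi> x *\<^sub>R G x + c *\<^sub>R (\<phi>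
        x *\<^sub>R H x) \<partial>lebesgue_on S)"
      using i by (simp del: scaleR_scaleR)
    also have "\<dots> = (\<integral>x. \<phi> x *\<^sub>R (G x + c *\<^sub>R H x) \<partial>lebesgue_on S)" by (simp add: scaleR_add_right mult.commute)
    finally show "(\<integral>x. (u x + c * v x) *\<^sub>R grad \<phi> x \<partial>lebesgue_on S) = - (\<integral>x. \<phi> x *\<^sub>R (G x + c *\<^sub>R H x) \<partial>lebesgue_on S)"
        .
  qed
qed

text \<open>This makes the arbitrary choice \<open>wgrad\<close> usable: any explicit weak gradient
  agrees with it almost everywhere.\<close>

lemma H1_grad_unique:
  assumes S: "open S" and u: "H1_grad S u G" "H1_grad S u G'"
  shows "AE x in lebesgue. x \<in> S \<longrightarrow> G x = G' x"
proof -
  have m: "S \<in> sets lebesgue" using S by auto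
  note u = u[unfolded H1_grad_iff[OF S]]
  have comp: "AE x in lebesgue. x \<in> S \<longrightarrow> (G x - G' x) \<bullet> b = 0" for b
  proof (rule fundamental_lemma[OF S])
    have d: "sqi (lebesgue_on S) (\<lambda>x. G x - G' x)" using u sqi_diff by blast
    show "sqi (lebesgue_on S) (\<lambda>x. (G x - G' x) \<bullet> b)"
    proof -
      have [measurable]: "(\<lambda>x. G x - G' x) \<in> borel_measurable (lebesgue_on S)" using d by (simp add: sqi_def)
      have "integrable (lebesgue_on S) (\<lambda>x. (norm b)\<^sup>2 * (norm (G x - G' x))\<^sup>2)" using d by (simp add: sqi_def)
      then have "integrable (lebesgue_on S) (\<lambda>x. ((G x - G' x) \<bullet> b)\<^sup>2)"
      proof (rule Bochner_Integration.integrable_bound)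
        have "((G x - G' x) \<bullet> b)\<^sup>2 \<le> (norm b)\<^sup>2 * (norm (G x - G' x))\<^sup>2" for x
        proof -
          have "\<bar>(G x - G' x) \<bullet> b\<bar>\<^sup>2 \<le> (norm (G x - G' x) * norm b)\<^sup>2"
            by (intro power_mono Cauchy_Schwarz_ineq2) auto
          then show ?thesis by (simp add: power_mult_distrib mult.commute)
        qed
        then show "AE x in lebesgue_on S. norm (((G x - G' x) \<bullet> b)\<^sup>2) \<le> norm ((norm b)\<^sup>2 * (norm (G x - G' x))\<^sup>2)"
          by (intro AE_I2) simp
      qed simp
      then show ?thesis by (simp add: sqi_def)
    qed
    fix \<phi> assume t: "test_fun S \<phi>"
    have i: "integrable (lebesgue_on S) (\<lambda>x. \<phi> x *\<^sub>R G x)" "integrable (lebesgue_on S) (\<lambda>x. \<phi> x *\<^sub>R G' x)"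
      using u test_fun_sqi[OF t m] sqi_scaleR_integrable by blast+
    have eq: "(\<integral>x. \<phi> x *\<^sub>R G x \<partial>lebesgue_on S) = (\<integral>x. \<phi> x *\<^sub>R G' x \<partial>lebesgue_on S)" using u t by (metis
        neg_equal_iff_equal)
    have "(\<integral>x. \<phi> x * ((G x - G' x) \<bullet> b) \<partial>lebesgue_on S) = (\<integral>x. (\<phi> x *\<^sub>R G x - \<phi> x *\<^sub>R G' x) \<bullet> b \<partial>lebesgue_on S)"
      by (intro Bochner_Integration.integral_cong refl) (simp add: inner_diff_left algebra_simps)
    also have "\<dots> = (\<integral>x. \<phi> x *\<^sub>R G x - \<phi> x *\<^sub>R G' x \<partial>lebesgue_on S) \<bullet> b"
      using i by (intro integral_inner_left) auto
    also have "\<dots> = 0" using i eq by simp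
    finally show "(\<integral>x. \<phi> x * ((G x - G' x) \<bullet> b) \<partial>lebesgue_on S) = 0" .
  qed
  have "AE x in lebesgue. \<forall>b\<in>Basis. x \<in> S \<longrightarrow> (G x - G' x) \<bullet> b = 0"
    using comp by (intro AE_finite_allI) auto
  then show ?thesis
    by (rule eventually_mono) (metis eq_iff_diff_eq_0 euclidean_all_zero_iff)
qed

lemma wgrad_H1: "H1 S u \<Longrightarrow> H1_grad S u (wgrad S u)"
  unfolding H1_def wgrad_def by (rule someI_ex[of "H1_grad S u"])

lemma wgrad_AE_eq: assumes "open S" "H1_grad S u G" shows "AE x in lebesgue. x \<in> S \<longrightarrow> wgrad S u x = G x"
  using H1_grad_unique[OF assms(1) wgrad_H1 assms(2)] assms(2) by (auto simp: H1_def)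

lemma weak_gradient_componentwise:
  assumes S: "open S" and sq: "sqi (lebesgue_on S) u" "sqi (lebesgue_on S) G"
    and comp: "\<And>\<phi> b. test_fun S \<phi> \<Longrightarrow> b \<in> Basis \<Longrightarrow> (\<integral>x. (u x *\<^sub>R grad \<phi> x + \<phi> x *\<^sub>R G x) \<bullet> b \<partial>lebesgue_on S) = 0"
  shows "H1_grad S u G"
  unfolding H1_grad_iff[OF S]
proof (intro conjI allI impI)
  have m: "S \<in> sets lebesgue" using S by auto
  fix \<phi> assume t: "test_fun S \<phi>"
  have i: "integrable (lebesgue_on S) (\<lambda>x. u x *\<^sub>R grad \<phi> x)" "integrable (lebesgue_on S) (\<lambda>x. \<phi> x *\<^sub>R G x)"
    using sq test_fun_sqi[OF t m] sqi_scaleR_integrable by blast+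
  have "(\<integral>x. u x *\<^sub>R grad \<phi> x + \<phi> x *\<^sub>R G x \<partial>lebesgue_on S) \<bullet> b = 0" if "b \<in> Basis" for b
    using comp[OF t that] i by (subst integral_inner_left[symmetric]) auto
  then have "(\<integral>x. u x *\<^sub>R grad \<phi> x + \<phi> x *\<^sub>R G x \<partial>lebesgue_on S) = 0"
    using euclidean_all_zero_iff by blast
  then show "(\<integral>x. u x *\<^sub>R grad \<phi> x \<partial>lebesgue_on S) = - (\<integral>x. \<phi> x *\<^sub>R G x \<partial>lebesgue_on S)"
    using i by (simp add: eq_neg_iff_add_eq_0)
qed (use sq in auto)

text \<open>Agreement with a C1 function is asked on \<open>S\<close> only, which is the situation
  of a piecewise polynomial on one open element. The product with a test function is C1 with compact
  support, so its directional derivatives integrate to 0.\<close>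

lemma C1_weak_gradient:
  fixes u v :: "'a::euclidean_space \<Rightarrow> real"
  assumes S: "open S" and v: "C1_grad v gv" and eq: "\<And>x. x \<in> S \<Longrightarrow> u x = v x" "\<And>x. x \<in> S \<Longrightarrow> G x = gv x"
    and sq: "sqi (lebesgue_on S) u" "sqi (lebesgue_on S) G"
  shows "H1_grad S u G"
proof (rule weak_gradient_componentwise[OF S sq])
  have m: "S \<in> sets lebesgue" using S by auto
  fix \<phi> :: "'a \<Rightarrow> real" and b :: 'a assume t: "test_fun S \<phi>" and b: "b \<in> Basis"
  note D = test_funD[OF t]
  have cont: "continuous_on UNIV v" "continuous_on UNIV gv" "continuous_on UNIV \<phi>" "continuous_on UNIV (grad \<phi>)"
    using C1_grad_continuous C1_gradD(2) v D(1) by blast+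
  define F where "F = (\<lambda>x. v x * \<phi> x)"
  define F' where "F' = (\<lambda>x. v x * (grad \<phi> x \<bullet> b) + \<phi> x * (gv x \<bullet> b))"
  have cF: "continuous_on UNIV F" "continuous_on UNIV F'" unfolding F_def F'_def by (intro continuous_intros cont)+
  have [measurable]: "F \<in> borel_measurable borel" "F' \<in> borel_measurable borel"
    using cF by (auto intro: borel_measurable_continuous_onI)
  have z: "F x = 0" "F' x = 0" if "x \<notin> tsupp \<phi>" for x using D that by (auto simp: F_def F'_def)
  have line: "((\<lambda>s. F (x + s *\<^sub>R b)) has_real_derivative F' (x + s *\<^sub>R b)) (at s)" for x s
  proof -
    have "((\<lambda>s. x + s *\<^sub>R b) has_derivative (\<lambda>t. t *\<^sub>R b)) (at s)" by (auto intro!: derivative_eq_intros)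
    from has_derivative_compose[OF this has_derivative_mult[OF C1_gradD(1)[OF v] C1_gradD(1)[OF D(1)]]]
    have "((\<lambda>s. F (x + s *\<^sub>R b)) has_derivative (\<lambda>t. v (x + s *\<^sub>R b) * ((t *\<^sub>R b) \<bullet> grad \<phi> (x + s *\<^sub>R b)) + (t *\<^sub>R b) \<bullet>
        gv (x + s *\<^sub>R b) * \<phi> (x + s *\<^sub>R b))) (at s)"
      by (simp add: F_def)
    moreover have "(\<lambda>t. v (x + s *\<^sub>R b) * ((t *\<^sub>R b) \<bullet> grad \<phi> (x + s *\<^sub>R b)) + (t *\<^sub>R b) \<bullet> gv (x + s *\<^sub>R b) * \<phi> (x + s
        *\<^sub>R b)) = (*) (F' (x + s *\<^sub>R b))"
      by (auto simp: F'_def inner_commute algebra_simps)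
    ultimately show ?thesis by (simp add: has_field_derivative_def)
  qed
  obtain C where C: "\<And>x. x \<in> tsupp \<phi> \<Longrightarrow> \<bar>F' x\<bar> \<le> C"
    using compact_imp_bounded[OF compact_continuous_image[OF continuous_on_subset[OF cF(2)] D(2)]]
    by (auto simp: bounded_iff)
  have C': "\<bar>F' x\<bar> \<le> \<bar>C\<bar>" for x using C[of x] z(2)[of x] by (cases "x \<in> tsupp \<phi>") auto
  obtain R where R: "\<And>x. x \<in> tsupp \<phi> \<Longrightarrow> norm x \<le> R" using compact_imp_bounded[OF D(2)] by (auto simp: bounded_iff)
  have "integrable lborel (\<lambda>x. indicator (tsupp \<phi>) x *\<^sub>R F x)"
    by (intro borel_integrable_compact D(2) continuous_on_subset[OF cF(1)]) auto
  moreover have "(\<lambda>x. indicator (tsupp \<phi>) x *\<^sub>R F x) = F" using z(1) by (auto simp: indicator_def fun_eq_iff)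
  ultimately have iF: "integrable lborel F" by simp
  have "(\<integral>x. F' x \<partial>lborel) = 0"
  proof (rule integral_directional_derivative_eq_0(2)[where G = F and e = b and C = "\<bar>C\<bar>" and R = R and ?t0.0 = 1])
    fix x and t :: real assume "0 < t" "t \<le> 1"
    obtain s where "F (x + t *\<^sub>R b) - F (x + 0 *\<^sub>R b) = (t - 0) * F' (x + s *\<^sub>R b)"
      using MVT2[OF \<open>0 < t\<close> line, of x] by blast
    then show "\<bar>F (x + t *\<^sub>R b) - F x\<bar> \<le> \<bar>C\<bar> * t"
      using C'[of "x + s *\<^sub>R b"] \<open>0 < t\<close> by (simp add: abs_mult mult.commute mult_left_mono)
  next
    show "AE x in lborel. ((\<lambda>t. (F (x + t *\<^sub>R b) - F x) / t) \<longlongrightarrow> F' x) (at_right 0)"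
    proof (rule AE_I2)
      fix x
      have "((\<lambda>s. (F (x + s *\<^sub>R b) - F x) / s) \<longlongrightarrow> F' x) (at 0)"
        using line[of x 0] by (simp add: has_field_derivative_iff)
      then show "((\<lambda>t. (F (x + t *\<^sub>R b) - F x) / t) \<longlongrightarrow> F' x) (at_right 0)"
        by (rule tendsto_mono[rotated]) (simp add: at_le)
    qed
  qed (use iF z(1) R in auto)
  also have "(\<integral>x. F' x \<partial>lborel) = (\<integral>x. F' x \<partial>lebesgue)" by (rule integral_completion[symmetric]) simp
  also have "\<dots> = (\<integral>x. indicator S x *\<^sub>R F' x \<partial>lebesgue)"
    using z(2) D(5) by (intro Bochner_Integration.integral_cong refl) (auto simp: indicator_def)
  also have "\<dots> = (\<integral>x. F' x \<partial>lebesgue_on S)" using m by (simp add: integral_restrict_space)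
  also have "\<dots> = (\<integral>x. (u x *\<^sub>R grad \<phi> x + \<phi> x *\<^sub>R G x) \<bullet> b \<partial>lebesgue_on S)"
    using eq by (intro Bochner_Integration.integral_cong refl) (simp add: F'_def inner_add_left)
  finally show "(\<integral>x. (u x *\<^sub>R grad \<phi> x + \<phi> x *\<^sub>R G x) \<bullet> b \<partial>lebesgue_on S) = 0" by simp
qed

lemma test_fun_H1_grad: assumes "open S" "test_fun S \<phi>" shows "H1_grad S \<phi> (grad \<phi>)"
proof -
  have m: "S \<in> sets lebesgue" using assms by auto
  show ?thesis
    by (rule C1_weak_gradient[OF assms(1) test_funD(1)[OF assms(2)]]) (use test_fun_sqi[OF assms(2) m] in auto)
qed

lemma test_fun_H10: assumes S: "open S" and t: "test_fun S \<phi>" shows "H10 S \<phi>"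
proof -
  have m: "S \<in> sets lebesgue" using S by auto
  have H: "H1_grad S \<phi> (grad \<phi>)" by (rule test_fun_H1_grad[OF assms])
  have "AE x in lebesgue_on S. wgrad S \<phi> x = grad \<phi> x"
    using wgrad_AE_eq[OF S H] m by (simp add: AE_lebesgue_on_iff)
  then have "(\<integral>x. (norm (grad \<phi> x - wgrad S \<phi> x))\<^sup>2 \<partial>lebesgue_on S) = 0"
    by (intro integral_eq_zero_AE) (auto elim: eventually_mono)
  then have "L2normv S (\<lambda>x. grad \<phi> x - wgrad S \<phi> x) = 0" using m by (simp add: L2normv_lebesgue_on)
  moreover have "L2norm S (\<lambda>x. \<phi> x - \<phi> x) = 0" using m by (simp add: L2norm_lebesgue_on)
  ultimately show ?thesis using t H unfolding H10_def H1_def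
    by (intro conjI exI[of _ "\<lambda>n. \<phi>"]) auto
qed

section \<open>Hat functions of a simplicial mesh\<close>

text \<open>By completeness of Lebesgue measure. The congruence rules that follow can therefore
  dispense with measurability side conditions: on changing to an almost everywhere equal function,
  both integrals exist or both are 0 by convention.\<close>

lemma borel_measurable_lebesgue_AE_cong:
  fixes f g :: "'a::euclidean_space \<Rightarrow> 'b::euclidean_space"
  assumes f: "f \<in> borel_measurable lebesgue" and ae: "AE x in lebesgue. f x = g x"
  shows "g \<in> borel_measurable lebesgue"
proof (rule measurableI)
  fix A :: "'b set" assume A: "A \<in> sets borel"
  have "f -` A \<inter> space lebesgue \<in> sets lebesgue" using f A by (rule measurable_sets)
  moreover have "AE x in lebesgue. x \<in> f -` A \<inter> space lebesgue \<longleftrightarrow> x \<in> g -` A \<inter> space lebesgue"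
    using ae by eventually_elim auto
  ultimately show "g -` A \<inter> space lebesgue \<in> sets lebesgue"
    using completion.in_sets_AE[of "f -` A \<inter> space lebesgue" "g -` A \<inter> space lebesgue" lborel] by auto
qed simp

lemma lebesgue_integral_AE_cong:
  fixes f g :: "'a::euclidean_space \<Rightarrow> 'b::euclidean_space"
  assumes ae: "AE x in lebesgue. f x = g x"
  shows "integrable lebesgue f \<longleftrightarrow> integrable lebesgue g" "(\<integral>x. f x \<partial>lebesgue) = (\<integral>x. g x \<partial>lebesgue)"
proof -
  have ae': "AE x in lebesgue. g x = f x" using ae by eventually_elim auto
  have m: "f \<in> borel_measurable lebesgue \<longleftrightarrow> g \<in> borel_measurable lebesgue"
    using borel_measurable_lebesgue_AE_cong[OF _ ae] borel_measurable_lebesgue_AE_cong[OF _ ae'] by blast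
  show i: "integrable lebesgue f \<longleftrightarrow> integrable lebesgue g"
  proof (cases "f \<in> borel_measurable lebesgue")
    case True
    then show ?thesis using m ae by (intro integrable_cong_AE) auto
  next
    case False
    then show ?thesis using m borel_measurable_integrable by blast
  qed
  show "(\<integral>x. f x \<partial>lebesgue) = (\<integral>x. g x \<partial>lebesgue)"
  proof (cases "f \<in> borel_measurable lebesgue")
    case True
    then show ?thesis using m ae by (intro integral_cong_AE) auto
  next
    case False
    then have "\<not> integrable lebesgue f" "\<not> integrable lebesgue g" using i borel_measurable_integrable by blast+
    then show ?thesis by (simp add: not_integrable_integral_eq)
  qed
qed

lemma lebesgue_on_AE_cong:
  fixes f g :: "'a::euclidean_space \<Rightarrow> 'b::euclidean_space"
  assumes S: "S \<in> sets lebesgue" "S' \<in> sets lebesgue"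
    and ae: "AE x in lebesgue. (x \<in> S \<longleftrightarrow> x \<in> S') \<and> (x \<in> S \<longrightarrow> f x = g x)"
  shows "integrable (lebesgue_on S) f \<longleftrightarrow> integrable (lebesgue_on S') g"
    "(\<integral>x. f x \<partial>lebesgue_on S) = (\<integral>x. g x \<partial>lebesgue_on S')"
    "sqi (lebesgue_on S) f \<longleftrightarrow> sqi (lebesgue_on S') g"
proof -
  have ae1: "AE x in lebesgue. indicator S x *\<^sub>R f x = indicator S' x *\<^sub>R g x"
    using ae by eventually_elim (auto simp: indicator_def)
  have ae2: "AE x in lebesgue. indicator S x *\<^sub>R (norm (f x))\<^sup>2 = indicator S' x *\<^sub>R (norm (g x))\<^sup>2"
    using ae by eventually_elim (auto simp: indicator_def)
  show "integrable (lebesgue_on S) f \<longleftrightarrow> integrable (lebesgue_on S') g"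
    using lebesgue_integral_AE_cong(1)[OF ae1] S by (simp add: integrable_restrict_space)
  show "(\<integral>x. f x \<partial>lebesgue_on S) = (\<integral>x. g x \<partial>lebesgue_on S')"
    using lebesgue_integral_AE_cong(2)[OF ae1] S by (simp add: integral_restrict_space)
  have ae1': "AE x in lebesgue. indicator S' x *\<^sub>R g x = indicator S x *\<^sub>R f x"
    using ae1 by eventually_elim (rule sym)
  have "S \<inter> space lebesgue \<in> sets lebesgue" "S' \<inter> space lebesgue \<in> sets lebesgue" using S by auto
  note bm = borel_measurable_restrict_space_iff[OF this(1), of f] borel_measurable_restrict_space_iff[OF this(2), of g]
  have "f \<in> borel_measurable (lebesgue_on S) \<longleftrightarrow> g \<in> borel_measurable (lebesgue_on S')"
    unfolding bm using borel_measurable_lebesgue_AE_cong[OF _ ae1] borel_measurable_lebesgue_AE_cong[OF _ ae1'] by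
        (rule iffI)
  moreover have "integrable (lebesgue_on S) (\<lambda>x. (norm (f x))\<^sup>2) \<longleftrightarrow> integrable (lebesgue_on S') (\<lambda>x. (norm (g x))\<^sup>2)"
    using lebesgue_integral_AE_cong(1)[OF ae2] S by (simp add: integrable_restrict_space)
  ultimately show "sqi (lebesgue_on S) f \<longleftrightarrow> sqi (lebesgue_on S') g" by (simp add: sqi_def)
qed

locale fe_mesh =
  fixes \<Omega> :: "'a::euclidean_space set" and T :: "'a set set"
  assumes dom: "lipschitz_domain \<Omega>" and mesh: "simplicial_mesh \<Omega> T"
begin

abbreviation V :: "'a set \<Rightarrow> 'a set" where "V \<equiv> simplex_verts"

lemma open_\<Omega>: "open \<Omega>" and bounded_\<Omega>: "bounded \<Omega>" using dom by (auto simp: lipschitz_domain_def)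

lemma \<Omega>_lebesgue: "\<Omega> \<in> sets lebesgue" using open_\<Omega> by auto

lemma finite_T: "finite T" and union_T: "\<Union>T = closure \<Omega>" using mesh by (auto simp: simplicial_mesh_def)

lemma element:
  assumes "K \<in> T"
  shows "full_simplex (V K)" "full_simplex.K (V K) = K"
proof -
  have "(int DIM('a)) simplex K" using mesh assms by (auto simp: simplicial_mesh_def)
  then obtain C where C: "\<not> affine_dependent C" "int (card C) = int DIM('a) + 1" "K = convex hull C"
    by (auto simp: simplex_def)
  have VC: "V K = C" unfolding simplex_verts_def C(3) using extreme_point_of_convex_hull_affine_independent[OF C(1)] by
      auto
  show fs: "full_simplex (V K)" using C(1,2) unfolding full_simplex_def VC by simp
  show "full_simplex.K (V K) = K" using full_simplex.K_def[OF fs] C(3) VC by simp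
qed

lemma K_compact: "K \<in> T \<Longrightarrow> compact K" and K_convex: "K \<in> T \<Longrightarrow> convex K"
  and interior_K_nonempty: "K \<in> T \<Longrightarrow> interior K \<noteq> {}"
  using full_simplex.K_compact full_simplex.K_convex full_simplex.interior_K_nonempty element by metis+

lemma K_lebesgue: "K \<in> T \<Longrightarrow> K \<in> sets lebesgue" using K_compact compact_imp_lebesgue by blast

text \<open>A proper face misses the interior. An overlap would thus make \<open>K\<close> a proper
  face of \<open>K'\<close>, although the interior of \<open>K\<close> lies in that of
  \<open>K'\<close>.\<close>

lemma interior_disjoint:
  assumes "K \<in> T" "K' \<in> T" "K \<noteq> K'" shows "interior K \<inter> K' = {}"
proof (rule ccontr)
  assume ne: "interior K \<inter> K' \<noteq> {}"
  have f: "(K \<inter> K') face_of K" "(K \<inter> K') face_of K'" using mesh assms by (auto simp: simplicial_mesh_def)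
  have "K \<inter> K' = K"
  proof (rule ccontr)
    assume "K \<inter> K' \<noteq> K"
    then show False using face_of_disjoint_interior[OF f(1)] ne interior_subset by blast
  qed
  then have "K \<subseteq> K'" "K face_of K'" using f(2) by auto
  then have "K \<inter> interior K' = {}" using face_of_disjoint_interior assms(3) by blast
  moreover have "interior K \<subseteq> interior K'" using \<open>K \<subseteq> K'\<close> by (rule interior_mono)
  ultimately show False using interior_K_nonempty[OF assms(1)] interior_subset by blast
qed

text \<open>The elements cover \<open>closure \<Omega>\<close>, so a slit domain could have boundary
  points inside an element. The Lipschitz graph rules this out: arbitrarily close to a boundary
  point there is an open set free of \<Omega>.\<close>

lemma interior_K_subset: assumes "K \<in> T" shows "interior K \<subseteq> \<Omega>"
proof
  fix x assume x: "x \<in> interior K"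
  show "x \<in> \<Omega>"
  proof (rule ccontr)
    assume "x \<notin> \<Omega>"
    have K: "K \<subseteq> closure \<Omega>" using assms union_T by blast
    then have "x \<in> frontier \<Omega>" using x interior_subset \<open>x \<notin> \<Omega>\<close> open_\<Omega> by (auto simp: frontier_def interior_open)
    then obtain r n L \<gamma> where r: "r > 0" "norm n = 1" "L-lipschitz_on {z. z \<bullet> n = 0} (\<gamma> :: 'a \<Rightarrow> real)"
      "\<Omega> \<inter> ball x r = {y \<in> ball x r. y \<bullet> n > \<gamma> (y - (y \<bullet> n) *\<^sub>R n)}"
      using dom unfolding lipschitz_domain_def by blast
    have nn: "n \<bullet> n = 1" using r(2) by (simp add: dot_square_norm)
    define P where "P = (\<lambda>y. y - (y \<bullet> n) *\<^sub>R n)"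
    have cP: "continuous_on UNIV (\<lambda>y. y \<bullet> n - \<gamma> (P y))"
    proof -
      have "continuous_on {z. z \<bullet> n = 0} \<gamma>" using r(3) by (rule lipschitz_on_continuous_on)
      then have "continuous_on UNIV (\<lambda>y. \<gamma> (P y))"
        by (rule continuous_on_compose2) (auto simp: P_def inner_diff_left nn intro!: continuous_intros)
      then show ?thesis by (intro continuous_intros)
    qed
    have x0: "x \<bullet> n \<le> \<gamma> (P x)" using \<open>x \<notin> \<Omega>\<close> r(1,4) by (force simp: P_def)
    obtain \<rho> where \<rho>: "\<rho> > 0" "ball x \<rho> \<subseteq> K" using x by (auto simp: mem_interior)
    define t where "t = min r \<rho> / 2"
    have t: "t > 0" "t < r" "t < \<rho>" using r(1) \<rho>(1) by (auto simp: t_def)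
    \<comment> \<open>A short step against \<open>n\<close> ends strictly below the graph while
      remaining in \<open>K\<close>.\<close>
    define y where "y = x - t *\<^sub>R n"
    have yb: "y \<in> ball x r" "y \<in> ball x \<rho>" using t r(2) by (auto simp: y_def dist_norm)
    have "P y = P x" by (simp add: y_def P_def inner_diff_left nn algebra_simps)
    then have "y \<bullet> n - \<gamma> (P y) < 0" using x0 t by (simp add: y_def inner_diff_left nn)
    then have "y \<in> {z. z \<bullet> n - \<gamma> (P z) < 0} \<inter> ball x r" using yb by simp
    moreover have "open ({z. z \<bullet> n - \<gamma> (P z) < 0} \<inter> ball x r)"
      by (intro open_Int open_Collect_less cP continuous_intros) auto
    moreover have "\<gamma> (P z) < z \<bullet> n" if "z \<in> \<Omega>" "z \<in> ball x r" for z
      using r(4) that unfolding P_def by blast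
    then have "({z. z \<bullet> n - \<gamma> (P z) < 0} \<inter> ball x r) \<inter> \<Omega> = {}" by force
    ultimately have "y \<notin> closure \<Omega>" using open_Int_closure_eq_empty by blast
    moreover have "y \<in> closure \<Omega>" using yb \<rho>(2) K by blast
    ultimately show False by blast
  qed
qed

lemma AE_not_frontier: "AE x in lebesgue. \<forall>K\<in>T. x \<notin> frontier K"
proof (rule AE_finite_allI[OF finite_T])
  fix K assume "K \<in> T"
  then have "frontier K \<in> null_sets lebesgue"
    using negligible_convex_frontier[OF K_convex] by (simp add: negligible_iff_null_sets)
  then show "AE x in lebesgue. x \<notin> frontier K" by (rule AE_not_in)
qed

lemma not_frontier_interior: "K \<in> T \<Longrightarrow> x \<notin> frontier K \<Longrightarrow> x \<in> K \<longleftrightarrow> x \<in> interior K"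
  using K_compact[THEN compact_imp_closed] interior_subset by (auto simp: frontier_def closure_closed)

lemma AE_interior: "AE x in lebesgue. \<forall>K\<in>T. x \<in> K \<longleftrightarrow> x \<in> interior K"
  using AE_not_frontier by eventually_elim (use not_frontier_interior in blast)

lemma AE_\<Omega>_cases: "AE x in lebesgue. x \<in> \<Omega> \<longleftrightarrow> (\<exists>K\<in>T. x \<in> interior K)"
  using AE_interior
proof eventually_elim
  case (elim x)
  have "x \<in> \<Omega> \<Longrightarrow> \<exists>K\<in>T. x \<in> K" using union_T closure_subset by blast
  then show ?case using elim interior_K_subset by blast
qed

lemma on_element_interior:
  fixes f g :: "'a \<Rightarrow> 'b::euclidean_space"
  assumes "K \<in> T" "AE x in lebesgue. x \<in> interior K \<longrightarrow> f x = g x"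
  shows "(\<integral>x. f x \<partial>lebesgue_on K) = (\<integral>x. g x \<partial>lebesgue_on (interior K))"
    "integrable (lebesgue_on K) f \<longleftrightarrow> integrable (lebesgue_on (interior K)) g"
    "sqi (lebesgue_on K) f \<longleftrightarrow> sqi (lebesgue_on (interior K)) g"
proof -
  have ae: "AE x in lebesgue. (x \<in> K \<longleftrightarrow> x \<in> interior K) \<and> (x \<in> K \<longrightarrow> f x = g x)"
    using AE_interior assms(2) by eventually_elim (use assms(1) in auto)
  have m: "K \<in> sets lebesgue" "interior K \<in> sets lebesgue" using K_lebesgue[OF assms(1)] by auto
  show "(\<integral>x. f x \<partial>lebesgue_on K) = (\<integral>x. g x \<partial>lebesgue_on (interior K))"
    "integrable (lebesgue_on K) f \<longleftrightarrow> integrable (lebesgue_on (interior K)) g"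
    "sqi (lebesgue_on K) f \<longleftrightarrow> sqi (lebesgue_on (interior K)) g"
    using lebesgue_on_AE_cong[OF m ae] by auto
qed

lemma on_element_cong:
  fixes f g :: "'a \<Rightarrow> 'b::euclidean_space"
  assumes "K \<in> T" "AE x in lebesgue. x \<in> interior K \<longrightarrow> f x = g x"
  shows "(\<integral>x. f x \<partial>lebesgue_on K) = (\<integral>x. g x \<partial>lebesgue_on K)"
    "integrable (lebesgue_on K) f \<longleftrightarrow> integrable (lebesgue_on K) g"
    "sqi (lebesgue_on K) f \<longleftrightarrow> sqi (lebesgue_on K) g"
  using on_element_interior[OF assms] on_element_interior[OF assms(1), of g g] by auto

lemma sqi_element:
  fixes f :: "'a \<Rightarrow> 'b::euclidean_space"
  assumes "K \<in> T" "S \<in> sets lebesgue" "interior K \<subseteq> S" "sqi (lebesgue_on S) f"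
  shows "sqi (lebesgue_on K) f"
  using sqi_subset[OF assms(4,2) _ assms(3)] on_element_interior(3)[OF assms(1), of f f] by auto

lemma integrable_element:
  fixes f :: "'a \<Rightarrow> real"
  assumes "K \<in> T" "S \<in> sets lebesgue" "interior K \<subseteq> S" "integrable (lebesgue_on S) f"
  shows "integrable (lebesgue_on K) f"
proof -
  have "integrable lebesgue (\<lambda>x. indicator S x *\<^sub>R f x)" using assms by (simp add: integrable_restrict_space)
  then have "integrable lebesgue (\<lambda>x. indicator (interior K) x *\<^sub>R (indicator S x *\<^sub>R f x))"
    by (rule integrable_mult_indicator[rotated]) auto
  moreover have "(\<lambda>x. indicator (interior K) x *\<^sub>R (indicator S x *\<^sub>R f x)) = (\<lambda>x. indicator (interior K) x *\<^sub>R f x)"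
    using assms(3) by (auto simp: indicator_def fun_eq_iff)
  ultimately have "integrable (lebesgue_on (interior K)) f" by (simp add: integrable_restrict_space)
  then show ?thesis using on_element_interior(2)[OF assms(1), of f f] by simp
qed

text \<open>Formulated for a subfamily of elements so as to serve both the whole domain and a vertex
  patch.\<close>

lemma integral_split:
  fixes f :: "'a \<Rightarrow> real"
  assumes S: "S \<in> sets lebesgue" and T': "T' \<subseteq> T"
    and ae: "AE x in lebesgue. x \<in> S \<longleftrightarrow> (\<exists>K\<in>T'. x \<in> interior K)"
    and int: "\<And>K. K \<in> T' \<Longrightarrow> integrable (lebesgue_on K) f"
  shows "integrable (lebesgue_on S) f" "(\<integral>x. f x \<partial>lebesgue_on S) = (\<Sum>K\<in>T'. \<integral>x. f x \<partial>lebesgue_on K)"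
proof -
  have i: "integrable lebesgue (\<lambda>x. indicator K x *\<^sub>R f x)" if "K \<in> T'" for K
    using int[OF that] K_lebesgue T' that by (subst (asm) integrable_restrict_space) auto
  have eq: "AE x in lebesgue. indicator S x *\<^sub>R f x = (\<Sum>K\<in>T'. indicator K x *\<^sub>R f x)"
    using ae AE_interior
  proof eventually_elim
    case (elim x)
    show ?case
    proof (cases "x \<in> S")
      case True
      then obtain K where K: "K \<in> T'" "x \<in> interior K" using elim by blast
      have "indicator K' x *\<^sub>R f x = (if K' = K then f x else 0)" if "K' \<in> T'" for K'
        using interior_disjoint[of K K'] K T' that interior_subset by (auto simp: indicator_def)
      then have "(\<Sum>K'\<in>T'. indicator K' x *\<^sub>R f x) = (\<Sum>K'\<in>T'. if K' = K then f x else 0)" by (intro sum.cong) auto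
      then show ?thesis using True K(1) finite_subset[OF T' finite_T] by simp
    next
      case False
      then have "x \<notin> K" if "K \<in> T'" for K using that elim T' by blast
      then have "(\<Sum>K\<in>T'. indicator K x *\<^sub>R f x) = 0" by (intro sum.neutral) auto
      then show ?thesis using False by simp
    qed
  qed
  have "integrable lebesgue (\<lambda>x. \<Sum>K\<in>T'. indicator K x *\<^sub>R f x)" using i by (intro Bochner_Integration.integrable_sum)
  then have "integrable lebesgue (\<lambda>x. indicator S x *\<^sub>R f x)" using lebesgue_integral_AE_cong(1)[OF eq] by simp
  then show "integrable (lebesgue_on S) f" using S by (simp add: integrable_restrict_space)
  have "(\<integral>x. f x \<partial>lebesgue_on S) = (\<integral>x. (\<Sum>K\<in>T'. indicator K x *\<^sub>R f x) \<partial>lebesgue)"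
    using lebesgue_integral_AE_cong(2)[OF eq] S by (simp add: integral_restrict_space)
  also have "\<dots> = (\<Sum>K\<in>T'. \<integral>x. indicator K x *\<^sub>R f x \<partial>lebesgue)"
    using i by (intro Bochner_Integration.integral_sum)
  also have "\<dots> = (\<Sum>K\<in>T'. \<integral>x. f x \<partial>lebesgue_on K)"
    using K_lebesgue T' by (intro sum.cong refl) (subst integral_restrict_space, auto)
  finally show "(\<integral>x. f x \<partial>lebesgue_on S) = (\<Sum>K\<in>T'. \<integral>x. f x \<partial>lebesgue_on K)" .
qed

lemma integral_split_\<Omega>:
  fixes f :: "'a \<Rightarrow> real"
  assumes "integrable (lebesgue_on \<Omega>) f"
  shows "(\<integral>x. f x \<partial>lebesgue_on \<Omega>) = (\<Sum>K\<in>T. \<integral>x. f x \<partial>lebesgue_on K)"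
  using integral_split(2)[OF \<Omega>_lebesgue subset_refl AE_\<Omega>_cases] integrable_element[OF _ \<Omega>_lebesgue interior_K_subset
      assms]
  by blast

text \<open>The common face is the hull of one vertex set \<open>c\<close>, recovered from either
  element as the extreme points of the intersection. Coefficients of \<open>x\<close> over
  \<open>c\<close>, extended by 0, are its barycentric coordinates in both elements. Hence the
  element picked in \<open>hat\<close> does not matter.\<close>

lemma bary_consistent:
  assumes "K \<in> T" "K' \<in> T" "x \<in> K" "x \<in> K'"
  shows "bary (V K) a x = bary (V K') a x"
proof -
  interpret S: full_simplex "V K" using element(1)[OF assms(1)] .
  interpret S': full_simplex "V K'" using element(1)[OF assms(2)] .
  have KV: "K = convex hull (V K)" "K' = convex hull (V K')"
    using element(2) assms S.K_def S'.K_def by auto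
  have f: "(K \<inter> K') face_of K" "(K \<inter> K') face_of K'" using mesh assms by (auto simp: simplicial_mesh_def)
  obtain c where c: "c \<subseteq> V K" "K \<inter> K' = convex hull c"
    using f(1) face_of_convex_hull_affine_independent[OF S.indep] KV by metis
  obtain c' where c': "c' \<subseteq> V K'" "K \<inter> K' = convex hull c'"
    using f(2) face_of_convex_hull_affine_independent[OF S'.indep] KV by metis
  have "c = {v. v extreme_point_of (K \<inter> K')}"
    using extreme_point_of_convex_hull_affine_independent[OF affine_independent_subset[OF S.indep c(1)]] c(2) by auto
  moreover have "c' = {v. v extreme_point_of (K \<inter> K')}"
    using extreme_point_of_convex_hull_affine_independent[OF affine_independent_subset[OF S'.indep c'(1)]] c'(2) by auto
  ultimately have cc: "c = c'" by simp
  have fc: "finite c" using c(1) S.fin finite_subset by blast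
  have "x \<in> convex hull c" using assms c(2) by auto
  then obtain u where u: "sum u c = 1" "(\<Sum>v\<in>c. u v *\<^sub>R v) = x"
    unfolding convex_hull_finite[OF fc] by auto
  define \<mu> where "\<mu> = (\<lambda>v. if v \<in> c then u v else 0)"
  have s: "(\<Sum>v\<in>W. \<mu> v) = 1" "(\<Sum>v\<in>W. \<mu> v *\<^sub>R v) = x" if "c \<subseteq> W" "finite W" for W
  proof -
    have "(\<Sum>v\<in>W. \<mu> v) = (\<Sum>v\<in>c. u v)"
      using that by (intro sum.mono_neutral_cong_right) (auto simp: \<mu>_def)
    then show "(\<Sum>v\<in>W. \<mu> v) = 1" using u by simp
    have "(\<Sum>v\<in>W. \<mu> v *\<^sub>R v) = (\<Sum>v\<in>c. u v *\<^sub>R v)"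
      using that by (intro sum.mono_neutral_cong_right) (auto simp: \<mu>_def)
    then show "(\<Sum>v\<in>W. \<mu> v *\<^sub>R v) = x" using u by simp
  qed
  have "bary (V K) a x = \<mu> a"
    using S.lam_eqI[OF s[OF c(1) S.fin]] S.lam_outside[of a x] c(1) by (cases "a \<in> V K") (auto simp: \<mu>_def)
  moreover have "bary (V K') a x = \<mu> a"
    using S'.lam_eqI[OF s[OF c'(1)[folded cc] S'.fin]] S'.lam_outside[of a x] c'(1) cc by (cases "a \<in> V K'") (auto
        simp: \<mu>_def)
  ultimately show ?thesis by simp
qed

lemma hat_eq_bary:
  assumes "K \<in> T" "x \<in> K" shows "hat T a x = bary (V K) a x"
proof (cases "\<exists>K\<in>T. x \<in> K \<and> a \<in> V K")
  case True
  define K' where "K' = (SOME K. K \<in> T \<and> x \<in> K \<and> a \<in> V K)"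
  have "\<exists>K. K \<in> T \<and> x \<in> K \<and> a \<in> V K" using True by blast
  from someI_ex[OF this] have "K' \<in> T \<and> x \<in> K' \<and> a \<in> V K'" unfolding K'_def .
  then show ?thesis using bary_consistent[of K' K x a] assms True by (simp add: hat_def K'_def)
next
  case False
  then have "a \<notin> V K" using assms by blast
  then have "bary (V K) a x = 0" using full_simplex.lam_outside[OF element(1)[OF assms(1)]] by blast
  then show ?thesis unfolding hat_def using False by (simp only: if_False)
qed

section \<open>Bounds and weak gradients of the hat functions\<close>

lemma finite_verts: "finite (mesh_verts T)"
  unfolding mesh_verts_def using finite_T full_simplex.fin[OF element(1)] by blast

lemma V_subset_verts: "K \<in> T \<Longrightarrow> V K \<subseteq> mesh_verts T" unfolding mesh_verts_def by blast

lemma hat_bounds: assumes "K \<in> T" "x \<in> K" shows "0 \<le> hat T a x" "hat T a x \<le> 1"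
  using hat_eq_bary[OF assms] full_simplex.lam_nonneg[OF element(1)[OF assms(1)]] full_simplex.lam_le_1[OF
      element(1)[OF assms(1)]]
    element(2)[OF assms(1)] assms(2) by metis+

lemma hat_sum: assumes "K \<in> T" "x \<in> K" shows "(\<Sum>a\<in>V K. hat T a x) = 1"
  using hat_eq_bary[OF assms] full_simplex.lam_sum[OF element(1)[OF assms(1)], of x] by simp

lemma continuous_hat: "continuous_on (\<Union>T) (hat T a)"
proof -
  have "continuous_on (\<Union>K\<in>T. K) (hat T a)"
  proof (rule continuous_on_closed_Union[OF finite_T])
    fix K assume K: "K \<in> T"
    show "closed K" using K_compact[OF K] by (rule compact_imp_closed)
    have "continuous_on K (bary (V K) a)" using full_simplex.continuous_lam[OF element(1)[OF K]] .
    then show "continuous_on K (hat T a)" using hat_eq_bary[OF K] by (simp cong: continuous_on_cong)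
  qed
  then show ?thesis by simp
qed

text \<open>An explicit representative of the weak gradient, constant on each open element and 0
  elsewhere.\<close>

definition hat_grad :: "'a \<Rightarrow> 'a \<Rightarrow> 'a" where
  "hat_grad a x = (\<Sum>K\<in>T. indicator (interior K) x *\<^sub>R full_simplex.dlam (V K) a)"

lemma hat_grad_eq: assumes "K \<in> T" "x \<in> interior K" shows "hat_grad a x = full_simplex.dlam (V K) a"
proof -
  have "indicator (interior K') x *\<^sub>R full_simplex.dlam (V K') a = (if K' = K then full_simplex.dlam (V K) a else 0)"
    if "K' \<in> T" for K'
    using interior_disjoint[of K K'] assms that interior_subset by (auto simp: indicator_def)
  then have "hat_grad a x = (\<Sum>K'\<in>T. if K' = K then full_simplex.dlam (V K) a else 0)"
    unfolding hat_grad_def by (intro sum.cong) auto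
  then show ?thesis using assms finite_T by simp
qed

lemma hat_grad_sum: assumes "K \<in> T" "x \<in> interior K" shows "(\<Sum>a\<in>V K. hat_grad a x) = 0"
proof -
  interpret S: full_simplex "V K" using element(1)[OF assms(1)] .
  have "(\<Sum>a\<in>V K. hat_grad a x) = (\<Sum>a\<in>V K. \<Sum>b\<in>Basis. (bary (V K) a b - bary (V K) a 0) *\<^sub>R b)"
    using hat_grad_eq[OF assms] by (simp add: S.dlam_def)
  also have "\<dots> = (\<Sum>b\<in>Basis. \<Sum>a\<in>V K. (bary (V K) a b - bary (V K) a 0) *\<^sub>R b)" by (rule sum.swap)
  also have "\<dots> = 0" by (intro sum.neutral) (simp add: scaleR_sum_left[symmetric] sum_subtractf S.lam_sum)
  finally show ?thesis .
qed

lemma bounded_measurable_sqi: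
  fixes f :: "'a \<Rightarrow> 'b::euclidean_space"
  assumes "f \<in> borel_measurable (lebesgue_on \<Omega>)" "\<And>x. x \<in> \<Omega> \<Longrightarrow> norm (f x) \<le> B"
  shows "sqi (lebesgue_on \<Omega>) f"
proof -
  have fin: "emeasure lebesgue \<Omega> < \<infinity>"
    using emeasure_bounded_finite[OF bounded_\<Omega>] open_\<Omega> by simp
  have "integrable (lebesgue_on \<Omega>) (\<lambda>x. B\<^sup>2)"
    using fin \<Omega>_lebesgue by (intro finite_measure.integrable_const finite_measureI) (auto simp: emeasure_restrict_space)
  then have "integrable (lebesgue_on \<Omega>) (\<lambda>x. (norm (f x))\<^sup>2)"
  proof (rule Bochner_Integration.integrable_bound)
    show "AE x in lebesgue_on \<Omega>. norm ((norm (f x))\<^sup>2) \<le> norm (B\<^sup>2)"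
    proof (rule AE_I2)
      fix x assume "x \<in> space (lebesgue_on \<Omega>)"
      then have "norm (f x) \<le> B" using assms(2) by simp
      then show "norm ((norm (f x))\<^sup>2) \<le> norm (B\<^sup>2)" by (simp add: power_mono)
    qed
  qed (use assms(1) in simp)
  then show ?thesis using assms(1) by (simp add: sqi_def)
qed

lemma \<Omega>_subset_union: "\<Omega> \<subseteq> \<Union>T" using union_T closure_subset by blast

lemma union_T_borel: "\<Union>T \<in> sets borel" unfolding union_T by simp

lemma hat_measurable: "(\<lambda>x. indicator (\<Union>T) x * hat T a x) \<in> borel_measurable borel"
  using borel_measurable_continuous_on_indicator[OF union_T_borel continuous_hat] by simp

lemma hat_sqi: "sqi (lebesgue_on \<Omega>) (hat T a)"
proof (rule bounded_measurable_sqi)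
  have "(\<lambda>x. indicator (\<Union>T) x * hat T a x) \<in> borel_measurable lebesgue"
    using hat_measurable by (intro measurable_completion) simp
  then have "(\<lambda>x. indicator (\<Union>T) x * hat T a x) \<in> borel_measurable (lebesgue_on \<Omega>)"
    by (rule measurable_restrict_space1)
  then show "hat T a \<in> borel_measurable (lebesgue_on \<Omega>)"
    by (rule measurable_cong[THEN iffD1, rotated]) (use \<Omega>_subset_union in \<open>auto simp: indicator_def\<close>)
  fix x assume "x \<in> \<Omega>"
  then obtain K where "K \<in> T" "x \<in> K" using \<Omega>_subset_union by blast
  then show "norm (hat T a x) \<le> 1" using hat_bounds[of K x a] by simp
qed

lemma hat_grad_measurable: "hat_grad a \<in> borel_measurable borel"
  unfolding hat_grad_def[abs_def] by (intro borel_measurable_sum borel_measurable_scaleR borel_measurable_indicator)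
      auto

lemma hat_grad_bounded: "norm (hat_grad a x) \<le> (\<Sum>K\<in>T. norm (full_simplex.dlam (V K) a))"
proof -
  have "norm (hat_grad a x) \<le> (\<Sum>K\<in>T. norm (indicator (interior K) x *\<^sub>R full_simplex.dlam (V K) a))"
    unfolding hat_grad_def by (rule norm_sum)
  also have "\<dots> \<le> (\<Sum>K\<in>T. norm (full_simplex.dlam (V K) a))" by (intro sum_mono) (auto simp: indicator_def)
  finally show ?thesis .
qed

lemma hat_grad_sqi: "sqi (lebesgue_on \<Omega>) (hat_grad a)"
  by (rule bounded_measurable_sqi[OF _ hat_grad_bounded])
    (intro measurable_restrict_space1 measurable_completion, simp add: hat_grad_measurable)

text \<open>The elements cut the parameter interval into finitely many closed pieces, on each of
  which the slope is that of an affine function. The pieces glue along the interval; the sum over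
  all elements is a crude common bound for the slopes.\<close>

lemma hat_segment_lipschitz:
  assumes t: "0 \<le> t" and seg: "\<And>s. s \<in> {0..t} \<Longrightarrow> x + s *\<^sub>R b \<in> \<Union>T" and b: "norm b \<le> 1"
  shows "\<bar>hat T a (x + t *\<^sub>R b) - hat T a x\<bar> \<le> (\<Sum>K\<in>T. norm (full_simplex.dlam (V K) a)) * t"
proof -
  define L where "L = (\<Sum>K\<in>T. norm (full_simplex.dlam (V K) a))"
  have "L-lipschitz_on {0..t} (\<lambda>s. hat T a (x + s *\<^sub>R b))"
  proof (rule lipschitz_on_closed_Union[where I = T and U = "\<lambda>K. {s \<in> {0..t}. x + s *\<^sub>R b \<in> K}"])
    fix K assume K: "K \<in> T"
    interpret S: full_simplex "V K" using element(1)[OF K] .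
    have "closed ((\<lambda>s. x + s *\<^sub>R b) -` K \<inter> {0..t})"
      using K_compact[OF K]
      by (intro continuous_closed_vimage closed_Int compact_imp_closed) (auto intro!: continuous_intros)
    moreover have "(\<lambda>s. x + s *\<^sub>R b) -` K \<inter> {0..t} = {s \<in> {0..t}. x + s *\<^sub>R b \<in> K}" by auto
    ultimately show "closed {s \<in> {0..t}. x + s *\<^sub>R b \<in> K}" by simp
    show "L-lipschitz_on {s \<in> {0..t}. x + s *\<^sub>R b \<in> K} (\<lambda>s. hat T a (x + s *\<^sub>R b))"
    proof (rule lipschitz_onI)
      fix s s' assume s: "s \<in> {s \<in> {0..t}. x + s *\<^sub>R b \<in> K}" "s' \<in> {s \<in> {0..t}. x + s *\<^sub>R b \<in> K}"
      have "hat T a (x + s *\<^sub>R b) - hat T a (x + s' *\<^sub>R b) = ((x + s *\<^sub>R b) - (x + s' *\<^sub>R b)) \<bullet> S.dlam a"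
        using s hat_eq_bary[OF K] S.lam_diff by auto
      also have "\<dots> = (s - s') * (b \<bullet> S.dlam a)" by (simp add: inner_diff_left algebra_simps)
      finally have "dist (hat T a (x + s *\<^sub>R b)) (hat T a (x + s' *\<^sub>R b)) = \<bar>s - s'\<bar> * \<bar>b \<bullet> S.dlam a\<bar>"
        by (simp add: dist_real_def abs_mult)
      also have "\<dots> \<le> \<bar>s - s'\<bar> * L"
      proof (intro mult_left_mono)
        have "\<bar>b \<bullet> S.dlam a\<bar> \<le> norm b * norm (S.dlam a)" by (rule Cauchy_Schwarz_ineq2)
        also have "\<dots> \<le> 1 * norm (S.dlam a)" using b by (intro mult_right_mono) auto
        also have "\<dots> \<le> L" unfolding L_def using member_le_sum[OF K, of "\<lambda>K. norm (full_simplex.dlam (V K) a)"] finite_T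
            by simp
        finally show "\<bar>b \<bullet> S.dlam a\<bar> \<le> L" .
      qed simp
      finally show "dist (hat T a (x + s *\<^sub>R b)) (hat T a (x + s' *\<^sub>R b)) \<le> L * dist s s'" by (simp add: dist_real_def
          mult.commute)
    qed (simp add: L_def sum_nonneg)
  qed (use seg finite_T in \<open>auto simp: L_def sum_nonneg\<close>)
  from lipschitz_onD[OF this, of t 0] show ?thesis using t by (simp add: L_def dist_real_def)
qed

text \<open>No face terms have to be cancelled: the product with a test function is Lipschitz along
  each coordinate direction, compactly supported and differentiable off the element boundaries, a
  null set. So the integral of its directional derivative is 0.\<close>

lemma hat_H1_grad: "H1_grad \<Omega> (hat T a) (hat_grad a)"
proof (rule weak_gradient_componentwise[OF open_\<Omega> hat_sqi hat_grad_sqi])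
  fix \<phi> :: "'a \<Rightarrow> real" and b :: 'a assume t: "test_fun \<Omega> \<phi>" and b: "b \<in> Basis"
  note D = test_funD[OF t]
  have cont: "continuous_on UNIV \<phi>" "continuous_on UNIV (grad \<phi>)" using C1_grad_continuous C1_gradD(2) D(1) by blast+
  have [measurable]: "\<phi> \<in> borel_measurable borel" "grad \<phi> \<in> borel_measurable borel"
    using cont by (auto intro: borel_measurable_continuous_onI)
  note [measurable] = hat_measurable[of a] hat_grad_measurable[of a]
  have nb: "norm b = 1" using b by simp
  define L where "L = (\<Sum>K\<in>T. norm (full_simplex.dlam (V K) a))"
  define \<psi> where "\<psi> = (\<lambda>x. indicator (\<Union>T) x * hat T a x)"
  have [measurable]: "\<psi> \<in> borel_measurable borel" unfolding \<psi>_def by (rule hat_measurable)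
  define F where "F = (\<lambda>x. \<psi> x * \<phi> x)"
  define F' where "F' = (\<lambda>x. \<psi> x * (grad \<phi> x \<bullet> b) + \<phi> x * (hat_grad a x \<bullet> b))"
  have [measurable]: "F \<in> borel_measurable borel" "F' \<in> borel_measurable borel"
    unfolding F_def F'_def by measurable
  have \<psi>b: "\<bar>\<psi> x\<bar> \<le> 1" for x
  proof (cases "x \<in> \<Union>T")
    case True
    then obtain K where "K \<in> T" "x \<in> K" by blast
    then show ?thesis using hat_bounds[of K x a] True by (simp add: \<psi>_def)
  qed (simp add: \<psi>_def)
  have z: "F x = 0" "F' x = 0" if "x \<notin> tsupp \<phi>" for x using D that by (auto simp: F_def F'_def)
  obtain C\<phi> where C\<phi>0: "\<And>x. x \<in> tsupp \<phi> \<Longrightarrow> \<bar>\<phi> x\<bar> \<le> C\<phi>"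
    using compact_imp_bounded[OF compact_continuous_image[OF continuous_on_subset[OF cont(1)] D(2)]] by (auto simp:
        bounded_iff)
  obtain Cg where Cg0: "\<And>x. x \<in> tsupp \<phi> \<Longrightarrow> norm (grad \<phi> x) \<le> Cg"
    using compact_imp_bounded[OF compact_continuous_image[OF continuous_on_subset[OF cont(2)] D(2)]] by (auto simp:
        bounded_iff)
  have C\<phi>: "\<bar>\<phi> x\<bar> \<le> \<bar>C\<phi>\<bar>" for x using C\<phi>0[of x] D(3)[of x] by (cases "x \<in> tsupp \<phi>") auto
  have Cg: "norm (grad \<phi> x) \<le> \<bar>Cg\<bar>" for x using Cg0[of x] D(4)[of x] by (cases "x \<in> tsupp \<phi>") auto
  have \<phi>lip: "\<bar>\<phi> (x + s *\<^sub>R b) - \<phi> x\<bar> \<le> \<bar>Cg\<bar> * s" if s: "s > 0" for x s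
  proof -
    have line: "((\<lambda>s. \<phi> (x + s *\<^sub>R b)) has_real_derivative (b \<bullet> grad \<phi> (x + s *\<^sub>R b))) (at s)" for s
    proof -
      have "((\<lambda>s. x + s *\<^sub>R b) has_derivative (\<lambda>t. t *\<^sub>R b)) (at s)" by (auto intro!: derivative_eq_intros)
      from has_derivative_compose[OF this C1_gradD(1)[OF D(1)]]
      have "((\<lambda>s. \<phi> (x + s *\<^sub>R b)) has_derivative (\<lambda>t. (t *\<^sub>R b) \<bullet> grad \<phi> (x + s *\<^sub>R b))) (at s)" .
      moreover have "(\<lambda>t. (t *\<^sub>R b) \<bullet> grad \<phi> (x + s *\<^sub>R b)) = (*) (b \<bullet> grad \<phi> (x + s *\<^sub>R b))" by (auto simp:
          mult.commute)
      ultimately show ?thesis by (simp add: has_field_derivative_def)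
    qed
    obtain r where "\<phi> (x + s *\<^sub>R b) - \<phi> (x + 0 *\<^sub>R b) = (s - 0) * (b \<bullet> grad \<phi> (x + r *\<^sub>R b))"
      using MVT2[OF s line] by blast
    moreover have "\<bar>b \<bullet> grad \<phi> (x + r *\<^sub>R b)\<bar> \<le> \<bar>Cg\<bar>"
      using Cauchy_Schwarz_ineq2[of b "grad \<phi> (x + r *\<^sub>R b)"] Cg[of "x + r *\<^sub>R b"] nb by simp
    ultimately show ?thesis using s by (simp add: abs_mult mult.commute mult_left_mono)
  qed
  \<comment> \<open>A step shorter than \<epsilon> that starts or ends in the support stays in
    \<Omega>, hence within the mesh, where the Lipschitz bound along segments is available.\<close>
  obtain \<epsilon> where \<epsilon>: "\<epsilon> > 0" "(\<Union>x\<in>tsupp \<phi>. ball x \<epsilon>) \<subseteq> \<Omega>"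
    using compact_subset_open_imp_ball_epsilon_subset[OF D(2) open_\<Omega> D(5)] by blast
  obtain R where R: "\<And>x. x \<in> tsupp \<phi> \<Longrightarrow> norm x \<le> R" using compact_imp_bounded[OF D(2)] by (auto simp: bounded_iff)
  have "continuous_on (tsupp \<phi>) F"
  proof -
    have "tsupp \<phi> \<subseteq> \<Union>T" using D(5) \<Omega>_subset_union by blast
    then have "continuous_on (tsupp \<phi>) (\<lambda>x. hat T a x * \<phi> x)"
      by (intro continuous_intros continuous_on_subset[OF continuous_hat] continuous_on_subset[OF cont(1)]) auto
    then show ?thesis
      by (rule continuous_on_eq) (use \<open>tsupp \<phi> \<subseteq> \<Union>T\<close> in \<open>auto simp: F_def \<psi>_def indicator_def\<close>)
  qed
  then have "integrable lborel (\<lambda>x. indicator (tsupp \<phi>) x *\<^sub>R F x)"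
    by (intro borel_integrable_compact D(2))
  moreover have "(\<lambda>x. indicator (tsupp \<phi>) x *\<^sub>R F x) = F" using z(1) by (auto simp: indicator_def fun_eq_iff)
  ultimately have iF: "integrable lborel F" by simp
  have "(\<integral>x. F' x \<partial>lborel) = 0"
  proof (rule integral_directional_derivative_eq_0(2)[where G = F and e = b and C = "L * \<bar>C\<phi>\<bar> + \<bar>Cg\<bar>" and R = R and
      ?t0.0 = "\<epsilon> / 2"])
    fix x and s :: real assume s: "0 < s" "s \<le> \<epsilon> / 2"
    show "\<bar>F (x + s *\<^sub>R b) - F x\<bar> \<le> (L * \<bar>C\<phi>\<bar> + \<bar>Cg\<bar>) * s"
    proof (cases "x \<in> tsupp \<phi> \<or> x + s *\<^sub>R b \<in> tsupp \<phi>")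
      case True
      have seg: "x + r *\<^sub>R b \<in> \<Union>T" if r: "r \<in> {0..s}" for r
      proof -
        have "x + r *\<^sub>R b \<in> \<Omega>"
          using True
        proof
          assume "x \<in> tsupp \<phi>"
          moreover have "x + r *\<^sub>R b \<in> ball x \<epsilon>" using r s \<epsilon>(1) nb by (simp add: dist_norm)
          ultimately show ?thesis using \<epsilon>(2) by blast
        next
          assume "x + s *\<^sub>R b \<in> tsupp \<phi>"
          moreover have "x + r *\<^sub>R b \<in> ball (x + s *\<^sub>R b) \<epsilon>"
          proof -
            have "x + s *\<^sub>R b - (x + r *\<^sub>R b) = (s - r) *\<^sub>R b" by (simp add: algebra_simps)
            then show ?thesis using r s \<epsilon>(1) nb by (simp add: dist_norm)
          qed
          ultimately show ?thesis using \<epsilon>(2) by blast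
        qed
        then show ?thesis using \<Omega>_subset_union by blast
      qed
      have "\<bar>\<psi> (x + s *\<^sub>R b) - \<psi> x\<bar> \<le> L * s"
        using hat_segment_lipschitz[OF less_imp_le[OF s(1)] seg, of a] nb seg[of s] seg[of 0] s(1) by (simp add: \<psi>_def
            L_def)
      then have "\<bar>(\<psi> (x + s *\<^sub>R b) - \<psi> x) * \<phi> (x + s *\<^sub>R b)\<bar> \<le> (L * s) * \<bar>C\<phi>\<bar>"
        unfolding abs_mult using C\<phi> by (intro mult_mono) auto
      moreover have "\<bar>\<psi> x * (\<phi> (x + s *\<^sub>R b) - \<phi> x)\<bar> \<le> 1 * (\<bar>Cg\<bar> * s)"
        unfolding abs_mult using \<psi>b \<phi>lip[OF s(1)] by (intro mult_mono) auto
      moreover have "F (x + s *\<^sub>R b) - F x = (\<psi> (x + s *\<^sub>R b) - \<psi> x) * \<phi> (x + s *\<^sub>R b) + \<psi> x * (\<phi> (x + s *\<^sub>R b) - \<phi> x)"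
        by (simp add: F_def algebra_simps)
      ultimately have "\<bar>F (x + s *\<^sub>R b) - F x\<bar> \<le> (L * s) * \<bar>C\<phi>\<bar> + 1 * (\<bar>Cg\<bar> * s)" by linarith
      then show ?thesis by (simp add: algebra_simps)
    next
      case False
      then show ?thesis using z(1) s(1) by (simp add: L_def sum_nonneg)
    qed
  next
    have "AE x in lebesgue. ((\<lambda>t. (F (x + t *\<^sub>R b) - F x) / t) \<longlongrightarrow> F' x) (at_right 0)"
      using AE_\<Omega>_cases
    proof eventually_elim
      case (elim x)
      have line0: "((\<lambda>t. x + t *\<^sub>R b) \<longlongrightarrow> x) (at_right 0)" by (rule tendsto_eq_intros refl | simp)+
      show ?case
      proof (cases "x \<in> tsupp \<phi>")
        case True
        then obtain K where K: "K \<in> T" "x \<in> interior K" using elim D(5) by blast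
        interpret S: full_simplex "V K" using element(1)[OF K(1)] .
        have \<psi>K: "\<psi> y = bary (V K) a x + (y - x) \<bullet> S.dlam a" if "y \<in> K" for y
        proof -
          have "y \<in> \<Union>T" using K(1) that by blast
          then have "\<psi> y = bary (V K) a y" using hat_eq_bary[OF K(1) that] by (simp add: \<psi>_def)
          then show ?thesis using S.lam_diff[of a y x] by simp
        qed
        have xK: "x \<in> K" using K(2) interior_subset by blast
        have "((\<lambda>y. (bary (V K) a x + (y - x) \<bullet> S.dlam a) * \<phi> y) has_derivative
           (\<lambda>h. (bary (V K) a x + (x - x) \<bullet> S.dlam a) * (h \<bullet> grad \<phi> x) + (h \<bullet> S.dlam a) * \<phi> x)) (at x)"
          by (intro has_derivative_mult C1_gradD(1)[OF D(1)]) (auto intro!: derivative_eq_intros)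
        then have "(F has_derivative (\<lambda>h. (bary (V K) a x + (x - x) \<bullet> S.dlam a) * (h \<bullet> grad \<phi> x) + (h \<bullet> S.dlam a) * \<phi>
            x)) (at x)"
          by (rule has_derivative_transform_within_open[of _ _ _ _ "interior K"])
            (use K(2) \<psi>K[OF subsetD[OF interior_subset]] in \<open>auto simp: F_def\<close>)
        moreover have "(bary (V K) a x + (x - x) \<bullet> S.dlam a) = \<psi> x" using \<psi>K[OF xK] by simp
        moreover have "hat_grad a x = S.dlam a" by (rule hat_grad_eq[OF K])
        ultimately have "(F has_derivative (\<lambda>h. \<psi> x * (h \<bullet> grad \<phi> x) + (h \<bullet> hat_grad a x) * \<phi> x)) (at x)" by simp
        then have "(F has_derivative (\<lambda>h. \<psi> x * (h \<bullet> grad \<phi> x) + (h \<bullet> hat_grad a x) * \<phi> x)) (at (x + 0 *\<^sub>R b))" by simp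
        moreover have "((\<lambda>s. x + s *\<^sub>R b) has_derivative (\<lambda>t. t *\<^sub>R b)) (at (0::real))" by (auto intro!:
            derivative_eq_intros)
        ultimately have "((\<lambda>s. F (x + s *\<^sub>R b)) has_derivative (\<lambda>t. \<psi> x * ((t *\<^sub>R b) \<bullet> grad \<phi> x) + ((t *\<^sub>R b) \<bullet>
            hat_grad a x) * \<phi> x)) (at 0)"
          using has_derivative_compose[of "\<lambda>s. x + s *\<^sub>R b" "\<lambda>t. t *\<^sub>R b" 0 UNIV F] by blast
        moreover have "(\<lambda>t. \<psi> x * ((t *\<^sub>R b) \<bullet> grad \<phi> x) + ((t *\<^sub>R b) \<bullet> hat_grad a x) * \<phi> x) = (*) (F' x)"
          by (auto simp: F'_def inner_commute algebra_simps)
        ultimately have "((\<lambda>s. F (x + s *\<^sub>R b)) has_real_derivative F' x) (at 0)" by (simp add: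
            has_field_derivative_def)
        then have "((\<lambda>s. (F (x + s *\<^sub>R b) - F x) / s) \<longlongrightarrow> F' x) (at 0)" by (simp add: has_field_derivative_iff)
        then show ?thesis by (rule tendsto_mono[rotated]) (simp add: at_le)
      next
        case False
        have "open (- tsupp \<phi>)" unfolding tsupp_def by (intro open_Compl closed_closure)
        then have "\<forall>\<^sub>F s in at_right 0. x + s *\<^sub>R b \<in> - tsupp \<phi>" using topological_tendstoD[OF line0] False by blast
        then have "\<forall>\<^sub>F s in at_right 0. 0 = (F (x + s *\<^sub>R b) - F x) / s"
          by (rule eventually_mono) (use z(1) False in auto)
        then have "((\<lambda>s. (F (x + s *\<^sub>R b) - F x) / s) \<longlongrightarrow> 0) (at_right 0)"
          using Lim_transform_eventually[OF tendsto_const] by fast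
        then show ?thesis using z(2)[OF False] by simp
      qed
    qed
    then show "AE x in lborel. ((\<lambda>t. (F (x + t *\<^sub>R b) - F x) / t) \<longlongrightarrow> F' x) (at_right 0)"
      by (simp add: AE_completion_iff)
  qed (use iF z(1) R \<epsilon>(1) in auto)
  also have "(\<integral>x. F' x \<partial>lborel) = (\<integral>x. F' x \<partial>lebesgue)" by (rule integral_completion[symmetric]) simp
  also have "\<dots> = (\<integral>x. indicator \<Omega> x *\<^sub>R F' x \<partial>lebesgue)"
    using z(2) D(5) by (intro Bochner_Integration.integral_cong refl) (auto simp: indicator_def)
  also have "\<dots> = (\<integral>x. F' x \<partial>lebesgue_on \<Omega>)" using \<Omega>_lebesgue by (simp add: integral_restrict_space)
  also have "\<dots> = (\<integral>x. (hat T a x *\<^sub>R grad \<phi> x + \<phi> x *\<^sub>R hat_grad a x) \<bullet> b \<partial>lebesgue_on \<Omega>)"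
  proof (intro Bochner_Integration.integral_cong refl)
    fix x assume "x \<in> space (lebesgue_on \<Omega>)"
    then have "x \<in> \<Union>T" using \<Omega>_subset_union by auto
    then show "F' x = (hat T a x *\<^sub>R grad \<phi> x + \<phi> x *\<^sub>R hat_grad a x) \<bullet> b" by (simp add: F'_def \<psi>_def inner_add_left)
  qed
  finally show "(\<integral>x. (hat T a x *\<^sub>R grad \<phi> x + \<phi> x *\<^sub>R hat_grad a x) \<bullet> b \<partial>lebesgue_on \<Omega>) = 0" by simp
qed

text \<open>Gradient of a partition of unity. It removes the terms with the gradient of
  \<open>uh\<close> from the sum of the patch equations.\<close>

lemma wgrad_hat_sum:
  assumes "K \<in> T" shows "AE x in lebesgue. x \<in> interior K \<longrightarrow> (\<Sum>a\<in>V K. wgrad \<Omega> (hat T a) x) = 0"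
proof -
  have "AE x in lebesgue. \<forall>a\<in>V K. x \<in> \<Omega> \<longrightarrow> wgrad \<Omega> (hat T a) x = hat_grad a x"
    by (intro AE_finite_allI full_simplex.fin[OF element(1)[OF assms]] wgrad_AE_eq[OF open_\<Omega> hat_H1_grad])
  then show ?thesis
    by eventually_elim (use interior_K_subset[OF assms] hat_grad_sum[OF assms] in auto)
qed

end

section \<open>Local projections, equilibration and element bounds\<close>

text \<open>The left-hand side gathers the factors of \<open>flux_bound\<close> for
  \<open>N = p + 1\<close>, the degree of a Raviart-Thomas field, with \<open>th\<close> for the
  ratio of diameter to \<open>rho\<close>. From dimension 3 on, the trace part of
  \<open>C_star\<close> is large enough by itself; in dimensions 1 and 2 the part
  \<open>C_elem\<close> is added.\<close>

lemma C_star_bound: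
  fixes p d :: nat and th :: real
  assumes p: "p \<ge> 1" and d: "d \<ge> 1" and th: "th \<ge> 0"
  shows "2 * sqrt (real d) * (191/100 * sqrt (real ((p + 1 + 1) * (p + 1 + d)))) * th \<le> sqrt 2 * C_star (real p) (real
      d) th"
proof -
  define M where "M = (real p + 2) * (real p + real d + 1)"
  define X where "X = sqrt M"
  have M0: "M \<ge> 0" by (simp add: M_def)
  have X0: "X \<ge> 0" by (simp add: X_def M0)
  have Meq: "real ((p + 1 + 1) * (p + 1 + d)) = M" by (simp add: M_def algebra_simps)
  define q where "q = sqrt (real p * (real p + 1) * (real p + 2) * (real p + 3))"
  have q0: "q \<ge> 0" by (simp add: q_def)
  define E where "E = sqrt (real d) * (sqrt 5 / 4) * (2 * sqrt 2) powr real d * q"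
  have E0: "E \<ge> 0" by (simp add: E_def q0)
  have el: "C_elem (real p) (real d) th = th * E" by (simp add: C_elem_def E_def q_def)
  have tr: "C_Tr (real d) th * C_bdry (real p) (real d) th = th * ((real d + 1) * sqrt (2 + real d / pi) * X)"
  proof -
    have "C_Tr (real d) th * C_bdry (real p) (real d) th = sqrt ((th * (real d + 1))\<^sup>2 * ((2 + real d / pi) * M))"
      by (simp add: C_Tr_def C_bdry_def M_def real_sqrt_mult[symmetric] power2_eq_square algebra_simps)
    also have "\<dots> = \<bar>th * (real d + 1)\<bar> * (sqrt (2 + real d / pi) * X)" by (simp add: real_sqrt_mult X_def)
    finally show ?thesis using th by (simp add: abs_mult)
  qed
  have sp: "sqrt pi \<le> 2" using pi_less_4 real_sqrt_le_mono[of pi 4] by simp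
  have "1 / sqrt pi \<ge> 1 / 2" using sp by (intro divide_left_mono) auto
  then have "(1 / sqrt pi) * (th * E) \<ge> (1 / 2) * (th * E)" using th E0 by (intro mult_right_mono) auto
  then have lower: "th * (E / 2 + (real d + 1) * sqrt (2 + real d / pi) * X) \<le> sqrt 2 * C_star (real p) (real d) th"
    unfolding C_star_def el tr by (simp add: distrib_left)
  have pil: "real d / 4 \<le> real d / pi" using pi_less_4 by (intro divide_left_mono) auto
  have qd: "q \<ge> sqrt 2 * sqrt ((real p + 2) * (real p + 3))"
  proof -
    have "1 * (1 + 1) \<le> real p * (real p + 1)" using p by (intro mult_mono) auto
    then have "2 * ((real p + 2) * (real p + 3)) \<le> (real p * (real p + 1)) * ((real p + 2) * (real p + 3))"
      by (intro mult_right_mono) auto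
    then show ?thesis unfolding q_def real_sqrt_mult[symmetric] by (intro real_sqrt_le_mono) (simp add: mult.assoc)
  qed
  have main: "2 * sqrt (real d) * (191/100 * X) \<le> E / 2 + (real d + 1) * sqrt (2 + real d / pi) * X"
  proof -
    consider "d = 1" | "d = 2" | "d \<ge> 3" using d by linarith
    then show ?thesis
    proof cases
      case 1
      have "M = (real p + 2)\<^sup>2" using 1 by (simp add: M_def power2_eq_square algebra_simps)
      then have "X = real p + 2" by (simp add: X_def)
      have "sqrt ((real p + 2) * (real p + 3)) \<ge> sqrt ((real p + 2)\<^sup>2)"
        by (intro real_sqrt_le_mono) (simp add: power2_eq_square)
      then have "sqrt 2 * (real p + 2) \<le> sqrt 2 * sqrt ((real p + 2) * (real p + 3))" by (intro mult_left_mono) auto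
      with qd have "sqrt 2 * (real p + 2) \<le> q" by linarith
      then have "sqrt 5 / 4 * (2 * sqrt 2) * (sqrt 2 * (real p + 2)) \<le> E"
        unfolding E_def 1 by (simp add: mult_left_mono)
      also have "sqrt 5 / 4 * (2 * sqrt 2) * (sqrt 2 * (real p + 2)) = sqrt 5 * X"
      proof -
        have "sqrt 5 / 4 * (2 * sqrt 2) * (sqrt 2 * (real p + 2)) = (sqrt 2 * sqrt 2) * (sqrt 5 / 4) * 2 * (real p + 2)"
          by (simp only: mult_ac)
        then show ?thesis using \<open>X = real p + 2\<close> by (simp only: real_sqrt_mult_self abs_numeral, simp?)
      qed
      finally have e: "sqrt 5 * X \<le> E" .
      have "(2::real) \<le> sqrt 5" by (intro real_le_rsqrt) simp
      then have "2 * X \<le> sqrt 5 * X" using X0 by (intro mult_right_mono)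
      \<comment> \<open>In dimension 1: \<open>E / 2\<close> yields \<open>X\<close> and the trace
        part \<open>3 * X\<close>, against \<open>382/100 * X\<close> on the left.\<close>
      with e have e2: "2 * X \<le> E" by linarith
      have "3 / 2 \<le> sqrt (2 + real d / pi)" using pil 1 by (intro real_le_rsqrt) (simp add: power2_eq_square)
      then have "2 * (3 / 2) * X \<le> (real d + 1) * sqrt (2 + real d / pi) * X"
        using X0 1 by (intro mult_right_mono mult_mono) auto
      then show ?thesis using e2 X0 1 by simp
    next
      case 2
      have "X = sqrt ((real p + 2) * (real p + 3))" using 2 by (simp add: X_def M_def)
      then have qX: "sqrt 2 * X \<le> q" using qd by simp
      have sd: "sqrt (real d) = sqrt 2" using 2 by simp
      have pw: "(2 * sqrt 2) powr real d = 8" using 2 by (simp add: powr_realpow power2_eq_square)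
      have "sqrt 2 * (sqrt 5 / 4) * 8 * (sqrt 2 * X) \<le> E"
        unfolding E_def pw sd using qX by (intro mult_left_mono) auto
      moreover have "sqrt 2 * (sqrt 5 / 4) * 8 * (sqrt 2 * X) = 4 * sqrt 5 * X"
      proof -
        have "sqrt 2 * (sqrt 5 / 4) * 8 * (sqrt 2 * X) = (sqrt 2 * sqrt 2) * (sqrt 5 / 4) * 8 * X" by (simp only:
            mult_ac)
        then show ?thesis by (simp only: real_sqrt_mult_self abs_numeral, simp?)
      qed
      ultimately have "4 * sqrt 5 * X \<le> E" by (simp only:)
      moreover have "(2::real) \<le> sqrt 5" by (intro real_le_rsqrt) simp
      then have "4 * 2 * X \<le> 4 * sqrt 5 * X" using X0 by (intro mult_right_mono) auto
      \<comment> \<open>In dimension 2: \<open>E / 2\<close> yields \<open>4 * X\<close> and the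
        trace part \<open>9/2 * X\<close>, against at most \<open>573/100 * X\<close> on the
        left.\<close>
      ultimately have e2: "8 * X \<le> E" by linarith
      have "sqrt (real d) \<le> 3 / 2" using 2 by (intro real_le_lsqrt) (auto simp: power2_eq_square)
      then have "2 * sqrt (real d) * (191/100 * X) \<le> 2 * (3 / 2) * (191/100 * X)" using X0 by (intro mult_right_mono)
          auto
      moreover have "3 / 2 \<le> sqrt (2 + real d / pi)" using pil 2 by (intro real_le_rsqrt) (simp add: power2_eq_square)
      then have "3 * (3 / 2) * X \<le> (real d + 1) * sqrt (2 + real d / pi) * X"
        using X0 2 by (intro mult_right_mono mult_mono) auto
      ultimately show ?thesis using e2 X0 by simp
    next
      case 3
      have "2 * sqrt (real d) * (191/100) \<le> (real d + 1) * sqrt (2 + real d / pi)"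
      proof (rule power2_le_imp_le)
        have d3: "real d \<ge> 3" using 3 by simp
        \<comment> \<open>The bound \<open>16 / 3 * d \<le> (d + 1)\<^sup>2\<close> is sharp at
          \<open>d = 3\<close>. What remains after multiplication by \<open>11 / 4\<close> is the
          factor \<open>44 / 3\<close> against \<open>145924 / 10000\<close>.\<close>
        have "0 \<le> (3 * real d - 1) * (real d - 3)" using d3 by (intro mult_nonneg_nonneg) auto
        then have a: "16 / 3 * real d \<le> (real d + 1)\<^sup>2" by (simp add: power2_eq_square algebra_simps)
        have b: "11 / 4 \<le> 2 + real d / pi" using pil d3 by simp
        have "(16 / 3 * real d) * (11 / 4) \<le> (real d + 1)\<^sup>2 * (2 + real d / pi)"
          using a b by (intro mult_mono) auto
        moreover have "(2 * sqrt (real d) * (191/100))\<^sup>2 = 145924 / 10000 * real d" by (simp add: power_mult_distrib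
            power2_eq_square)
        ultimately show "(2 * sqrt (real d) * (191/100))\<^sup>2 \<le> ((real d + 1) * sqrt (2 + real d / pi))\<^sup>2"
          by (simp add: power_mult_distrib)
      qed simp
      then have "2 * sqrt (real d) * (191/100) * X \<le> (real d + 1) * sqrt (2 + real d / pi) * X"
        using X0 by (rule mult_right_mono)
      moreover have "2 * sqrt (real d) * (191/100 * X) = 2 * sqrt (real d) * (191/100) * X" by simp
      ultimately show ?thesis using E0 by linarith
    qed
  qed
  have "2 * sqrt (real d) * (191/100 * X) * th \<le> (E / 2 + (real d + 1) * sqrt (2 + real d / pi) * X) * th"
    using main th by (rule mult_right_mono)
  then show ?thesis using lower unfolding Meq X_def[symmetric] by (simp add: mult.commute)
qed

lemma sqrt_mult_le_half_sum: "0 \<le> a \<Longrightarrow> 0 \<le> b \<Longrightarrow> sqrt 2 * sqrt (a * b) \<le> sqrt (a\<^sup>2 + b\<^sup>2)"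
  unfolding real_sqrt_mult[symmetric] using sum_squares_bound[of a b] by (intro real_sqrt_le_mono) simp

context fe_mesh
begin

section \<open>The projection onto piecewise polynomials\<close>

lemma sqi_mult_hat: assumes "sqi (lebesgue_on \<Omega>) f" shows "sqi (lebesgue_on \<Omega>) (\<lambda>x. f x * hat T a x)"
proof -
  have m: "f \<in> borel_measurable (lebesgue_on \<Omega>)" "hat T a \<in> borel_measurable (lebesgue_on \<Omega>)"
    using assms hat_sqi by (auto simp: sqi_def)
  have "integrable (lebesgue_on \<Omega>) (\<lambda>x. (f x)\<^sup>2)" using assms by (simp add: sqi_def)
  then have "integrable (lebesgue_on \<Omega>) (\<lambda>x. (f x * hat T a x)\<^sup>2)"
  proof (rule Bochner_Integration.integrable_bound)
    show "AE x in lebesgue_on \<Omega>. norm ((f x * hat T a x)\<^sup>2) \<le> norm ((f x)\<^sup>2)"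
    proof (rule AE_I2)
      fix x assume "x \<in> space (lebesgue_on \<Omega>)"
      then obtain K where "K \<in> T" "x \<in> K" using \<Omega>_subset_union by auto
      then have "(hat T a x)\<^sup>2 \<le> 1" using hat_bounds[of K x a] by (simp add: power_le_one)
      then show "norm ((f x * hat T a x)\<^sup>2) \<le> norm ((f x)\<^sup>2)" by (simp add: power_mult_distrib mult_left_le)
    qed
  qed (use m in simp)
  then show ?thesis using m by (simp add: sqi_def)
qed

text \<open>\<open>Pih\<close> is a choice, so a witness has to be built: the elementwise
  projections, glued on the open elements and set to 0 on the remaining null set.\<close>

lemma Pih_spec:
  assumes f: "sqi (lebesgue_on \<Omega>) f"
  shows "pw_poly p T (Pih \<Omega> T p f)" "sqi (lebesgue_on \<Omega>) (Pih \<Omega> T p f)"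
    "\<And>q. pw_poly p T q \<Longrightarrow> (\<integral>x. (f x - Pih \<Omega> T p f x) * q x \<partial>lebesgue_on \<Omega>) = 0"
proof -
  have fK: "sqi (lebesgue_on K) f" if "K \<in> T" for K
    using sqi_element[OF that \<Omega>_lebesgue interior_K_subset[OF that] f] .
  have "\<exists>r. pol (Suc p) r \<and> (\<forall>s. pol (Suc p) s \<longrightarrow> (\<integral>x. (f x - r x) * s x \<partial>lebesgue_on K) = 0)" if "K \<in> T" for K
    using full_simplex.K_projection[OF element(1)[OF that], of f "Suc p"] fK[OF that] element(2)[OF that] by simp
  then obtain r where r: "\<And>K. K \<in> T \<Longrightarrow> pol (Suc p) (r K)"
    "\<And>K s. K \<in> T \<Longrightarrow> pol (Suc p) s \<Longrightarrow> (\<integral>x. (f x - r K x) * s x \<partial>lebesgue_on K) = 0" by metis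
  define g where "g = (\<lambda>x. \<Sum>K\<in>T. indicator (interior K) x * r K x)"
  have gK: "g x = r K x" if "K \<in> T" "x \<in> interior K" for K x
  proof -
    have "indicator (interior K') x * r K' x = (if K' = K then r K x else 0)" if "K' \<in> T" for K'
      using interior_disjoint[of K K'] \<open>K \<in> T\<close> \<open>x \<in> interior K\<close> that interior_subset by (auto simp: indicator_def)
    then have "g x = (\<Sum>K'\<in>T. if K' = K then r K x else 0)" unfolding g_def by (intro sum.cong) auto
    then show ?thesis using that finite_T by simp
  qed
  have pw: "pw_poly p T g" unfolding pw_poly_def poly_le_iff_pol using r(1) gK by blast
  have polK: "sqi (lebesgue_on K) s" if "K \<in> T" "pol n s" for K n s
    using sqi_compact[OF K_compact[OF that(1)] pol_continuous[OF that(2)]] .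
  have gsq: "sqi (lebesgue_on \<Omega>) g"
  proof -
    have "g \<in> borel_measurable borel" unfolding g_def
      using r(1) pol_continuous
      by (intro borel_measurable_sum borel_measurable_times borel_measurable_indicator borel_measurable_continuous_onI)
          auto
    then have m: "g \<in> borel_measurable (lebesgue_on \<Omega>)" by (intro measurable_restrict_space1 measurable_completion) simp
    have "integrable (lebesgue_on \<Omega>) (\<lambda>x. (g x)\<^sup>2)"
    proof (rule integral_split(1)[OF \<Omega>_lebesgue subset_refl AE_\<Omega>_cases])
      fix K assume K: "K \<in> T"
      have "integrable (lebesgue_on K) (\<lambda>x. (r K x)\<^sup>2)" using polK[OF K r(1)[OF K]] by (simp add: sqi_def)
      then show "integrable (lebesgue_on K) (\<lambda>x. (g x)\<^sup>2)"
        using on_element_cong(2)[OF K, of "\<lambda>x. (g x)\<^sup>2" "\<lambda>x. (r K x)\<^sup>2"] gK[OF K] by simp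
    qed
    then show ?thesis using m by (simp add: sqi_def)
  qed
  have orth: "(\<integral>x. (f x - g x) * q x \<partial>lebesgue_on \<Omega>) = 0" if "pw_poly p T q" for q
  proof -
    have ex: "\<exists>s. pol (Suc p) s \<and> (\<forall>x\<in>interior K. q x = s x)" if "K \<in> T" for K
      using \<open>pw_poly p T q\<close> that unfolding pw_poly_def poly_le_iff_pol by blast
    have K1: "integrable (lebesgue_on K) (\<lambda>x. (f x - g x) * q x) \<and> (\<integral>x. (f x - g x) * q x \<partial>lebesgue_on K) = 0" if K: "K
        \<in> T" for K
    proof -
      obtain s where s: "pol (Suc p) s" "\<And>x. x \<in> interior K \<Longrightarrow> q x = s x" using ex[OF K] by blast
      have ae: "AE x in lebesgue. x \<in> interior K \<longrightarrow> (f x - g x) * q x = (f x - r K x) * s x"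
        using gK[OF K] s(2) by simp
      have "integrable (lebesgue_on K) (\<lambda>x. (f x - r K x) * s x)"
        by (intro sqi_mult_integrable sqi_diff fK[OF K] polK[OF K r(1)[OF K]] polK[OF K s(1)])
      then show ?thesis using on_element_cong(1,2)[OF K ae] r(2)[OF K s(1)] by simp
    qed
    then show ?thesis using integral_split(2)[OF \<Omega>_lebesgue subset_refl AE_\<Omega>_cases, of "\<lambda>x. (f x - g x) * q x"] by simp
  qed
  have "\<exists>g. pw_poly p T g \<and> L2 \<Omega> g \<and> (\<forall>q. pw_poly p T q \<longrightarrow> (LINT x:\<Omega>|lebesgue. (f x - g x) * q x) = 0)"
    using pw gsq orth \<Omega>_lebesgue by (intro exI[of _ g]) (simp add: L2_iff_sqi set_integral_lebesgue_on)
  from someI_ex[OF this, folded Pih_def]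
  show "pw_poly p T (Pih \<Omega> T p f)" "sqi (lebesgue_on \<Omega>) (Pih \<Omega> T p f)"
    "\<And>q. pw_poly p T q \<Longrightarrow> (\<integral>x. (f x - Pih \<Omega> T p f x) * q x \<partial>lebesgue_on \<Omega>) = 0"
    using \<Omega>_lebesgue by (simp_all add: L2_iff_sqi set_integral_lebesgue_on)
qed

text \<open>A polynomial cut off to one open element is still piecewise polynomial, so testing with
  it localises the orthogonality.\<close>

lemma Pih_local:
  assumes f: "sqi (lebesgue_on \<Omega>) f" and K: "K \<in> T"
  shows "\<exists>r. pol (Suc p) r \<and> (\<forall>x\<in>interior K. Pih \<Omega> T p f x = r x) \<and>
    (\<forall>s. pol (Suc p) s \<longrightarrow> (\<integral>x. (f x - r x) * s x \<partial>lebesgue_on K) = 0)"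
proof -
  obtain r where r: "pol (Suc p) r" "\<And>x. x \<in> interior K \<Longrightarrow> Pih \<Omega> T p f x = r x"
    using Pih_spec(1)[OF f, of p] K unfolding pw_poly_def poly_le_iff_pol by blast
  have "(\<integral>x. (f x - r x) * s x \<partial>lebesgue_on K) = 0" if s: "pol (Suc p) s" for s
  proof -
    define q where "q = (\<lambda>x. indicator (interior K) x * s x)"
    have "pw_poly p T q" unfolding pw_poly_def poly_le_iff_pol
    proof
      fix K' assume K': "K' \<in> T"
      show "\<exists>s. pol (Suc p) s \<and> (\<forall>x\<in>interior K'. q x = s x)"
      proof (cases "K' = K")
        case True
        then show ?thesis using s by (auto simp: q_def)
      next
        case False
        have "q x = 0" if "x \<in> interior K'" for x
          using interior_disjoint[OF K' K False] that interior_subset by (auto simp: q_def indicator_def)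
        then show ?thesis using pol_zero by blast
      qed
    qed
    from Pih_spec(3)[OF f this]
    have "0 = (\<integral>x. (f x - Pih \<Omega> T p f x) * q x \<partial>lebesgue_on \<Omega>)" by simp
    also have "\<dots> = (\<integral>x. (f x - Pih \<Omega> T p f x) * q x \<partial>lebesgue_on (interior K))"
      by (rule integral_lebesgue_on_cong_support[OF \<Omega>_lebesgue _ interior_K_subset[OF K]]) (auto simp: q_def)
    also have "\<dots> = (\<integral>x. (f x - r x) * s x \<partial>lebesgue_on K)"
      by (rule on_element_interior(1)[OF K, symmetric]) (auto simp: q_def r(2))
    finally show ?thesis by simp
  qed
  then show ?thesis using r by blast
qed

text \<open>The chosen functions need not add up literally, so the polynomials representing them on
  \<open>K\<close> are compared. Their difference \<open>w\<close> is orthogonal to all of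
  \<open>pol (Suc p)\<close>, itself included, because the hats sum to 1 on
  \<open>K\<close>.\<close>

lemma Pih_hat_sum:
  assumes f: "sqi (lebesgue_on \<Omega>) f" and K: "K \<in> T"
  shows "AE x in lebesgue. x \<in> interior K \<longrightarrow> (\<Sum>a\<in>V K. Pih \<Omega> T p (\<lambda>y. f y * hat T a y) x) = Pih \<Omega> T p f x"
proof -
  have finV: "finite (V K)" using full_simplex.fin[OF element(1)[OF K]] .
  have fK: "sqi (lebesgue_on K) f" using sqi_element[OF K \<Omega>_lebesgue interior_K_subset[OF K] f] .
  have fhK: "sqi (lebesgue_on K) (\<lambda>x. f x * hat T a x)" for a
    using sqi_element[OF K \<Omega>_lebesgue interior_K_subset[OF K] sqi_mult_hat[OF f]] .
  obtain r where r: "pol (Suc p) r" "\<And>x. x \<in> interior K \<Longrightarrow> Pih \<Omega> T p f x = r x"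
    "\<And>s. pol (Suc p) s \<Longrightarrow> (\<integral>x. (f x - r x) * s x \<partial>lebesgue_on K) = 0" using Pih_local[OF f K, of p] by blast
  have "\<forall>a. \<exists>r. pol (Suc p) r \<and> (\<forall>x\<in>interior K. Pih \<Omega> T p (\<lambda>y. f y * hat T a y) x = r x) \<and>
    (\<forall>s. pol (Suc p) s \<longrightarrow> (\<integral>x. (f x * hat T a x - r x) * s x \<partial>lebesgue_on K) = 0)"
    using Pih_local[OF sqi_mult_hat[OF f] K] by (rule allI)
  from choice[OF this] obtain ra where ra: "\<And>a. pol (Suc p) (ra a)"
    "\<And>a x. x \<in> interior K \<Longrightarrow> Pih \<Omega> T p (\<lambda>y. f y * hat T a y) x = ra a x"
    "\<And>a s. pol (Suc p) s \<Longrightarrow> (\<integral>x. (f x * hat T a x - ra a x) * s x \<partial>lebesgue_on K) = 0" by blast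
  define w where "w = (\<lambda>x. (\<Sum>a\<in>V K. ra a x) - r x)"
  have w: "pol (Suc p) w" unfolding w_def by (intro pol_diff pol_sum ra(1) r(1))
  have sq: "sqi (lebesgue_on K) s" if "pol n s" for n s
    using sqi_compact[OF K_compact[OF K] pol_continuous[OF that]] .
  have "(\<integral>x. (w x)\<^sup>2 \<partial>lebesgue_on K) = (\<integral>x. (f x - r x) * w x - (\<Sum>a\<in>V K. (f x * hat T a x - ra a x) * w x) \<partial>lebesgue_on
      K)"
  proof (intro Bochner_Integration.integral_cong refl)
    fix x assume "x \<in> space (lebesgue_on K)"
    then have "(\<Sum>a\<in>V K. f x * hat T a x) = f x" using hat_sum[OF K] by (simp add: sum_distrib_left[symmetric])
    then have "(\<Sum>a\<in>V K. (f x * hat T a x - ra a x)) = f x - (\<Sum>a\<in>V K. ra a x)" by (simp add: sum_subtractf)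
    then have "(\<Sum>a\<in>V K. (f x * hat T a x - ra a x) * w x) = (f x - (\<Sum>a\<in>V K. ra a x)) * w x" by (simp add:
        sum_distrib_right[symmetric])
    then show "(w x)\<^sup>2 = (f x - r x) * w x - (\<Sum>a\<in>V K. (f x * hat T a x - ra a x) * w x)"
      by (simp add: w_def power2_eq_square algebra_simps)
  qed
  also have "\<dots> = (\<integral>x. (f x - r x) * w x \<partial>lebesgue_on K) - (\<Sum>a\<in>V K. \<integral>x. (f x * hat T a x - ra a x) * w x \<partial>lebesgue_on K)"
    by (subst Bochner_Integration.integral_diff, (intro sqi_mult_integrable sqi_diff Bochner_Integration.integrable_sum
        fK fhK sq[OF r(1)] sq[OF ra(1)] sq[OF w])+,
        subst Bochner_Integration.integral_sum, (intro sqi_mult_integrable sqi_diff fhK sq[OF ra(1)] sq[OF w]), rule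
            refl)
  also have "\<dots> = 0" using r(3)[OF w] ra(3)[OF w] by simp
  finally have "AE x in lebesgue_on K. (w x)\<^sup>2 = 0"
    using sq[OF w] by (subst (asm) integral_nonneg_eq_0_iff_AE) (auto simp: sqi_def)
  then have "AE x in lebesgue. x \<in> K \<longrightarrow> w x = 0" using K_lebesgue[OF K] by (simp add: AE_lebesgue_on_iff)
  then show ?thesis
  proof eventually_elim
    case (elim x)
    show ?case
    proof
      assume x: "x \<in> interior K"
      then have "w x = 0" using elim interior_subset by blast
      then show "(\<Sum>a\<in>V K. Pih \<Omega> T p (\<lambda>y. f y * hat T a y) x) = Pih \<Omega> T p f x" using ra(2)[OF x] r(2)[OF x] by (simp
          add: w_def)
    qed
  qed
qed

section \<open>Vertex patches and the equilibrated fields\<close>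

lemma interior_patch_iff:
  assumes "K \<in> T" "x \<in> interior K" shows "x \<in> patch T a \<longleftrightarrow> a \<in> V K"
proof
  assume "x \<in> patch T a"
  then have "x \<in> \<Union>(patch_elems T a)" unfolding patch_def using interior_subset by blast
  then obtain K' where K': "K' \<in> T" "a \<in> V K'" "x \<in> K'" by (auto simp: patch_elems_def)
  then have "K = K'" using interior_disjoint[OF assms(1) K'(1)] assms(2) by blast
  then show "a \<in> V K" using K' by simp
next
  assume "a \<in> V K"
  then have "K \<subseteq> \<Union>(patch_elems T a)" using assms(1) by (auto simp: patch_elems_def)
  then show "x \<in> patch T a" unfolding patch_def using interior_mono assms(2) by blast
qed

lemma AE_patch: "AE x in lebesgue. x \<in> patch T a \<longleftrightarrow> (\<exists>K\<in>patch_elems T a. x \<in> interior K)"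
  using AE_interior
proof eventually_elim
  case (elim x)
  show ?case
  proof
    assume "x \<in> patch T a"
    then have "x \<in> \<Union>(patch_elems T a)" unfolding patch_def using interior_subset by blast
    then show "\<exists>K\<in>patch_elems T a. x \<in> interior K" using elim by (auto simp: patch_elems_def)
  next
    assume "\<exists>K\<in>patch_elems T a. x \<in> interior K"
    then show "x \<in> patch T a" using interior_patch_iff by (auto simp: patch_elems_def)
  qed
qed

lemma patch_lebesgue: "patch T a \<in> sets lebesgue" by (simp add: patch_def)

lemma patch_sum_eq:
  fixes F :: "'a \<Rightarrow> 'a \<Rightarrow> 'b::real_vector"
  assumes "K \<in> T" "x \<in> interior K"
  shows "(\<Sum>a\<in>mesh_verts T. if x \<in> patch T a then F a x else 0) = (\<Sum>a\<in>V K. F a x)"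
  using V_subset_verts[OF assms(1)] interior_patch_iff[OF assms] finite_verts
  by (intro sum.mono_neutral_cong_right) auto

text \<open>Weak form of the statement that the total flux has divergence
  \<open>Pih f - kap\<^sup>2 * \<phi>h\<close>. Each patch equation vanishes against the test
  function; exchanging the sums over vertices and elements, the data of the vertices of one element
  add up to \<open>Pih f\<close> by the partition of unity.\<close>

lemma equilibrium:
  assumes f: "sqi (lebesgue_on \<Omega>) f" and t: "test_fun \<Omega> \<phi>"
    and adm: "\<And>a. a \<in> mesh_verts T \<Longrightarrow> patch_adm eps kap \<Omega> T p f uh a (\<sigma>a a) (\<phi>a a)"
  defines "\<sigma>h \<equiv> (\<lambda>x. \<Sum>a\<in>mesh_verts T. if x \<in> patch T a then \<sigma>a a x else 0)"
    and "\<phi>h \<equiv> (\<lambda>x. \<Sum>a\<in>mesh_verts T. if x \<in> patch T a then \<phi>a a x else 0)"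
  shows "(\<Sum>K\<in>T. \<integral>x. \<sigma>h x \<bullet> grad \<phi> x + (Pih \<Omega> T p f x - kap\<^sup>2 * \<phi>h x) * \<phi> x \<partial>lebesgue_on K) = 0"
proof -
  note D = test_funD[OF t]
  have "\<forall>a\<in>mesh_verts T. \<exists>D. hdiv_bc (patch T a) (if a \<in> \<Omega> then {} else frontier \<Omega> \<inter> frontier (patch T a)) (\<sigma>a a) D \<and>
     (AE x in lebesgue. x \<in> patch T a \<longrightarrow> D x + kap\<^sup>2 * \<phi>a a x = patch_rhs eps \<Omega> T p f uh a x)"
    using adm unfolding patch_adm_def by blast
  from bchoice[OF this] obtain Da where "\<forall>a\<in>mesh_verts T. hdiv_bc (patch T a) (if a \<in> \<Omega> then {} else frontier \<Omega> \<inter>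
      frontier (patch T a)) (\<sigma>a a) (Da a) \<and>
     (AE x in lebesgue. x \<in> patch T a \<longrightarrow> Da a x + kap\<^sup>2 * \<phi>a a x = patch_rhs eps \<Omega> T p f uh a x)" by blast
  then have Da: "\<And>a. a \<in> mesh_verts T \<Longrightarrow> hdiv_bc (patch T a) (if a \<in> \<Omega> then {} else frontier \<Omega> \<inter> frontier (patch T a))
      (\<sigma>a a) (Da a)"
     "\<And>a. a \<in> mesh_verts T \<Longrightarrow> AE x in lebesgue. x \<in> patch T a \<longrightarrow> Da a x + kap\<^sup>2 * \<phi>a a x = patch_rhs eps \<Omega> T p f uh a x"
    by blast+
  define I where "I = (\<lambda>a K. \<integral>x. \<sigma>a a x \<bullet> grad \<phi> x + Da a x * \<phi> x \<partial>lebesgue_on K)"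
  have ip: "interior K \<subseteq> patch T a" if "K \<in> patch_elems T a" for a K
    using that interior_patch_iff by (auto simp: patch_elems_def)
  have intK: "integrable (lebesgue_on K) (\<lambda>x. \<sigma>a a x \<bullet> grad \<phi> x + Da a x * \<phi> x)"
    if a: "a \<in> mesh_verts T" and K: "K \<in> patch_elems T a" for a K
  proof -
    have KT: "K \<in> T" using K by (simp add: patch_elems_def)
    have "sqi (lebesgue_on (patch T a)) (\<sigma>a a)" "sqi (lebesgue_on (patch T a)) (Da a)"
      using Da(1)[OF a] patch_lebesgue by (auto simp: hdiv_bc_def L2_iff_sqi L2v_iff_sqi)
    then have "sqi (lebesgue_on K) (\<sigma>a a)" "sqi (lebesgue_on K) (Da a)"
      using sqi_element[OF KT patch_lebesgue ip[OF K]] by auto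
    then show ?thesis
      using test_fun_sqi[OF t K_lebesgue[OF KT]]
      by (intro Bochner_Integration.integrable_add sqi_inner_integrable sqi_mult_integrable) auto
  qed
  have zero: "(\<Sum>K\<in>patch_elems T a. I a K) = 0" if a: "a \<in> mesh_verts T" for a
  proof -
    \<comment> \<open>At boundary vertices the flux may cross the boundary of \<Omega>, so the test
      function has to vanish near it. At interior vertices the normal trace is zero on the whole
      patch boundary and the excluded set is empty.\<close>
    have "tsupp \<phi> \<inter> frontier \<Omega> = {}" using D(5) open_\<Omega> by (auto simp: frontier_def interior_open)
    then have "tsupp \<phi> \<inter> (if a \<in> \<Omega> then {} else frontier \<Omega> \<inter> frontier (patch T a)) = {}" by auto
    then have "(LINT x:patch T a|lebesgue. \<sigma>a a x \<bullet> grad \<phi> x + Da a x * \<phi> x) = 0"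
      using Da(1)[OF a] t D(2) unfolding hdiv_bc_def test_fun_def by blast
    then have "(\<integral>x. \<sigma>a a x \<bullet> grad \<phi> x + Da a x * \<phi> x \<partial>lebesgue_on (patch T a)) = 0"
      using patch_lebesgue by (simp add: set_integral_lebesgue_on)
    then show ?thesis unfolding I_def
      using integral_split(2)[OF patch_lebesgue _ AE_patch intK[OF a]] by (simp add: patch_elems_def)
  qed
  have elem: "(\<integral>x. \<sigma>h x \<bullet> grad \<phi> x + (Pih \<Omega> T p f x - kap\<^sup>2 * \<phi>h x) * \<phi> x \<partial>lebesgue_on K) = (\<Sum>a\<in>V K. I a K)" if K: "K \<in>
      T" for K
  proof -
    have VM: "a \<in> mesh_verts T" "K \<in> patch_elems T a" if "a \<in> V K" for a
      using that K V_subset_verts[OF K] by (auto simp: patch_elems_def)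
    have "AE x in lebesgue. \<forall>a\<in>V K. x \<in> patch T a \<longrightarrow> Da a x + kap\<^sup>2 * \<phi>a a x = patch_rhs eps \<Omega> T p f uh a x"
      by (intro AE_finite_allI full_simplex.fin[OF element(1)[OF K]] Da(2)) (use VM in auto)
    then have ae: "AE x in lebesgue. x \<in> interior K \<longrightarrow>
       \<sigma>h x \<bullet> grad \<phi> x + (Pih \<Omega> T p f x - kap\<^sup>2 * \<phi>h x) * \<phi> x = (\<Sum>a\<in>V K. \<sigma>a a x \<bullet> grad \<phi> x + Da a x * \<phi> x)"
      using Pih_hat_sum[OF f K, of p] wgrad_hat_sum[OF K]
    proof eventually_elim
      case (elim x)
      show ?case
      proof
        assume x: "x \<in> interior K"
        have s1: "\<sigma>h x = (\<Sum>a\<in>V K. \<sigma>a a x)" unfolding \<sigma>h_def by (rule patch_sum_eq[OF K x])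
        have s2: "\<phi>h x = (\<Sum>a\<in>V K. \<phi>a a x)" unfolding \<phi>h_def by (rule patch_sum_eq[OF K x])
        have "Da a x = Pih \<Omega> T p (\<lambda>y. f y * hat T a y) x - eps\<^sup>2 * (wgrad \<Omega> uh x \<bullet> wgrad \<Omega> (hat T a) x) - kap\<^sup>2 * \<phi>a a
            x" if "a \<in> V K" for a
          using elim(1) interior_patch_iff[OF K x] that by (force simp: patch_rhs_def)
        then have "(\<Sum>a\<in>V K. Da a x) = (\<Sum>a\<in>V K. Pih \<Omega> T p (\<lambda>y. f y * hat T a y) x) - eps\<^sup>2 * (wgrad \<Omega> uh x \<bullet> (\<Sum>a\<in>V K.
            wgrad \<Omega> (hat T a) x)) - kap\<^sup>2 * (\<Sum>a\<in>V K. \<phi>a a x)"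
          by (simp add: sum_subtractf sum_distrib_left inner_sum_right)
        then have "(\<Sum>a\<in>V K. Da a x) = Pih \<Omega> T p f x - kap\<^sup>2 * \<phi>h x" using elim(2,3) x s2 by simp
        then show "\<sigma>h x \<bullet> grad \<phi> x + (Pih \<Omega> T p f x - kap\<^sup>2 * \<phi>h x) * \<phi> x = (\<Sum>a\<in>V K. \<sigma>a a x \<bullet> grad \<phi> x + Da a x * \<phi> x)"
          by (simp add: s1 sum.distrib inner_sum_left flip: sum_distrib_right)
      qed
    qed
    have "(\<integral>x. \<sigma>h x \<bullet> grad \<phi> x + (Pih \<Omega> T p f x - kap\<^sup>2 * \<phi>h x) * \<phi> x \<partial>lebesgue_on K) =
       (\<integral>x. (\<Sum>a\<in>V K. \<sigma>a a x \<bullet> grad \<phi> x + Da a x * \<phi> x) \<partial>lebesgue_on K)"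
      by (rule on_element_cong(1)[OF K ae])
    also have "\<dots> = (\<Sum>a\<in>V K. I a K)" unfolding I_def
      by (rule Bochner_Integration.integral_sum) (use intK VM in blast)
    finally show ?thesis .
  qed
  have "(\<Sum>K\<in>T. \<Sum>a\<in>V K. I a K) = (\<Sum>K\<in>T. \<Sum>a\<in>{a \<in> mesh_verts T. a \<in> V K}. I a K)"
    using V_subset_verts by (intro sum.cong refl) auto
  also have "\<dots> = (\<Sum>a\<in>mesh_verts T. \<Sum>K\<in>{K \<in> T. a \<in> V K}. I a K)"
    by (rule sum.swap_restrict[OF finite_T finite_verts])
  also have "\<dots> = 0" using zero by (intro sum.neutral) (simp add: patch_elems_def)
  finally show ?thesis using elem by simp
qed

text \<open>Restricted to an open element, both \<open>wgrad\<close> and the classical gradient are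
  weak gradients of the same function, and uniqueness applies.\<close>

lemma wgrad_pw_poly:
  assumes u: "H1 \<Omega> u" and K: "K \<in> T" and q: "pol (Suc p) q" "\<And>x. x \<in> interior K \<Longrightarrow> u x = q x"
  obtains g where "\<And>b. pol (Suc p) (\<lambda>x. g x \<bullet> b)" "AE x in lebesgue. x \<in> interior K \<longrightarrow> wgrad \<Omega> u x = g x"
proof -
  obtain g H k where g: "\<And>x. (q has_derivative (\<lambda>h. h \<bullet> g x)) (at x)" "\<And>e. pol (Suc p - 1) (\<lambda>x. e \<bullet> g x)"
    using pol_derivatives[OF q(1)] by metis
  have pg: "pol (Suc p) (\<lambda>x. g x \<bullet> b)" for b using pol_mono[OF g(2)[of b]] by (simp add: inner_commute)
  have cg: "continuous_on UNIV g" by (subst continuous_on_componentwise) (use pg pol_continuous in blast)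
  have C1: "C1_grad q g" using g(1) cg by (simp add: C1_grad_def)
  have S: "open (interior K)" "interior K \<in> sets lebesgue" by auto
  have sq: "sqi (lebesgue_on (interior K)) f" if "continuous_on UNIV f" for f :: "'a \<Rightarrow> 'a"
    using sqi_compact[OF K_compact[OF K] continuous_on_subset[OF that subset_UNIV]] on_element_interior(3)[OF K, of f
        f] by simp
  have "sqi (lebesgue_on (interior K)) u"
    using wgrad_H1[OF u] sqi_subset[OF _ \<Omega>_lebesgue S(2) interior_K_subset[OF K]] unfolding H1_grad_iff[OF open_\<Omega>] by
        blast
  then have "H1_grad (interior K) u g"
    by (intro C1_weak_gradient[OF S(1) C1]) (use q(2) sq[OF cg] in auto)
  moreover have "H1_grad (interior K) u (wgrad \<Omega> u)"
    by (rule H1_grad_subset[OF open_\<Omega> S(1) interior_K_subset[OF K] wgrad_H1[OF u]])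
  ultimately have "AE x in lebesgue. x \<in> interior K \<longrightarrow> wgrad \<Omega> u x = g x"
    using H1_grad_unique[OF S(1)] by blast
  then show thesis using that pg by blast
qed

text \<open>The term \<open>r x *\<^sub>R x\<close> may reach degree \<open>p + 1\<close>, which is
  index \<open>p + 2\<close>, that is \<open>Suc N\<close> for \<open>N = p + 1\<close> in the flux
  estimate.\<close>

lemma RT_sum_pol:
  assumes K: "K \<in> T" and RT: "\<And>a. a \<in> V K \<Longrightarrow> pw_RT p (patch_elems T a) (\<sigma>a a)"
  obtains g where "\<And>b. b \<in> Basis \<Longrightarrow> pol (p + 2) (\<lambda>x. g x \<bullet> b)" "\<And>x. x \<in> interior K \<Longrightarrow> (\<Sum>a\<in>V K. \<sigma>a a x) = g x"
proof -
  have "\<exists>Q r. (\<forall>b\<in>Basis. pol (Suc p) (\<lambda>x. Q x \<bullet> b)) \<and> pol (Suc p) r \<and> (\<forall>x\<in>interior K. \<sigma>a a x = Q x + r x *\<^sub>R x)" if "a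
      \<in> V K" for a
    using RT[OF that] K that unfolding pw_RT_def poly_le_iff_pol patch_elems_def by blast
  then obtain Q r where Qr: "\<And>a b. a \<in> V K \<Longrightarrow> b \<in> Basis \<Longrightarrow> pol (Suc p) (\<lambda>x. Q a x \<bullet> b)" "\<And>a. a \<in> V K \<Longrightarrow> pol (Suc p) (r a)"
    "\<And>a x. a \<in> V K \<Longrightarrow> x \<in> interior K \<Longrightarrow> \<sigma>a a x = Q a x + r a x *\<^sub>R x" by metis
  define g where "g = (\<lambda>x. \<Sum>a\<in>V K. Q a x + r a x *\<^sub>R x)"
  have "pol (p + 2) (\<lambda>x. g x \<bullet> b)" if b: "b \<in> Basis" for b
  proof -
    have "pol (p + 2) (\<lambda>x. \<Sum>a\<in>V K. Q a x \<bullet> b + (x \<bullet> b) * r a x)"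
      using pol_mono[OF Qr(1)[OF _ b]] pol_mult_inner[OF Qr(2)] by (intro pol_sum pol_add) auto
    then show ?thesis by (rule pol_cong) (simp add: g_def inner_sum_left inner_add_left mult.commute)
  qed
  moreover have "(\<Sum>a\<in>V K. \<sigma>a a x) = g x" if "x \<in> interior K" for x
    unfolding g_def using Qr(3) that by (intro sum.cong) auto
  ultimately show thesis using that by blast
qed

lemma shape_reg_bound:
  assumes K: "K \<in> T" shows "diameter K \<le> shape_reg T * rho K" "rho K > 0" "diameter K > 0"
proof -
  show r: "rho K > 0" using full_simplex.rho_pos[OF element(1)[OF K]] element(2)[OF K] by simp
  have "diameter K / rho K \<le> shape_reg T" unfolding shape_reg_def using finite_T K by (intro Max_ge) auto
  then show "diameter K \<le> shape_reg T * rho K" using r by (simp add: pos_divide_le_eq)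
  obtain x where "x \<in> interior K" using interior_K_nonempty[OF K] by blast
  then obtain e where e: "e > 0" "ball x e \<subseteq> K" by (auto simp: mem_interior)
  have "diameter (ball x e) \<le> diameter K" using e(2) compact_imp_bounded[OF K_compact[OF K]] by (rule diameter_subset)
  then show "diameter K > 0" using e(1) by (simp add: diameter_ball)
qed

text \<open>Cauchy-Schwarz yields the entry 1 of the minimum. For the other one, \<open>h\<close> is
  bounded by \<open>th * rho K\<close>, and half of it cancels against the \<open>h\<close> inside
  the root of \<open>flux_bound\<close>, leaving \<open>sqrt h * X\<close> below a multiple of the
  geometric mean of the two norms.\<close>

lemma flux_element_bound:
  assumes K: "K \<in> T" and p: "p \<ge> 1" and eps: "eps > 0" and kap: "kap \<ge> 0"
    and g: "\<And>b. b \<in> Basis \<Longrightarrow> pol (p + 2) (\<lambda>x. g x \<bullet> b)"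
    and v: "C1_grad v gv"
  defines "E \<equiv> sqrt (eps\<^sup>2 * (\<integral>x. (norm (gv x))\<^sup>2 \<partial>lebesgue_on K) + kap\<^sup>2 * (\<integral>x. (v x)\<^sup>2 \<partial>lebesgue_on K))"
  shows "eps * \<bar>\<integral>x. g x \<bullet> gv x \<partial>lebesgue_on K\<bar> \<le>
    wfac (C_star (real p) (real DIM('a)) (shape_reg T)) eps kap (diameter K) * sqrt (\<integral>x. (norm (g x))\<^sup>2 \<partial>lebesgue_on K)
        * E"
proof -
  interpret S: full_simplex "V K" using element(1)[OF K] .
  note SK = element(2)[OF K]
  define th where "th = shape_reg T"
  define h where "h = diameter K"
  define X where "X = \<bar>\<integral>x. g x \<bullet> gv x \<partial>lebesgue_on K\<bar>"
  define G where "G = sqrt (\<integral>x. (norm (g x))\<^sup>2 \<partial>lebesgue_on K)"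
  define a where "a = sqrt (\<integral>x. (v x)\<^sup>2 \<partial>lebesgue_on K)"
  define b where "b = sqrt (\<integral>x. (norm (gv x))\<^sup>2 \<partial>lebesgue_on K)"
  have nn: "X \<ge> 0" "G \<ge> 0" "a \<ge> 0" "b \<ge> 0" by (auto simp: X_def G_def a_def b_def)
  have h: "h > 0" "rho K > 0" "h \<le> th * rho K" using shape_reg_bound[OF K] by (auto simp: h_def th_def)
  have th: "th \<ge> 0"
  proof (rule ccontr)
    assume "\<not> th \<ge> 0"
    then have "th * rho K < 0" using h(2) by (simp add: mult_neg_pos)
    then show False using h by linarith
  qed
  have E: "E = sqrt ((eps * b)\<^sup>2 + (kap * a)\<^sup>2)" unfolding E_def a_def b_def by (simp add: power_mult_distrib)
  have cg: "continuous_on UNIV g" by (subst continuous_on_componentwise) (use g pol_continuous in blast)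
  have triv: "eps * X \<le> G * E"
  proof -
    have "X \<le> G * b" unfolding X_def G_def b_def
      by (intro sqi_Cauchy_Schwarz sqi_compact K_compact[OF K] continuous_on_subset[OF cg] continuous_on_subset[OF
          C1_gradD(2)[OF v]]) auto
    then have "eps * X \<le> G * (eps * b)" using eps by (simp add: mult.left_commute)
    also have "\<dots> \<le> G * E" unfolding E using nn eps
      by (intro mult_left_mono) (auto intro!: real_le_rsqrt)
    finally show ?thesis .
  qed
  show ?thesis
  proof (cases "kap = 0")
    case True
    then show ?thesis using triv by (simp add: wfac_def X_def G_def)
  next
    case False
    then have kp: "kap > 0" using kap by simp
    define C where "C = C_star (real p) (real DIM('a)) th"
    define c where "c = 2 * sqrt (real DIM('a)) * S.radial_const (p + 1)"
    have c0: "c \<ge> 0" using S.radial_const_nonneg by (simp add: c_def)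
    have cC: "c * th \<le> sqrt 2 * C"
      using C_star_bound[OF p _ th, of "DIM('a)"] by (simp add: c_def S.radial_const_def C_def Suc_leI)
    have "rho K * X \<le> c * (G * sqrt (a * (h * b)))"
      using S.flux_bound[of "p + 1" g v gv] g p C1_gradD[OF v] unfolding SK
      by (simp add: c_def X_def G_def a_def b_def h_def)
    then have "th * (rho K * X) \<le> th * (c * (G * sqrt (a * (h * b))))" using th by (rule mult_left_mono)
    moreover have "h * X \<le> th * (rho K * X)" using h(3) nn(1) mult_right_mono[of h "th * rho K" X] by (simp add:
        mult.assoc)
    moreover have "(c * th) * (G * sqrt (a * (h * b))) \<le> (sqrt 2 * C) * (G * sqrt (a * (h * b)))"
      using cC nn h by (intro mult_right_mono) auto
    ultimately have hX: "h * X \<le> (sqrt 2 * C) * (G * sqrt (a * (h * b)))" by (simp add: mult.assoc mult.left_commute)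
    have "sqrt (a * (h * b)) = sqrt h * sqrt (a * b)" using h(1) by (simp add: real_sqrt_mult algebra_simps)
    then have "sqrt h * (sqrt h * X) \<le> sqrt h * ((sqrt 2 * C) * (G * sqrt (a * b)))"
      using hX h(1) by (simp add: mult.left_commute mult.assoc[symmetric])
    then have X1: "sqrt h * X \<le> (sqrt 2 * C) * (G * sqrt (a * b))" using h(1) by simp
    have C0: "C \<ge> 0"
    proof -
      have "0 \<le> c * th" using c0 th by simp
      then have "0 \<le> sqrt 2 * C" using cC by linarith
      then show ?thesis by (simp add: zero_le_mult_iff)
    qed
    have s: "sqrt eps * sqrt kap * sqrt (a * b) = sqrt ((eps * b) * (kap * a))"
      by (simp add: real_sqrt_mult algebra_simps)
    \<comment> \<open>The factor \<open>eps\<close> is split so that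
      \<open>sqrt (eps / (kap * h))\<close> forms the weight, while
      \<open>sqrt eps * sqrt kap\<close> completes the geometric mean to that of the two halves of
      the energy.\<close>
    have "eps * X = (sqrt (eps / (kap * h)) * (sqrt eps * sqrt kap)) * (sqrt h * X)"
    proof -
      have "sqrt (eps / (kap * h)) * (sqrt eps * sqrt kap) * sqrt h = eps"
        using eps kp h(1) by (simp add: real_sqrt_divide real_sqrt_mult)
      then show ?thesis by (metis mult.assoc)
    qed
    also have "\<dots> \<le> (sqrt (eps / (kap * h)) * (sqrt eps * sqrt kap)) * ((sqrt 2 * C) * (G * sqrt (a * b)))"
      using X1 eps kp h(1) by (intro mult_left_mono) auto
    also have "\<dots> = C * sqrt (eps / (kap * h)) * G * (sqrt 2 * (sqrt eps * sqrt kap * sqrt (a * b)))" by (simp only: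
        mult_ac)
    also have "\<dots> \<le> C * sqrt (eps / (kap * h)) * G * E"
      unfolding s E using C0 nn eps kp h(1) by (intro mult_left_mono sqrt_mult_le_half_sum) auto
    finally have 2: "eps * X \<le> C * sqrt (eps / (kap * h)) * G * E" .
    have "eps * X \<le> min 1 (C * sqrt (eps / (kap * h))) * G * E"
      using triv 2 by (simp add: min_def)
    then show ?thesis using False by (simp add: wfac_def X_def G_def C_def th_def h_def)
  qed
qed

text \<open>The two entries of the minimum use different halves of the local energy: the gradient
  through the Poincare inequality, the reaction term through Cauchy-Schwarz.\<close>

lemma oscillation_bound:
  assumes K: "K \<in> T" and eps: "eps > 0" and kap: "kap \<ge> 0"
    and F: "sqi (lebesgue_on K) F" "\<And>r. pol 2 r \<Longrightarrow> (\<integral>x. F x * r x \<partial>lebesgue_on K) = 0" and v: "C1_grad v gv"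
  defines "E \<equiv> sqrt (eps\<^sup>2 * (\<integral>x. (norm (gv x))\<^sup>2 \<partial>lebesgue_on K) + kap\<^sup>2 * (\<integral>x. (v x)\<^sup>2 \<partial>lebesgue_on K))"
  shows "\<bar>\<integral>x. F x * v x \<partial>lebesgue_on K\<bar> \<le> wtil eps kap (diameter K) * sqrt (\<integral>x. (F x)\<^sup>2 \<partial>lebesgue_on K) * E"
proof -
  interpret S: full_simplex "V K" using element(1)[OF K] .
  note SK = element(2)[OF K]
  define X where "X = \<bar>\<integral>x. F x * v x \<partial>lebesgue_on K\<bar>"
  define G where "G = sqrt (\<integral>x. (F x)\<^sup>2 \<partial>lebesgue_on K)"
  define a where "a = sqrt (\<integral>x. (v x)\<^sup>2 \<partial>lebesgue_on K)"
  define b where "b = sqrt (\<integral>x. (norm (gv x))\<^sup>2 \<partial>lebesgue_on K)"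
  have nn: "G \<ge> 0" "a \<ge> 0" "b \<ge> 0" by (auto simp: G_def a_def b_def)
  have E: "E = sqrt ((eps * b)\<^sup>2 + (kap * a)\<^sup>2)" unfolding E_def a_def b_def by (simp add: power_mult_distrib)
  have Eb: "eps * b \<le> E" "kap * a \<le> E" unfolding E by (auto intro!: real_le_rsqrt)
  have h: "diameter K > 0" using shape_reg_bound[OF K] by simp
  have "X \<le> diameter K / pi * G * b"
    using S.poincare_P1[OF v, of F] F unfolding SK by (simp add: X_def G_def b_def)
  also have "\<dots> = diameter K / (pi * eps) * G * (eps * b)" using eps by simp
  also have "\<dots> \<le> diameter K / (pi * eps) * G * E" using h eps nn Eb by (intro mult_left_mono) auto
  finally have 1: "X \<le> diameter K / (pi * eps) * G * E" .
  show ?thesis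
  proof (cases "kap = 0")
    case True
    then show ?thesis using 1 by (simp add: wtil_def X_def G_def)
  next
    case False
    then have kp: "kap > 0" using kap by simp
    have "X \<le> G * a" unfolding X_def G_def a_def
      by (intro sqi_Cauchy_Schwarz_real F sqi_compact K_compact[OF K] continuous_on_subset[OF C1_grad_continuous[OF
          v]]) auto
    also have "\<dots> = 1 / kap * G * (kap * a)" using kp by simp
    also have "\<dots> \<le> 1 / kap * G * E" using kp nn Eb by (intro mult_left_mono) auto
    finally have "X \<le> 1 / kap * G * E" .
    with 1 have "X \<le> min (diameter K / (pi * eps)) (1 / kap) * G * E" by (simp add: min_def)
    then show ?thesis using False by (simp add: wtil_def X_def G_def)
  qed
qed

end

section \<open>The error bound\<close>

text \<open>Everything reduces to the cross term with the remainder \<open>g n - G\<close>, which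
  Cauchy-Schwarz sends to 0.\<close>

lemma sqi_limit:
  fixes G :: "'a \<Rightarrow> 'b::euclidean_space"
  assumes G: "sqi M G" and g: "\<And>n. sqi M (g n)" and lim: "(\<lambda>n. \<integral>x. (norm (g n x - G x))\<^sup>2 \<partial>M) \<longlonglongrightarrow> 0"
  shows "(\<lambda>n. \<integral>x. G x \<bullet> g n x \<partial>M) \<longlonglongrightarrow> (\<integral>x. (norm (G x))\<^sup>2 \<partial>M)"
    "(\<lambda>n. \<integral>x. (norm (g n x))\<^sup>2 \<partial>M) \<longlonglongrightarrow> (\<integral>x. (norm (G x))\<^sup>2 \<partial>M)"
proof -
  define r where "r = (\<lambda>n x. g n x - G x)"
  have r: "sqi M (r n)" for n unfolding r_def by (intro sqi_diff g G)
  have i: "integrable M (\<lambda>x. G x \<bullet> r n x)" "integrable M (\<lambda>x. (norm (G x))\<^sup>2)" "integrable M (\<lambda>x. (norm (r n x))\<^sup>2)"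
      for n
    using sqi_inner_integrable[OF G r] G r by (auto simp: sqi_def)
  have cross: "(\<lambda>n. \<integral>x. G x \<bullet> r n x \<partial>M) \<longlonglongrightarrow> 0"
  proof (rule tendsto_rabs_zero_cancel, rule tendsto_sandwich)
    show "\<forall>\<^sub>F n in sequentially. 0 \<le> \<bar>\<integral>x. G x \<bullet> r n x \<partial>M\<bar>" by simp
    show "\<forall>\<^sub>F n in sequentially. \<bar>\<integral>x. G x \<bullet> r n x \<partial>M\<bar> \<le> sqrt (\<integral>x. (norm (G x))\<^sup>2 \<partial>M) * sqrt (\<integral>x. (norm (r n x))\<^sup>2 \<partial>M)"
      using sqi_Cauchy_Schwarz[OF G r] by simp
    have "(\<lambda>n. sqrt (\<integral>x. (norm (G x))\<^sup>2 \<partial>M) * sqrt (\<integral>x. (norm (r n x))\<^sup>2 \<partial>M)) \<longlonglongrightarrow> sqrt (\<integral>x. (norm (G x))\<^sup>2 \<partial>M) * sqrt 0"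
      using lim unfolding r_def by (intro tendsto_intros)
    then show "(\<lambda>n. sqrt (\<integral>x. (norm (G x))\<^sup>2 \<partial>M) * sqrt (\<integral>x. (norm (r n x))\<^sup>2 \<partial>M)) \<longlonglongrightarrow> 0" by simp
  qed simp
  have "(\<integral>x. G x \<bullet> g n x \<partial>M) = (\<integral>x. (norm (G x))\<^sup>2 + G x \<bullet> r n x \<partial>M)" for n
    by (intro Bochner_Integration.integral_cong refl) (simp add: r_def power2_norm_eq_inner inner_diff_right)
  then have e1: "(\<integral>x. G x \<bullet> g n x \<partial>M) = (\<integral>x. (norm (G x))\<^sup>2 \<partial>M) + (\<integral>x. G x \<bullet> r n x \<partial>M)" for n using i by simp
  show "(\<lambda>n. \<integral>x. G x \<bullet> g n x \<partial>M) \<longlonglongrightarrow> (\<integral>x. (norm (G x))\<^sup>2 \<partial>M)"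
    unfolding e1 using tendsto_add[OF tendsto_const cross] by simp
  have "(\<integral>x. (norm (g n x))\<^sup>2 \<partial>M) = (\<integral>x. (norm (G x))\<^sup>2 + 2 * (G x \<bullet> r n x) + (norm (r n x))\<^sup>2 \<partial>M)" for n
    by (intro Bochner_Integration.integral_cong refl)
      (simp add: r_def power2_norm_eq_inner inner_diff_right inner_diff_left inner_commute)
  then have e2: "(\<integral>x. (norm (g n x))\<^sup>2 \<partial>M) = (\<integral>x. (norm (G x))\<^sup>2 \<partial>M) + 2 * (\<integral>x. G x \<bullet> r n x \<partial>M) + (\<integral>x. (norm (r n x))\<^sup>2
      \<partial>M)" for n using i by simp
  have "(\<lambda>n. (\<integral>x. (norm (G x))\<^sup>2 \<partial>M) + 2 * (\<integral>x. G x \<bullet> r n x \<partial>M) + (\<integral>x. (norm (r n x))\<^sup>2 \<partial>M)) \<longlonglongrightarrow> (\<integral>x. (norm (G x))\<^sup>2 \<partial>M)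
      + 2 * 0 + 0"
    using lim unfolding r_def[symmetric] by (intro tendsto_intros cross) (simp add: r_def)
  then show "(\<lambda>n. \<integral>x. (norm (g n x))\<^sup>2 \<partial>M) \<longlonglongrightarrow> (\<integral>x. (norm (G x))\<^sup>2 \<partial>M)" unfolding e2 by simp
qed

lemma sqi_diff_limit:
  fixes G H :: "'a \<Rightarrow> 'b::euclidean_space"
  assumes "sqi M G" "sqi M H" "\<And>n. sqi M (g n)" "\<And>n. sqi M (h n)"
    and lim: "(\<lambda>n. \<integral>x. (norm (g n x - G x))\<^sup>2 \<partial>M) \<longlonglongrightarrow> 0" "(\<lambda>n. \<integral>x. (norm (h n x - H x))\<^sup>2 \<partial>M) \<longlonglongrightarrow> 0"
  shows "(\<lambda>n. \<integral>x. (norm ((g n x - h n x) - (G x - H x)))\<^sup>2 \<partial>M) \<longlonglongrightarrow> 0"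
proof (rule tendsto_sandwich)
  show "\<forall>\<^sub>F n in sequentially. 0 \<le> (\<integral>x. (norm ((g n x - h n x) - (G x - H x)))\<^sup>2 \<partial>M)" by simp
  have bound: "(\<integral>x. (norm ((g n x - h n x) - (G x - H x)))\<^sup>2 \<partial>M) \<le> 2 * (\<integral>x. (norm (g n x - G x))\<^sup>2 \<partial>M) + 2 * (\<integral>x. (norm
      (h n x - H x))\<^sup>2 \<partial>M)" for n
  proof -
    have s: "sqi M (\<lambda>x. g n x - G x)" "sqi M (\<lambda>x. h n x - H x)" "sqi M (\<lambda>x. (g n x - h n x) - (G x - H x))"
      by (intro sqi_diff assms)+
    have "(\<integral>x. (norm ((g n x - h n x) - (G x - H x)))\<^sup>2 \<partial>M) \<le> (\<integral>x. 2 * (norm (g n x - G x))\<^sup>2 + 2 * (norm (h n x - H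
        x))\<^sup>2 \<partial>M)"
    proof (rule integral_mono)
      fix x
      have "(norm ((g n x - h n x) - (G x - H x)))\<^sup>2 = (norm ((g n x - G x) - (h n x - H x)))\<^sup>2" by (simp add:
          algebra_simps)
      also have "\<dots> \<le> (norm (g n x - G x) + norm (h n x - H x))\<^sup>2" by (intro power_mono norm_triangle_ineq4) auto
      also have "\<dots> \<le> 2 * (norm (g n x - G x))\<^sup>2 + 2 * (norm (h n x - H x))\<^sup>2"
        using zero_le_power2[of "norm (g n x - G x) - norm (h n x - H x)"] by (simp add: power2_eq_square algebra_simps)
      finally show "(norm ((g n x - h n x) - (G x - H x)))\<^sup>2 \<le> 2 * (norm (g n x - G x))\<^sup>2 + 2 * (norm (h n x - H x))\<^sup>2"
          .
    qed (use s in \<open>auto simp: sqi_def\<close>)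
    then show ?thesis using s by (simp add: sqi_def)
  qed
  then show "\<forall>\<^sub>F n in sequentially. (\<integral>x. (norm ((g n x - h n x) - (G x - H x)))\<^sup>2 \<partial>M) \<le> 2 * (\<integral>x. (norm (g n x - G x))\<^sup>2
      \<partial>M) + 2 * (\<integral>x. (norm (h n x - H x))\<^sup>2 \<partial>M)"
    by simp
  have "(\<lambda>n. 2 * (\<integral>x. (norm (g n x - G x))\<^sup>2 \<partial>M) + 2 * (\<integral>x. (norm (h n x - H x))\<^sup>2 \<partial>M)) \<longlonglongrightarrow> 2 * 0 + 2 * 0"
    by (intro tendsto_intros lim)
  then show "(\<lambda>n. 2 * (\<integral>x. (norm (g n x - G x))\<^sup>2 \<partial>M) + 2 * (\<integral>x. (norm (h n x - H x))\<^sup>2 \<partial>M)) \<longlonglongrightarrow> 0" by simp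
qed simp

lemma test_fun_diff:
  assumes "test_fun S \<phi>" "test_fun S \<psi>"
  shows "test_fun S (\<lambda>x. \<phi> x - \<psi> x)" "grad (\<lambda>x. \<phi> x - \<psi> x) = (\<lambda>x. grad \<phi> x - grad \<psi> x)"
proof -
  have sm: "smooth_fun (\<lambda>x. \<phi> x + (-1) * \<psi> x)" using assms by (intro smooth_fun_add_scaled) (auto simp: test_fun_def)
  have sub: "tsupp (\<lambda>x. \<phi> x - \<psi> x) \<subseteq> tsupp \<phi> \<union> tsupp \<psi>"
    unfolding tsupp_def closure_Un[symmetric] by (intro closure_mono) auto
  have cl: "closed (tsupp (\<lambda>x. \<phi> x - \<psi> x))" unfolding tsupp_def by (rule closed_closure)
  have cp: "compact (tsupp \<phi> \<union> tsupp \<psi>)" "tsupp \<phi> \<union> tsupp \<psi> \<subseteq> S" using assms by (auto simp: test_fun_def)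
  have "compact (tsupp (\<lambda>x. \<phi> x - \<psi> x))" using compact_Int_closed[OF cp(1) cl] Int_absorb1[OF sub] by simp
  then show t: "test_fun S (\<lambda>x. \<phi> x - \<psi> x)" using sm order_trans[OF sub cp(2)] unfolding test_fun_def by simp
  have "C1_grad (\<lambda>x. \<phi> x + (-1) * \<psi> x) (\<lambda>x. grad \<phi> x + (-1) *\<^sub>R grad \<psi> x)"
    by (intro C1_grad_add_scaled test_funD(1)[OF assms(1)] test_funD(1)[OF assms(2)])
  then show "grad (\<lambda>x. \<phi> x - \<psi> x) = (\<lambda>x. grad \<phi> x - grad \<psi> x)" using C1_grad_unique[OF test_funD(1)[OF t]] by simp
qed

context fe_mesh
begin

text \<open>The subtracted integrals sum to 0 over the mesh by \<open>equilibrium\<close>; on a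
  single element they turn the residual into flux, reaction and oscillation terms. All discrete
  quantities are replaced by polynomials agreeing with them inside \<open>K\<close>, because the
  element estimates ask for globally defined polynomial fields.\<close>

lemma element_residual_bound:
  assumes K: "K \<in> T" and p: "p \<ge> 1" and eps: "eps > 0" and kap: "kap \<ge> 0"
    and f: "sqi (lebesgue_on \<Omega>) f" and uh: "H1 \<Omega> uh" "pw_poly p T uh"
    and adm: "\<And>a. a \<in> mesh_verts T \<Longrightarrow> patch_adm eps kap \<Omega> T p f uh a (\<sigma>a a) (\<phi>a a)"
    and t: "test_fun \<Omega> \<phi>"
  defines "\<sigma>h \<equiv> (\<lambda>x. \<Sum>a\<in>mesh_verts T. if x \<in> patch T a then \<sigma>a a x else 0)"
    and "\<phi>h \<equiv> (\<lambda>x. \<Sum>a\<in>mesh_verts T. if x \<in> patch T a then \<phi>a a x else 0)"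
  shows "(\<integral>x. f x * \<phi> x - eps\<^sup>2 * (wgrad \<Omega> uh x \<bullet> grad \<phi> x) - kap\<^sup>2 * (uh x * \<phi> x) \<partial>lebesgue_on K)
      - (\<integral>x. \<sigma>h x \<bullet> grad \<phi> x + (Pih \<Omega> T p f x - kap\<^sup>2 * \<phi>h x) * \<phi> x \<partial>lebesgue_on K)
    \<le> (wfac (C_star (real p) (real DIM('a)) (shape_reg T)) eps kap (diameter K) *
          L2normv K (\<lambda>x. eps *\<^sub>R wgrad \<Omega> uh x + (1 / eps) *\<^sub>R \<sigma>h x)
        + L2norm K (\<lambda>x. kap * (uh x - \<phi>h x))
        + wtil eps kap (diameter K) * L2norm K (\<lambda>x. f x - Pih \<Omega> T p f x)) *
      sqrt (eps\<^sup>2 * (\<integral>x. (norm (grad \<phi> x))\<^sup>2 \<partial>lebesgue_on K) + kap\<^sup>2 * (\<integral>x. (\<phi> x)\<^sup>2 \<partial>lebesgue_on K))"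
proof -
  note C1 = test_funD(1)[OF t]
  note Km = K_lebesgue[OF K]
  have VM: "a \<in> mesh_verts T" "K \<in> patch_elems T a" if "a \<in> V K" for a
    using that K V_subset_verts[OF K] by (auto simp: patch_elems_def)
  have polK: "sqi (lebesgue_on K) s" if "pol n s" for n s
    using sqi_compact[OF K_compact[OF K] pol_continuous[OF that]] .
  obtain q where q: "pol (Suc p) q" "\<And>x. x \<in> interior K \<Longrightarrow> uh x = q x"
    using uh(2) K unfolding pw_poly_def poly_le_iff_pol by blast
  obtain gu where gu: "\<And>b. pol (Suc p) (\<lambda>x. gu x \<bullet> b)" "AE x in lebesgue. x \<in> interior K \<longrightarrow> wgrad \<Omega> uh x = gu x"
    using wgrad_pw_poly[OF uh(1) K q] by blast
  obtain gs where gs: "\<And>b. b \<in> Basis \<Longrightarrow> pol (p + 2) (\<lambda>x. gs x \<bullet> b)" "\<And>x. x \<in> interior K \<Longrightarrow> (\<Sum>a\<in>V K. \<sigma>a a x) = gs x"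
    using RT_sum_pol[OF K, of p \<sigma>a] adm VM unfolding patch_adm_def by blast
  have \<sigma>h: "\<sigma>h x = gs x" if "x \<in> interior K" for x
    unfolding \<sigma>h_def using patch_sum_eq[OF K that, of \<sigma>a] gs(2)[OF that] by simp
  have "\<forall>a\<in>V K. \<exists>s. pol (Suc p) s \<and> (\<forall>x\<in>interior K. \<phi>a a x = s x)"
    using adm VM unfolding patch_adm_def pw_poly_def poly_le_iff_pol by blast
  from bchoice[OF this] obtain sa where sa: "\<And>a. a \<in> V K \<Longrightarrow> pol (Suc p) (sa a)" "\<And>a x. a \<in> V K \<Longrightarrow> x \<in> interior K \<Longrightarrow> \<phi>a a x
      = sa a x"
    by blast
  define s where "s = (\<lambda>x. \<Sum>a\<in>V K. sa a x)"
  have s: "pol (Suc p) s" unfolding s_def by (intro pol_sum sa(1))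
  have \<phi>h: "\<phi>h x = s x" if "x \<in> interior K" for x
    unfolding \<phi>h_def s_def using patch_sum_eq[OF K that, of \<phi>a] sa(2) that by simp
  define gR where "gR = (\<lambda>x. eps *\<^sub>R gu x + (1 / eps) *\<^sub>R gs x)"
  have gR: "pol (p + 2) (\<lambda>x. gR x \<bullet> b)" if "b \<in> Basis" for b
  proof -
    have "pol (p + 2) (\<lambda>x. eps * (gu x \<bullet> b) + (1 / eps) * (gs x \<bullet> b))"
      by (intro pol_add pol_scale gs(1)[OF that] pol_mono[OF gu(1)]) auto
    then show ?thesis by (rule pol_cong) (simp add: gR_def inner_add_left)
  qed
  define R where "R = (\<lambda>x. eps *\<^sub>R wgrad \<Omega> uh x + (1 / eps) *\<^sub>R \<sigma>h x)"
  have R_ae: "AE x in lebesgue. x \<in> interior K \<longrightarrow> R x = gR x"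
    using gu(2) by eventually_elim (auto simp: R_def gR_def \<sigma>h)
  obtain r where r: "pol (Suc p) r" "\<And>x. x \<in> interior K \<Longrightarrow> Pih \<Omega> T p f x = r x"
    "\<And>s. pol (Suc p) s \<Longrightarrow> (\<integral>x. (f x - r x) * s x \<partial>lebesgue_on K) = 0"
    using Pih_local[OF f K, of p] by blast
  define F where "F = (\<lambda>x. f x - r x)"
  have fK: "sqi (lebesgue_on K) f" using sqi_element[OF K \<Omega>_lebesgue interior_K_subset[OF K] f] .
  have FK: "sqi (lebesgue_on K) F" unfolding F_def by (intro sqi_diff fK polK[OF r(1)])
  \<comment> \<open>\<open>pol 2\<close> are the affine functions; \<open>p \<ge> 1\<close> places
    them in \<open>pol (Suc p)\<close>.\<close>
  have Forth: "(\<integral>x. F x * s x \<partial>lebesgue_on K) = 0" if "pol 2 s" for s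
    unfolding F_def using r(3)[OF pol_mono[OF that]] p by simp
  define E where "E = sqrt (eps\<^sup>2 * (\<integral>x. (norm (grad \<phi> x))\<^sup>2 \<partial>lebesgue_on K) + kap\<^sup>2 * (\<integral>x. (\<phi> x)\<^sup>2 \<partial>lebesgue_on K))"
  have cgR: "continuous_on UNIV gR" by (subst continuous_on_componentwise) (use gR pol_continuous in blast)
  have cgs: "continuous_on UNIV gs" by (subst continuous_on_componentwise) (use gs(1) pol_continuous in blast)
  have cgu: "continuous_on UNIV gu" by (subst continuous_on_componentwise) (use gu(1) pol_continuous in blast)
  have vK: "sqi (lebesgue_on K) h" if "continuous_on UNIV h" for h :: "'a \<Rightarrow> 'a"
    by (intro sqi_compact K_compact[OF K] continuous_on_subset[OF that]) auto
  note s\<phi> = test_fun_sqi[OF t Km]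
  have b1: "eps * \<bar>\<integral>x. gR x \<bullet> grad \<phi> x \<partial>lebesgue_on K\<bar> \<le>
     wfac (C_star (real p) (real DIM('a)) (shape_reg T)) eps kap (diameter K) * L2normv K R * E"
  proof -
    have "L2normv K R = sqrt (\<integral>x. (norm (gR x))\<^sup>2 \<partial>lebesgue_on K)"
      unfolding L2normv_lebesgue_on[OF Km]
      using R_ae by (intro arg_cong[of _ _ sqrt] on_element_cong(1)[OF K]) (auto elim!: eventually_mono)
    then show ?thesis using flux_element_bound[OF K p eps kap gR C1] by (simp add: E_def)
  qed
  have b2: "\<bar>\<integral>x. F x * \<phi> x \<partial>lebesgue_on K\<bar> \<le> wtil eps kap (diameter K) * L2norm K (\<lambda>x. f x - Pih \<Omega> T p f x) * E"
  proof -
    have "L2norm K (\<lambda>x. f x - Pih \<Omega> T p f x) = sqrt (\<integral>x. (F x)\<^sup>2 \<partial>lebesgue_on K)"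
      unfolding L2norm_lebesgue_on[OF Km]
      using on_element_cong(1)[OF K, of "\<lambda>x. (f x - Pih \<Omega> T p f x)\<^sup>2" "\<lambda>x. (F x)\<^sup>2"] r(2) by (simp add: F_def)
    then show ?thesis using oscillation_bound[OF K eps kap FK Forth C1] by (simp add: E_def)
  qed
  have b3: "kap\<^sup>2 * \<bar>\<integral>x. (q x - s x) * \<phi> x \<partial>lebesgue_on K\<bar> \<le> L2norm K (\<lambda>x. kap * (uh x - \<phi>h x)) * E"
  proof -
    have n: "L2norm K (\<lambda>x. kap * (uh x - \<phi>h x)) = kap * sqrt (\<integral>x. (q x - s x)\<^sup>2 \<partial>lebesgue_on K)"
    proof -
      have "L2norm K (\<lambda>x. kap * (uh x - \<phi>h x)) = sqrt (\<integral>x. (kap * (q x - s x))\<^sup>2 \<partial>lebesgue_on K)"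
        unfolding L2norm_lebesgue_on[OF Km]
        using on_element_cong(1)[OF K, of "\<lambda>x. (kap * (uh x - \<phi>h x))\<^sup>2" "\<lambda>x. (kap * (q x - s x))\<^sup>2"] q(2) \<phi>h by simp
      then show ?thesis using kap by (simp add: power_mult_distrib real_sqrt_mult)
    qed
    have "\<bar>\<integral>x. (q x - s x) * \<phi> x \<partial>lebesgue_on K\<bar> \<le> sqrt (\<integral>x. (q x - s x)\<^sup>2 \<partial>lebesgue_on K) * sqrt (\<integral>x. (\<phi> x)\<^sup>2
        \<partial>lebesgue_on K)"
      by (intro sqi_Cauchy_Schwarz_real sqi_diff polK[OF q(1)] polK[OF s] s\<phi>(1))
    then have "kap\<^sup>2 * \<bar>\<integral>x. (q x - s x) * \<phi> x \<partial>lebesgue_on K\<bar> \<le> kap\<^sup>2 * (sqrt (\<integral>x. (q x - s x)\<^sup>2 \<partial>lebesgue_on K) * sqrt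
        (\<integral>x. (\<phi> x)\<^sup>2 \<partial>lebesgue_on K))"
      by (intro mult_left_mono) auto
    also have "\<dots> = (kap * sqrt (\<integral>x. (q x - s x)\<^sup>2 \<partial>lebesgue_on K)) * (kap * sqrt (\<integral>x. (\<phi> x)\<^sup>2 \<partial>lebesgue_on K))"
      by (simp add: power2_eq_square)
    also have "\<dots> \<le> (kap * sqrt (\<integral>x. (q x - s x)\<^sup>2 \<partial>lebesgue_on K)) * E"
    proof (rule mult_left_mono)
      show "kap * sqrt (\<integral>x. (\<phi> x)\<^sup>2 \<partial>lebesgue_on K) \<le> E"
        unfolding E_def by (rule real_le_rsqrt) (simp add: power_mult_distrib)
    qed (use kap in simp)
    finally show ?thesis unfolding n .
  qed
  have i: "integrable (lebesgue_on K) (\<lambda>x. F x * \<phi> x)" "integrable (lebesgue_on K) (\<lambda>x. gR x \<bullet> grad \<phi> x)"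
    "integrable (lebesgue_on K) (\<lambda>x. (q x - s x) * \<phi> x)"
    by (intro sqi_mult_integrable sqi_inner_integrable sqi_diff FK polK[OF q(1)] polK[OF s] vK cgR s\<phi>)+
  have iZ: "integrable (lebesgue_on K) (\<lambda>x. f x * \<phi> x - eps\<^sup>2 * (gu x \<bullet> grad \<phi> x) - kap\<^sup>2 * (q x * \<phi> x))"
    by (intro Bochner_Integration.integrable_diff integrable_mult_right sqi_mult_integrable sqi_inner_integrable fK
        polK[OF q(1)] vK cgu s\<phi>)
  have iW: "integrable (lebesgue_on K) (\<lambda>x. gs x \<bullet> grad \<phi> x + (r x - kap\<^sup>2 * s x) * \<phi> x)"
    by (intro Bochner_Integration.integrable_add sqi_mult_integrable sqi_inner_integrable polK[OF pol_diff[OF r(1)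
        pol_scale[OF s]]] vK cgs s\<phi>)
  have "(\<integral>x. f x * \<phi> x - eps\<^sup>2 * (wgrad \<Omega> uh x \<bullet> grad \<phi> x) - kap\<^sup>2 * (uh x * \<phi> x) \<partial>lebesgue_on K) =
      (\<integral>x. f x * \<phi> x - eps\<^sup>2 * (gu x \<bullet> grad \<phi> x) - kap\<^sup>2 * (q x * \<phi> x) \<partial>lebesgue_on K)"
    using gu(2) by (intro on_element_cong(1)[OF K]) (auto elim!: eventually_mono simp: q(2))
  moreover have "(\<integral>x. \<sigma>h x \<bullet> grad \<phi> x + (Pih \<Omega> T p f x - kap\<^sup>2 * \<phi>h x) * \<phi> x \<partial>lebesgue_on K) =
      (\<integral>x. gs x \<bullet> grad \<phi> x + (r x - kap\<^sup>2 * s x) * \<phi> x \<partial>lebesgue_on K)"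
    by (intro on_element_cong(1)[OF K]) (simp add: \<sigma>h \<phi>h r(2))
  \<comment> \<open>The flux terms merge by
    \<open>eps\<^sup>2 *\<^sub>R gu x + gs x = eps *\<^sub>R gR x\<close>, the reaction terms leave
    \<open>q - s\<close>, and the source enters only through \<open>F = f - r\<close>.\<close>
  moreover have "(\<integral>x. f x * \<phi> x - eps\<^sup>2 * (gu x \<bullet> grad \<phi> x) - kap\<^sup>2 * (q x * \<phi> x) \<partial>lebesgue_on K)
      - (\<integral>x. gs x \<bullet> grad \<phi> x + (r x - kap\<^sup>2 * s x) * \<phi> x \<partial>lebesgue_on K)
    = (\<integral>x. F x * \<phi> x - eps * (gR x \<bullet> grad \<phi> x) - kap\<^sup>2 * ((q x - s x) * \<phi> x) \<partial>lebesgue_on K)"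
    unfolding Bochner_Integration.integral_diff[OF iZ iW, symmetric]
    using eps by (intro Bochner_Integration.integral_cong refl)
      (simp add: F_def gR_def inner_add_left power2_eq_square algebra_simps)
  moreover have "\<dots> = (\<integral>x. F x * \<phi> x \<partial>lebesgue_on K) - eps * (\<integral>x. gR x \<bullet> grad \<phi> x \<partial>lebesgue_on K) - kap\<^sup>2 * (\<integral>x. (q x -
      s x) * \<phi> x \<partial>lebesgue_on K)"
    using i by simp
  moreover have "\<dots> \<le> \<bar>\<integral>x. F x * \<phi> x \<partial>lebesgue_on K\<bar> + eps * \<bar>\<integral>x. gR x \<bullet> grad \<phi> x \<partial>lebesgue_on K\<bar> + kap\<^sup>2 * \<bar>\<integral>x. (q x -
      s x) * \<phi> x \<partial>lebesgue_on K\<bar>"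
  proof -
    have "- (eps * (\<integral>x. gR x \<bullet> grad \<phi> x \<partial>lebesgue_on K)) \<le> eps * \<bar>\<integral>x. gR x \<bullet> grad \<phi> x \<partial>lebesgue_on K\<bar>"
      using eps by (metis abs_ge_minus_self abs_mult abs_of_pos)
    moreover have "- (kap\<^sup>2 * (\<integral>x. (q x - s x) * \<phi> x \<partial>lebesgue_on K)) \<le> kap\<^sup>2 * \<bar>\<integral>x. (q x - s x) * \<phi> x \<partial>lebesgue_on K\<bar>"
      using mult_left_mono[OF abs_ge_minus_self[of "\<integral>x. (q x - s x) * \<phi> x \<partial>lebesgue_on K"] zero_le_power2[of kap]] by
          simp
    ultimately show ?thesis by linarith
  qed
  ultimately show ?thesis using b1 b2 b3 unfolding R_def[symmetric] E_def[symmetric] by (simp add: distrib_right)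
qed

end

theorem theorem3p1:
  fixes \<Omega> :: "'a::euclidean_space set" and T :: "'a set set" and p :: nat
    and eps kap :: real and f u uh :: "'a \<Rightarrow> real"
    and \<sigma>a :: "'a \<Rightarrow> 'a \<Rightarrow> 'a" and \<phi>a :: "'a \<Rightarrow> 'a \<Rightarrow> real"
  assumes dom: "lipschitz_domain \<Omega>"
    and mesh: "simplicial_mesh \<Omega> T"
    and p: "p \<ge> 1"
    and eps: "eps > 0" and kap: "kap \<ge> 0"
    and f: "L2 \<Omega> f"
    and u_weak: "H10 \<Omega> u" "\<forall>v. H10 \<Omega> v \<longrightarrow> bil eps kap \<Omega> u v = (LINT x:\<Omega>|lebesgue. f x * v x)"
    and uh_Vh: "pw_poly p T uh" "H10 \<Omega> uh"
    and uh_galerkin: "\<forall>vh. pw_poly p T vh \<and> H10 \<Omega> vh \<longrightarrow>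
                        bil eps kap \<Omega> uh vh = (LINT x:\<Omega>|lebesgue. f x * vh x)"
    and min_adm: "\<forall>a\<in>mesh_verts T. patch_adm eps kap \<Omega> T p f uh a (\<sigma>a a) (\<phi>a a)"
    and min_opt: "\<forall>a\<in>mesh_verts T. \<forall>v q. patch_adm eps kap \<Omega> T p f uh a v q \<longrightarrow>
                    patch_fun eps kap \<Omega> T p uh a (\<sigma>a a) (\<phi>a a) \<le> patch_fun eps kap \<Omega> T p uh a v q"
  shows "(enorm eps kap \<Omega> (\<lambda>x. u x - uh x))\<^sup>2 \<le>
    (\<Sum>K\<in>T.
       (wfac (C_star (real p) (real DIM('a)) (shape_reg T)) eps kap (diameter K) *
          L2normv K (\<lambda>x. eps *\<^sub>R wgrad \<Omega> uh x +
             (1 / eps) *\<^sub>R (\<Sum>a\<in>mesh_verts T. if x \<in> patch T a then \<sigma>a a x else 0))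
        + L2norm K (\<lambda>x. kap * (uh x - (\<Sum>a\<in>mesh_verts T. if x \<in> patch T a then \<phi>a a x else 0)))
        + wtil eps kap (diameter K) * L2norm K (\<lambda>x. f x - Pih \<Omega> T p f x))\<^sup>2)"
proof -
  interpret fe_mesh \<Omega> T using dom mesh by unfold_locales
  note \<Omega>m = \<Omega>_lebesgue
  have fs: "sqi (lebesgue_on \<Omega>) f" using f \<Omega>m by (simp add: L2_iff_sqi)
  define Gu where "Gu = wgrad \<Omega> u"
  define Gh where "Gh = wgrad \<Omega> uh"
  have H1: "H1 \<Omega> u" "H1 \<Omega> uh" using u_weak(1) uh_Vh(2) by (auto simp: H10_def)
  have hu: "H1_grad \<Omega> u Gu" "H1_grad \<Omega> uh Gh" unfolding Gu_def Gh_def using wgrad_H1 H1 by auto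
  have su: "sqi (lebesgue_on \<Omega>) u" "sqi (lebesgue_on \<Omega>) uh" "sqi (lebesgue_on \<Omega>) Gu" "sqi (lebesgue_on \<Omega>) Gh"
    using hu unfolding H1_grad_iff[OF open_\<Omega>] by auto
  define e where "e = (\<lambda>x. u x - uh x)"
  define Ge where "Ge = (\<lambda>x. Gu x - Gh x)"
  have he: "H1_grad \<Omega> e Ge" using H1_grad_add_scaled[OF open_\<Omega> hu, of "-1"] by (simp add: e_def Ge_def)
  have se: "sqi (lebesgue_on \<Omega>) e" "sqi (lebesgue_on \<Omega>) Ge" using he unfolding H1_grad_iff[OF open_\<Omega>] by auto
  define Q where "Q = eps\<^sup>2 * (\<integral>x. (norm (Ge x))\<^sup>2 \<partial>lebesgue_on \<Omega>) + kap\<^sup>2 * (\<integral>x. (norm (e x))\<^sup>2 \<partial>lebesgue_on \<Omega>)"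
  have Q0: "Q \<ge> 0" by (simp add: Q_def)
  have enorm: "(enorm eps kap \<Omega> (\<lambda>x. u x - uh x))\<^sup>2 = Q"
  proof -
    have "(\<integral>x. wgrad \<Omega> e x \<bullet> wgrad \<Omega> e x \<partial>lebesgue_on \<Omega>) = (\<integral>x. (norm (Ge x))\<^sup>2 \<partial>lebesgue_on \<Omega>)"
      using wgrad_AE_eq[OF open_\<Omega> he]
      by (intro lebesgue_on_AE_cong(2)[OF \<Omega>m \<Omega>m]) (auto elim!: eventually_mono simp: power2_norm_eq_inner)
    moreover have "(\<integral>x. e x * e x \<partial>lebesgue_on \<Omega>) = (\<integral>x. (norm (e x))\<^sup>2 \<partial>lebesgue_on \<Omega>)" by (simp add: power2_eq_square)
    ultimately have "bil eps kap \<Omega> e e = Q"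
      using \<Omega>m by (simp add: bil_def Q_def set_integral_lebesgue_on)
    then show ?thesis using Q0 by (simp add: enorm_def e_def)
  qed
  define \<sigma>h where "\<sigma>h = (\<lambda>x. \<Sum>a\<in>mesh_verts T. if x \<in> patch T a then \<sigma>a a x else 0)"
  define \<phi>h where "\<phi>h = (\<lambda>x. \<Sum>a\<in>mesh_verts T. if x \<in> patch T a then \<phi>a a x else 0)"
  define \<eta> where "\<eta> = (\<lambda>K. wfac (C_star (real p) (real DIM('a)) (shape_reg T)) eps kap (diameter K) *
          L2normv K (\<lambda>x. eps *\<^sub>R wgrad \<Omega> uh x + (1 / eps) *\<^sub>R \<sigma>h x)
        + L2norm K (\<lambda>x. kap * (uh x - \<phi>h x))
        + wtil eps kap (diameter K) * L2norm K (\<lambda>x. f x - Pih \<Omega> T p f x))"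
  define B where "B = (\<Sum>K\<in>T. (\<eta> K)\<^sup>2)"
  have B0: "B \<ge> 0" by (simp add: B_def sum_nonneg)
  have adm: "\<And>a. a \<in> mesh_verts T \<Longrightarrow> patch_adm eps kap \<Omega> T p f uh a (\<sigma>a a) (\<phi>a a)" using min_adm by blast
  \<comment> \<open>The sum over elements is resolved by Cauchy-Schwarz before any limit is taken.
    The energy of the test function is additive over the mesh, so the squared indicators meet its
    global energy.\<close>
  have key: "eps\<^sup>2 * (\<integral>x. Ge x \<bullet> grad \<phi> x \<partial>lebesgue_on \<Omega>) + kap\<^sup>2 * (\<integral>x. e x * \<phi> x \<partial>lebesgue_on \<Omega>)
     \<le> sqrt B * sqrt (eps\<^sup>2 * (\<integral>x. (norm (grad \<phi> x))\<^sup>2 \<partial>lebesgue_on \<Omega>) + kap\<^sup>2 * (\<integral>x. (norm (\<phi> x))\<^sup>2 \<partial>lebesgue_on \<Omega>))"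
    if t: "test_fun \<Omega> \<phi>" for \<phi>
  proof -
    note st = test_fun_sqi[OF t \<Omega>m]
    define E2 where "E2 = (\<lambda>K. eps\<^sup>2 * (\<integral>x. (norm (grad \<phi> x))\<^sup>2 \<partial>lebesgue_on K) + kap\<^sup>2 * (\<integral>x. (\<phi> x)\<^sup>2 \<partial>lebesgue_on K))"
    have E20: "E2 K \<ge> 0" for K by (simp add: E2_def)
    have weak: "eps\<^sup>2 * (\<integral>x. Gu x \<bullet> grad \<phi> x \<partial>lebesgue_on \<Omega>) + kap\<^sup>2 * (\<integral>x. u x * \<phi> x \<partial>lebesgue_on \<Omega>) = (\<integral>x. f x * \<phi> x
        \<partial>lebesgue_on \<Omega>)"
    proof -
      have "(\<integral>x. wgrad \<Omega> u x \<bullet> wgrad \<Omega> \<phi> x \<partial>lebesgue_on \<Omega>) = (\<integral>x. Gu x \<bullet> grad \<phi> x \<partial>lebesgue_on \<Omega>)"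
        using wgrad_AE_eq[OF open_\<Omega> test_fun_H1_grad[OF open_\<Omega> t]]
        by (intro lebesgue_on_AE_cong(2)[OF \<Omega>m \<Omega>m]) (auto elim!: eventually_mono simp: Gu_def)
      moreover have "bil eps kap \<Omega> u \<phi> = (LINT x:\<Omega>|lebesgue. f x * \<phi> x)" using u_weak(2) test_fun_H10[OF open_\<Omega> t] by
          blast
      ultimately show ?thesis using \<Omega>m by (simp add: bil_def set_integral_lebesgue_on)
    qed
    have ig: "integrable (lebesgue_on \<Omega>) (\<lambda>x. Gu x \<bullet> grad \<phi> x)" "integrable (lebesgue_on \<Omega>) (\<lambda>x. Gh x \<bullet> grad \<phi> x)"
      "integrable (lebesgue_on \<Omega>) (\<lambda>x. u x * \<phi> x)" "integrable (lebesgue_on \<Omega>) (\<lambda>x. uh x * \<phi> x)" "integrable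
          (lebesgue_on \<Omega>) (\<lambda>x. f x * \<phi> x)"
      by (intro sqi_inner_integrable sqi_mult_integrable su st fs)+
    define Z where "Z = (\<lambda>x. f x * \<phi> x - eps\<^sup>2 * (Gh x \<bullet> grad \<phi> x) - kap\<^sup>2 * (uh x * \<phi> x))"
    define W where "W = (\<lambda>x. \<sigma>h x \<bullet> grad \<phi> x + (Pih \<Omega> T p f x - kap\<^sup>2 * \<phi>h x) * \<phi> x)"
    have iZ: "integrable (lebesgue_on \<Omega>) Z" unfolding Z_def using ig by simp
    have "eps\<^sup>2 * (\<integral>x. Ge x \<bullet> grad \<phi> x \<partial>lebesgue_on \<Omega>) + kap\<^sup>2 * (\<integral>x. e x * \<phi> x \<partial>lebesgue_on \<Omega>) = (\<integral>x. Z x \<partial>lebesgue_on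
        \<Omega>)"
    proof -
      have "(\<integral>x. Ge x \<bullet> grad \<phi> x \<partial>lebesgue_on \<Omega>) = (\<integral>x. Gu x \<bullet> grad \<phi> x \<partial>lebesgue_on \<Omega>) - (\<integral>x. Gh x \<bullet> grad \<phi> x
          \<partial>lebesgue_on \<Omega>)"
        using ig by (simp add: Ge_def inner_diff_left)
      moreover have "(\<integral>x. e x * \<phi> x \<partial>lebesgue_on \<Omega>) = (\<integral>x. u x * \<phi> x \<partial>lebesgue_on \<Omega>) - (\<integral>x. uh x * \<phi> x \<partial>lebesgue_on \<Omega>)"
        using ig by (simp add: e_def left_diff_distrib)
      moreover have "(\<integral>x. Z x \<partial>lebesgue_on \<Omega>) = (\<integral>x. f x * \<phi> x \<partial>lebesgue_on \<Omega>) - eps\<^sup>2 * (\<integral>x. Gh x \<bullet> grad \<phi> x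
          \<partial>lebesgue_on \<Omega>) - kap\<^sup>2 * (\<integral>x. uh x * \<phi> x \<partial>lebesgue_on \<Omega>)"
        unfolding Z_def using ig by simp
      ultimately show ?thesis using weak by (simp add: right_diff_distrib)
    qed
    \<comment> \<open>The sum of the \<open>W\<close> integrals is 0 by equilibration; subtracting
      it prepares the elementwise comparison.\<close>
    also have "\<dots> = (\<Sum>K\<in>T. \<integral>x. Z x \<partial>lebesgue_on K) - (\<Sum>K\<in>T. \<integral>x. W x \<partial>lebesgue_on K)"
      using integral_split_\<Omega>[OF iZ] equilibrium[OF fs t adm] by (simp add: W_def \<sigma>h_def \<phi>h_def)
    also have "\<dots> = (\<Sum>K\<in>T. (\<integral>x. Z x \<partial>lebesgue_on K) - (\<integral>x. W x \<partial>lebesgue_on K))" by (simp add: sum_subtractf)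
    also have "\<dots> \<le> (\<Sum>K\<in>T. \<eta> K * sqrt (E2 K))"
      unfolding Z_def W_def \<eta>_def E2_def Gh_def \<sigma>h_def \<phi>h_def
      by (intro sum_mono element_residual_bound p eps kap fs H1(2) uh_Vh(1) adm t)
    also have "\<dots> \<le> sqrt ((\<Sum>K\<in>T. (\<eta> K)\<^sup>2) * (\<Sum>K\<in>T. (sqrt (E2 K))\<^sup>2))"
      by (rule real_le_rsqrt) (rule Cauchy_Schwarz_ineq_sum)
    also have "\<dots> = sqrt B * sqrt (\<Sum>K\<in>T. E2 K)" using E20 by (simp add: B_def real_sqrt_mult)
    also have "(\<Sum>K\<in>T. E2 K) = eps\<^sup>2 * (\<integral>x. (norm (grad \<phi> x))\<^sup>2 \<partial>lebesgue_on \<Omega>) + kap\<^sup>2 * (\<integral>x. (norm (\<phi> x))\<^sup>2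
        \<partial>lebesgue_on \<Omega>)"
    proof -
      have "integrable (lebesgue_on \<Omega>) (\<lambda>x. (norm (grad \<phi> x))\<^sup>2)" "integrable (lebesgue_on \<Omega>) (\<lambda>x. (\<phi> x)\<^sup>2)"
        using st by (auto simp: sqi_def)
      from integral_split_\<Omega>[OF this(1)] integral_split_\<Omega>[OF this(2)]
      show ?thesis by (simp add: E2_def sum.distrib sum_distrib_left)
    qed
    finally show ?thesis .
  qed
  obtain \<phi>u where \<phi>u: "\<And>n. test_fun \<Omega> (\<phi>u n)" "(\<lambda>n. L2norm \<Omega> (\<lambda>x. \<phi>u n x - u x)) \<longlonglongrightarrow> 0" "(\<lambda>n. L2normv \<Omega> (\<lambda>x. grad (\<phi>u n)
      x - Gu x)) \<longlonglongrightarrow> 0"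
    using u_weak(1) unfolding H10_def Gu_def by blast
  obtain \<psi>u where \<psi>u: "\<And>n. test_fun \<Omega> (\<psi>u n)" "(\<lambda>n. L2norm \<Omega> (\<lambda>x. \<psi>u n x - uh x)) \<longlonglongrightarrow> 0" "(\<lambda>n. L2normv \<Omega> (\<lambda>x. grad (\<psi>u n)
      x - Gh x)) \<longlonglongrightarrow> 0"
    using uh_Vh(2) unfolding H10_def Gh_def by blast
  have sqr: "(\<lambda>n. \<integral>x. (norm (g n x))\<^sup>2 \<partial>lebesgue_on \<Omega>) \<longlonglongrightarrow> 0" if "(\<lambda>n. L2norm \<Omega> (g n)) \<longlonglongrightarrow> 0" for g
    using tendsto_power[OF that, of 2] \<Omega>m by (simp add: L2norm_lebesgue_on)
  have sqrv: "(\<lambda>n. \<integral>x. (norm (g n x))\<^sup>2 \<partial>lebesgue_on \<Omega>) \<longlonglongrightarrow> 0" if "(\<lambda>n. L2normv \<Omega> (g n)) \<longlonglongrightarrow> 0" for g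
    using tendsto_power[OF that, of 2] \<Omega>m by (simp add: L2normv_lebesgue_on)
  \<comment> \<open>\<open>u\<close> and \<open>uh\<close> are approximated separately; the
    differences of their test functions converge to the error together with their gradients.\<close>
  define v where "v = (\<lambda>n x. \<phi>u n x - \<psi>u n x)"
  have tv: "test_fun \<Omega> (v n)" and gv: "grad (v n) = (\<lambda>x. grad (\<phi>u n) x - grad (\<psi>u n) x)" for n
    unfolding v_def by (rule test_fun_diff[OF \<phi>u(1) \<psi>u(1)])+
  have l1: "(\<lambda>n. \<integral>x. (norm (v n x - e x))\<^sup>2 \<partial>lebesgue_on \<Omega>) \<longlonglongrightarrow> 0"
    unfolding v_def e_def by (rule sqi_diff_limit) (use su test_fun_sqi(1)[OF \<phi>u(1) \<Omega>m] test_fun_sqi(1)[OF \<psi>u(1) \<Omega>m]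
        sqr[OF \<phi>u(2)] sqr[OF \<psi>u(2)] in auto)
  have l2: "(\<lambda>n. \<integral>x. (norm (grad (v n) x - Ge x))\<^sup>2 \<partial>lebesgue_on \<Omega>) \<longlonglongrightarrow> 0"
    unfolding gv Ge_def by (rule sqi_diff_limit) (use su test_fun_sqi(2)[OF \<phi>u(1) \<Omega>m] test_fun_sqi(2)[OF \<psi>u(1) \<Omega>m]
        sqrv[OF \<phi>u(3)] sqrv[OF \<psi>u(3)] in auto)
  note c1 = sqi_limit[OF se(1) test_fun_sqi(1)[OF tv \<Omega>m] l1] and c2 = sqi_limit[OF se(2) test_fun_sqi(2)[OF tv \<Omega>m] l2]
  have L: "(\<lambda>n. eps\<^sup>2 * (\<integral>x. Ge x \<bullet> grad (v n) x \<partial>lebesgue_on \<Omega>) + kap\<^sup>2 * (\<integral>x. e x * v n x \<partial>lebesgue_on \<Omega>)) \<longlonglongrightarrow> Q"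
    unfolding Q_def using c1(1) c2(1) by (intro tendsto_intros) auto
  have Rl: "(\<lambda>n. sqrt B * sqrt (eps\<^sup>2 * (\<integral>x. (norm (grad (v n) x))\<^sup>2 \<partial>lebesgue_on \<Omega>) + kap\<^sup>2 * (\<integral>x. (norm (v n x))\<^sup>2
      \<partial>lebesgue_on \<Omega>))) \<longlonglongrightarrow> sqrt B * sqrt Q"
    unfolding Q_def by (intro tendsto_intros c1(2) c2(2))
  \<comment> \<open>In the limit the error energy stands on both sides, on the right only under a
    root, and one root can be divided out.\<close>
  have "Q \<le> sqrt B * sqrt Q" by (rule LIMSEQ_le[OF L Rl]) (use key[OF tv] in auto)
  then have "Q \<le> B"
  proof -
    have "Q = sqrt Q * sqrt Q" using Q0 by simp
    with \<open>Q \<le> sqrt B * sqrt Q\<close> have "sqrt Q * sqrt Q \<le> sqrt B * sqrt Q" by simp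
    then have "sqrt Q \<le> sqrt B" using Q0 B0 mult_le_cancel_right_pos[of "sqrt Q" "sqrt Q" "sqrt B"] by (cases "Q = 0")
        (simp, fastforce)
    then show ?thesis by simp
  qed
  then show ?thesis unfolding enorm B_def \<eta>_def \<sigma>h_def \<phi>h_def .
qed

end
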